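(* For $0<s<1/2$ there is a constant $M$ such that for all $h$ and all $u\in X_h$: $$\lfloor u\rfloor_s\le M\,|u|^{1-s}\,\lceil u\rceil_h^{s} ,$$ where $\lceil\cdot\rceil_h$ is the discrete $\mathrm H^1$ semi-norm defined in the context.
   Context: Domain: $S=\mathbb R^n/\mathbb L$, $\mathbb L=\sum_{i=1}^n\mathbb Z e_i$ for a basis $(e_i)$ of $\mathbb R^n$, with the flat Euclidean metric. $O=\mathrm L^2\mathrm{Alt}^\bullet(S)$ is the space of $\mathrm L^2$ differential forms of all degrees, with norm $|\cdot|$; $\mathrm d$ is the exterior derivative; $X=\{u\in O:\mathrm d u\in O\}$. For $s\in\,]0,1[$ the Slobodetskij semi-norm is $\lfloor u\rfloor_s^2=\iint_{S\times S}\frac{|u(x)-u(y)|^2}{|x-y|^{n+2s}}\,\mathrm dx\,\mathrm dy$ (forms are identified with their coefficient fields). Meshes: $(\mathcal T_h)$ is a sequence of cellular complexes on $S$, indexed by $h>0$ with $h\to0$, where $h$ is the largest diameter of a cell of $\mathcal T_h$. It is quasi-uniform: each $\mathcal T_h$ has a simplicial refinement, these refinements being quasi-uniform in the usual sense (uniformly shape-regular simplices with diameters uniformly comparable to $h$), and each cell of $\mathcal T_h$ is composed of a uniformly bounded number of simplices. Discrete $\mathrm H^1$ semi-norm: for $u$ piecewise of class $\mathrm H^1$ with respect to $\mathcal T_h$, $\lceil u\rceil_h^2=\sum_T\|\nabla u\|_{\mathrm L^2(T)}^2+\sum_{T'}h_{T'}^{-1}\|[\![u]\!]\|_{\mathrm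 L^2(T')}^2$, where $T$ ranges over $n$-cells, $T'$ over $(n-1)$-cells (interfaces), $[\![u]\!]$ is the jump of (all components of) $u$ across $T'$ and $h_{T'}$ is the diameter of $T'$. Finite element spaces: for each $h$, $X_h=\bigoplus_{k=0}^n X_h^k\subset X$ is the space of a finite element system on $\mathcal T_h$: to each cell $T$ (of any dimension) and each $k$ is attached a finite dimensional space $X^k(T)$ of $k$-forms on $T$, smooth up to the boundary, such that $\mathrm d X^k(T)\subset X^{k+1}(T)$ and pullback to a subcell $T'\subset T$ maps $X^k(T)$ into $X^k(T')$; $X_h^k$ consists of the $k$-forms on $S$ having, on every cell $T$, a single-valued pullback belonging to $X^k(T)$. The system is compatible: for each $T$ the sequence $0\to\mathbb R\to X^0(T)\to\cdots\to X^{\dim T}(T)\to0$ (with maps $\mathrm d$) is exact, and any family of elements of the $X^k(T')$, $T'$ ranging over proper subcells of $T$, compatible under pullback, extends to an element of $X^k(T)$. In the $h$-setting: after scaling by $h^{-1}$, the macro-elements (unions of cells touching a given cell) with their local spaces range in a compact family (finitely many combinatorial types, uniformly bounded dimensions). The local spaces contain the polynomial forms of degree up to a fixed integer $p\ge0$. *)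

theory Defs
  imports "HOL-Analysis.Analysis"
begin

type_synonym 'n point = "real^'n"

section \<open>The flat torus\<close>

text \<open>
  The torus \<open>S\<close> is \<open>\<real>\<^sup>n\<close> modulo the lattice spanned by \<open>e\<close>.  Functions on \<open>S\<close> are
  periodic functions on \<open>\<real>\<^sup>n\<close>, and a cell of \<open>S\<close> (being contractible) is represented by all of
  its lifts to \<open>\<real>\<^sup>n\<close>, which form one orbit under the lattice.
\<close>

definition lattice_basis :: "('n::finite \<Rightarrow> 'n point) \<Rightarrow> bool" where
  "lattice_basis e \<longleftrightarrow> inj e \<and> independent (range e)"

definition lattice :: "('n::finite \<Rightarrow> 'n point) \<Rightarrow> ('n point) set" where
  "lattice e = {(\<Sum>i\<in>UNIV. of_int (z i) *\<^sub>R e i) | z :: 'n \<Rightarrow> int. True}"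

definition fund_domain :: "('n::finite \<Rightarrow> 'n point) \<Rightarrow> ('n point) set" where
  "fund_domain e = {(\<Sum>i\<in>UNIV. t i *\<^sub>R e i) | t :: 'n \<Rightarrow> real. \<forall>i. 0 \<le> t i \<and> t i < 1}"

definition periodic :: "('n::finite \<Rightarrow> 'n point) \<Rightarrow> ('n point \<Rightarrow> 'b) \<Rightarrow> bool" where
  "periodic e u \<longleftrightarrow> (\<forall>l\<in>lattice e. \<forall>x. u (x + l) = u x)"

definition tdist :: "('n::finite \<Rightarrow> 'n point) \<Rightarrow> 'n point \<Rightarrow> 'n point \<Rightarrow> real" where
  "tdist e x y = (INF l\<in>lattice e. norm (x - y + l))"

definition tdiam :: "('n::finite \<Rightarrow> 'n point) \<Rightarrow> ('n point) set \<Rightarrow> real" where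
  "tdiam e T = (SUP (x, y)\<in>T \<times> T. tdist e x y)"

definition orbit :: "('n::finite \<Rightarrow> 'n point) \<Rightarrow> ('n point) set \<Rightarrow> ('n point) set set" where
  "orbit e T = (\<lambda>l. (+) l ` T) ` lattice e"

text \<open>Sum over the cells of \<open>S\<close> of a lattice invariant quantity of their lifts.\<close>

definition sum_mod ::
  "('n::finite \<Rightarrow> 'n point) \<Rightarrow> (('n point) set \<Rightarrow> real) \<Rightarrow> ('n point) set set \<Rightarrow> real" where
  "sum_mod e f A = (\<Sum>Q\<in>orbit e ` A. f (SOME T. T \<in> Q))"

section \<open>Differentiability and weak derivatives\<close>

primrec cdiff :: "nat \<Rightarrow> (('n::finite) point \<Rightarrow> 'b::real_normed_vector) \<Rightarrow> bool" where
  "cdiff 0 f \<longleftrightarrow> continuous_on UNIV f"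
| "cdiff (Suc k) f \<longleftrightarrow> (\<forall>x. f differentiable (at x)) \<and>
     (\<forall>v. cdiff k (\<lambda>x. frechet_derivative f (at x) v))"

definition smooth :: "(('n::finite) point \<Rightarrow> 'b::real_normed_vector) \<Rightarrow> bool" where
  "smooth f \<longleftrightarrow> (\<forall>k. cdiff k f)"

definition partial :: "'n::finite \<Rightarrow> ('n point \<Rightarrow> 'b::real_normed_vector) \<Rightarrow> 'n point \<Rightarrow> 'b" where
  "partial i f x = frechet_derivative f (at x) (axis i 1)"

text \<open>
  Weak derivatives are tested against \<open>C\<^sup>1\<close> functions with compact support; by mollification
  this is the same as testing against smooth ones.
\<close>

definition test_fun :: "(('n::finite) point) set \<Rightarrow> ('n point \<Rightarrow> real) \<Rightarrow> bool" where
  "test_fun U \<phi> \<longleftrightarrow> cdiff 1 \<phi> \<and> compact (closure {x. \<phi> x \<noteq> 0}) \<and> closure {x. \<phi> x \<noteq> 0} \<subseteq> U"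

definition weak_partial ::
  "(('n::finite) point) set \<Rightarrow> 'n \<Rightarrow> ('n point \<Rightarrow> 'b::euclidean_space) \<Rightarrow> ('n point \<Rightarrow> 'b) \<Rightarrow> bool" where
  "weak_partial U i f g \<longleftrightarrow>
     (\<forall>A. compact A \<and> A \<subseteq> U \<longrightarrow> set_integrable lebesgue A f \<and> set_integrable lebesgue A g) \<and>
     (\<forall>\<phi>. test_fun U \<phi> \<longrightarrow>
        (LINT x:U|lebesgue. partial i \<phi> x *\<^sub>R f x) = - (LINT x:U|lebesgue. \<phi> x *\<^sub>R g x))"

definition grad_norm2 :: "(('n::finite) point) set \<Rightarrow> ('n point \<Rightarrow> 'b::euclidean_space) \<Rightarrow> real" where
  "grad_norm2 U u =
     (\<Sum>i\<in>UNIV. LINT x:U|lebesgue. (norm ((SOME g. weak_partial U i u g) x))\<^sup>2)"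

section \<open>Differential forms\<close>

text \<open>
  An element \<open>a\<close> of \<open>Alt\<^sup>\<bullet>(\<real>\<^sup>n)\<close> is given by its coefficients: \<open>a $ I\<close> belongs to
  \<open>dx\<^sub>I = dx\<^bsub>i1\<^esub> \<and> \<dots> \<and> dx\<^bsub>ik\<^esub>\<close>, where \<open>i1 < \<dots> < ik\<close> are the elements of \<open>I\<close>.  The \<open>dx\<^sub>I\<close> are
  orthonormal, so the norm of \<open>real^('n set)\<close> is the Euclidean norm of forms.
\<close>

type_synonym 'n form = "'n point \<Rightarrow> real^('n set)"

definition deg_form :: "nat \<Rightarrow> ('n::finite) form \<Rightarrow> bool" where
  "deg_form k \<omega> \<longleftrightarrow> (\<forall>x I. card I \<noteq> k \<longrightarrow> \<omega> x $ I = 0)"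

text \<open>The sign in \<open>dx\<^sub>i \<and> dx\<^bsub>I - {i}\<^esub> = \<plusminus> dx\<^bsub>I \<union> {i}\<^esub>\<close>.\<close>

definition wsgn :: "'n::{finite,linorder} \<Rightarrow> 'n set \<Rightarrow> real" where
  "wsgn i I = (-1) ^ card {j\<in>I. j < i}"

definition ext_deriv :: "('n::{finite,linorder}) form \<Rightarrow> 'n form" where
  "ext_deriv \<omega> x = (\<chi> I. \<Sum>i\<in>I. wsgn i I * partial i (\<lambda>y. \<omega> y $ (I - {i})) x)"

definition contract :: "('n::{finite,linorder}) point \<Rightarrow> real^('n set) \<Rightarrow> real^('n set)" where
  "contract v a = (\<chi> J. \<Sum>i\<in>-J. wsgn i J * v $ i * a $ (insert i J))"

text \<open>
  \<open>form_eval a [v1, \<dots>, vk] = a(v1, \<dots>, vk)\<close>, by successive interior products; only the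
  component of degree \<open>k\<close> of \<open>a\<close> contributes.
\<close>

primrec form_eval :: "real^('n::{finite,linorder} set) \<Rightarrow> (('n::{finite,linorder}) point) list \<Rightarrow> real" where
  "form_eval a [] = a $ {}"
| "form_eval a (v # vs) = form_eval (contract v a) vs"

definition L2_forms :: "('n::finite \<Rightarrow> 'n point) \<Rightarrow> 'n form set" where
  "L2_forms e = {u. u \<in> borel_measurable lebesgue \<and> periodic e u \<and>
     set_integrable lebesgue (fund_domain e) (\<lambda>x. (norm (u x))\<^sup>2)}"

definition L2_norm :: "('n::finite \<Rightarrow> 'n point) \<Rightarrow> 'n form \<Rightarrow> real" where
  "L2_norm e u = sqrt (LINT x:fund_domain e|lebesgue. (norm (u x))\<^sup>2)"

definition weak_ext_deriv :: "('n::{finite,linorder}) form \<Rightarrow> 'n form \<Rightarrow> bool" where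
  "weak_ext_deriv u g \<longleftrightarrow> (\<forall>\<phi> I. test_fun UNIV \<phi> \<longrightarrow>
     (\<Sum>i\<in>I. wsgn i I * (LINT x|lebesgue. partial i \<phi> x * u x $ (I - {i})))
       = - (LINT x|lebesgue. \<phi> x * g x $ I))"

definition Hd_forms :: "('n::{finite,linorder} \<Rightarrow> 'n point) \<Rightarrow> 'n form set" where
  "Hd_forms e = {u \<in> L2_forms e. \<exists>g\<in>L2_forms e. weak_ext_deriv u g}"

definition slobodetskij2 :: "('n::finite \<Rightarrow> 'n point) \<Rightarrow> real \<Rightarrow> 'n form \<Rightarrow> ennreal" where
  "slobodetskij2 e s u =
     (\<integral>\<^sup>+x\<in>fund_domain e. (\<integral>\<^sup>+y\<in>fund_domain e.
        ennreal ((norm (u x - u y))\<^sup>2 / tdist e x y powr (real CARD('n) + 2 * s))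
      \<partial>lebesgue) \<partial>lebesgue)"

definition slobodetskij :: "('n::finite \<Rightarrow> 'n point) \<Rightarrow> real \<Rightarrow> 'n form \<Rightarrow> real" where
  "slobodetskij e s u = sqrt (enn2real (slobodetskij2 e s u))"

section \<open>Cellular complexes\<close>

text \<open>
  A \<open>d\<close>-cell is a bi-Lipschitz image of the closed unit ball of a \<open>d\<close>-dimensional space; its
  boundary \<open>B\<close> is the image of the unit sphere (empty if \<open>d = 0\<close>).  By invariance of domain,
  \<open>d\<close> and \<open>B\<close> only depend on \<open>T\<close>.
\<close>

definition lip_cell :: "nat \<Rightarrow> (('n::finite) point) set \<Rightarrow> ('n point) set \<Rightarrow> bool" where
  "lip_cell d T B \<longleftrightarrow> (\<exists>(V :: ('n point) set) g g'. subspace V \<and> dim V = d \<and>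
     homeomorphism (cball 0 1 \<inter> V) T g g' \<and>
     (\<exists>c. c-lipschitz_on (cball 0 1 \<inter> V) g) \<and> (\<exists>c. c-lipschitz_on T g') \<and>
     B = g ` (sphere 0 1 \<inter> V))"

definition cell_dim :: "(('n::finite) point) set \<Rightarrow> nat" where
  "cell_dim T = (THE d. \<exists>B. lip_cell d T B)"

definition cell_boundary :: "(('n::finite) point) set \<Rightarrow> ('n point) set" where
  "cell_boundary T = (THE B. \<exists>d. lip_cell d T B)"

definition cell_interior :: "(('n::finite) point) set \<Rightarrow> ('n point) set" where
  "cell_interior T = T - cell_boundary T"

text \<open>The third condition says that \<open>T\<close> is embedded in the torus.\<close>

definition cellular_complex :: "('n::finite \<Rightarrow> 'n point) \<Rightarrow> ('n point) set set \<Rightarrow> bool" where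
  "cellular_complex e C \<longleftrightarrow>
     (\<forall>T\<in>C. \<exists>d B. lip_cell d T B) \<and>
     (\<forall>T\<in>C. \<forall>l\<in>lattice e. (+) l ` T \<in> C) \<and>
     (\<forall>T\<in>C. \<forall>l\<in>lattice e. l \<noteq> 0 \<longrightarrow> T \<inter> (+) l ` T = {}) \<and>
     finite (orbit e ` C) \<and>
     (\<forall>T\<in>C. \<forall>T'\<in>C. T \<noteq> T' \<longrightarrow> cell_interior T \<inter> cell_interior T' = {}) \<and>
     (\<forall>T\<in>C. \<exists>D\<subseteq>C. cell_boundary T = \<Union>D) \<and>
     \<Union>C = UNIV"

definition mesh_width :: "('n::finite \<Rightarrow> 'n point) \<Rightarrow> ('n point) set set \<Rightarrow> real" where
  "mesh_width e C = (SUP T\<in>C. tdiam e T)"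

definition simplicial_refinement ::
  "('n::finite \<Rightarrow> 'n point) \<Rightarrow> ('n point) set set \<Rightarrow> ('n point) set set \<Rightarrow> bool" where
  "simplicial_refinement e C K \<longleftrightarrow>
     (\<forall>\<sigma>\<in>K. \<exists>d::nat. int d simplex \<sigma>) \<and>
     (\<forall>\<sigma>\<in>K. \<forall>\<tau>. \<tau> face_of \<sigma> \<and> \<tau> \<noteq> {} \<longrightarrow> \<tau> \<in> K) \<and>
     (\<forall>\<sigma>\<in>K. \<forall>\<tau>\<in>K. (\<sigma> \<inter> \<tau>) face_of \<sigma> \<and> (\<sigma> \<inter> \<tau>) face_of \<tau>) \<and>
     (\<forall>\<sigma>\<in>K. \<forall>l\<in>lattice e. (+) l ` \<sigma> \<in> K) \<and>
     finite (orbit e ` K) \<and>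
     (\<forall>T\<in>C. \<exists>D\<subseteq>K. T = \<Union>D)"

definition simplices_in :: "(('n::finite) point) set set \<Rightarrow> ('n point) set \<Rightarrow> ('n point) set set" where
  "simplices_in K T = {\<sigma>\<in>K. \<sigma> \<subseteq> T}"

definition quasi_uniform ::
  "('n::finite \<Rightarrow> 'n point) \<Rightarrow> (nat \<Rightarrow> ('n point) set set) \<Rightarrow> (nat \<Rightarrow> ('n point) set set) \<Rightarrow> bool" where
  "quasi_uniform e C K \<longleftrightarrow>
     (\<forall>m. simplicial_refinement e (C m) (K m)) \<and>
     (\<exists>\<kappa>>0. \<forall>m. \<forall>\<sigma>\<in>K m. int CARD('n) simplex \<sigma> \<longrightarrow>
        (\<exists>x. cball x (\<kappa> * diameter \<sigma>) \<subseteq> \<sigma>) \<and>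
        \<kappa> * mesh_width e (C m) \<le> diameter \<sigma> \<and> \<kappa> * diameter \<sigma> \<le> mesh_width e (C m)) \<and>
     (\<exists>N. \<forall>m. \<forall>T\<in>C m. finite (simplices_in (K m) T) \<and> card (simplices_in (K m) T) \<le> N)"

section \<open>The discrete \<open>H\<^sup>1\<close> semi-norm\<close>

text \<open>
  The trace on \<open>\<partial>T\<close> of an \<open>H\<^sup>1\<close> function on a Lipschitz domain \<open>T\<close> is, at almost every boundary
  point, the limit of its averages over small half balls.
\<close>

definition trace ::
  "(('n::finite) point) set \<Rightarrow> ('n point \<Rightarrow> 'b::euclidean_space) \<Rightarrow> 'n point \<Rightarrow> 'b" where
  "trace T u x = Lim (at_right 0) (\<lambda>r.
     (1 / measure lebesgue (T \<inter> ball x r)) *\<^sub>R (LINT y:T \<inter> ball x r|lebesgue. u y))"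

text \<open>
  An interface \<open>T'\<close> lies in exactly two \<open>n\<close>-cells; the sum over ordered pairs counts the
  squared jump twice.
\<close>

definition jump_norm2 ::
  "(('n::finite) point) set set \<Rightarrow> ('n point) set \<Rightarrow> ('n point \<Rightarrow> 'b::euclidean_space) \<Rightarrow> 'n point \<Rightarrow> real"
where
  "jump_norm2 C T' u x =
     (let A = {T\<in>C. cell_dim T = CARD('n) \<and> T' \<subseteq> T}
      in (\<Sum>T1\<in>A. \<Sum>T2\<in>A. (norm (trace T1 u x - trace T2 u x))\<^sup>2) / 2)"

text \<open>
  Integration over an \<open>(n-1)\<close>-simplex \<open>\<sigma>\<close> with respect to surface measure.  By Fubini it is the
  volume integral over the right prism of height 1 on \<open>\<sigma>\<close>, the integrand being extended
  constantly in the normal direction.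
\<close>

definition unit_normal :: "(('n::finite) point) set \<Rightarrow> 'n point" where
  "unit_normal \<sigma> = (SOME \<nu>. norm \<nu> = 1 \<and> (\<forall>x\<in>\<sigma>. \<forall>y\<in>\<sigma>. (x - y) \<bullet> \<nu> = 0))"

definition facet_integral :: "(('n::finite) point) set \<Rightarrow> ('n point \<Rightarrow> real) \<Rightarrow> real" where
  "facet_integral \<sigma> f =
     (let \<nu> = unit_normal \<sigma>; a = (SOME a. a \<in> \<sigma>); foot = (\<lambda>y. y - ((y - a) \<bullet> \<nu>) *\<^sub>R \<nu>)
      in LINT y:{x + t *\<^sub>R \<nu> | x t. x \<in> \<sigma> \<and> 0 \<le> t \<and> t \<le> 1}|lebesgue. f (foot y))"

text \<open>
  The weight \<open>h\<^bsub>T'\<^esub>\<close> is the diameter of the interface.  If \<open>n = 1\<close> interfaces are points, of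
  diameter 0, and the mesh width is used instead.
\<close>

definition interface_size ::
  "('n::finite \<Rightarrow> 'n point) \<Rightarrow> ('n point) set set \<Rightarrow> ('n point) set \<Rightarrow> real" where
  "interface_size e C T' = (if CARD('n) = 1 then mesh_width e C else tdiam e T')"

definition discrete_H1 ::
  "('n::finite \<Rightarrow> 'n point) \<Rightarrow> ('n point) set set \<Rightarrow> ('n point) set set \<Rightarrow> 'n form \<Rightarrow> real" where
  "discrete_H1 e C K u = sqrt (
     sum_mod e (\<lambda>T. grad_norm2 (interior T) u) {T\<in>C. cell_dim T = CARD('n)} +
     sum_mod e (\<lambda>T'. 1 / interface_size e C T' *
         (\<Sum>\<sigma> | \<sigma> \<in> simplices_in K T' \<and> (int CARD('n) - 1) simplex \<sigma>.
            facet_integral \<sigma> (jump_norm2 C T' u)))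
       {T'\<in>C. cell_dim T' = CARD('n) - 1})"

section \<open>Finite element systems\<close>

text \<open>
  A form on a cell \<open>T\<close> that is smooth up to the boundary is the pullback to \<open>T\<close> of a smooth form
  on \<open>\<real>\<^sup>n\<close>.  It is represented by its smooth extensions to \<open>\<real>\<^sup>n\<close>, two of which are the same
  form on \<open>T\<close> if they have the same pullback to all (flat, closed) simplices composing \<open>T\<close>.
  In terms of extensions, pullback from \<open>T\<close> to a subcell is the identity, and the exterior
  derivative is that of \<open>\<real>\<^sup>n\<close>.
\<close>

definition same_pullback ::
  "(('n::{finite,linorder}) point) set set \<Rightarrow> 'n form \<Rightarrow> 'n form \<Rightarrow> bool" where
  "same_pullback \<S> \<omega> \<eta> \<longleftrightarrow>
     (\<forall>\<sigma>\<in>\<S>. \<forall>x\<in>\<sigma>. \<forall>vs. set vs \<subseteq> span {y - z | y z. y \<in> \<sigma> \<and> z \<in> \<sigma>} \<longrightarrow>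
        form_eval (\<omega> x) vs = form_eval (\<eta> x) vs)"

abbreviation eq_on_cell ::
  "(('n::{finite,linorder}) point) set set \<Rightarrow> ('n point) set \<Rightarrow> 'n form \<Rightarrow> 'n form \<Rightarrow> bool" where
  "eq_on_cell K T \<omega> \<eta> \<equiv> same_pullback (simplices_in K T) \<omega> \<eta>"

text \<open>\<open>X k T\<close> is the set of all smooth extensions of the elements of \<open>X\<^sup>k(T)\<close>.\<close>

definition element_system ::
  "('n::{finite,linorder} \<Rightarrow> 'n point) \<Rightarrow> ('n point) set set \<Rightarrow> ('n point) set set \<Rightarrow>
     (nat \<Rightarrow> ('n point) set \<Rightarrow> 'n form set) \<Rightarrow> bool" where
  "element_system e C K X \<longleftrightarrow> (\<forall>T\<in>C. \<forall>k.
     (\<forall>\<omega>\<in>X k T. smooth \<omega> \<and> deg_form k \<omega>) \<and>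
     (\<forall>\<omega>\<in>X k T. \<forall>\<eta>. smooth \<eta> \<and> deg_form k \<eta> \<and> eq_on_cell K T \<omega> \<eta> \<longrightarrow> \<eta> \<in> X k T) \<and>
     (\<lambda>x. 0) \<in> X k T \<and>
     (\<forall>\<omega>\<in>X k T. \<forall>\<eta>\<in>X k T. \<forall>a b. (\<lambda>x. a *\<^sub>R \<omega> x + b *\<^sub>R \<eta> x) \<in> X k T) \<and>
     (\<exists>B. finite B \<and> B \<subseteq> X k T \<and>
        (\<forall>\<omega>\<in>X k T. \<exists>c. eq_on_cell K T \<omega> (\<lambda>x. \<Sum>b\<in>B. c b *\<^sub>R b x))) \<and>
     (\<forall>l\<in>lattice e. \<forall>\<omega>\<in>X k T. (\<lambda>x. \<omega> (x - l)) \<in> X k ((+) l ` T)) \<and>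
     (\<forall>\<omega>\<in>X k T. ext_deriv \<omega> \<in> X (Suc k) T) \<and>
     (\<forall>T'\<in>C. T' \<subseteq> T \<longrightarrow> X k T \<subseteq> X k T'))"

definition exact_system ::
  "(('n::{finite,linorder}) point) set set \<Rightarrow> ('n point) set set \<Rightarrow>
     (nat \<Rightarrow> ('n point) set \<Rightarrow> 'n form set) \<Rightarrow> bool" where
  "exact_system C K X \<longleftrightarrow> (\<forall>T\<in>C.
     (\<forall>c. (\<lambda>x. axis {} c) \<in> X 0 T) \<and>
     (\<forall>\<omega>\<in>X 0 T. eq_on_cell K T (ext_deriv \<omega>) (\<lambda>x. 0) \<longrightarrow>
        (\<exists>c. eq_on_cell K T \<omega> (\<lambda>x. axis {} c))) \<and>
     (\<forall>k. \<forall>\<omega>\<in>X (Suc k) T. eq_on_cell K T (ext_deriv \<omega>) (\<lambda>x. 0) \<longrightarrow>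
        (\<exists>\<eta>\<in>X k T. eq_on_cell K T (ext_deriv \<eta>) \<omega>)))"

definition extendable_system ::
  "(('n::{finite,linorder}) point) set set \<Rightarrow> ('n point) set set \<Rightarrow>
     (nat \<Rightarrow> ('n point) set \<Rightarrow> 'n form set) \<Rightarrow> bool" where
  "extendable_system C K X \<longleftrightarrow> (\<forall>T\<in>C. \<forall>k w.
     (\<forall>T'\<in>C. T' \<subset> T \<longrightarrow> w T' \<in> X k T') \<and>
     (\<forall>T'\<in>C. \<forall>T''\<in>C. T' \<subset> T \<and> T'' \<subseteq> T' \<longrightarrow> eq_on_cell K T'' (w T') (w T'')) \<longrightarrow>
     (\<exists>\<omega>\<in>X k T. \<forall>T'\<in>C. T' \<subset> T \<longrightarrow> eq_on_cell K T' \<omega> (w T')))"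

definition compatible_system ::
  "('n::{finite,linorder} \<Rightarrow> 'n point) \<Rightarrow> ('n point) set set \<Rightarrow> ('n point) set set \<Rightarrow>
     (nat \<Rightarrow> ('n point) set \<Rightarrow> 'n form set) \<Rightarrow> bool" where
  "compatible_system e C K X \<longleftrightarrow>
     element_system e C K X \<and> exact_system C K X \<and> extendable_system C K X"

definition poly_form :: "nat \<Rightarrow> nat \<Rightarrow> ('n::finite) form \<Rightarrow> bool" where
  "poly_form p k \<omega> \<longleftrightarrow> deg_form k \<omega> \<and>
     (\<exists>c :: ('n \<Rightarrow> nat) \<Rightarrow> real^('n set). \<forall>x.
        \<omega> x = (\<Sum>\<alpha> | sum \<alpha> UNIV \<le> p. (\<Prod>i\<in>UNIV. (x $ i) ^ \<alpha> i) *\<^sub>R c \<alpha>))"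

definition contains_polys ::
  "nat \<Rightarrow> (('n::finite) point) set set \<Rightarrow> (nat \<Rightarrow> ('n point) set \<Rightarrow> 'n form set) \<Rightarrow> bool" where
  "contains_polys p C X \<longleftrightarrow> (\<forall>T\<in>C. \<forall>k \<omega>. poly_form p k \<omega> \<longrightarrow> \<omega> \<in> X k T)"

text \<open>
  \<open>w T\<close> is the single-valued pullback of \<open>u\<close> to the cell \<open>T\<close>.  On \<open>n\<close>-cells it is \<open>u\<close> itself, and
  on the other cells it is determined as the common pullback from the adjacent \<open>n\<close>-cells.
\<close>

definition fe_space_deg ::
  "('n::{finite,linorder} \<Rightarrow> 'n point) \<Rightarrow> ('n point) set set \<Rightarrow> ('n point) set set \<Rightarrow>
     (nat \<Rightarrow> ('n point) set \<Rightarrow> 'n form set) \<Rightarrow> nat \<Rightarrow> 'n form set" where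
  "fe_space_deg e C K X k = {u \<in> Hd_forms e. deg_form k u \<and>
     (\<exists>w. (\<forall>T\<in>C. w T \<in> X k T) \<and>
        (\<forall>T\<in>C. \<forall>T'\<in>C. T' \<subseteq> T \<longrightarrow> eq_on_cell K T' (w T) (w T')) \<and>
        (\<forall>T\<in>C. cell_dim T = CARD('n) \<longrightarrow> (AE x in lebesgue. x \<in> T \<longrightarrow> u x = w T x)))}"

definition fe_space ::
  "('n::{finite,linorder} \<Rightarrow> 'n point) \<Rightarrow> ('n point) set set \<Rightarrow> ('n point) set set \<Rightarrow>
     (nat \<Rightarrow> ('n point) set \<Rightarrow> 'n form set) \<Rightarrow> 'n form set" where
  "fe_space e C K X = {\<lambda>x. \<Sum>k\<le>CARD('n). v k x | v.
     \<forall>k\<le>CARD('n). v k \<in> fe_space_deg e C K X k}"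

section \<open>Compact families of macro-elements\<close>

text \<open>
  A macro-element with its local spaces is described by numbering the vertices of the simplices
  it is composed of: \<open>sh_pos\<close> gives their positions, \<open>sh_simps\<close> the simplices (as sets of vertex
  numbers), \<open>sh_cells\<close> the cells (as sets of simplices, faces included), \<open>sh_bas k D\<close> a basis with
  \<open>sh_rank k D\<close> elements of the space of \<open>k\<close>-forms on the cell \<open>D\<close>.
\<close>

record ('n::finite) shape =
  sh_simps :: "nat set set"
  sh_cells :: "nat set set set"
  sh_rank :: "nat \<Rightarrow> nat set set \<Rightarrow> nat"
  sh_pos :: "nat \<Rightarrow> 'n point"
  sh_bas :: "nat \<Rightarrow> nat set set \<Rightarrow> nat \<Rightarrow> 'n form"

definition geo :: "('n::finite) shape \<Rightarrow> nat set set \<Rightarrow> ('n point) set set" where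
  "geo R D = (\<lambda>s. convex hull (sh_pos R ` s)) ` D"

definition sh_comb ::
  "('n::finite) shape \<Rightarrow> nat \<Rightarrow> nat set set \<Rightarrow> (nat \<Rightarrow> real) \<Rightarrow> 'n form" where
  "sh_comb R k D a x = (\<Sum>i<sh_rank R k D. a i *\<^sub>R sh_bas R k D i x)"

text \<open>
  The elements of a compact family are non-degenerate: simplices do not collapse and bases are
  linearly independent.
\<close>

definition shape_ok :: "('n::{finite,linorder}) shape \<Rightarrow> bool" where
  "shape_ok R \<longleftrightarrow>
     finite (sh_simps R) \<and> inj_on (sh_pos R) (\<Union>(sh_simps R)) \<and>
     (\<forall>s\<in>sh_simps R. finite s \<and> s \<noteq> {} \<and> \<not> affine_dependent (sh_pos R ` s)) \<and>
     (\<forall>D\<in>sh_cells R. D \<subseteq> sh_simps R \<and> (\<forall>k.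
        (\<forall>i<sh_rank R k D. cdiff 1 (sh_bas R k D i) \<and> deg_form k (sh_bas R k D i)) \<and>
        (\<forall>a. same_pullback (geo R D) (sh_comb R k D a) (\<lambda>x. 0) \<longrightarrow>
           (\<forall>i<sh_rank R k D. a i = 0))))"

text \<open>
  Convergence of vertices, and of bases in the topology of \<open>C\<^sup>1\<close>, for a constant combinatorial
  type and constant dimensions.  As these are constant in the limit, a (sequentially) compact
  family has finitely many combinatorial types and bounded dimensions.
\<close>

definition C1_conv :: "(nat \<Rightarrow> ('n::finite) form) \<Rightarrow> 'n form \<Rightarrow> bool" where
  "C1_conv F G \<longleftrightarrow> (\<forall>r.
     uniform_limit (cball 0 r) F G sequentially \<and>
     (\<forall>i. uniform_limit (cball 0 r) (\<lambda>j. partial i (F j)) (partial i G) sequentially))"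

definition shape_conv :: "(nat \<Rightarrow> ('n::finite) shape) \<Rightarrow> 'n shape \<Rightarrow> bool" where
  "shape_conv \<rho> R \<longleftrightarrow>
     (\<forall>j. sh_simps (\<rho> j) = sh_simps R \<and> sh_cells (\<rho> j) = sh_cells R \<and>
        (\<forall>k. \<forall>D\<in>sh_cells R. sh_rank (\<rho> j) k D = sh_rank R k D)) \<and>
     (\<forall>i\<in>\<Union>(sh_simps R). (\<lambda>j. sh_pos (\<rho> j) i) \<longlonglongrightarrow> sh_pos R i) \<and>
     (\<forall>k. \<forall>D\<in>sh_cells R. \<forall>i<sh_rank R k D. C1_conv (\<lambda>j. sh_bas (\<rho> j) k D i) (sh_bas R k D i))"

definition compact_family :: "('n::{finite,linorder}) shape set \<Rightarrow> bool" where
  "compact_family F \<longleftrightarrow> (\<forall>R\<in>F. shape_ok R) \<and>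
     (\<forall>\<rho> :: nat \<Rightarrow> 'n shape. (\<forall>j. \<rho> j \<in> F) \<longrightarrow>
       (\<exists>R\<in>F. \<exists>r :: nat \<Rightarrow> nat. strict_mono r \<and> shape_conv (\<rho> \<circ> r) R))"

definition macro_element :: "(('n::finite) point) set set \<Rightarrow> ('n point) set \<Rightarrow> ('n point) set" where
  "macro_element C T = \<Union>{T'\<in>C. T' \<inter> T \<noteq> {}}"

text \<open>
  The macro-element of \<open>T\<close> has shape \<open>R\<close> after a translation and scaling by \<open>1 / h\<close>.
  Scaling of \<open>k\<close>-forms multiplies the coefficients by a power of \<open>h\<close>, which does not
  affect the spanned space.
\<close>

definition has_shape ::
  "(('n::{finite,linorder}) point) set set \<Rightarrow> ('n point) set set \<Rightarrow>
     (nat \<Rightarrow> ('n point) set \<Rightarrow> 'n form set) \<Rightarrow> real \<Rightarrow> ('n point) set \<Rightarrow> 'n shape \<Rightarrow> bool" where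
  "has_shape C K X h T R \<longleftrightarrow> (\<exists>c.
     let M = macro_element C T;
         scaled = (\<lambda>A. (`) (\<lambda>x. (1 / h) *\<^sub>R (x - c)) ` simplices_in K A)
     in geo R (sh_simps R) = scaled M \<and>
        geo R ` sh_cells R = scaled ` {T'\<in>C. T' \<subseteq> M} \<and>
        (\<forall>T'\<in>C. \<forall>D\<in>sh_cells R. T' \<subseteq> M \<and> geo R D = scaled T' \<longrightarrow>
           (\<forall>k. X k T' = {\<omega>. smooth \<omega> \<and> deg_form k \<omega> \<and>
              (\<exists>a. same_pullback (geo R D) (\<lambda>x. \<omega> (c + h *\<^sub>R x)) (sh_comb R k D a))})))"

definition compact_macro_elements ::
  "('n::{finite,linorder} \<Rightarrow> 'n point) \<Rightarrow> (nat \<Rightarrow> ('n point) set set) \<Rightarrow>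
     (nat \<Rightarrow> ('n point) set set) \<Rightarrow> (nat \<Rightarrow> nat \<Rightarrow> ('n point) set \<Rightarrow> 'n form set) \<Rightarrow> bool" where
  "compact_macro_elements e C K X \<longleftrightarrow> (\<exists>F. compact_family F \<and>
     (\<forall>m. \<forall>T\<in>C m. \<exists>R\<in>F. has_shape (C m) (K m) (X m) (mesh_width e (C m)) T R))"

end

theory Submission
  imports Defs
begin

text \<open>
  Let \<open>\<Phi>(z)\<close> be the square of the \<open>L\<^sup>2\<close> norm on the torus of \<open>u(\<cdot> + z) - u\<close>, let \<open>E\<^sub>0\<close> and \<open>E\<^sub>1\<close> be
  the squares of the norm and of the discrete \<open>H\<^sup>1\<close> semi-norm of \<open>u\<close>, and let \<open>h\<close> be the mesh width.
  Unfolding the torus bounds the squared Slobodetskij semi-norm by the integral over \<open>\<real>\<^sup>n\<close> of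
  \<open>\<Phi>(z) / |z|\<^sup>n\<^sup>+\<^sup>2\<^sup>s\<close>.

  For \<open>|z|\<close> smaller than a multiple of \<open>h\<close>, the field changes by \<open>O(|z|)\<close> times its derivatives, except
  in a layer of relative volume \<open>O(|z| / h)\<close> along the boundaries of the simplices, where it changes
  by its local oscillation.  Inverse estimates therefore give \<open>\<Phi>(z) \<le> C (|z| / h) min(E\<^sub>0, h\<^sup>2 E\<^sub>1)\<close>; the
  oscillation is bounded by \<open>E\<^sub>1\<close> along a chain of simplices that meet in facets, because jumps across
  facets are controlled.  Splitting a large \<open>z\<close> into steps of size \<open>O(h)\<close> gives
  \<open>\<Phi>(z) \<le> C min(E\<^sub>0, |z|\<^sup>2 E\<^sub>1)\<close>.  Integrating these two bounds gives \<open>E\<^sub>0\<^sup>1\<^sup>-\<^sup>s E\<^sub>1\<^sup>s\<close>; the first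
  factor \<open>|z|\<close> makes the integral converge at 0 exactly when \<open>2s < 1\<close>.

  The inverse estimates hold uniformly because their failure along a sequence of cells would
  contradict the linear independence of the bases in the limit shape.
\<close>

section \<open>Lattices and periodic integrals\<close>

text \<open>The local spaces need not be polynomial, and bases converge only in C^1, so the inverse
  estimates cannot be read off from one reference element. They are first proved for combinations
  with coefficient norm 1, at one point, and then spread to a ball of fixed relative size by
  equicontinuity. For gradients linear independence is not enough: a limit with vanishing
  derivatives is only constant on each simplex. Connectedness of cells links the simplices of a cell
  through common vertices, and subtracting a constant form, which belongs to the local space,
  normalises the value at one vertex. Jumps are measured by facet integrals, but a chain of
  simplices needs pointwise comparison; one point per facet where the jump is at most its mean
  suffices, because derivatives control the rest of the simplex. Local energies are collected over
  neighbourhoods of bounded cardinality and summed by double counting of orbits, so that no constant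
  depends on the mesh. Finally min(a, b) \<le> a^(1-s) b^s, applied with a =
  \<open>E\<^sub>0\<close> and b = h^2 \<open>E\<^sub>1\<close>, removes h from the contribution of
  short translations.\<close>

definition lat_map :: "('n::finite \<Rightarrow> 'n point) \<Rightarrow> 'n point \<Rightarrow> 'n point" where
  "lat_map e t = (\<Sum>i\<in>UNIV. t $ i *\<^sub>R e i)"

lemma linear_lat_map: "linear (lat_map e)"
  unfolding lat_map_def
  by (rule linearI) (simp_all add: scaleR_add_left sum.distrib scaleR_sum_right)

lemma lattice_eq_lat_map: "lattice e = lat_map e ` {z. \<forall>i. z $ i \<in> \<int>}"
proof
  show "lattice e \<subseteq> lat_map e ` {z. \<forall>i. z $ i \<in> \<int>}"
  proof
    fix l assume "l \<in> lattice e"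
    then obtain z :: "'a \<Rightarrow> int" where "l = (\<Sum>i\<in>UNIV. of_int (z i) *\<^sub>R e i)"
      by (auto simp: lattice_def)
    then have "l = lat_map e (\<chi> i. of_int (z i))" by (simp add: lat_map_def)
    then show "l \<in> lat_map e ` {z. \<forall>i. z $ i \<in> \<int>}" by (rule image_eqI) auto
  qed
  show "lat_map e ` {z. \<forall>i. z $ i \<in> \<int>} \<subseteq> lattice e"
  proof
    fix l assume "l \<in> lat_map e ` {z. \<forall>i. z $ i \<in> \<int>}"
    then obtain z where z: "\<forall>i. z $ i \<in> \<int>" and l: "l = lat_map e z" by auto
    have "l = (\<Sum>i\<in>UNIV. of_int \<lfloor>z $ i\<rfloor> *\<^sub>R e i)"
      unfolding l lat_map_def using z by (intro sum.cong) auto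
    then show "l \<in> lattice e" unfolding lattice_def by (intro CollectI exI[of _ "\<lambda>i. \<lfloor>z $ i\<rfloor>"]) simp
  qed
qed

lemma fund_domain_eq_lat_map: "fund_domain e = lat_map e ` {t. \<forall>i. 0 \<le> t $ i \<and> t $ i < 1}"
proof
  show "fund_domain e \<subseteq> lat_map e ` {t. \<forall>i. 0 \<le> t $ i \<and> t $ i < 1}"
  proof
    fix x assume "x \<in> fund_domain e"
    then obtain t where t: "\<forall>i. 0 \<le> t i \<and> t i < 1" "x = (\<Sum>i\<in>UNIV. t i *\<^sub>R e i)"
      by (auto simp: fund_domain_def)
    then have "x = lat_map e (\<chi> i. t i)" by (simp add: lat_map_def)
    with t(1) show "x \<in> lat_map e ` {t. \<forall>i. 0 \<le> t $ i \<and> t $ i < 1}"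
      by (intro image_eqI[of _ _ "\<chi> i. t i"]) auto
  qed
  show "lat_map e ` {t. \<forall>i. 0 \<le> t $ i \<and> t $ i < 1} \<subseteq> fund_domain e"
    by (auto simp: fund_domain_def lat_map_def)
qed

lemma inj_lat_map:
  assumes "lattice_basis e" shows "inj (lat_map e)"
proof -
  have inj: "inj e" and ind: "independent (range e)" using assms by (auto simp: lattice_basis_def)
  have "t = 0" if "lat_map e t = 0" for t
  proof -
    have "(\<Sum>v\<in>range e. t $ (inv e v) *\<^sub>R v) = 0"
      using that inj by (subst sum.reindex) (auto simp: lat_map_def)
    then have "\<forall>v\<in>range e. t $ (inv e v) = 0"
      using ind independentD[OF ind, of "range e" "\<lambda>v. t $ (inv e v)"] by auto
    then show "t = 0" using inj by (auto simp: vec_eq_iff)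
  qed
  then show ?thesis by (simp add: linear_injective_0[OF linear_lat_map])
qed

lemma bij_lat_map: "lattice_basis e \<Longrightarrow> bij (lat_map e)"
  using inj_lat_map linear_injective_imp_surjective[OF linear_lat_map] by (metis bij_def)

definition lat_coord :: "('n::finite \<Rightarrow> 'n point) \<Rightarrow> 'n point \<Rightarrow> 'n point" where
  "lat_coord e = inv (lat_map e)"

context
  fixes e :: "'n::finite \<Rightarrow> 'n point"
  assumes e: "lattice_basis e"
begin

lemma lat_coord_map [simp]: "lat_coord e (lat_map e t) = t"
  unfolding lat_coord_def using inj_lat_map[OF e] by simp

lemma lat_map_coord [simp]: "lat_map e (lat_coord e x) = x"
  unfolding lat_coord_def using bij_lat_map[OF e] by (simp add: bij_is_surj surj_f_inv_f)

lemma linear_lat_coord: "linear (lat_coord e)"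
  unfolding lat_coord_def
  by (rule inj_linear_imp_inv_linear[OF linear_lat_map inj_lat_map[OF e]])

lemma mem_lattice_iff: "x \<in> lattice e \<longleftrightarrow> (\<forall>i. lat_coord e x $ i \<in> \<int>)"
proof -
  have "x \<in> lat_map e ` Z \<longleftrightarrow> lat_coord e x \<in> Z" for Z
    by (metis image_iff lat_coord_map lat_map_coord)
  then show ?thesis by (simp add: lattice_eq_lat_map)
qed

lemma mem_fund_domain_iff: "x \<in> fund_domain e \<longleftrightarrow> (\<forall>i. 0 \<le> lat_coord e x $ i \<and> lat_coord e x $ i < 1)"
proof -
  have "x \<in> lat_map e ` Z \<longleftrightarrow> lat_coord e x \<in> Z" for Z
    by (metis image_iff lat_coord_map lat_map_coord)
  then show ?thesis by (simp add: fund_domain_eq_lat_map)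
qed

lemma lattice_0: "0 \<in> lattice e"
  and lattice_add: "x \<in> lattice e \<Longrightarrow> y \<in> lattice e \<Longrightarrow> x + y \<in> lattice e"
  and lattice_diff: "x \<in> lattice e \<Longrightarrow> y \<in> lattice e \<Longrightarrow> x - y \<in> lattice e"
  and lattice_uminus: "x \<in> lattice e \<Longrightarrow> - x \<in> lattice e"
  by (auto simp: mem_lattice_iff linear_0[OF linear_lat_coord] linear_add[OF linear_lat_coord]
    linear_diff[OF linear_lat_coord] linear_neg[OF linear_lat_coord])

text \<open>Countability is what permits sums over the lattice, written as integrals against
  \<open>count_space\<close>, to be exchanged with Lebesgue integrals.\<close>

lemma countable_lattice: "countable (lattice e)"
proof -
  have "lattice e = range (\<lambda>z :: 'n \<Rightarrow> int. (\<Sum>i\<in>UNIV. of_int (z i) *\<^sub>R e i))"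
    by (auto simp: lattice_def)
  then show ?thesis by simp
qed

text \<open>The lattice vector is given by the integer parts of the coordinates of \<open>x\<close>;
  uniqueness holds because the coordinates left over lie in a half-open unit interval.\<close>

lemma ex1_fund_domain: "\<exists>!l. l \<in> lattice e \<and> x - l \<in> fund_domain e"
proof
  let ?l = "lat_map e (\<chi> i. of_int \<lfloor>lat_coord e x $ i\<rfloor>)"
  show "?l \<in> lattice e \<and> x - ?l \<in> fund_domain e"
    by (auto simp: mem_lattice_iff mem_fund_domain_iff linear_diff[OF linear_lat_coord]) linarith
  fix l assume l: "l \<in> lattice e \<and> x - l \<in> fund_domain e"
  have "lat_coord e l $ i = of_int \<lfloor>lat_coord e x $ i\<rfloor>" for i
  proof -
    obtain k :: int where k: "lat_coord e l $ i = of_int k"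
      using l by (auto simp: mem_lattice_iff elim: Ints_cases)
    have "0 \<le> lat_coord e x $ i - of_int k" "lat_coord e x $ i - of_int k < 1"
      using l k[symmetric] by (auto simp: mem_fund_domain_iff linear_diff[OF linear_lat_coord])
    then have "\<lfloor>lat_coord e x $ i\<rfloor> = k" by linarith
    with k show ?thesis by simp
  qed
  then have "lat_coord e l = (\<chi> i. of_int \<lfloor>lat_coord e x $ i\<rfloor>)" by (simp add: vec_eq_iff)
  then show "l = ?l" by (metis lat_map_coord)
qed

lemma borel_fund_domain [measurable]: "fund_domain e \<in> sets borel"
proof -
  have [measurable]: "lat_coord e \<in> borel_measurable borel"
    by (intro borel_measurable_continuous_onI linear_continuous_on linear_conv_bounded_linear[THEN iffD1] linear_lat_coord)
  have *: "fund_domain e = {x \<in> space borel. \<forall>i. 0 \<le> lat_coord e x $ i \<and> lat_coord e x $ i < 1}"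
    by (auto simp: mem_fund_domain_iff)
  have [measurable]: "(\<lambda>x. lat_coord e x $ i) \<in> borel_measurable borel" for i
    by (rule measurable_compose[OF \<open>lat_coord e \<in> borel_measurable borel\<close>]) (intro borel_measurable_continuous_onI continuous_intros)
  show ?thesis unfolding * by measurable
qed

lemma bounded_fund_domain: "bounded (fund_domain e)"
proof -
  have "bounded {t :: 'n point. \<forall>i. 0 \<le> t $ i \<and> t $ i < 1}"
    by (rule bounded_subset[OF bounded_cbox[of 0 "\<chi> i. 1"]]) (auto simp: mem_box_cart less_imp_le)
  then show ?thesis
    unfolding fund_domain_eq_lat_map
    by (rule bounded_linear_image) (simp add: linear_lat_map linear_conv_bounded_linear[symmetric])
qed

text \<open>A nonzero lattice vector has an integer coordinate of modulus at least 1, and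
  \<open>lat_map\<close> is bounded below because it is injective on a finite-dimensional
  space.\<close>

lemma lattice_min_norm: "\<exists>\<delta>>0. \<forall>l\<in>lattice e. l \<noteq> 0 \<longrightarrow> \<delta> \<le> norm l"
proof -
  obtain B where B: "B > 0" "\<And>x. B * norm x \<le> norm (lat_map e x)"
    using linear_inj_bounded_below_pos[OF linear_lat_map inj_lat_map[OF e]] by metis
  have "B \<le> norm l" if l: "l \<in> lattice e" "l \<noteq> 0" for l
  proof -
    have "lat_coord e l \<noteq> 0" using l(2) linear_0[OF linear_lat_map] by (metis lat_map_coord)
    then obtain i where i: "lat_coord e l $ i \<noteq> 0" by (auto simp: vec_eq_iff)
    then have "1 \<le> \<bar>lat_coord e l $ i\<bar>" using l(1) by (simp add: mem_lattice_iff Ints_nonzero_abs_ge1)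
    also have "\<dots> \<le> norm (lat_coord e l)" by (rule component_le_norm_cart)
    finally have "B * 1 \<le> B * norm (lat_coord e l)" using B(1) by simp
    then show ?thesis using B(2)[of "lat_coord e l"] by simp
  qed
  then show ?thesis using B(1) by blast
qed

section \<open>Unfolding integrals over the fundamental domain\<close>

lemma nn_integral_translate:
  fixes f :: "'n point \<Rightarrow> ennreal"
  assumes [measurable]: "f \<in> borel_measurable borel"
  shows "(\<integral>\<^sup>+x. f (x + c) \<partial>lborel) = (\<integral>\<^sup>+x. f x \<partial>lborel)"
proof -
  have "(\<integral>\<^sup>+x. f x \<partial>lborel) = (\<integral>\<^sup>+x. f x \<partial>distr lborel borel ((+) c))" by (simp add: lborel_distr_plus)
  also have "\<dots> = (\<integral>\<^sup>+x. f (c + x) \<partial>lborel)" by (subst nn_integral_distr) auto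
  finally show ?thesis by (simp add: add.commute)
qed

lemma nn_integral_lattice_indicator:
  fixes x :: "'n point"
  shows "(\<integral>\<^sup>+l. indicator (fund_domain e) (x - l) \<partial>count_space (lattice e)) = 1"
proof -
  obtain l0 where l0: "l0 \<in> lattice e" "x - l0 \<in> fund_domain e" 
    and uniq: "\<forall>l. l \<in> lattice e \<and> x - l \<in> fund_domain e \<longrightarrow> l = l0"
  proof -
    have "\<exists>l0. (l0 \<in> lattice e \<and> x - l0 \<in> fund_domain e) \<and> (\<forall>l. l \<in> lattice e \<and> x - l \<in> fund_domain e \<longrightarrow> l = l0)"
      using ex1_fund_domain[of x] unfolding Ex1_def .
    with that show ?thesis by blast
  qed
  have ind: "indicator (fund_domain e) (x - l) = (indicator {l0} l :: ennreal)" if "l \<in> lattice e" for l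
  proof (cases "l = l0")
    case False
    then have "x - l \<notin> fund_domain e" using uniq that by blast
    with False show ?thesis by simp
  qed (use l0 in simp)
  have "(\<integral>\<^sup>+l. indicator (fund_domain e) (x - l) \<partial>count_space (lattice e))
     = (\<integral>\<^sup>+l. indicator {l0} l \<partial>count_space (lattice e))"
    by (rule nn_integral_cong) (use ind in simp)
  also have "\<dots> = (1::ennreal)" using l0 by simp
  finally show ?thesis .
qed

text \<open>Exchange the sum with the integral, translate by \<open>- l\<close>, and use that the
  translates of the fundamental domain tile the space, so that the indicators add up to 1.\<close>

lemma nn_integral_fund_domain_lattice:
  fixes f :: "'n point \<Rightarrow> ennreal"
  assumes [measurable]: "f \<in> borel_measurable borel"
  shows "(\<integral>\<^sup>+x\<in>fund_domain e. (\<integral>\<^sup>+l. f (x + l) \<partial>count_space (lattice e)) \<partial>lborel) = (\<integral>\<^sup>+x. f x \<partial>lborel)"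
proof -
  have "(\<integral>\<^sup>+x\<in>fund_domain e. (\<integral>\<^sup>+l. f (x + l) \<partial>count_space (lattice e)) \<partial>lborel)
     = (\<integral>\<^sup>+x. (\<integral>\<^sup>+l. f (x + l) * indicator (fund_domain e) x \<partial>count_space (lattice e)) \<partial>lborel)"
    by (intro nn_integral_cong nn_integral_multc[symmetric]) auto
  also have "\<dots> = (\<integral>\<^sup>+l. (\<integral>\<^sup>+x. f (x + l) * indicator (fund_domain e) x \<partial>lborel) \<partial>count_space (lattice e))"
    by (intro nn_integral_count_space_nn_integral countable_lattice) measurable
  also have "\<dots> = (\<integral>\<^sup>+l. (\<integral>\<^sup>+x. f x * indicator (fund_domain e) (x - l) \<partial>lborel) \<partial>count_space (lattice e))"
  proof (rule nn_integral_cong)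
    fix l
    show "(\<integral>\<^sup>+x. f (x + l) * indicator (fund_domain e) x \<partial>lborel) = (\<integral>\<^sup>+x. f x * indicator (fund_domain e) (x - l) \<partial>lborel)"
      using nn_integral_translate[of "\<lambda>x. f x * indicator (fund_domain e) (x - l)" l] by simp
  qed
  also have "\<dots> = (\<integral>\<^sup>+x. (\<integral>\<^sup>+l. f x * indicator (fund_domain e) (x - l) \<partial>count_space (lattice e)) \<partial>lborel)"
    by (intro nn_integral_count_space_nn_integral[symmetric] countable_lattice) measurable
  also have "\<dots> = (\<integral>\<^sup>+x. f x \<partial>lborel)"
    by (simp add: nn_integral_cmult nn_integral_lattice_indicator)
  finally show ?thesis .
qed

text \<open>The inner integral counts the lifts of \<open>x\<close> that lie in \<open>P\<close>.
  Bounds for this number from above or below turn integrals over cells into bounds on the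
  torus.\<close>

lemma nn_integral_periodic:
  fixes f :: "'n point \<Rightarrow> ennreal"
  assumes [measurable]: "f \<in> borel_measurable borel" "P \<in> sets borel"
    and per: "periodic e f"
  shows "(\<integral>\<^sup>+x\<in>P. f x \<partial>lborel)
    = (\<integral>\<^sup>+x\<in>fund_domain e. f x * (\<integral>\<^sup>+l. indicator P (x + l) \<partial>count_space (lattice e)) \<partial>lborel)"
proof -
  have "(\<integral>\<^sup>+x\<in>P. f x \<partial>lborel)
    = (\<integral>\<^sup>+x\<in>fund_domain e. (\<integral>\<^sup>+l. f (x + l) * indicator P (x + l) \<partial>count_space (lattice e)) \<partial>lborel)"
    by (rule nn_integral_fund_domain_lattice[symmetric]) measurable
  also have "\<dots> = (\<integral>\<^sup>+x\<in>fund_domain e. (\<integral>\<^sup>+l. f x * indicator P (x + l) \<partial>count_space (lattice e)) \<partial>lborel)"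
  proof -
    have "(\<integral>\<^sup>+l. f (x + l) * indicator P (x + l) \<partial>count_space (lattice e)) = 
      (\<integral>\<^sup>+l. f x * indicator P (x + l) \<partial>count_space (lattice e))" for x
      by (intro nn_integral_cong) (use per in \<open>auto simp: periodic_def\<close>)
    then show ?thesis by simp
  qed
  finally show ?thesis by (simp add: nn_integral_cmult)
qed

text \<open>A translated fundamental domain still contains exactly one lift of each point, so the
  counting weight in \<open>nn_integral_periodic\<close> is 1.\<close>

lemma nn_integral_fund_domain_shift:
  fixes f :: "'n point \<Rightarrow> ennreal"
  assumes [measurable]: "f \<in> borel_measurable borel" and per: "periodic e f"
  shows "(\<integral>\<^sup>+x\<in>fund_domain e. f (x + v) \<partial>lborel) = (\<integral>\<^sup>+x\<in>fund_domain e. f x \<partial>lborel)"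
proof -
  have "(\<integral>\<^sup>+x\<in>fund_domain e. f (x + v) \<partial>lborel) = (\<integral>\<^sup>+x. f x * indicator (fund_domain e) (x - v) \<partial>lborel)"
    using nn_integral_translate[of "\<lambda>x. f x * indicator (fund_domain e) (x - v)" v] by simp
  also have "\<dots> = (\<integral>\<^sup>+x\<in>(\<lambda>x. x - v) -` fund_domain e. f x \<partial>lborel)"
    by (simp add: indicator_def)
  also have "\<dots> = (\<integral>\<^sup>+x\<in>fund_domain e. f x * (\<integral>\<^sup>+l. indicator ((\<lambda>x. x - v) -` fund_domain e) (x + l) \<partial>count_space (lattice e)) \<partial>lborel)"
  proof (rule nn_integral_periodic)
    have "(\<lambda>x. x - v) -` fund_domain e \<inter> space borel \<in> sets borel"
      by (rule measurable_sets) measurable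
    then show "(\<lambda>x. x - v) -` fund_domain e \<in> sets borel" by simp
  qed (use per in measurable)
  also have "\<dots> = (\<integral>\<^sup>+x\<in>fund_domain e. f x \<partial>lborel)"
  proof -
    have "(\<integral>\<^sup>+l. indicator ((\<lambda>x. x - v) -` fund_domain e) (x + l) \<partial>count_space (lattice e)) = (1::ennreal)" for x
    proof -
      have "(\<integral>\<^sup>+l. indicator ((\<lambda>x. x - v) -` fund_domain e) (x + l) \<partial>count_space (lattice e)) = 
        (\<integral>\<^sup>+l. indicator (fund_domain e) ((x - v) - (- l)) \<partial>count_space (lattice e))"
        by (intro nn_integral_cong) (auto simp: indicator_def algebra_simps)
      also have "\<dots> = (\<integral>\<^sup>+l. indicator (fund_domain e) ((x - v) - l) \<partial>count_space (lattice e))"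
      proof (rule nn_integral_bij_count_space)
        show "bij_betw uminus (lattice e) (lattice e)"
          by (rule bij_betwI[where g=uminus]) (auto simp: lattice_uminus)
      qed
      finally show ?thesis by (simp add: nn_integral_lattice_indicator)
    qed
    then show ?thesis by simp
  qed
  finally show ?thesis .
qed

section \<open>The distance on the torus\<close>

lemma tdist_nonneg: "0 \<le> tdist e x y"
  unfolding tdist_def using lattice_0 by (intro cINF_greatest) auto

lemma tdist_le: "l \<in> lattice e \<Longrightarrow> tdist e x y \<le> norm (x - y + l)"
  unfolding tdist_def by (rule cINF_lower) (auto intro!: bdd_belowI[of _ 0])

lemma tdist_bounded: "\<exists>D. \<forall>x y. tdist e x y \<le> D"
proof -
  obtain D where D: "\<And>x. x \<in> fund_domain e \<Longrightarrow> norm x \<le> D"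
    using bounded_fund_domain by (auto simp: bounded_iff)
  have "tdist e x y \<le> D" for x y
  proof -
    obtain l where l: "l \<in> lattice e" "(x - y) - l \<in> fund_domain e" using ex1_fund_domain by blast
    then show ?thesis using tdist_le[OF lattice_uminus[OF l(1)], of x y] D[OF l(2)] by simp
  qed
  then show ?thesis by blast
qed

lemma tdist_less_ex: "tdist e x y < c \<Longrightarrow> \<exists>l\<in>lattice e. norm (x - y + l) < c"
  unfolding tdist_def using lattice_0
  by (subst (asm) cINF_less_iff) (auto intro!: bdd_belowI[of _ 0])

text \<open>Positivity is not immediate for an infimum over the lattice. If it failed, a nonzero
  lattice vector would shorten \<open>x - y\<close>, and would then itself be shorter than
  \<delta>.\<close>

lemma tdist_pos:
  assumes d: "\<forall>l\<in>lattice e. l \<noteq> 0 \<longrightarrow> \<delta> \<le> norm l" and xy: "x \<noteq> y" "norm (x - y) < \<delta> / 2"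
  shows "0 < tdist e x y"
proof (rule ccontr)
  assume "\<not> 0 < tdist e x y"
  then have "tdist e x y < norm (x - y)" using xy by (smt (verit) zero_less_norm_iff right_minus_eq)
  then obtain l where l: "l \<in> lattice e" "norm (x - y + l) < norm (x - y)" using tdist_less_ex by blast
  then have "l \<noteq> 0" by auto
  then have "\<delta> \<le> norm l" using d l by blast
  moreover have "norm l \<le> norm (x - y + l) + norm (x - y)"
    using norm_triangle_ineq4[of "x - y + l" "x - y"] by simp
  ultimately show False using l xy by linarith
qed

end

section \<open>Continuously differentiable fields and forms\<close>

lemma cdiff_1_iff:
  "cdiff 1 f \<longleftrightarrow> (\<forall>x. f differentiable (at x)) \<and>
     (\<forall>v. continuous_on UNIV (\<lambda>x. frechet_derivative f (at x) v))"
  by simp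

lemma smooth_imp_cdiff_1: "smooth f \<Longrightarrow> cdiff 1 f"
  by (simp add: smooth_def)

lemma cdiff_1_differentiable: "cdiff 1 f \<Longrightarrow> f differentiable (at x)"
  by simp

lemma cdiff_1_has_derivative: "cdiff 1 f \<Longrightarrow> (f has_derivative frechet_derivative f (at x)) (at x)"
  by (simp add: frechet_derivative_works[symmetric])

lemma cdiff_1_continuous: "cdiff 1 f \<Longrightarrow> continuous_on S f"
  using cdiff_1_differentiable differentiable_imp_continuous_within
  by (metis continuous_at_imp_continuous_on)

lemma cdiff_1_continuous_partial: "cdiff 1 f \<Longrightarrow> continuous_on S (partial i f)"
  unfolding partial_def cdiff_1_iff by (auto intro: continuous_on_subset)

lemma frechet_derivative_partial:
  fixes f :: "('n::finite) point \<Rightarrow> 'b::real_normed_vector"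
  assumes "f differentiable (at x)"
  shows "frechet_derivative f (at x) v = (\<Sum>i\<in>UNIV. v $ i *\<^sub>R partial i f x)"
proof -
  have lin: "linear (frechet_derivative f (at x))" using assms by (rule linear_frechet_derivative)
  have "frechet_derivative f (at x) v = frechet_derivative f (at x) (\<Sum>i\<in>UNIV. v $ i *\<^sub>R axis i 1)"
    by (simp add: basis_expansion flip: scalar_mult_eq_scaleR)
  also have "\<dots> = (\<Sum>i\<in>UNIV. v $ i *\<^sub>R partial i f x)"
    by (simp add: linear_sum[OF lin] linear_cmul[OF lin] partial_def)
  finally show ?thesis .
qed

lemma partial_eqI: "(f has_derivative f') (at x) \<Longrightarrow> partial i f x = f' (axis i 1)"
  unfolding partial_def using frechet_derivative_at by metis

text \<open>Mean value inequality on a convex set; the factor \<open>CARD('n)\<close> comes from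
  summing over the coordinate directions, each component of \<open>v\<close> being bounded by
  \<open>norm v\<close>.\<close>

lemma lipschitz_on_partial_bound:
  fixes f :: "('n::finite) point \<Rightarrow> 'b::real_normed_vector"
  assumes f: "cdiff 1 f" and S: "convex S" and g: "\<And>x i. x \<in> S \<Longrightarrow> norm (partial i f x) \<le> g"
    and xy: "x \<in> S" "y \<in> S"
  shows "norm (f x - f y) \<le> real CARD('n) * g * norm (x - y)"
proof (rule differentiable_bound[OF S])
  show "(f has_derivative frechet_derivative f (at z)) (at z within S)" if "z \<in> S" for z
    using cdiff_1_has_derivative[OF f] has_derivative_at_withinI by blast
  show "onorm (frechet_derivative f (at z)) \<le> real CARD('n) * g" if "z \<in> S" for z
  proof (rule onorm_le)
    fix v
    have "norm (frechet_derivative f (at z) v) \<le> (\<Sum>i\<in>UNIV. norm (v $ i *\<^sub>R partial i f z))"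
      by (subst frechet_derivative_partial[OF cdiff_1_differentiable[OF f]]) (rule norm_sum)
    also have "\<dots> \<le> (\<Sum>i\<in>(UNIV::'n set). norm v * g)"
      by (intro sum_mono) (auto intro!: mult_mono g that component_le_norm_cart)
    finally show "norm (frechet_derivative f (at z) v) \<le> real CARD('n) * g * norm v"
      by (simp add: mult_ac)
  qed
qed (use xy in auto)

text \<open>Contraction with a coordinate vector selects the coefficient with one more index, up to
  the sign \<open>wsgn\<close>; the factor \<open>\<epsilon>\<close> is the product of these
  signs.\<close>

lemma form_eval_axis:
  assumes "distinct is"
  shows "\<exists>\<epsilon>. \<epsilon> \<noteq> 0 \<and> (\<forall>a :: real^('n::{finite,linorder} set). form_eval a (map (\<lambda>i. axis i 1) is) = \<epsilon> * a $ set is)"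
  using assms
proof (induction "is")
  case Nil
  then show ?case by (intro exI[of _ 1]) simp
next
  case (Cons i "is")
  then obtain \<epsilon> where \<epsilon>: "\<epsilon> \<noteq> 0"
    "\<And>a :: real^('n set). form_eval a (map (\<lambda>i. axis i 1) is) = \<epsilon> * a $ set is" by auto
  have "contract (axis i 1) a $ set is = wsgn i (set is) * a $ insert i (set is)" for a
  proof -
    have "contract (axis i 1) a $ set is
      = (\<Sum>j\<in>- set is. if j = i then wsgn j (set is) * a $ (insert j (set is)) else 0)"
      unfolding contract_def vec_lambda_beta by (rule sum.cong) (auto simp: axis_def)
    also have "\<dots> = wsgn i (set is) * a $ insert i (set is)"
      using Cons.prems by (subst sum.delta) auto
    finally show ?thesis .
  qed
  then have "form_eval a (map (\<lambda>i. axis i 1) (i # is)) = (\<epsilon> * wsgn i (set is)) * a $ set (i # is)" for a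
    by (simp add: \<epsilon>)
  moreover have "\<epsilon> * wsgn i (set is) \<noteq> 0" using \<epsilon> by (simp add: wsgn_def)
  ultimately show ?case by blast
qed

text \<open>Every index set can be listed, so evaluation on coordinate vectors recovers each
  coefficient up to a nonzero factor. This turns equality of pullbacks to a full-dimensional simplex
  into equality of forms.\<close>

lemma form_eval_eqD:
  fixes a b :: "real^('n::{finite,linorder} set)"
  assumes "\<And>vs. form_eval a vs = form_eval b vs"
  shows "a = b"
proof -
  have "a $ I = b $ I" for I
  proof -
    obtain xs where "set xs = I" "distinct xs" using finite_distinct_list[of I] by auto
    with form_eval_axis[of xs] obtain \<epsilon> where \<epsilon>: "\<epsilon> \<noteq> 0"
      "\<And>a :: real^('n set). form_eval a (map (\<lambda>i. axis i 1) xs) = \<epsilon> * a $ I" by auto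
    then have "\<epsilon> * a $ I = \<epsilon> * b $ I" using assms by metis
    then show ?thesis using \<epsilon>(1) by simp
  qed
  then show ?thesis by (simp add: vec_eq_iff)
qed

section \<open>Compactness of shapes\<close>

text \<open>Bolzano-Weierstrass for one coefficient at a time; each new extraction keeps the limits
  found before.\<close>

lemma coeff_subseq:
  fixes b :: "nat \<Rightarrow> nat \<Rightarrow> real"
  assumes "\<And>j i. i < q \<Longrightarrow> \<bar>b j i\<bar> \<le> 1"
  shows "\<exists>(r :: nat \<Rightarrow> nat) l. strict_mono r \<and> (\<forall>i<q. (\<lambda>j. b (r j) i) \<longlonglongrightarrow> l i)"
  using assms
proof (induction q)
  case 0
  then show ?case by (auto intro: exI[of _ id] simp: strict_mono_def)
next
  case (Suc q)
  then obtain r l where r: "strict_mono (r :: nat \<Rightarrow> nat)" "\<forall>i<q. (\<lambda>j. b (r j) i) \<longlonglongrightarrow> l i"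
    by (metis less_SucI)
  have "\<forall>j. b (r j) q \<in> {-1..1}" using Suc.prems[of q] by (auto simp: abs_le_iff minus_le_iff)
  then obtain l' r' where r': "strict_mono r'" "((\<lambda>j. b (r j) q) \<circ> r') \<longlonglongrightarrow> l'"
    using compact_Icc[of "-1::real" 1] unfolding compact_def by metis
  have "strict_mono (r \<circ> r')" using r r' by (simp add: strict_mono_o)
  moreover have "(\<lambda>j. b ((r \<circ> r') j) i) \<longlonglongrightarrow> (l(q := l')) i" if "i < Suc q" for i
  proof (cases "i = q")
    case True then show ?thesis using r' by (simp add: o_def)
  next
    case False
    then have "(\<lambda>j. b (r j) i) \<longlonglongrightarrow> l i" using r that by auto
    from LIMSEQ_subseq_LIMSEQ[OF this r'(1)] False show ?thesis by (simp add: o_def)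
  qed
  ultimately show ?case by blast
qed

lemma constant_subseq:
  assumes "finite A" "\<And>j::nat. f j \<in> A"
  shows "\<exists>(r :: nat \<Rightarrow> nat) a. strict_mono r \<and> a \<in> A \<and> (\<forall>j. f (r j) = a)"
proof -
  have "finite (f ` UNIV)" using assms by (meson finite_subset image_subsetI)
  then obtain j0 where "infinite {j \<in> UNIV. f j = f j0}"
    using pigeonhole_infinite[of UNIV f] infinite_UNIV_nat by auto
  then obtain r where "strict_mono (r :: nat \<Rightarrow> nat)" "\<forall>n. r n \<in> {j \<in> UNIV. f j = f j0}"
    using infinite_enumerate by blast
  then have "strict_mono r \<and> f j0 \<in> A \<and> (\<forall>j. f (r j) = f j0)" using assms(2)[of j0] by auto
  then show ?thesis by blast
qed

lemma differentiable_sh_comb: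
  assumes "\<And>i. i < sh_rank R k D \<Longrightarrow> cdiff 1 (sh_bas R k D i)"
  shows "(sh_comb R k D a has_derivative
    (\<lambda>v. \<Sum>i<sh_rank R k D. a i *\<^sub>R frechet_derivative (sh_bas R k D i) (at x) v)) (at x)"
proof -
  have "((\<lambda>x. \<Sum>i<sh_rank R k D. a i *\<^sub>R sh_bas R k D i x) has_derivative
    (\<lambda>v. \<Sum>i<sh_rank R k D. a i *\<^sub>R frechet_derivative (sh_bas R k D i) (at x) v)) (at x)"
    by (intro has_derivative_sum has_derivative_scaleR_right cdiff_1_has_derivative assms) auto
  then show ?thesis by (simp add: sh_comb_def[abs_def])
qed

lemma partial_sh_comb:
  assumes "\<And>i. i < sh_rank R k D \<Longrightarrow> cdiff 1 (sh_bas R k D i)"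
  shows "partial l (sh_comb R k D a) = (\<lambda>x. \<Sum>i<sh_rank R k D. a i *\<^sub>R partial l (sh_bas R k D i) x)"
  using partial_eqI[OF differentiable_sh_comb[OF assms]] by (auto simp: partial_def)

lemma cdiff_1_sh_comb:
  assumes "\<And>i. i < sh_rank R k D \<Longrightarrow> cdiff 1 (sh_bas R k D i)"
  shows "cdiff 1 (sh_comb R k D a)"
proof -
  note d = differentiable_sh_comb[OF assms, where a=a]
  have "frechet_derivative (sh_comb R k D a) (at x) =
    (\<lambda>v. \<Sum>i<sh_rank R k D. a i *\<^sub>R frechet_derivative (sh_bas R k D i) (at x) v)" for x
    using frechet_derivative_at[OF d] by simp
  moreover have "continuous_on UNIV (\<lambda>x. \<Sum>i<sh_rank R k D. a i *\<^sub>R frechet_derivative (sh_bas R k D i) (at x) v)" for v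
    using assms by (intro continuous_on_sum continuous_on_scaleR continuous_on_const) (auto simp: cdiff_1_iff)
  ultimately show ?thesis unfolding cdiff_1_iff using d by (auto simp: differentiable_def)
qed

lemma shape_ok_cdiff:
  assumes "shape_ok R" "D \<in> sh_cells R" "i < sh_rank R k D"
  shows "cdiff 1 (sh_bas R k D i)"
proof -
  have "\<forall>k. \<forall>i<sh_rank R k D. cdiff 1 (sh_bas R k D i)" using assms(1,2) unfolding shape_ok_def by blast
  then show ?thesis using assms(3) by blast
qed

lemma uniform_limit_scaleR_seq:
  fixes f :: "nat \<Rightarrow> 'a \<Rightarrow> 'b::real_normed_vector"
  assumes f: "uniform_limit S f g sequentially" and a: "a \<longlonglongrightarrow> (a0::real)" and g: "bounded (g ` S)"
  shows "uniform_limit S (\<lambda>j x. a j *\<^sub>R f j x) (\<lambda>x. a0 *\<^sub>R g x) sequentially"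
proof -
  have "uniform_limit S (\<lambda>j x. a j) (\<lambda>x. a0) sequentially"
    using a unfolding uniform_limit_iff tendsto_iff by (auto elim: eventually_mono)
  then show ?thesis
    by (rule bounded_bilinear.bounded_uniform_limit[OF bounded_bilinear_scaleR _ f])
      (use g in \<open>auto intro: bounded_subset[of "{a0}"]\<close>)
qed

lemma uniform_limit_finite_sum:
  fixes f :: "'i \<Rightarrow> nat \<Rightarrow> 'a \<Rightarrow> 'b::real_normed_vector"
  assumes "\<And>i. i \<in> I \<Longrightarrow> uniform_limit S (f i) (g i) sequentially"
  shows "uniform_limit S (\<lambda>j x. \<Sum>i\<in>I. f i j x) (\<lambda>x. \<Sum>i\<in>I. g i x) sequentially"
  using assms
proof (induction I rule: infinite_finite_induct)
  case (insert i I)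
  then show ?case by (simp add: uniform_limit_add)
qed (auto intro: uniform_limit_const)

lemma C1_conv_sh_comb:
  assumes rk: "\<And>j. sh_rank (\<rho> j) k D = sh_rank R k D"
    and bas: "\<And>i. i < sh_rank R k D \<Longrightarrow> C1_conv (\<lambda>j. sh_bas (\<rho> j) k D i) (sh_bas R k D i)"
    and a: "\<And>i. i < sh_rank R k D \<Longrightarrow> (\<lambda>j. a j i) \<longlonglongrightarrow> a0 i"
    and cd: "\<And>j i. i < sh_rank R k D \<Longrightarrow> cdiff 1 (sh_bas (\<rho> j) k D i)"
    and cdR: "\<And>i. i < sh_rank R k D \<Longrightarrow> cdiff 1 (sh_bas R k D i)"
  shows "C1_conv (\<lambda>j. sh_comb (\<rho> j) k D (a j)) (sh_comb R k D a0)"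
  unfolding C1_conv_def
proof (intro allI conjI)
  fix r l
  have bdd: "bounded (f ` cball 0 r)" if "continuous_on (cball 0 r) f" for f :: "'a point \<Rightarrow> real^('a set)"
    using that compact_cball compact_continuous_image compact_imp_bounded by blast
  show "uniform_limit (cball 0 r) (\<lambda>j. sh_comb (\<rho> j) k D (a j)) (sh_comb R k D a0) sequentially"
    unfolding sh_comb_def[abs_def] rk
    by (intro uniform_limit_finite_sum uniform_limit_scaleR_seq a bdd cdiff_1_continuous cdR)
      (use bas in \<open>auto simp: C1_conv_def\<close>)
  have "partial l (sh_comb (\<rho> j) k D (a j)) = (\<lambda>x. \<Sum>i<sh_rank R k D. a j i *\<^sub>R partial l (sh_bas (\<rho> j) k D i) x)" for j
    using partial_sh_comb[of "\<rho> j" k D] cd rk by auto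
  moreover have "partial l (sh_comb R k D a0) = (\<lambda>x. \<Sum>i<sh_rank R k D. a0 i *\<^sub>R partial l (sh_bas R k D i) x)"
    using partial_sh_comb[of R k D] cdR by auto
  moreover have "uniform_limit (cball 0 r) (\<lambda>j x. \<Sum>i<sh_rank R k D. a j i *\<^sub>R partial l (sh_bas (\<rho> j) k D i) x)
     (\<lambda>x. \<Sum>i<sh_rank R k D. a0 i *\<^sub>R partial l (sh_bas R k D i) x) sequentially"
    by (intro uniform_limit_finite_sum uniform_limit_scaleR_seq a bdd cdiff_1_continuous_partial cdR)
      (use bas in \<open>auto simp: C1_conv_def\<close>)
  ultimately show "uniform_limit (cball 0 r) (\<lambda>j. partial l (sh_comb (\<rho> j) k D (a j)))
    (partial l (sh_comb R k D a0)) sequentially" by simp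
qed

text \<open>The evaluation points move as well. They stay in one ball, since a convergent sequence
  is bounded, and there the convergence of \<open>f\<close> is uniform.\<close>

lemma uniform_limit_compose_seq:
  fixes f :: "nat \<Rightarrow> 'a::real_normed_vector \<Rightarrow> 'b::real_normed_vector"
  assumes f: "\<And>r. uniform_limit (cball 0 r) f g sequentially" and g: "continuous_on UNIV g"
    and z: "z \<longlonglongrightarrow> z0"
  shows "(\<lambda>j. f j (z j)) \<longlonglongrightarrow> g z0"
proof -
  have "bounded (range z)" using z convergent_imp_bounded by blast
  then obtain r where r: "\<And>j. norm (z j) \<le> r" by (auto simp: bounded_iff)
  have "(\<lambda>j. f j (z j) - g (z j)) \<longlonglongrightarrow> 0"
  proof (rule tendstoI)
    fix \<epsilon> :: real assume "\<epsilon> > 0"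
    with f[of r] have "\<forall>\<^sub>F j in sequentially. \<forall>x\<in>cball 0 r. dist (f j x) (g x) < \<epsilon>"
      by (simp add: uniform_limit_iff)
    then show "\<forall>\<^sub>F j in sequentially. dist (f j (z j) - g (z j)) 0 < \<epsilon>"
      by eventually_elim (use r in \<open>auto simp: dist_norm\<close>)
  qed
  moreover have "(\<lambda>j. g (z j)) \<longlonglongrightarrow> g z0"
    using g z by (metis continuous_on_tendsto_compose UNIV_I eventually_sequentiallyI)
  ultimately have "(\<lambda>j. (f j (z j) - g (z j)) + g (z j)) \<longlonglongrightarrow> 0 + g z0" by (rule tendsto_add)
  then show ?thesis by simp
qed

section \<open>Limits of normalised combinations along converging shapes\<close>

definition coeff_norm :: "('n::finite) shape \<Rightarrow> nat \<Rightarrow> nat set set \<Rightarrow> (nat \<Rightarrow> real) \<Rightarrow> real" where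
  "coeff_norm R k D a = (\<Sum>i<sh_rank R k D. \<bar>a i\<bar>)"

text \<open>Common extraction for all the contradiction arguments: subsequences make the shape
  converge, then freeze the cell, the degree and an index, and finally make the coefficients
  converge. The index \<open>i\<close> carries a coordinate direction through the limit; where there
  is none it takes values in \<open>unit\<close>.\<close>

lemma shape_limit:
  fixes F :: "('n::{finite,linorder}) shape set" and i :: "nat \<Rightarrow> 'i::finite"
  assumes F: "compact_family F" and \<rho>: "\<And>j. \<rho> j \<in> F" and D: "\<And>j. D j \<in> sh_cells (\<rho> j)"
    and k: "\<And>j. k j \<le> CARD('n)" and a: "\<And>j. coeff_norm (\<rho> j) (k j) (D j) (a j) \<le> 1"
  obtains R D0 k0 a0 i0 r where "R \<in> F" "strict_mono r" "D0 \<in> sh_cells R" "shape_ok R"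
    "\<And>j. D (r j) = D0" "\<And>j. k (r j) = k0" "\<And>j. i (r j) = i0"
    "\<And>j. sh_rank (\<rho> (r j)) k0 D0 = sh_rank R k0 D0"
    "\<And>v. v \<in> \<Union>D0 \<Longrightarrow> (\<lambda>j. sh_pos (\<rho> (r j)) v) \<longlonglongrightarrow> sh_pos R v"
    "\<And>q. q < sh_rank R k0 D0 \<Longrightarrow> (\<lambda>j. a (r j) q) \<longlonglongrightarrow> a0 q"
    "C1_conv (\<lambda>j. sh_comb (\<rho> (r j)) k0 D0 (a (r j))) (sh_comb R k0 D0 a0)"
proof -
  obtain R r1 where R: "R \<in> F" and r1: "strict_mono (r1 :: nat \<Rightarrow> nat)" and conv: "shape_conv (\<rho> \<circ> r1) R"
    using F \<rho> unfolding compact_family_def by metis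
  have ok: "shape_ok S" if "S \<in> F" for S using F that unfolding compact_family_def by blast
  have fin: "finite (sh_cells R)"
    using ok[OF R] unfolding shape_ok_def by (intro finite_subset[of "sh_cells R" "Pow (sh_simps R)"]) auto
  have cells: "sh_cells (\<rho> (r1 j)) = sh_cells R" for j using conv by (auto simp: shape_conv_def)
  \<comment> \<open>The combinatorial type is constant along the first subsequence, which leaves
    finitely many cells; hence the triple takes finitely many values.\<close>
  have "(D (r1 j), k (r1 j), i (r1 j)) \<in> sh_cells R \<times> {..CARD('n)} \<times> UNIV" for j
    using D[of "r1 j"] k cells by auto
  moreover have "finite (sh_cells R \<times> {..CARD('n)} \<times> (UNIV :: 'i set))" using fin by simp
  ultimately obtain r2 p where r2: "strict_mono (r2 :: nat \<Rightarrow> nat)" "p \<in> sh_cells R \<times> {..CARD('n)} \<times> (UNIV :: 'i set)"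
    "\<And>j. (D (r1 (r2 j)), k (r1 (r2 j)), i (r1 (r2 j))) = p"
    using constant_subseq[of "sh_cells R \<times> {..CARD('n)} \<times> (UNIV :: 'i set)" "\<lambda>j. (D (r1 j), k (r1 j), i (r1 j))"] by metis
  obtain D0 k0 i0 where p: "p = (D0, k0, i0)" by (cases p)
  have D0: "D0 \<in> sh_cells R" using r2 p by auto
  have rank: "sh_rank (\<rho> (r1 j)) k0 D0 = sh_rank R k0 D0" for j
    using conv D0 by (auto simp: shape_conv_def)
  have "\<bar>a (r1 (r2 j)) q\<bar> \<le> 1" if "q < sh_rank R k0 D0" for j q
  proof -
    have "\<bar>a (r1 (r2 j)) q\<bar> \<le> coeff_norm (\<rho> (r1 (r2 j))) k0 D0 (a (r1 (r2 j)))"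
      unfolding coeff_norm_def using that by (intro member_le_sum) (auto simp: rank)
    also have "\<dots> \<le> 1" using a[of "r1 (r2 j)"] r2(3)[of j] p by simp
    finally show ?thesis .
  qed
  then obtain r3 a0 where r3: "strict_mono (r3 :: nat \<Rightarrow> nat)"
    "\<And>q. q < sh_rank R k0 D0 \<Longrightarrow> (\<lambda>j. a (r1 (r2 (r3 j))) q) \<longlonglongrightarrow> a0 q"
    using coeff_subseq[of "sh_rank R k0 D0" "\<lambda>j. a (r1 (r2 j))"] by metis
  define r where "r = r1 \<circ> r2 \<circ> r3"
  have sub: "strict_mono (r2 \<circ> r3)" using r2 r3 by (simp add: strict_mono_o)
  have D0_sub: "D0 \<subseteq> sh_simps R" using ok[OF R] D0 unfolding shape_ok_def by blast
  have pos: "(\<lambda>j. sh_pos (\<rho> (r j)) v) \<longlonglongrightarrow> sh_pos R v" if "v \<in> \<Union>D0" for v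
  proof -
    have "(\<lambda>j. sh_pos ((\<rho> \<circ> r1) j) v) \<longlonglongrightarrow> sh_pos R v"
      using conv that D0_sub unfolding shape_conv_def by blast
    from LIMSEQ_subseq_LIMSEQ[OF this sub] show ?thesis by (simp add: o_def r_def)
  qed
  have bas: "C1_conv (\<lambda>j. sh_bas (\<rho> (r j)) k0 D0 q) (sh_bas R k0 D0 q)" if "q < sh_rank R k0 D0" for q
  proof -
    have *: "C1_conv (\<lambda>j. sh_bas ((\<rho> \<circ> r1) j) k0 D0 q) (sh_bas R k0 D0 q)"
      using conv that D0 unfolding shape_conv_def by blast
    have **: "filterlim (r2 \<circ> r3) sequentially sequentially" using sub by (rule filterlim_subseq)
    show ?thesis unfolding C1_conv_def
      using * unfolding C1_conv_def by (auto simp: r_def o_def intro!: filterlim_compose[OF _ **[unfolded o_def]])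
  qed
  have "C1_conv (\<lambda>j. sh_comb (\<rho> (r j)) k0 D0 (a (r j))) (sh_comb R k0 D0 a0)"
  proof (rule C1_conv_sh_comb)
    fix j q assume q: "q < sh_rank R k0 D0"
    show "cdiff 1 (sh_bas (\<rho> (r j)) k0 D0 q)"
      using q by (intro shape_ok_cdiff ok \<rho>) (use D0 cells rank in \<open>auto simp: r_def\<close>)
    show "cdiff 1 (sh_bas R k0 D0 q)"
      using q by (intro shape_ok_cdiff ok R D0)
  qed (use rank bas r3 in \<open>auto simp: r_def\<close>)
  moreover have "strict_mono r" using r1 sub by (simp add: r_def strict_mono_o o_assoc[symmetric])
  ultimately show ?thesis
    using that[OF R _ D0 ok[OF R], of r k0 i0 a0] r2(3) p pos rank r3 by (auto simp: r_def)
qed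

text \<open>All cells along the sequence lie in one ball, because convergent vertices are bounded.
  Points chosen in these cells then have a convergent subsequence.\<close>

lemma convex_hull_pos_bounded:
  assumes "finite V" "\<And>v. v \<in> V \<Longrightarrow> (\<lambda>j. p j v) \<longlonglongrightarrow> (p0 v :: 'a::real_normed_vector)"
  shows "\<exists>B. \<forall>j. \<forall>s\<subseteq>V. convex hull (p j ` s) \<subseteq> cball 0 B"
proof -
  have "\<exists>B. \<forall>j. norm (p j v) \<le> B" if "v \<in> V" for v
    using convergent_imp_bounded[OF assms(2)[OF that]] by (auto simp: bounded_iff)
  then obtain b where b: "\<And>v j. v \<in> V \<Longrightarrow> norm (p j v) \<le> b v" by metis
  have "p j ` s \<subseteq> cball 0 (\<Sum>v\<in>V. \<bar>b v\<bar>)" if "s \<subseteq> V" for s j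
  proof (clarsimp)
    fix v assume "v \<in> s"
    then have v: "v \<in> V" using that by auto
    have "norm (p j v) \<le> \<bar>b v\<bar>" using b[OF v, of j] by simp
    also have "\<dots> \<le> (\<Sum>v\<in>V. \<bar>b v\<bar>)" using v assms(1) by (intro member_le_sum) auto
    finally show "norm (p j v) \<le> (\<Sum>v\<in>V. \<bar>b v\<bar>)" .
  qed
  then show ?thesis by (meson convex_cball hull_minimal)
qed

text \<open>The barycentric coordinates of \<open>z\<close> are kept while the vertices
  move.\<close>

lemma convex_hull_pos_approx:
  fixes p0 :: "nat \<Rightarrow> 'a::real_normed_vector"
  assumes s: "finite s" "inj_on p0 s" "\<And>v. v \<in> s \<Longrightarrow> (\<lambda>j. p j v) \<longlonglongrightarrow> p0 v"
    and z: "z \<in> convex hull (p0 ` s)"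
  shows "\<exists>zs. (\<forall>j. zs j \<in> convex hull (p j ` s)) \<and> zs \<longlonglongrightarrow> z"
proof -
  from z obtain u where u: "\<forall>x\<in>p0 ` s. 0 \<le> u x" "sum u (p0 ` s) = 1" "(\<Sum>x\<in>p0 ` s. u x *\<^sub>R x) = z"
    using s(1) by (auto simp: convex_hull_finite)
  have u2: "(\<Sum>v\<in>s. u (p0 v)) = 1" "(\<Sum>v\<in>s. u (p0 v) *\<^sub>R p0 v) = z"
    using u s(2) by (simp_all add: sum.reindex)
  have "(\<Sum>v\<in>s. u (p0 v) *\<^sub>R p j v) \<in> convex hull (p j ` s)" for j
    using s(1) u u2 by (intro convex_sum convex_convex_hull) (auto intro: hull_inc)
  moreover have "(\<lambda>j. \<Sum>v\<in>s. u (p0 v) *\<^sub>R p j v) \<longlonglongrightarrow> (\<Sum>v\<in>s. u (p0 v) *\<^sub>R p0 v)"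
    by (intro tendsto_sum tendsto_scaleR tendsto_const s)
  ultimately show ?thesis unfolding u2 by (intro exI[of _ "\<lambda>j. \<Sum>v\<in>s. u (p0 v) *\<^sub>R p j v"]) simp
qed

lemma shape_cell_finite:
  assumes "shape_ok R" "D \<in> sh_cells R"
  shows "finite D" "finite (\<Union>D)" "inj_on (sh_pos R) (\<Union>D)" "\<And>s. s \<in> D \<Longrightarrow> finite s \<and> s \<noteq> {}"
proof -
  have sub: "D \<subseteq> sh_simps R" using assms unfolding shape_ok_def by blast
  then show "finite D" using assms unfolding shape_ok_def by (meson finite_subset)
  moreover show *: "\<And>s. s \<in> D \<Longrightarrow> finite s \<and> s \<noteq> {}" using assms sub unfolding shape_ok_def by blast
  ultimately show "finite (\<Union>D)" by blast
  show "inj_on (sh_pos R) (\<Union>D)" using assms sub unfolding shape_ok_def by (meson Union_mono inj_on_subset)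
qed

lemma geo_Union: "\<Union>(geo R D) = (\<Union>s\<in>D. convex hull (sh_pos R ` s))"
  by (simp add: geo_def)

text \<open>The coefficient norms stay 1 in the limit, whereas a combination that vanishes on the
  limit cell has zero coefficients by the independence required in \<open>shape_ok\<close>.\<close>

lemma coeff_norm_limit_nonzero:
  assumes ok: "shape_ok R" "D \<in> sh_cells R"
    and a: "\<And>q. q < sh_rank R k D \<Longrightarrow> (\<lambda>j. a j q) \<longlonglongrightarrow> a0 q" "\<And>j. (\<Sum>q<sh_rank R k D. \<bar>a j q\<bar>) = 1"
    and z: "\<And>z. z \<in> \<Union>(geo R D) \<Longrightarrow> sh_comb R k D a0 z = 0"
  shows False
proof -
  have "same_pullback (geo R D) (sh_comb R k D a0) (\<lambda>x. 0)"
    unfolding same_pullback_def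
  proof (intro ballI allI impI)
    fix \<sigma> x vs assume "\<sigma> \<in> geo R D" "x \<in> \<sigma>"
    then have "sh_comb R k D a0 x = 0" using z by blast
    then show "form_eval (sh_comb R k D a0 x) vs = form_eval 0 vs" by simp
  qed
  then have 0: "\<forall>i<sh_rank R k D. a0 i = 0"
    using bspec[OF conjunct2[OF conjunct2[OF conjunct2[OF ok(1)[unfolded shape_ok_def]]]] ok(2),
      THEN conjunct2, THEN spec[of _ k], THEN conjunct2, THEN spec[of _ a0]] by (rule mp[rotated])
  have "(\<lambda>j. \<Sum>q<sh_rank R k D. \<bar>a j q\<bar>) \<longlonglongrightarrow> (\<Sum>q<sh_rank R k D. \<bar>a0 q\<bar>)"
    by (intro tendsto_sum tendsto_rabs a) auto
  then have "(\<lambda>j::nat. 1::real) \<longlonglongrightarrow> 0" using a(2) 0 by simp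
  then show False by (simp add: LIMSEQ_const_iff)
qed

text \<open>If no \<eta> worked, unit combinations bounded by 1/(j+1) would converge to a
  combination that vanishes on the limit cell: every point of that cell is a limit of points of the
  approximating cells.\<close>

lemma shape_comb_nondegenerate:
  fixes F :: "('n::{finite,linorder}) shape set"
  assumes F: "compact_family F"
  shows "\<exists>\<eta>>0. \<forall>R\<in>F. \<forall>D\<in>sh_cells R. \<forall>k\<le>CARD('n). \<forall>a. coeff_norm R k D a = 1 \<longrightarrow>
    (\<exists>z\<in>\<Union>(geo R D). \<eta> \<le> norm (sh_comb R k D a z))"
proof (rule ccontr)
  assume neg: "\<not> ?thesis"
  have "\<exists>R D k a. R \<in> F \<and> D \<in> sh_cells R \<and> k \<le> CARD('n) \<and> coeff_norm R k D a = 1 \<and>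
    (\<forall>z\<in>\<Union>(geo R D). norm (sh_comb R k D a z) < 1 / real (Suc j))" for j
    using neg by (metis not_le of_nat_0_less_iff zero_less_Suc zero_less_divide_1_iff)
  then obtain R D k a where RF: "\<And>j. R j \<in> F" and D: "\<And>j. D j \<in> sh_cells (R j)" and k: "\<And>j. k j \<le> CARD('n)"
    and a: "\<And>j. coeff_norm (R j) (k j) (D j) (a j) = 1"
    and small: "\<And>j z. z \<in> \<Union>(geo (R j) (D j)) \<Longrightarrow> norm (sh_comb (R j) (k j) (D j) (a j) z) < 1 / real (Suc j)"
    by metis
  have a1: "coeff_norm (R j) (k j) (D j) (a j) \<le> 1" for j using a[of j] by simp
  obtain R0 D0 k0 a0 i0 r where lim: "R0 \<in> F" "strict_mono r" "D0 \<in> sh_cells R0" "shape_ok R0"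
    "\<And>j. D (r j) = D0" "\<And>j. k (r j) = k0" "\<And>j. (\<lambda>_. ()) (r j) = (i0::unit)"
    "\<And>j. sh_rank (R (r j)) k0 D0 = sh_rank R0 k0 D0"
    "\<And>v. v \<in> \<Union>D0 \<Longrightarrow> (\<lambda>j. sh_pos (R (r j)) v) \<longlonglongrightarrow> sh_pos R0 v"
    "\<And>q. q < sh_rank R0 k0 D0 \<Longrightarrow> (\<lambda>j. a (r j) q) \<longlonglongrightarrow> a0 q"
    "C1_conv (\<lambda>j. sh_comb (R (r j)) k0 D0 (a (r j))) (sh_comb R0 k0 D0 a0)"
    by (rule shape_limit[OF F RF D k a1, where i="\<lambda>_. ()"]) (rule that; assumption)
  note fin = shape_cell_finite[OF lim(4,3)]
  have cd: "cdiff 1 (sh_comb R0 k0 D0 a0)" by (intro cdiff_1_sh_comb shape_ok_cdiff lim)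
  have inv0: "(\<lambda>j. 1 / real (Suc (r j))) \<longlonglongrightarrow> 0"
    using LIMSEQ_subseq_LIMSEQ[OF LIMSEQ_inverse_real_of_nat lim(2)] by (simp add: o_def inverse_eq_divide)
  have "sh_comb R0 k0 D0 a0 z = 0" if z: "z \<in> \<Union>(geo R0 D0)" for z
  proof -
    obtain s where s: "s \<in> D0" "z \<in> convex hull (sh_pos R0 ` s)" using z by (auto simp: geo_Union)
    obtain zs where zs: "\<And>j. zs j \<in> convex hull (sh_pos (R (r j)) ` s)" "zs \<longlonglongrightarrow> z"
      using convex_hull_pos_approx[of s "sh_pos R0" "\<lambda>j. sh_pos (R (r j))" z] fin s lim(9)
      by (metis (no_types, lifting) UnionI inj_on_subset Union_upper)
    have "(\<lambda>j. sh_comb (R (r j)) k0 D0 (a (r j)) (zs j)) \<longlonglongrightarrow> sh_comb R0 k0 D0 a0 z"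
      by (rule uniform_limit_compose_seq[OF _ cdiff_1_continuous[OF cd] zs(2)])
        (use lim(11) in \<open>auto simp: C1_conv_def\<close>)
    moreover have "(\<lambda>j. sh_comb (R (r j)) k0 D0 (a (r j)) (zs j)) \<longlonglongrightarrow> 0"
    proof (rule Lim_null_comparison[OF _ inv0], rule always_eventually, rule allI)
      fix j
      have "zs j \<in> \<Union>(geo (R (r j)) (D (r j)))" using zs(1)[of j] s lim(5) by (auto simp: geo_Union)
      from small[OF this] show "norm (sh_comb (R (r j)) k0 D0 (a (r j)) (zs j)) \<le> 1 / real (Suc (r j))"
        using lim(5,6) by simp
    qed
    ultimately show ?thesis by (rule LIMSEQ_unique)
  qed
  then show False
    using coeff_norm_limit_nonzero[OF lim(4,3), of k0 "\<lambda>j. a (r j)" a0] lim(10) a lim(5,6,8)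
    by (metis coeff_norm_def)
qed

text \<open>Chains of simplices through common vertices. The notion refers to vertex numbers only,
  so it is inherited by limits of shapes.\<close>

definition linked :: "nat set set \<Rightarrow> bool" where
  "linked D \<longleftrightarrow> (\<forall>s\<in>D. \<forall>t\<in>D. (s, t) \<in> {(s, t). s \<in> D \<and> t \<in> D \<and> s \<inter> t \<noteq> {}}\<^sup>*)"

text \<open>A limit whose partial derivatives vanish is constant on each simplex, by
  \<open>linked\<close> it takes one value on the whole cell, and the prescribed zero at a vertex
  makes this value 0.\<close>

lemma shape_partial_nondegenerate:
  fixes F :: "('n::{finite,linorder}) shape set"
  assumes F: "compact_family F"
  shows "\<exists>\<eta>>0. \<forall>R\<in>F. \<forall>D\<in>sh_cells R. \<forall>k\<le>CARD('n). \<forall>a. coeff_norm R k D a = 1 \<and> linked D \<and>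
      (\<exists>v\<in>\<Union>D. sh_comb R k D a (sh_pos R v) = 0) \<longrightarrow>
    (\<exists>z\<in>\<Union>(geo R D). \<exists>i. \<eta> \<le> norm (partial i (sh_comb R k D a) z))"
proof (rule ccontr)
  assume neg: "\<not> ?thesis"
  define Q where "Q \<eta> = (\<forall>R\<in>F. \<forall>D\<in>sh_cells R. \<forall>k\<le>CARD('n). \<forall>a. coeff_norm R k D a = 1 \<and> linked D \<and>
      (\<exists>v\<in>\<Union>D. sh_comb R k D a (sh_pos R v) = 0) \<longrightarrow>
    (\<exists>z\<in>\<Union>(geo R D). \<exists>i. \<eta> \<le> norm (partial i (sh_comb R k D a) z)))" for \<eta>
  have "\<exists>R D k a v. R \<in> F \<and> D \<in> sh_cells R \<and> k \<le> CARD('n) \<and> coeff_norm R k D a = 1 \<and> linked D \<and>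
     v \<in> \<Union>D \<and> sh_comb R k D a (sh_pos R v) = 0 \<and>
    (\<forall>z\<in>\<Union>(geo R D). \<forall>i. norm (partial i (sh_comb R k D a) z) < 1 / real (Suc j))" for j
  proof -
    have "\<not> Q (1 / real (Suc j))" using neg[folded Q_def] by simp
    then show ?thesis unfolding Q_def Ball_def Bex_def by (simp only: not_all not_imp not_ex de_Morgan_conj not_le) metis
  qed
  then obtain R D k a v where RF: "\<And>j. R j \<in> F" and D: "\<And>j. D j \<in> sh_cells (R j)" and k: "\<And>j. k j \<le> CARD('n)"
    and a: "\<And>j. coeff_norm (R j) (k j) (D j) (a j) = 1" and lk: "\<And>j. linked (D j)"
    and v: "\<And>j. v j \<in> \<Union>(D j)" and v0: "\<And>j. sh_comb (R j) (k j) (D j) (a j) (sh_pos (R j) (v j)) = 0"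
    and small: "\<And>j z i. z \<in> \<Union>(geo (R j) (D j)) \<Longrightarrow> norm (partial i (sh_comb (R j) (k j) (D j) (a j)) z) < 1 / real (Suc j)"
    by metis
  have a1: "coeff_norm (R j) (k j) (D j) (a j) \<le> 1" for j using a[of j] by simp
  obtain R0 D0 k0 a0 i0 r where lim: "R0 \<in> F" "strict_mono r" "D0 \<in> sh_cells R0" "shape_ok R0"
    "\<And>j. D (r j) = D0" "\<And>j. k (r j) = k0" "\<And>j. (\<lambda>_. ()) (r j) = (i0::unit)"
    "\<And>j. sh_rank (R (r j)) k0 D0 = sh_rank R0 k0 D0"
    "\<And>v. v \<in> \<Union>D0 \<Longrightarrow> (\<lambda>j. sh_pos (R (r j)) v) \<longlonglongrightarrow> sh_pos R0 v"
    "\<And>q. q < sh_rank R0 k0 D0 \<Longrightarrow> (\<lambda>j. a (r j) q) \<longlonglongrightarrow> a0 q"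
    "C1_conv (\<lambda>j. sh_comb (R (r j)) k0 D0 (a (r j))) (sh_comb R0 k0 D0 a0)"
    by (rule shape_limit[OF F RF D k a1, where i="\<lambda>_. ()"]) (rule that; assumption)
  note fin = shape_cell_finite[OF lim(4,3)]
  define w where "w = sh_comb R0 k0 D0 a0"
  have cd: "cdiff 1 w" unfolding w_def by (intro cdiff_1_sh_comb shape_ok_cdiff lim)
  have inv0: "(\<lambda>j. 1 / real (Suc (r j))) \<longlonglongrightarrow> 0"
    using LIMSEQ_subseq_LIMSEQ[OF LIMSEQ_inverse_real_of_nat lim(2)] by (simp add: o_def inverse_eq_divide)
  have par0: "partial i w z = 0" if s: "s \<in> D0" "z \<in> convex hull (sh_pos R0 ` s)" for z s i
  proof -
    obtain zs where zs: "\<And>j. zs j \<in> convex hull (sh_pos (R (r j)) ` s)" "zs \<longlonglongrightarrow> z"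
      using convex_hull_pos_approx[of s "sh_pos R0" "\<lambda>j. sh_pos (R (r j))" z] fin s lim(9)
      by (metis (no_types, lifting) UnionI inj_on_subset Union_upper)
    have "(\<lambda>j. partial i (sh_comb (R (r j)) k0 D0 (a (r j))) (zs j)) \<longlonglongrightarrow> partial i w z"
      by (rule uniform_limit_compose_seq[OF _ cdiff_1_continuous_partial[OF cd] zs(2)])
        (use lim(11) in \<open>auto simp: C1_conv_def w_def\<close>)
    moreover have "(\<lambda>j. partial i (sh_comb (R (r j)) k0 D0 (a (r j))) (zs j)) \<longlonglongrightarrow> 0"
    proof (rule Lim_null_comparison[OF _ inv0], rule always_eventually, rule allI)
      fix j
      have "zs j \<in> \<Union>(geo (R (r j)) (D (r j)))" using zs(1)[of j] s lim(5) by (auto simp: geo_Union)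
      from small[OF this, of i] show "norm (partial i (sh_comb (R (r j)) k0 D0 (a (r j))) (zs j)) \<le> 1 / real (Suc (r j))"
        using lim(5,6) by simp
    qed
    ultimately show ?thesis by (rule LIMSEQ_unique)
  qed
  have const: "w y = w z" if "s \<in> D0" "y \<in> convex hull (sh_pos R0 ` s)" "z \<in> convex hull (sh_pos R0 ` s)" for s y z
    using lipschitz_on_partial_bound[OF cd convex_convex_hull[of "sh_pos R0 ` s"], of 0 y z] par0 that by auto
  have vert: "sh_pos R0 q \<in> convex hull (sh_pos R0 ` s)" if "q \<in> s" for q s
    using that by (simp add: hull_inc)
  have step: "w y = w z" if "(s, t) \<in> {(s, t). s \<in> D0 \<and> t \<in> D0 \<and> s \<inter> t \<noteq> {}}\<^sup>*"
    "s \<in> D0" "y \<in> convex hull (sh_pos R0 ` s)" "z \<in> convex hull (sh_pos R0 ` t)" for s t y z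
    using that
  proof (induction arbitrary: z rule: rtrancl_induct)
    case base then show ?case using const by blast
  next
    case (step t t')
    then obtain q where "q \<in> t" "q \<in> t'" "t' \<in> D0" by auto
    then show ?case using step.IH[of "sh_pos R0 q"] step.prems vert const by metis
  qed
  \<comment> \<open>The vertex where the combination vanishes may change with the index; as there
    are finitely many, one of them occurs infinitely often.\<close>
  have "\<exists>q. \<forall>n. \<exists>m\<ge>n. v (r m) = q"
  proof -
    have "v (r j) \<in> \<Union>D0" for j using v[of "r j"] lim(5) by simp
    from constant_subseq[of "\<Union>D0" "\<lambda>j. v (r j)", OF fin(2) this]
    obtain r' q where "strict_mono (r' :: nat \<Rightarrow> nat)" "\<forall>j. v (r (r' j)) = q" by blast
    then show ?thesis by (metis seq_suble)
  qed
  then obtain q where q: "\<And>n. \<exists>m\<ge>n. v (r m) = q" by blast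
  have qD: "q \<in> \<Union>D0" using q[of 0] v lim(5) by metis
  have "w (sh_pos R0 q) = 0"
  proof -
    have l: "(\<lambda>j. sh_comb (R (r j)) k0 D0 (a (r j)) (sh_pos (R (r j)) q)) \<longlonglongrightarrow> w (sh_pos R0 q)"
      by (rule uniform_limit_compose_seq[OF _ cdiff_1_continuous[OF cd] lim(9)[OF qD]])
        (use lim(11) in \<open>auto simp: C1_conv_def w_def\<close>)
    show ?thesis
    proof (rule ccontr)
      assume "w (sh_pos R0 q) \<noteq> 0"
      then have "\<forall>\<^sub>F j in sequentially. sh_comb (R (r j)) k0 D0 (a (r j)) (sh_pos (R (r j)) q) \<noteq> 0"
        using l tendsto_imp_eventually_ne by blast
      then obtain n where "\<And>m. m \<ge> n \<Longrightarrow> sh_comb (R (r m)) k0 D0 (a (r m)) (sh_pos (R (r m)) q) \<noteq> 0"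
        by (auto simp: eventually_sequentially)
      then show False using q[of n] v0 lim(5,6) by metis
    qed
  qed
  moreover have "linked D0" using lk[of "r 0"] lim(5) by simp
  ultimately have "w z = 0" if z: "z \<in> \<Union>(geo R0 D0)" for z
  proof -
    obtain s where s: "s \<in> D0" "z \<in> convex hull (sh_pos R0 ` s)" using z by (auto simp: geo_Union)
    obtain t where t: "t \<in> D0" "q \<in> t" using qD by auto
    have "(t, s) \<in> {(s, t). s \<in> D0 \<and> t \<in> D0 \<and> s \<inter> t \<noteq> {}}\<^sup>*"
      using \<open>linked D0\<close> s t unfolding linked_def by simp
    from step[OF this t(1) vert[OF t(2)] s(2)] \<open>w (sh_pos R0 q) = 0\<close> show ?thesis by simp
  qed
  then show False
    using coeff_norm_limit_nonzero[OF lim(4,3), of k0 "\<lambda>j. a (r j)" a0] lim(10) a lim(5,6,8)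
    by (metis coeff_norm_def w_def)
qed

text \<open>Two points violating the estimate at distance below 1/(j+1) would converge to the same
  point along a subsequence, and the limit combination and its derivative are continuous
  there.\<close>

lemma shape_equicontinuous:
  fixes F :: "('n::{finite,linorder}) shape set"
  assumes F: "compact_family F" and \<epsilon>: "\<epsilon> > 0"
  shows "\<exists>\<delta>>0. \<forall>R\<in>F. \<forall>D\<in>sh_cells R. \<forall>k\<le>CARD('n). \<forall>a z z' i. coeff_norm R k D a \<le> 1 \<and>
      z \<in> \<Union>(geo R D) \<and> z' \<in> \<Union>(geo R D) \<and> norm (z - z') < \<delta> \<longrightarrow>
      norm (sh_comb R k D a z - sh_comb R k D a z') < \<epsilon> \<and>
      norm (partial i (sh_comb R k D a) z - partial i (sh_comb R k D a) z') < \<epsilon>"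
proof (rule ccontr)
  assume neg: "\<not> ?thesis"
  define Q where "Q \<delta> = (\<forall>R\<in>F. \<forall>D\<in>sh_cells R. \<forall>k\<le>CARD('n). \<forall>a z z' i. coeff_norm R k D a \<le> 1 \<and>
      z \<in> \<Union>(geo R D) \<and> z' \<in> \<Union>(geo R D) \<and> norm (z - z') < \<delta> \<longrightarrow>
      norm (sh_comb R k D a z - sh_comb R k D a z') < \<epsilon> \<and>
      norm (partial i (sh_comb R k D a) z - partial i (sh_comb R k D a) z') < \<epsilon>)" for \<delta>
  have "\<exists>R D k a z z' i. R \<in> F \<and> D \<in> sh_cells R \<and> k \<le> CARD('n) \<and> coeff_norm R k D a \<le> 1 \<and>
     z \<in> \<Union>(geo R D) \<and> z' \<in> \<Union>(geo R D) \<and> norm (z - z') < 1 / real (Suc j) \<and>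
     \<not> (norm (sh_comb R k D a z - sh_comb R k D a z') < \<epsilon> \<and>
      norm (partial i (sh_comb R k D a) z - partial i (sh_comb R k D a) z') < \<epsilon>)" for j
  proof -
    have "\<not> Q (1 / real (Suc j))" using neg[folded Q_def] by simp
    then show ?thesis unfolding Q_def Ball_def by (simp only: not_all not_imp) metis
  qed
  then obtain R D k a z z' i where RF: "\<And>j. R j \<in> F" and D: "\<And>j. D j \<in> sh_cells (R j)" and k: "\<And>j. k j \<le> CARD('n)"
    and a: "\<And>j. coeff_norm (R j) (k j) (D j) (a j) \<le> 1"
    and z: "\<And>j. z j \<in> \<Union>(geo (R j) (D j))" and z': "\<And>j. z' j \<in> \<Union>(geo (R j) (D j))"
    and zz: "\<And>j. norm (z j - z' j) < 1 / real (Suc j)"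
    and far: "\<And>j. \<not> (norm (sh_comb (R j) (k j) (D j) (a j) (z j) - sh_comb (R j) (k j) (D j) (a j) (z' j)) < \<epsilon> \<and>
      norm (partial (i j) (sh_comb (R j) (k j) (D j) (a j)) (z j) - partial (i j) (sh_comb (R j) (k j) (D j) (a j)) (z' j)) < \<epsilon>)"
    by metis
  have a1: "coeff_norm (R j) (k j) (D j) (a j) \<le> 1" for j using a[of j] by simp
  obtain R0 D0 k0 a0 i0 r where lim: "R0 \<in> F" "strict_mono r" "D0 \<in> sh_cells R0" "shape_ok R0"
    "\<And>j. D (r j) = D0" "\<And>j. k (r j) = k0" "\<And>j. i (r j) = i0"
    "\<And>j. sh_rank (R (r j)) k0 D0 = sh_rank R0 k0 D0"
    "\<And>v. v \<in> \<Union>D0 \<Longrightarrow> (\<lambda>j. sh_pos (R (r j)) v) \<longlonglongrightarrow> sh_pos R0 v"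
    "\<And>q. q < sh_rank R0 k0 D0 \<Longrightarrow> (\<lambda>j. a (r j) q) \<longlonglongrightarrow> a0 q"
    "C1_conv (\<lambda>j. sh_comb (R (r j)) k0 D0 (a (r j))) (sh_comb R0 k0 D0 a0)"
    by (rule shape_limit[OF F RF D k a1, where i=i]) (rule that; assumption)
  note fin = shape_cell_finite[OF lim(4,3)]
  define w where "w = sh_comb R0 k0 D0 a0"
  have cd: "cdiff 1 w" unfolding w_def by (intro cdiff_1_sh_comb shape_ok_cdiff lim)
  obtain B where B: "\<And>j s. s \<subseteq> \<Union>D0 \<Longrightarrow> convex hull (sh_pos (R (r j)) ` s) \<subseteq> cball 0 B"
    using convex_hull_pos_bounded[of "\<Union>D0" "\<lambda>j. sh_pos (R (r j))" "sh_pos R0", OF fin(2) lim(9)] by metis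
  have "\<forall>j. z (r j) \<in> cball 0 B"
  proof
    fix j
    obtain s where "s \<in> D0" "z (r j) \<in> convex hull (sh_pos (R (r j)) ` s)"
      using z[of "r j"] lim(5)[of j] by (auto simp: geo_Union)
    then show "z (r j) \<in> cball 0 B" using B[of s j] by blast
  qed
  then obtain z0 r' where r': "strict_mono (r' :: nat \<Rightarrow> nat)" "((\<lambda>j. z (r j)) \<circ> r') \<longlonglongrightarrow> z0"
    using compact_cball[of "0::'n point" B] unfolding compact_def by metis
  define \<sigma> where "\<sigma> = r \<circ> r'"
  have sm: "strict_mono \<sigma>" using lim(2) r' by (simp add: \<sigma>_def strict_mono_o)
  have zl: "(\<lambda>j. z (\<sigma> j)) \<longlonglongrightarrow> z0" using r' by (simp add: \<sigma>_def o_def)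
  have "(\<lambda>j. z (\<sigma> j) - z' (\<sigma> j)) \<longlonglongrightarrow> 0"
  proof (rule Lim_null_comparison)
    show "(\<lambda>j. 1 / real (Suc (\<sigma> j))) \<longlonglongrightarrow> 0"
      using LIMSEQ_subseq_LIMSEQ[OF LIMSEQ_inverse_real_of_nat sm] by (simp add: o_def inverse_eq_divide)
    show "\<forall>\<^sub>F j in sequentially. norm (z (\<sigma> j) - z' (\<sigma> j)) \<le> 1 / real (Suc (\<sigma> j))"
      using zz by (auto intro!: always_eventually less_imp_le)
  qed
  from tendsto_diff[OF zl this] have zl': "(\<lambda>j. z' (\<sigma> j)) \<longlonglongrightarrow> z0" by simp
  have ul: "uniform_limit (cball 0 \<rho>) (\<lambda>j. sh_comb (R (\<sigma> j)) k0 D0 (a (\<sigma> j))) w sequentially" for \<rho>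
  proof -
    have "uniform_limit (cball 0 \<rho>) (\<lambda>j. sh_comb (R (r j)) k0 D0 (a (r j))) w sequentially"
      using lim(11) unfolding C1_conv_def w_def by blast
    from filterlim_compose[OF this filterlim_subseq[OF r'(1)]] show ?thesis by (simp add: \<sigma>_def)
  qed
  have ul': "uniform_limit (cball 0 \<rho>) (\<lambda>j. partial i0 (sh_comb (R (\<sigma> j)) k0 D0 (a (\<sigma> j)))) (partial i0 w) sequentially" for \<rho>
  proof -
    have "uniform_limit (cball 0 \<rho>) (\<lambda>j. partial i0 (sh_comb (R (r j)) k0 D0 (a (r j)))) (partial i0 w) sequentially"
      using lim(11) unfolding C1_conv_def w_def by blast
    from filterlim_compose[OF this filterlim_subseq[OF r'(1)]] show ?thesis by (simp add: \<sigma>_def)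
  qed
  have l1: "(\<lambda>j. norm (sh_comb (R (\<sigma> j)) k0 D0 (a (\<sigma> j)) (z (\<sigma> j)) - sh_comb (R (\<sigma> j)) k0 D0 (a (\<sigma> j)) (z' (\<sigma> j)))) \<longlonglongrightarrow> norm (w z0 - w z0)"
    by (intro tendsto_norm tendsto_diff uniform_limit_compose_seq[OF ul cdiff_1_continuous[OF cd]] zl zl')
  have l2: "(\<lambda>j. norm (partial i0 (sh_comb (R (\<sigma> j)) k0 D0 (a (\<sigma> j))) (z (\<sigma> j)) - partial i0 (sh_comb (R (\<sigma> j)) k0 D0 (a (\<sigma> j))) (z' (\<sigma> j)))) \<longlonglongrightarrow> norm (partial i0 w z0 - partial i0 w z0)"
    by (intro tendsto_norm tendsto_diff uniform_limit_compose_seq[OF ul' cdiff_1_continuous_partial[OF cd]] zl zl')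
  have "\<forall>\<^sub>F j in sequentially. norm (sh_comb (R (\<sigma> j)) k0 D0 (a (\<sigma> j)) (z (\<sigma> j)) - sh_comb (R (\<sigma> j)) k0 D0 (a (\<sigma> j)) (z' (\<sigma> j))) < \<epsilon> \<and>
     norm (partial i0 (sh_comb (R (\<sigma> j)) k0 D0 (a (\<sigma> j))) (z (\<sigma> j)) - partial i0 (sh_comb (R (\<sigma> j)) k0 D0 (a (\<sigma> j))) (z' (\<sigma> j))) < \<epsilon>"
    using order_tendstoD(2)[OF l1, of \<epsilon>] order_tendstoD(2)[OF l2, of \<epsilon>] \<epsilon> by (simp add: eventually_conj)
  then obtain j where "norm (sh_comb (R (\<sigma> j)) k0 D0 (a (\<sigma> j)) (z (\<sigma> j)) - sh_comb (R (\<sigma> j)) k0 D0 (a (\<sigma> j)) (z' (\<sigma> j))) < \<epsilon> \<and>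
     norm (partial i0 (sh_comb (R (\<sigma> j)) k0 D0 (a (\<sigma> j))) (z (\<sigma> j)) - partial i0 (sh_comb (R (\<sigma> j)) k0 D0 (a (\<sigma> j))) (z' (\<sigma> j))) < \<epsilon>"
    using eventually_happens'[OF sequentially_bot] by blast
  moreover have "D (\<sigma> j) = D0" "k (\<sigma> j) = k0" "i (\<sigma> j) = i0" using lim(5,6,7) by (auto simp: \<sigma>_def)
  ultimately show False using far[of "\<sigma> j"] by simp
qed

text \<open>Values exceeding every bound are impossible, because along a subsequence shapes,
  coefficients and evaluation points converge, and with them the values.\<close>

lemma shape_bounded:
  fixes F :: "('n::{finite,linorder}) shape set"
  assumes F: "compact_family F"
  shows "\<exists>L>0. \<forall>R\<in>F. \<forall>D\<in>sh_cells R. \<forall>k\<le>CARD('n). \<forall>a z i. coeff_norm R k D a \<le> 1 \<and>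
      z \<in> \<Union>(geo R D) \<longrightarrow>
      norm (sh_comb R k D a z) \<le> L \<and> norm (partial i (sh_comb R k D a) z) \<le> L"
proof (rule ccontr)
  assume neg: "\<not> ?thesis"
  define Q where "Q L = (\<forall>R\<in>F. \<forall>D\<in>sh_cells R. \<forall>k\<le>CARD('n). \<forall>a z i. coeff_norm R k D a \<le> 1 \<and>
      z \<in> \<Union>(geo R D) \<longrightarrow>
      norm (sh_comb R k D a z) \<le> L \<and> norm (partial i (sh_comb R k D a) z) \<le> L)" for L
  have "\<exists>R D k a z i. R \<in> F \<and> D \<in> sh_cells R \<and> k \<le> CARD('n) \<and> coeff_norm R k D a \<le> 1 \<and>
     z \<in> \<Union>(geo R D) \<and> 
     \<not> (norm (sh_comb R k D a z) \<le> real (Suc j) \<and> norm (partial i (sh_comb R k D a) z) \<le> real (Suc j))" for j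
  proof -
    have "\<not> Q (real (Suc j))" using neg[folded Q_def] by (simp del: of_nat_Suc)
    then show ?thesis unfolding Q_def Ball_def by (simp only: not_all not_imp) metis
  qed
  then obtain R D k a z i where RF: "\<And>j. R j \<in> F" and D: "\<And>j. D j \<in> sh_cells (R j)" and k: "\<And>j. k j \<le> CARD('n)"
    and a: "\<And>j. coeff_norm (R j) (k j) (D j) (a j) \<le> 1"
    and z: "\<And>j. z j \<in> \<Union>(geo (R j) (D j))" 
    and far: "\<And>j. \<not> (norm (sh_comb (R j) (k j) (D j) (a j) (z j)) \<le> real (Suc j) \<and>
      norm (partial (i j) (sh_comb (R j) (k j) (D j) (a j)) (z j)) \<le> real (Suc j))"
    by metis
  have a1: "coeff_norm (R j) (k j) (D j) (a j) \<le> 1" for j using a[of j] by simp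
  obtain R0 D0 k0 a0 i0 r where lim: "R0 \<in> F" "strict_mono r" "D0 \<in> sh_cells R0" "shape_ok R0"
    "\<And>j. D (r j) = D0" "\<And>j. k (r j) = k0" "\<And>j. i (r j) = i0"
    "\<And>j. sh_rank (R (r j)) k0 D0 = sh_rank R0 k0 D0"
    "\<And>v. v \<in> \<Union>D0 \<Longrightarrow> (\<lambda>j. sh_pos (R (r j)) v) \<longlonglongrightarrow> sh_pos R0 v"
    "\<And>q. q < sh_rank R0 k0 D0 \<Longrightarrow> (\<lambda>j. a (r j) q) \<longlonglongrightarrow> a0 q"
    "C1_conv (\<lambda>j. sh_comb (R (r j)) k0 D0 (a (r j))) (sh_comb R0 k0 D0 a0)"
    by (rule shape_limit[OF F RF D k a1, where i=i]) (rule that; assumption)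
  note fin = shape_cell_finite[OF lim(4,3)]
  define w where "w = sh_comb R0 k0 D0 a0"
  have cd: "cdiff 1 w" unfolding w_def by (intro cdiff_1_sh_comb shape_ok_cdiff lim)
  obtain B where B: "\<And>j s. s \<subseteq> \<Union>D0 \<Longrightarrow> convex hull (sh_pos (R (r j)) ` s) \<subseteq> cball 0 B"
    using convex_hull_pos_bounded[of "\<Union>D0" "\<lambda>j. sh_pos (R (r j))" "sh_pos R0", OF fin(2) lim(9)] by metis
  have "\<forall>j. z (r j) \<in> cball 0 B"
  proof
    fix j
    obtain s where "s \<in> D0" "z (r j) \<in> convex hull (sh_pos (R (r j)) ` s)"
      using z[of "r j"] lim(5)[of j] by (auto simp: geo_Union)
    then show "z (r j) \<in> cball 0 B" using B[of s j] by blast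
  qed
  then obtain z0 r' where r': "strict_mono (r' :: nat \<Rightarrow> nat)" "((\<lambda>j. z (r j)) \<circ> r') \<longlonglongrightarrow> z0"
    using compact_cball[of "0::'n point" B] unfolding compact_def by metis
  define \<sigma> where "\<sigma> = r \<circ> r'"
  have sm: "strict_mono \<sigma>" using lim(2) r' by (simp add: \<sigma>_def strict_mono_o)
  have zl: "(\<lambda>j. z (\<sigma> j)) \<longlonglongrightarrow> z0" using r' by (simp add: \<sigma>_def o_def)
  have ul: "uniform_limit (cball 0 \<rho>) (\<lambda>j. sh_comb (R (\<sigma> j)) k0 D0 (a (\<sigma> j))) w sequentially" for \<rho>
  proof -
    have "uniform_limit (cball 0 \<rho>) (\<lambda>j. sh_comb (R (r j)) k0 D0 (a (r j))) w sequentially"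
      using lim(11) unfolding C1_conv_def w_def by blast
    from filterlim_compose[OF this filterlim_subseq[OF r'(1)]] show ?thesis by (simp add: \<sigma>_def)
  qed
  have ul': "uniform_limit (cball 0 \<rho>) (\<lambda>j. partial i0 (sh_comb (R (\<sigma> j)) k0 D0 (a (\<sigma> j)))) (partial i0 w) sequentially" for \<rho>
  proof -
    have "uniform_limit (cball 0 \<rho>) (\<lambda>j. partial i0 (sh_comb (R (r j)) k0 D0 (a (r j)))) (partial i0 w) sequentially"
      using lim(11) unfolding C1_conv_def w_def by blast
    from filterlim_compose[OF this filterlim_subseq[OF r'(1)]] show ?thesis by (simp add: \<sigma>_def)
  qed
  have l1: "(\<lambda>j. sh_comb (R (\<sigma> j)) k0 D0 (a (\<sigma> j)) (z (\<sigma> j))) \<longlonglongrightarrow> w z0"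
    by (intro uniform_limit_compose_seq[OF ul cdiff_1_continuous[OF cd]] zl)
  have l2: "(\<lambda>j. partial i0 (sh_comb (R (\<sigma> j)) k0 D0 (a (\<sigma> j))) (z (\<sigma> j))) \<longlonglongrightarrow> partial i0 w z0"
    by (intro uniform_limit_compose_seq[OF ul' cdiff_1_continuous_partial[OF cd]] zl)
  obtain b where b: "\<And>j. norm (sh_comb (R (\<sigma> j)) k0 D0 (a (\<sigma> j)) (z (\<sigma> j))) \<le> b"
    using convergent_imp_bounded[OF l1] by (auto simp: bounded_iff)
  obtain b' where b': "\<And>j. norm (partial i0 (sh_comb (R (\<sigma> j)) k0 D0 (a (\<sigma> j))) (z (\<sigma> j))) \<le> b'"
    using convergent_imp_bounded[OF l2] by (auto simp: bounded_iff)
  \<comment> \<open>Since \<open>\<sigma> j\<close> is at least \<open>j\<close>, an index beyond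
    both bounds contradicts the growth assumed in \<open>far\<close>.\<close>
  obtain j where j: "max b b' \<le> real j" using real_arch_simple by blast
  have "j \<le> \<sigma> j" using sm by (rule seq_suble)
  then have "max b b' \<le> real (Suc (\<sigma> j))" using j by linarith
  moreover have "D (\<sigma> j) = D0" "k (\<sigma> j) = k0" "i (\<sigma> j) = i0" using lim(5,6,7) by (auto simp: \<sigma>_def)
  ultimately show False using far[of "\<sigma> j"] b[of j] b'[of j] by simp
qed

declare cdiff.simps(2) [simp del]

section \<open>Weak derivatives\<close>

lemma cdiff_1_continuous_frechet: "cdiff 1 f \<Longrightarrow> continuous_on S (\<lambda>x. frechet_derivative f (at x) v)"
  unfolding cdiff_1_iff by (blast intro: continuous_on_subset)

text \<open>Completeness of Lebesgue measure: the preimages under \<open>f\<close> and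
  \<open>h\<close> differ by a subset of a null set. It supplies the measurability of functions
  obtained by choice.\<close>

lemma borel_measurable_lebesgue_AE_eq:
  fixes f h :: "'a::euclidean_space \<Rightarrow> 'b::topological_space"
  assumes h: "h \<in> borel_measurable lebesgue" and eq: "AE x in lebesgue. f x = h x"
  shows "f \<in> borel_measurable lebesgue"
proof (rule measurableI)
  fix B :: "'b set" assume "B \<in> sets borel"
  then have hB: "h -` B \<in> sets lebesgue" using measurable_sets[OF h] by simp
  from eq obtain N where N: "negligible N" "{x. f x \<noteq> h x} \<subseteq> N"
    unfolding eventually_ae_filter_negligible by auto
  have "f -` B = (h -` B - N) \<union> (f -` B \<inter> N)" using N(2) by auto
  moreover have "f -` B \<inter> N \<in> sets lebesgue" using N(1) by (metis negligible_imp_sets negligible_subset inf_le2)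
  moreover have "N \<in> sets lebesgue" using N(1) by (rule negligible_imp_sets)
  ultimately have "f -` B \<in> sets lebesgue" using hB by (metis sets.Diff sets.Un)
  then show "f -` B \<inter> space lebesgue \<in> sets lebesgue" by simp
qed simp

lemma cdiff_1I:
  assumes "\<And>x. (f has_derivative f' x) (at x)" "\<And>v. continuous_on UNIV (\<lambda>x. f' x v)"
  shows "cdiff 1 f"
proof -
  have "frechet_derivative f (at x) = f' x" for x using frechet_derivative_at[OF assms(1)] by simp
  then show ?thesis unfolding cdiff_1_iff using assms by (auto simp: differentiable_def)
qed

lemma cdiff_1_scaleR:
  fixes f :: "('n::finite) point \<Rightarrow> real" and g :: "'n point \<Rightarrow> 'b::real_normed_vector"
  assumes f: "cdiff 1 f" and g: "cdiff 1 g"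
  shows "cdiff 1 (\<lambda>x. f x *\<^sub>R g x)"
    and "partial i (\<lambda>x. f x *\<^sub>R g x) x = f x *\<^sub>R partial i g x + partial i f x *\<^sub>R g x"
proof -
  have d: "((\<lambda>x. f x *\<^sub>R g x) has_derivative
      (\<lambda>v. f x *\<^sub>R frechet_derivative g (at x) v + frechet_derivative f (at x) v *\<^sub>R g x)) (at x)" for x
    by (rule has_derivative_scaleR[OF cdiff_1_has_derivative[OF f] cdiff_1_has_derivative[OF g]])
  show "cdiff 1 (\<lambda>x. f x *\<^sub>R g x)"
  proof (rule cdiff_1I[OF d])
    fix v
    show "continuous_on UNIV (\<lambda>x. f x *\<^sub>R frechet_derivative g (at x) v + frechet_derivative f (at x) v *\<^sub>R g x)"
      by (intro continuous_on_add continuous_on_scaleR cdiff_1_continuous[OF f] cdiff_1_continuous[OF g]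
        cdiff_1_continuous_frechet f g)
  qed
  show "partial i (\<lambda>x. f x *\<^sub>R g x) x = f x *\<^sub>R partial i g x + partial i f x *\<^sub>R g x"
    using partial_eqI[OF d] by (simp add: partial_def)
qed

lemma cdiff_1_const: "cdiff 1 (\<lambda>x::('n::finite) point. c :: 'b::real_normed_vector)"
  by (rule cdiff_1I[where f'="\<lambda>x v. 0"]) (auto intro!: derivative_eq_intros)

lemma cdiff_1_prod:
  fixes f :: "'i \<Rightarrow> ('n::finite) point \<Rightarrow> real"
  assumes "\<And>j. j \<in> J \<Longrightarrow> cdiff 1 (f j)"
  shows "cdiff 1 (\<lambda>x. \<Prod>j\<in>J. f j x)"
  using assms
proof (induction J rule: infinite_finite_induct)
  case (insert j J)
  then have "cdiff 1 (\<lambda>x. f j x *\<^sub>R (\<Prod>j\<in>J. f j x))" by (intro cdiff_1_scaleR) auto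
  with insert.hyps show ?case by simp
next
  case (infinite J)
  then show ?case using cdiff_1_const[of "1::real"] by simp
next
  case empty
  show ?case using cdiff_1_const[of "1::real"] by simp
qed

text \<open>Differentiability of \<open>\<psi>\<close> is asked for on the range of \<open>f\<close>
  only, since it will be a rational function with a pole on the negative axis, composed with a
  nonnegative \<open>f\<close>.\<close>

lemma cdiff_1_compose:
  fixes f :: "('n::finite) point \<Rightarrow> real" and \<psi> :: "real \<Rightarrow> real"
  assumes f: "cdiff 1 f" and \<psi>: "\<And>t. t \<in> range f \<Longrightarrow> (\<psi> has_real_derivative \<psi>' t) (at t)"
    and c: "continuous_on (range f) \<psi>'"
  shows "cdiff 1 (\<lambda>x. \<psi> (f x))"
proof (rule cdiff_1I)
  show "((\<lambda>x. \<psi> (f x)) has_derivative (\<lambda>v. \<psi>' (f x) * frechet_derivative f (at x) v)) (at x)" for x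
    using has_derivative_compose[OF cdiff_1_has_derivative[OF f], of \<psi> "(*) (\<psi>' (f x))" x] \<psi>[of "f x"]
    by (simp add: has_field_derivative_def)
  show "continuous_on UNIV (\<lambda>x. \<psi>' (f x) * frechet_derivative f (at x) v)" for v
    by (intro continuous_on_mult continuous_on_compose2[OF c cdiff_1_continuous[OF f]] cdiff_1_continuous_frechet f) auto
qed

lemma cdiff_1_affine_coord: "cdiff 1 (\<lambda>x::('n::finite) point. \<alpha> * x $ i + \<beta> :: real)"
  by (rule cdiff_1I[where f'="\<lambda>x v. \<alpha> * v $ i"])
    (auto intro!: derivative_eq_intros has_derivative_mult_right bounded_linear_imp_has_derivative bounded_linear_vec_nth)

text \<open>The squared positive part is C^1 but not C^2, which is enough since test functions are
  only required to be C^1. At 0 the difference quotient is at most the increment in modulus.\<close>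

lemma has_real_derivative_max0_squared:
  "((\<lambda>t::real. (max 0 t)\<^sup>2) has_real_derivative 2 * max 0 t) (at t)"
proof -
  consider "t > 0" | "t < 0" | "t = 0" by linarith
  then show ?thesis
  proof cases
    case 1
    have "((\<lambda>t::real. t\<^sup>2) has_real_derivative 2 * t) (at t)" by (auto intro!: derivative_eq_intros)
    then show ?thesis using 1
      by (subst DERIV_cong_ev[OF refl _ refl, of _ "\<lambda>t. t\<^sup>2"])
        (auto simp: max_def intro: eventually_mono[OF eventually_nhds_in_open[of "{0<..}" t]])
  next
    case 2
    have "((\<lambda>t::real. 0) has_real_derivative 0) (at t)" by simp
    then show ?thesis using 2
      by (subst DERIV_cong_ev[OF refl _ refl, of _ "\<lambda>t. 0"])
        (auto simp: max_def intro: eventually_mono[OF eventually_nhds_in_open[of "{..<0}" t]])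
  next
    case 3
    have "((\<lambda>h::real. (max 0 h)\<^sup>2 / h) \<longlongrightarrow> 0) (at 0)"
    proof (rule Lim_null_comparison)
      show "\<forall>\<^sub>F h in at 0. norm ((max 0 h)\<^sup>2 / h) \<le> \<bar>h\<bar>"
        by (rule always_eventually) (auto simp: max_def power2_eq_square)
      show "((\<lambda>h::real. \<bar>h\<bar>) \<longlongrightarrow> 0) (at 0)" using tendsto_rabs_zero[OF tendsto_ident_at] .
    qed
    with 3 show ?thesis by (simp add: DERIV_def)
  qed
qed

section \<open>Bump functions on boxes and the fundamental lemma of the calculus of
  variations\<close>

definition box_bump :: "('n::finite) point \<Rightarrow> 'n point \<Rightarrow> 'n point \<Rightarrow> real" where
  "box_bump a b x = (\<Prod>i\<in>UNIV. (max 0 (x $ i - a $ i))\<^sup>2 * (max 0 (b $ i - x $ i))\<^sup>2)"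

lemma cdiff_1_box_bump: "cdiff 1 (box_bump a b)"
proof -
  have c: "cdiff 1 (\<lambda>x::'a point. (max 0 (\<alpha> * x $ i + \<beta>))\<^sup>2)" for \<alpha> \<beta> i
    by (rule cdiff_1_compose[OF cdiff_1_affine_coord has_real_derivative_max0_squared]) (intro continuous_intros)
  have "cdiff 1 (\<lambda>x::'a point. (max 0 (x $ i - a $ i))\<^sup>2 *\<^sub>R (max 0 (b $ i - x $ i))\<^sup>2)" for i
    using cdiff_1_scaleR(1)[OF c[of 1 i "- a $ i"] c[of "-1" i "b $ i"]] by simp
  then show ?thesis unfolding box_bump_def[abs_def] by (intro cdiff_1_prod) simp
qed

lemma box_bump_nonneg: "0 \<le> box_bump a b x"
  unfolding box_bump_def by (intro prod_nonneg) auto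

lemma box_bump_pos: "0 < box_bump a b x \<longleftrightarrow> x \<in> box a b"
proof
  assume "x \<in> box a b"
  then show "0 < box_bump a b x" unfolding box_bump_def
    by (intro prod_pos ballI mult_pos_pos zero_less_power) (auto simp: mem_box_cart less_max_iff_disj)
next
  assume *: "0 < box_bump a b x"
  have "a $ i < x $ i \<and> x $ i < b $ i" for i
  proof (rule ccontr)
    assume "\<not> (a $ i < x $ i \<and> x $ i < b $ i)"
    then have "(max 0 (x $ i - a $ i))\<^sup>2 * (max 0 (b $ i - x $ i))\<^sup>2 = 0" by auto
    then have "box_bump a b x = 0" unfolding box_bump_def by (intro prod_zero) auto
    then show False using * by simp
  qed
  then show "x \<in> box a b" by (simp add: mem_box_cart)
qed

lemma integrable_test_mult:
  fixes g :: "('n::finite) point \<Rightarrow> 'b::euclidean_space"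
  assumes \<phi>: "continuous_on UNIV \<phi>" and A: "compact A" "{x. \<phi> x \<noteq> 0} \<subseteq> A"
    and g: "set_integrable lebesgue A g"
  shows "integrable lebesgue (\<lambda>x. \<phi> x *\<^sub>R g x)"
proof -
  have "compact (\<phi> ` A)" using \<phi> A(1) by (meson compact_continuous_image continuous_on_subset subset_UNIV)
  then obtain B where "\<forall>y\<in>\<phi> ` A. norm y \<le> B" by (meson bounded_iff compact_imp_bounded)
  then have B: "\<bar>\<phi> x\<bar> \<le> B" if "x \<in> A" for x using that by auto
  have [measurable]: "\<phi> \<in> borel_measurable lebesgue"
    using \<phi> by (simp add: borel_measurable_continuous_onI measurable_completion)
  have g': "integrable lebesgue (\<lambda>x. indicator A x *\<^sub>R g x)" using g by (simp add: set_integrable_def)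
  have eq: "(\<lambda>x. \<phi> x *\<^sub>R g x) = (\<lambda>x. \<phi> x *\<^sub>R (indicator A x *\<^sub>R g x))"
    using A(2) by (force simp: indicator_def fun_eq_iff)
  show ?thesis unfolding eq
  proof (rule Bochner_Integration.integrable_bound)
    show "integrable lebesgue (\<lambda>x. B *\<^sub>R (indicator A x *\<^sub>R g x))" using g' by (rule integrable_scaleR_right)
    show "(\<lambda>x. \<phi> x *\<^sub>R (indicator A x *\<^sub>R g x)) \<in> borel_measurable lebesgue"
      by (rule borel_measurable_scaleR[OF _ borel_measurable_integrable[OF g']]) simp
    show "AE x in lebesgue. norm (\<phi> x *\<^sub>R (indicator A x *\<^sub>R g x)) \<le> norm (B *\<^sub>R (indicator A x *\<^sub>R g x))"
    proof (rule AE_I2)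
      fix x show "norm (\<phi> x *\<^sub>R (indicator A x *\<^sub>R g x)) \<le> norm (B *\<^sub>R (indicator A x *\<^sub>R g x))"
        using B[of x] by (cases "x \<in> A") (auto intro!: mult_right_mono)
    qed
  qed
qed

text \<open>With \<beta> the bump function of the box, the test functions k \<beta> / (1 + k
  \<beta>) stay between 0 and 1 and converge to the indicator of the open box; dominated convergence
  applies.\<close>

lemma box_integral_zero:
  fixes f :: "('n::finite) point \<Rightarrow> real"
  assumes int: "\<And>A. compact A \<Longrightarrow> A \<subseteq> U \<Longrightarrow> set_integrable lebesgue A f"
    and zero: "\<And>\<phi>. test_fun U \<phi> \<Longrightarrow> (LINT x:U|lebesgue. \<phi> x * f x) = 0"
    and ab: "cbox a b \<subseteq> U"
  shows "(LINT x|lebesgue. indicator (box a b) x * f x) = 0"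
proof -
  define \<phi> where "\<phi> k x = real k * box_bump a b x / (1 + real k * box_bump a b x)" for k x
  have supp: "{x. \<phi> k x \<noteq> 0} \<subseteq> box a b" for k
  proof
    fix x assume "x \<in> {x. \<phi> k x \<noteq> 0}"
    then have "box_bump a b x \<noteq> 0" by (auto simp: \<phi>_def)
    then show "x \<in> box a b" using box_bump_nonneg[of a b x] box_bump_pos[of a b x] by linarith
  qed
  have clo: "closure {x. \<phi> k x \<noteq> 0} \<subseteq> cbox a b" for k
    using supp[of k] box_subset_cbox by (intro closure_minimal) auto
  have cd: "cdiff 1 (\<phi> k)" for k
  proof -
    have "((\<lambda>t. real k * t / (1 + real k * t)) has_real_derivative real k / (1 + real k * t)\<^sup>2) (at t)"
      if "0 \<le> t" for t
    proof -
      have "0 < 1 + real k * t" using that by (simp add: add_pos_nonneg)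
      then show ?thesis by (auto intro!: derivative_eq_intros simp: field_simps power2_eq_square)
    qed
    moreover have "continuous_on (range (box_bump a b)) (\<lambda>t. real k / (1 + real k * t)\<^sup>2)"
    proof (intro continuous_intros ballI)
      fix t assume "t \<in> range (box_bump a b)"
      then have "0 \<le> t" using box_bump_nonneg by auto
      then have "0 < 1 + real k * t" by (simp add: add_pos_nonneg)
      then show "(1 + real k * t)\<^sup>2 \<noteq> 0" by simp
    qed
    ultimately show ?thesis unfolding \<phi>_def[abs_def]
      by (intro cdiff_1_compose[OF cdiff_1_box_bump, of _ _ "\<lambda>t. real k * t / (1 + real k * t)"]) (auto simp: box_bump_nonneg)
  qed
  have test: "test_fun U (\<phi> k)" for k
    unfolding test_fun_def using cd[of k] clo[of k] ab
    by (auto simp: compact_eq_bounded_closed intro: bounded_subset[OF bounded_cbox])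
  have bnd: "\<bar>\<phi> k x\<bar> \<le> 1" for k x
  proof -
    have "0 \<le> real k * box_bump a b x" by (simp add: box_bump_nonneg)
    then show ?thesis unfolding \<phi>_def by (simp add: abs_of_nonneg divide_le_eq)
  qed
  have intf: "integrable lebesgue (\<lambda>x. indicator (cbox a b) x *\<^sub>R f x)"
    using int[OF compact_cbox ab] by (simp add: set_integrable_def)
  have lim: "(\<lambda>k. \<phi> k x * (indicator (cbox a b) x *\<^sub>R f x)) \<longlonglongrightarrow> indicator (box a b) x * f x" for x
  proof (cases "x \<in> box a b")
    case True
    then have pos: "0 < box_bump a b x" by (simp add: box_bump_pos)
    have "(\<lambda>k. \<phi> k x) \<longlonglongrightarrow> 1"
    proof -
      have "(\<lambda>k. 1 - 1 / (1 + box_bump a b x * real k)) \<longlonglongrightarrow> 1 - 0"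
        by (intro tendsto_diff tendsto_const real_tendsto_divide_at_top[of _ 1] filterlim_tendsto_add_at_top[of _ 1]
          filterlim_tendsto_pos_mult_at_top[OF tendsto_const pos filterlim_real_sequentially])
      moreover have "1 - 1 / (1 + box_bump a b x * real k) = \<phi> k x" for k
      proof -
        have "0 < 1 + box_bump a b x * real k" using pos by (simp add: add_pos_nonneg)
        then show ?thesis by (simp add: \<phi>_def field_simps)
      qed
      ultimately show ?thesis by simp
    qed
    from tendsto_mult_right[OF this, of "f x"] True box_subset_cbox[of a b] show ?thesis
      by (auto simp: indicator_def)
  next
    case False
    then have "\<phi> k x = 0" for k using supp[of k] by auto
    with False show ?thesis by simp
  qed
  have "(\<lambda>k. LINT x|lebesgue. \<phi> k x * (indicator (cbox a b) x *\<^sub>R f x)) \<longlonglongrightarrow> (LINT x|lebesgue. indicator (box a b) x * f x)"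
  proof (rule integral_dominated_convergence[where w="\<lambda>x. \<bar>indicator (cbox a b) x *\<^sub>R f x\<bar>"])
    have m: "(\<lambda>x. indicator (cbox a b) x *\<^sub>R f x) \<in> borel_measurable lebesgue"
      using intf by (rule borel_measurable_integrable)
    have "\<phi> k \<in> borel_measurable lebesgue" for k
      using cdiff_1_continuous[OF cd] by (simp add: borel_measurable_continuous_onI measurable_completion)
    then show "\<And>k. (\<lambda>x. \<phi> k x * (indicator (cbox a b) x *\<^sub>R f x)) \<in> borel_measurable lebesgue"
      using m by (rule borel_measurable_times)
    have "(\<lambda>x. indicator (box a b) x * f x) = (\<lambda>x. indicator (box a b) x * (indicator (cbox a b) x *\<^sub>R f x))"
      using box_subset_cbox[of a b] by (auto simp: indicator_def fun_eq_iff)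
    moreover have "(\<lambda>x. indicator (box a b) x * (indicator (cbox a b) x *\<^sub>R f x)) \<in> borel_measurable lebesgue"
      using m by (intro borel_measurable_times borel_measurable_indicator) auto
    ultimately show "(\<lambda>x. indicator (box a b) x * f x) \<in> borel_measurable lebesgue" by simp
    show "integrable lebesgue (\<lambda>x. \<bar>indicator (cbox a b) x *\<^sub>R f x\<bar>)" using intf by (rule integrable_abs)
    show "AE x in lebesgue. norm (\<phi> k x * (indicator (cbox a b) x *\<^sub>R f x)) \<le> \<bar>indicator (cbox a b) x *\<^sub>R f x\<bar>" for k
    proof (rule AE_I2)
      fix x show "norm (\<phi> k x * (indicator (cbox a b) x *\<^sub>R f x)) \<le> \<bar>indicator (cbox a b) x *\<^sub>R f x\<bar>"
        using mult_right_mono[OF bnd[of k x], of "\<bar>indicator (cbox a b) x *\<^sub>R f x\<bar>"] by (simp add: abs_mult)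
    qed
    show "AE x in lebesgue. (\<lambda>k. \<phi> k x * (indicator (cbox a b) x *\<^sub>R f x)) \<longlonglongrightarrow> indicator (box a b) x * f x"
      using lim by simp
  qed
  moreover have "(LINT x|lebesgue. \<phi> k x * (indicator (cbox a b) x *\<^sub>R f x)) = 0" for k
  proof -
    have "\<phi> k x * (indicator (cbox a b) x *\<^sub>R f x) = indicator U x *\<^sub>R (\<phi> k x * f x)" for x
      using supp[of k] box_subset_cbox[of a b] ab by (cases "x \<in> box a b") (auto simp: indicator_def)
    then show ?thesis using zero[OF test[of k]] by (simp only: set_lebesgue_integral_def)
  qed
  ultimately have "(\<lambda>k::nat. 0::real) \<longlonglongrightarrow> (LINT x|lebesgue. indicator (box a b) x * f x)" by simp
  then show ?thesis by (simp add: LIMSEQ_const_iff)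
qed

text \<open>The positive and the negative part of the function define finite measures that agree on
  open boxes. Boxes are stable under intersection and generate the Borel sets, so the measures and
  hence their densities coincide.\<close>

lemma AE_zero_if_box_integrals_zero:
  fixes f :: "('n::finite) point \<Rightarrow> real"
  assumes f: "integrable lebesgue f" and z: "\<And>a b. (LINT x|lebesgue. indicator (box a b) x * f x) = 0"
  shows "AE x in lebesgue. f x = 0"
proof -
  \<comment> \<open>The generator argument lives on Borel sets, so a Borel representative replaces
    \<open>f\<close>.\<close>
  obtain g where g[measurable]: "g \<in> borel_measurable lborel" and fg: "AE x in lborel. f x = g x"
    using completion_ex_borel_measurable_real[OF borel_measurable_integrable[OF f]] by auto
  have fg': "AE x in lebesgue. f x = g x" using fg by (rule AE_completion)
  have gl: "integrable lebesgue g"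
    using f fg' integrable_cong_AE[of f lebesgue g] borel_measurable_integrable[OF f] measurable_completion[OF g] by auto
  then have gi: "integrable lborel g" by (simp add: integrable_completion)
  have zb: "(LINT x|lborel. indicator (box a b) x * g x) = 0" for a b
  proof -
    have [measurable]: "(\<lambda>x. indicator (box a b) x * g x) \<in> borel_measurable lborel" by measurable
    have "(LINT x|lborel. indicator (box a b) x * g x) = (LINT x|lebesgue. indicator (box a b) x * g x)"
      by (simp add: integral_completion)
    also have "\<dots> = (LINT x|lebesgue. indicator (box a b) x * f x)"
    proof (rule integral_cong_AE)
      show "(\<lambda>x. indicator (box a b) x * g x) \<in> borel_measurable lebesgue" by (rule measurable_completion) measurable
      show "(\<lambda>x. indicator (box a b) x * f x) \<in> borel_measurable lebesgue"
        using borel_measurable_integrable[OF f] by (intro borel_measurable_times borel_measurable_indicator) auto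
      show "AE x in lebesgue. indicator (box a b) x * g x = indicator (box a b) x * f x"
        using fg' by eventually_elim simp
    qed
    finally show ?thesis using z by simp
  qed
  have fin: "(\<integral>\<^sup>+x. ennreal (g x) * indicator A x \<partial>lborel) \<noteq> \<infinity>" "(\<integral>\<^sup>+x. ennreal (- g x) * indicator A x \<partial>lborel) \<noteq> \<infinity>" for A
  proof -
    have "(\<integral>\<^sup>+x. ennreal (norm (g x)) \<partial>lborel) < \<infinity>" using gi by (simp add: integrable_iff_bounded)
    moreover have "(\<integral>\<^sup>+x. ennreal (g x) * indicator A x \<partial>lborel) \<le> (\<integral>\<^sup>+x. ennreal (norm (g x)) \<partial>lborel)"
      by (intro nn_integral_mono) (auto simp: indicator_def intro: ennreal_leI)
    moreover have "(\<integral>\<^sup>+x. ennreal (- g x) * indicator A x \<partial>lborel) \<le> (\<integral>\<^sup>+x. ennreal (norm (g x)) \<partial>lborel)"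
      by (intro nn_integral_mono) (auto simp: indicator_def intro: ennreal_leI)
    ultimately show "(\<integral>\<^sup>+x. ennreal (g x) * indicator A x \<partial>lborel) \<noteq> \<infinity>" "(\<integral>\<^sup>+x. ennreal (- g x) * indicator A x \<partial>lborel) \<noteq> \<infinity>"
      by auto
  qed
  have eqb: "emeasure (density lborel (\<lambda>x. ennreal (g x))) (box a b) = emeasure (density lborel (\<lambda>x. ennreal (- g x))) (box a b)" for a b
  proof -
    let ?P = "\<integral>\<^sup>+x. ennreal (g x) * indicator (box a b) x \<partial>lborel"
    let ?N = "\<integral>\<^sup>+x. ennreal (- g x) * indicator (box a b) x \<partial>lborel"
    have "integrable lborel (\<lambda>x. indicator (box a b) x * g x)"
      using integrable_mult_indicator[OF _ gi, of "box a b"] by simp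
    from real_lebesgue_integral_def[OF this] zb
    have "enn2real (\<integral>\<^sup>+x. ennreal (indicator (box a b) x * g x) \<partial>lborel) = enn2real (\<integral>\<^sup>+x. ennreal (- (indicator (box a b) x * g x)) \<partial>lborel)" by simp
    moreover have "(\<integral>\<^sup>+x. ennreal (indicator (box a b) x * g x) \<partial>lborel) = ?P"
      by (intro nn_integral_cong) (auto simp: indicator_def)
    moreover have "(\<integral>\<^sup>+x. ennreal (- (indicator (box a b) x * g x)) \<partial>lborel) = ?N"
      by (intro nn_integral_cong) (auto simp: indicator_def)
    ultimately have "enn2real ?P = enn2real ?N" by simp
    moreover have "ennreal (enn2real ?P) = ?P" "ennreal (enn2real ?N) = ?N"
      using fin[of "box a b"] by (simp_all add: less_top)
    ultimately have "?P = ?N" by metis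
    then show ?thesis by (simp add: emeasure_density)
  qed
  have "density lborel (\<lambda>x. ennreal (g x)) = density lborel (\<lambda>x. ennreal (- g x))"
  proof (rule measure_eqI_generator_eq)
    let ?E = "range (\<lambda>(a, b). box a b :: 'n point set)"
    show "Int_stable ?E" by (auto simp: Int_stable_def box_Int_box)
    show "?E \<subseteq> Pow UNIV" by auto
    show "sets (density lborel (\<lambda>x. ennreal (g x))) = sigma_sets UNIV ?E" by (simp add: borel_eq_box)
    show "sets (density lborel (\<lambda>x. ennreal (- g x))) = sigma_sets UNIV ?E" by (simp add: borel_eq_box)
    let ?A = "\<lambda>n::nat. box (- (real n *\<^sub>R One)) (real n *\<^sub>R One) :: 'n point set"
    show "range ?A \<subseteq> ?E" "(\<Union>i. ?A i) = UNIV"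
      unfolding UN_box_eq_UNIV by auto
    show "emeasure (density lborel (\<lambda>x. ennreal (g x))) (?A i) \<noteq> \<infinity>" for i
      using fin(1)[of "?A i"] by (simp add: emeasure_density)
    show "emeasure (density lborel (\<lambda>x. ennreal (g x))) X = emeasure (density lborel (\<lambda>x. ennreal (- g x))) X"
      if "X \<in> ?E" for X using that eqb by auto
  qed
  then have "AE x in lborel. ennreal (g x) = ennreal (- g x)"
    using fin(1)[of UNIV] by (subst (asm) finite_density_unique) auto
  then have "AE x in lborel. g x = 0"
  proof eventually_elim
    case (elim x)
    then show ?case by (cases "0 \<le> g x") (simp_all add: ennreal_neg)
  qed
  then have "AE x in lebesgue. g x = 0" by (rule AE_completion)
  with fg' show ?thesis by eventually_elim simp
qed

text \<open>Integrals over boxes determine \<open>f\<close> on every closed box inside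
  \<open>U\<close>, and an open set is a countable union of such boxes.\<close>

lemma fundamental_lemma:
  fixes f :: "('n::finite) point \<Rightarrow> real"
  assumes U: "open U"
    and int: "\<And>A. compact A \<Longrightarrow> A \<subseteq> U \<Longrightarrow> set_integrable lebesgue A f"
    and zero: "\<And>\<phi>. test_fun U \<phi> \<Longrightarrow> (LINT x:U|lebesgue. \<phi> x * f x) = 0"
  shows "AE x in lebesgue. x \<in> U \<longrightarrow> f x = 0"
proof -
  have box: "AE x in lebesgue. x \<in> cbox c d \<longrightarrow> f x = 0" if cd: "cbox c d \<subseteq> U" for c d
  proof -
    have cdi: "set_integrable lebesgue (box c d) f"
      by (rule set_integrable_subset[OF int[OF compact_cbox cd]]) (auto simp: box_subset_cbox)
    have "AE x in lebesgue. indicator (box c d) x * f x = 0"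
    proof (rule AE_zero_if_box_integrals_zero)
      show "integrable lebesgue (\<lambda>x. indicator (box c d) x * f x)" using cdi by (simp add: set_integrable_def)
      show "(LINT x|lebesgue. indicator (box a b) x * (indicator (box c d) x * f x)) = 0" for a b
      proof -
        \<comment> \<open>The intersection of two boxes is a box, so the truncated function is again
          tested on a box, which is empty or has its closure in \<open>U\<close>.\<close>
        obtain a' b' where ab: "box a b \<inter> box c d = box a' b'" by (auto simp: box_Int_box)
        have eq: "indicator (box a b) x * (indicator (box c d) x * f x) = indicator (box a' b') x * f x" for x
          unfolding ab[symmetric] by (simp add: indicator_inter_arith)
        show ?thesis
        proof (cases "box a' b' = {}")
          case False
          then have "cbox a' b' = closure (box a' b')" by (simp add: closure_box)
          also have "\<dots> \<subseteq> closure (box c d)" using ab by (intro closure_mono) auto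
          also have "\<dots> \<subseteq> cbox c d" by (intro closure_minimal box_subset_cbox closed_cbox)
          finally show ?thesis unfolding eq using cd by (intro box_integral_zero[OF int zero]) auto
        qed (simp add: eq)
      qed
    qed
    moreover have "AE x in lebesgue. x \<notin> cbox c d - box c d"
      unfolding eventually_ae_filter_negligible
      by (intro exI[of _ "cbox c d - box c d"]) (auto simp: negligible_frontier_interval)
    ultimately show ?thesis by eventually_elim (auto simp: indicator_def split: if_splits)
  qed
  obtain \<D> where D: "countable \<D>" "\<Union>\<D> = U" "\<And>X. X \<in> \<D> \<Longrightarrow> X \<subseteq> U \<and> (\<exists>a b. X = cbox a b)"
  proof (rule open_countable_Union_open_cbox[OF U])
    fix \<D> :: "'n point set set"
    assume a: "countable \<D>" "\<D> \<subseteq> Pow U" "\<And>X. X \<in> \<D> \<Longrightarrow> \<exists>a b. X = cbox a b" "\<Union>\<D> = U"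
    show thesis by (rule that[OF a(1,4)]) (use a(2,3) in blast)
  qed
  have "AE x in lebesgue. \<forall>X\<in>\<D>. x \<in> X \<longrightarrow> f x = 0"
    unfolding AE_ball_countable[OF D(1)]
  proof
    fix X assume "X \<in> \<D>"
    then obtain a b where "X = cbox a b" "cbox a b \<subseteq> U" using D(3)[of X] by blast
    then show "AE x in lebesgue. x \<in> X \<longrightarrow> f x = 0" using box[of a b] by simp
  qed
  then show ?thesis by eventually_elim (use D(2) in auto)
qed

text \<open>Testing the components of the difference reduces the claim to the real-valued
  fundamental lemma.\<close>

lemma weak_partial_unique:
  fixes f :: "('n::finite) point \<Rightarrow> 'b::euclidean_space"
  assumes U: "open U" and g: "weak_partial U i f g" and g': "weak_partial U i f g'"
  shows "AE x in lebesgue. x \<in> U \<longrightarrow> g x = g' x"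
proof -
  have int: "set_integrable lebesgue A g" "set_integrable lebesgue A g'" if "compact A" "A \<subseteq> U" for A
    using g g' that unfolding weak_partial_def by auto
  have "AE x in lebesgue. x \<in> U \<longrightarrow> (g x - g' x) \<bullet> b = 0" if b: "b \<in> Basis" for b
  proof (rule fundamental_lemma[OF U])
    show "set_integrable lebesgue A (\<lambda>x. (g x - g' x) \<bullet> b)" if "compact A" "A \<subseteq> U" for A
    proof -
      have "integrable lebesgue (\<lambda>x. (indicator A x *\<^sub>R g x - indicator A x *\<^sub>R g' x) \<bullet> b)"
        using int[OF that] by (intro integrable_inner_left Bochner_Integration.integrable_diff) (auto simp: set_integrable_def)
      then show ?thesis by (simp add: set_integrable_def algebra_simps inner_diff_left)
    qed
    fix \<phi> assume \<phi>: "test_fun U \<phi>"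
    let ?A = "closure {x. \<phi> x \<noteq> 0}"
    have A: "compact ?A" "?A \<subseteq> U" "{x. \<phi> x \<noteq> 0} \<subseteq> ?A" and c: "continuous_on UNIV \<phi>"
      using \<phi> unfolding test_fun_def by (auto intro: cdiff_1_continuous closure_subset[THEN subsetD])
    have supp: "indicator U x *\<^sub>R (\<phi> x *\<^sub>R h x) = \<phi> x *\<^sub>R h x" for h :: "'n point \<Rightarrow> 'b" and x
      using A by (cases "\<phi> x = 0") (auto simp: indicator_def)
    note i = integrable_test_mult[OF c A(1,3) int(1)[OF A(1,2)]] integrable_test_mult[OF c A(1,3) int(2)[OF A(1,2)]]
    have "(LINT x:U|lebesgue. \<phi> x *\<^sub>R g x) = (LINT x:U|lebesgue. \<phi> x *\<^sub>R g' x)"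
      using g g' \<phi> unfolding weak_partial_def by (metis neg_equal_iff_equal)
    then have e: "(LINT x|lebesgue. \<phi> x *\<^sub>R g x) = (LINT x|lebesgue. \<phi> x *\<^sub>R g' x)"
      by (simp only: set_lebesgue_integral_def supp)
    have "(LINT x:U|lebesgue. \<phi> x * ((g x - g' x) \<bullet> b)) = (LINT x|lebesgue. (\<phi> x *\<^sub>R g x - \<phi> x *\<^sub>R g' x) \<bullet> b)"
    proof -
      have "indicator U x *\<^sub>R (\<phi> x * ((g x - g' x) \<bullet> b)) = (\<phi> x *\<^sub>R g x - \<phi> x *\<^sub>R g' x) \<bullet> b" for x
        using A by (cases "\<phi> x = 0") (auto simp: indicator_def inner_diff_left algebra_simps)
      then show ?thesis by (simp add: set_lebesgue_integral_def)
    qed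
    also have "\<dots> = ((LINT x|lebesgue. \<phi> x *\<^sub>R g x) - (LINT x|lebesgue. \<phi> x *\<^sub>R g' x)) \<bullet> b"
      using i by (subst integral_inner_left) auto
    finally show "(LINT x:U|lebesgue. \<phi> x * ((g x - g' x) \<bullet> b)) = 0" using e by simp
  qed
  then have "AE x in lebesgue. \<forall>b\<in>Basis. x \<in> U \<longrightarrow> (g x - g' x) \<bullet> b = 0"
    by (subst AE_ball_countable) (auto intro: countable_finite)
  then show ?thesis by eventually_elim (auto simp: euclidean_eq_iff[of "g _"] inner_diff_left)
qed

section \<open>Integration by parts for C^1 fields\<close>

lemma partial_zero_outside:
  assumes "closed A" "{x. \<phi> x \<noteq> 0} \<subseteq> A" "x \<notin> A"
  shows "partial i \<phi> x = 0"
proof -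
  have "(\<phi> has_derivative (\<lambda>v. 0)) (at x)"
    by (rule has_derivative_transform_within_open[of "\<lambda>x. 0" _ x UNIV "- A"]) (use assms in auto)
  then show ?thesis by (rule partial_eqI)
qed

text \<open>The partial derivative is the limit of difference quotients, whose integrals vanish by
  translation invariance; the Lipschitz bound on a bounded set dominates them.\<close>

lemma integral_partial_zero:
  fixes \<psi> :: "('n::finite) point \<Rightarrow> real"
  assumes \<psi>: "cdiff 1 \<psi>" and A: "compact A" "{x. \<psi> x \<noteq> 0} \<subseteq> A"
  shows "(LINT x|lebesgue. partial i \<psi> x) = 0"
proof -
  have cont: "continuous_on UNIV \<psi>" "\<And>j. continuous_on UNIV (partial j \<psi>)"
    using cdiff_1_continuous[OF \<psi>] cdiff_1_continuous_partial[OF \<psi>] by blast+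
  have out: "partial j \<psi> x = 0" if "x \<notin> A" for x j
    by (rule partial_zero_outside[OF compact_imp_closed[OF A(1)] A(2) that])
  have "\<exists>G. \<forall>x. \<bar>partial j \<psi> x\<bar> \<le> G" for j
  proof -
    have "bounded (partial j \<psi> ` A)"
      using A(1) cont(2)[of j] by (meson compact_continuous_image compact_imp_bounded continuous_on_subset subset_UNIV)
    then obtain G where "\<And>x. x \<in> A \<Longrightarrow> \<bar>partial j \<psi> x\<bar> \<le> G" by (auto simp: bounded_iff)
    then have "\<bar>partial j \<psi> x\<bar> \<le> max G 0" for x using out[of x j] by (cases "x \<in> A") force+
    then show ?thesis by blast
  qed
  then obtain G0 where G0: "\<And>j x. \<bar>partial j \<psi> x\<bar> \<le> G0 j" by metis
  define G where "G = (\<Sum>j\<in>UNIV. \<bar>G0 j\<bar>)"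
  have G: "norm (partial j \<psi> x) \<le> G" for j x
  proof -
    have "\<bar>partial j \<psi> x\<bar> \<le> \<bar>G0 j\<bar>" using G0[where j=j and x=x] by linarith
    also have "\<dots> \<le> G" unfolding G_def by (rule member_le_sum) auto
    finally show ?thesis by simp
  qed
  have lip: "\<bar>\<psi> x - \<psi> y\<bar> \<le> real CARD('n) * G * norm (x - y)" for x y
    using lipschitz_on_partial_bound[OF \<psi> convex_UNIV, of G x y] G by simp
  define t where "t k = 1 / real (Suc k)" for k
  have t: "0 < t k" "t k \<le> 1" for k by (auto simp: t_def field_simps)
  define \<Delta> where "\<Delta> k x = (\<psi> (x + t k *\<^sub>R axis i 1) - \<psi> x) / t k" for k x
  \<comment> \<open>The steps \<open>t k\<close> are at most 1, so all quotients vanish outside this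
    enlargement of the support.\<close>
  define A' where "A' = {x + y | x y. x \<in> A \<and> y \<in> cball 0 1}"
  have A': "compact A'" unfolding A'_def by (intro compact_sums A(1) compact_cball)
  have lim: "(\<lambda>k. \<Delta> k x) \<longlonglongrightarrow> partial i \<psi> x" for x
  proof -
    have "((\<lambda>s. \<psi> (x + s *\<^sub>R axis i 1)) has_derivative (\<lambda>s. frechet_derivative \<psi> (at x) (s *\<^sub>R axis i 1))) (at 0)"
      by (rule has_derivative_compose[of "\<lambda>s. x + s *\<^sub>R axis i 1" "\<lambda>s. s *\<^sub>R axis i 1" 0 UNIV \<psi>])
        (use cdiff_1_has_derivative[OF \<psi>, of x] in \<open>auto intro!: derivative_eq_intros\<close>)
    moreover have "frechet_derivative \<psi> (at x) (s *\<^sub>R axis i 1) = partial i \<psi> x * s" for s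
      using linear_frechet_derivative[OF cdiff_1_differentiable[OF \<psi>, of x]]
      by (simp add: linear_cmul partial_def)
    ultimately have "((\<lambda>s. \<psi> (x + s *\<^sub>R axis i 1)) has_real_derivative partial i \<psi> x) (at 0)"
      by (simp add: has_field_derivative_def)
    then have l: "((\<lambda>s. (\<psi> (x + s *\<^sub>R axis i 1) - \<psi> x) / s) \<longlongrightarrow> partial i \<psi> x) (at 0)" by (simp add: DERIV_def)
    have "filterlim t (at 0) sequentially"
    proof (rule filterlim_atI)
      show "t \<longlonglongrightarrow> 0" unfolding t_def using LIMSEQ_inverse_real_of_nat by (simp add: inverse_eq_divide)
      show "\<forall>\<^sub>F k in sequentially. t k \<noteq> 0" using t(1) by (auto intro!: always_eventually simp: less_imp_neq[symmetric])
    qed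
    from filterlim_compose[OF l this] show ?thesis by (simp add: \<Delta>_def)
  qed
  have mpsi: "\<psi> \<in> borel_measurable borel" using cont(1) by (rule borel_measurable_continuous_onI)
  have int\<psi>: "integrable lborel \<psi>"
  proof -
    have "integrable lborel (\<lambda>x. indicator A x *\<^sub>R \<psi> x)"
      using borel_integrable_compact[OF A(1), of \<psi>] cont(1) by (auto intro: continuous_on_subset simp: indicator_def if_distrib cong: if_cong)
    moreover have "(\<lambda>x. indicator A x *\<^sub>R \<psi> x) = \<psi>" using A(2) by (force simp: indicator_def fun_eq_iff)
    ultimately show ?thesis by simp
  qed
  have shift: "integrable lborel (\<lambda>x. \<psi> (x + c))" "(LINT x|lborel. \<psi> (x + c)) = (LINT x|lborel. \<psi> x)" for c
  proof -
    have "integrable (distr lborel borel ((+) c)) \<psi>" using int\<psi> by (simp add: lborel_distr_plus)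
    then show "integrable lborel (\<lambda>x. \<psi> (x + c))" using mpsi by (subst (asm) integrable_distr_eq) (auto simp: add.commute)
    have "(LINT x|distr lborel borel ((+) c). \<psi> x) = (LINT x|lborel. \<psi> (c + x))" using mpsi by (subst integral_distr) auto
    then show "(LINT x|lborel. \<psi> (x + c)) = (LINT x|lborel. \<psi> x)" by (simp add: lborel_distr_plus add.commute)
  qed
  have z: "(LINT x|lborel. \<Delta> k x) = 0" for k
    unfolding \<Delta>_def using shift int\<psi> by simp
  have "(\<lambda>k. LINT x|lborel. \<Delta> k x) \<longlonglongrightarrow> (LINT x|lborel. partial i \<psi> x)"
  proof (rule integral_dominated_convergence[where w="\<lambda>x. indicator A' x *\<^sub>R (real CARD('n) * G)"])
    show "partial i \<psi> \<in> borel_measurable lborel" using cont(2) by (simp add: borel_measurable_continuous_onI)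
    show "\<Delta> k \<in> borel_measurable lborel" for k
    proof -
      have "continuous_on UNIV (\<Delta> k)" unfolding \<Delta>_def using t(1)[of k]
        by (intro continuous_intros continuous_on_compose2[OF cont(1)]) auto
      then show ?thesis by (simp add: borel_measurable_continuous_onI)
    qed
    have "emeasure lborel A' < \<infinity>" using emeasure_compact_finite[OF A'] .
    then show "integrable lborel (\<lambda>x. indicator A' x *\<^sub>R (real CARD('n) * G))"
      using A' by (intro integrable_scaleR_left integrable_real_indicator) (auto intro: borel_compact)
    show "AE x in lborel. (\<lambda>k. \<Delta> k x) \<longlonglongrightarrow> partial i \<psi> x" using lim by simp
    show "AE x in lborel. norm (\<Delta> k x) \<le> indicator A' x *\<^sub>R (real CARD('n) * G)" for k
    proof (rule AE_I2)
      fix x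
      have n: "norm (t k *\<^sub>R axis i 1 :: 'n point) = t k" using t(1)[of k] by simp
      show "norm (\<Delta> k x) \<le> indicator A' x *\<^sub>R (real CARD('n) * G)"
      proof (cases "x \<in> A'")
        case True
        have "\<bar>\<psi> (x + t k *\<^sub>R axis i 1) - \<psi> x\<bar> \<le> real CARD('n) * G * t k"
          using lip[of "x + t k *\<^sub>R axis i 1" x] n by simp
        then show ?thesis using True t(1)[of k] by (simp add: \<Delta>_def divide_le_eq)
      next
        case False
        have "x \<notin> A" using False by (auto simp: A'_def intro!: exI[of _ x] exI[of _ 0])
        moreover have "x + t k *\<^sub>R axis i 1 \<notin> A"
        proof
          assume "x + t k *\<^sub>R axis i 1 \<in> A"
          moreover have "- (t k *\<^sub>R axis i 1 :: 'n point) \<in> cball 0 1" using n t(2)[of k] by simp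
          ultimately have "x \<in> A'" unfolding A'_def
            by (intro CollectI exI[of _ "x + t k *\<^sub>R axis i 1"] exI[of _ "- (t k *\<^sub>R axis i 1)"]) simp
          then show False using False by simp
        qed
        ultimately have "\<psi> x = 0" "\<psi> (x + t k *\<^sub>R axis i 1) = 0" using A(2) by auto
        then show ?thesis using False by (simp add: \<Delta>_def)
      qed
    qed
  qed
  then have "(LINT x|lborel. partial i \<psi> x) = 0" using z by (simp add: LIMSEQ_const_iff)
  then show ?thesis using cont(2)[of i] by (simp add: integral_completion borel_measurable_continuous_onI)
qed

lemma set_integrable_lebesgue_continuous:
  fixes w :: "('n::finite) point \<Rightarrow> 'b::euclidean_space"
  assumes "continuous_on UNIV w" "compact A"
  shows "set_integrable lebesgue A w"
proof -
  have "integrable lborel (\<lambda>x. indicator A x *\<^sub>R w x)"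
    using borel_integrable_compact[OF assms(2), of w] assms(1)
    by (auto intro: continuous_on_subset simp: indicator_def if_distrib cong: if_cong)
  then show ?thesis by (simp add: set_integrable_def integrable_completion borel_measurable_integrable)
qed

text \<open>Integration by parts is \<open>integral_partial_zero\<close> applied to each component
  of the product of the test function and the field.\<close>

lemma weak_partial_C1:
  fixes w :: "('n::finite) point \<Rightarrow> 'b::euclidean_space"
  assumes U: "open U" and w: "cdiff 1 w" and u: "u \<in> borel_measurable lebesgue"
    and uw: "AE x in lebesgue. x \<in> U \<longrightarrow> u x = w x"
  shows "weak_partial U i u (partial i w)"
  unfolding weak_partial_def
proof (intro conjI allI impI)
  have mU: "U \<in> sets lebesgue" using U by (simp add: lebesgue_openin)
  fix A assume A: "compact A \<and> A \<subseteq> U"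
  show "set_integrable lebesgue A (partial i w)"
    using A cdiff_1_continuous_partial[OF w] by (intro set_integrable_lebesgue_continuous) auto
  have "set_integrable lebesgue A w" 
    using A cdiff_1_continuous[OF w] by (intro set_integrable_lebesgue_continuous) auto
  then have i: "integrable lebesgue (\<lambda>x. indicator A x *\<^sub>R w x)" by (simp add: set_integrable_def)
  have "A \<in> sets lebesgue" using A by (simp add: lmeasurable_compact fmeasurableD)
  then have m: "(\<lambda>x. indicator A x *\<^sub>R u x) \<in> borel_measurable lebesgue"
    using u by (intro borel_measurable_scaleR borel_measurable_indicator) auto
  have "AE x in lebesgue. indicator A x *\<^sub>R w x = indicator A x *\<^sub>R u x"
    using uw by eventually_elim (use A in \<open>auto simp: indicator_def\<close>)
  from integrable_cong_AE_imp[OF i m] this show "set_integrable lebesgue A u"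
    by (simp add: set_integrable_def)
next
  have mU: "U \<in> sets lebesgue" using U by (simp add: lebesgue_openin)
  fix \<phi> assume \<phi>: "test_fun U \<phi>"
  let ?A = "closure {x. \<phi> x \<noteq> 0}"
  have A: "compact ?A" "?A \<subseteq> U" "{x. \<phi> x \<noteq> 0} \<subseteq> ?A" and cd: "cdiff 1 \<phi>"
    using \<phi> unfolding test_fun_def by (auto intro: closure_subset[THEN subsetD])
  have c: "continuous_on UNIV \<phi>" "continuous_on UNIV (partial i \<phi>)" "continuous_on UNIV w" "continuous_on UNIV (partial i w)"
    using cdiff_1_continuous[OF cd] cdiff_1_continuous_partial[OF cd] cdiff_1_continuous[OF w]
      cdiff_1_continuous_partial[OF w] by blast+
  have out: "partial i \<phi> x = 0" if "x \<notin> ?A" for x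
    by (rule partial_zero_outside[OF closed_closure A(3) that])
  have int1: "integrable lebesgue (\<lambda>x. \<phi> x *\<^sub>R partial i w x)"
    by (rule integrable_test_mult[OF c(1) A(1,3) set_integrable_lebesgue_continuous[OF c(4) A(1)]])
  have int2: "integrable lebesgue (\<lambda>x. partial i \<phi> x *\<^sub>R w x)"
    by (rule integrable_test_mult[OF c(2) A(1) _ set_integrable_lebesgue_continuous[OF c(3) A(1)]]) (use out in auto)
  have "(LINT x|lebesgue. partial i \<phi> x *\<^sub>R w x) + (LINT x|lebesgue. \<phi> x *\<^sub>R partial i w x) = 0" (is "?I = 0")
  proof (rule euclidean_eqI)
    fix b :: 'b assume b: "b \<in> Basis"
    have dw: "((\<lambda>x. w x \<bullet> b) has_derivative (\<lambda>v. frechet_derivative w (at x) v \<bullet> b)) (at x)" for x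
      by (intro has_derivative_inner_left cdiff_1_has_derivative[OF w])
    have cwb: "cdiff 1 (\<lambda>x. w x \<bullet> b)"
      by (rule cdiff_1I[OF dw]) (intro continuous_on_inner cdiff_1_continuous_frechet w continuous_on_const)
    have pwb: "partial i (\<lambda>x. w x \<bullet> b) x = partial i w x \<bullet> b" for x
      using partial_eqI[OF dw] by (simp add: partial_def)
    have "(LINT x|lebesgue. partial i (\<lambda>x. \<phi> x *\<^sub>R (w x \<bullet> b)) x) = 0"
      by (rule integral_partial_zero[OF cdiff_1_scaleR(1)[OF cd cwb] A(1)]) (use A(3) in auto)
    moreover have "partial i (\<lambda>x. \<phi> x *\<^sub>R (w x \<bullet> b)) x = (\<phi> x *\<^sub>R partial i w x + partial i \<phi> x *\<^sub>R w x) \<bullet> b" for x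
      unfolding cdiff_1_scaleR(2)[OF cd cwb] pwb by (simp add: inner_add_left)
    ultimately have "(LINT x|lebesgue. (\<phi> x *\<^sub>R partial i w x + partial i \<phi> x *\<^sub>R w x) \<bullet> b) = 0"
      by (simp only:)
    moreover have "(LINT x|lebesgue. (\<phi> x *\<^sub>R partial i w x + partial i \<phi> x *\<^sub>R w x) \<bullet> b)
      = (LINT x|lebesgue. \<phi> x *\<^sub>R partial i w x + partial i \<phi> x *\<^sub>R w x) \<bullet> b"
      by (rule integral_inner_left) (use Bochner_Integration.integrable_add[OF int1 int2] in blast)
    ultimately show "?I \<bullet> b = 0 \<bullet> b"
      using Bochner_Integration.integral_add[OF int1 int2] by (simp add: add.commute)
  qed
  then have I: "(LINT x|lebesgue. partial i \<phi> x *\<^sub>R w x) = - (LINT x|lebesgue. \<phi> x *\<^sub>R partial i w x)"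
    by (simp add: eq_neg_iff_add_eq_0)
  have "(LINT x:U|lebesgue. partial i \<phi> x *\<^sub>R u x) = (LINT x|lebesgue. partial i \<phi> x *\<^sub>R w x)"
    unfolding set_lebesgue_integral_def
  proof (rule integral_cong_AE)
    have "partial i \<phi> \<in> borel_measurable lebesgue" 
      using c(2) by (simp add: borel_measurable_continuous_onI measurable_completion)
    then show "(\<lambda>x. indicator U x *\<^sub>R (partial i \<phi> x *\<^sub>R u x)) \<in> borel_measurable lebesgue"
      using u mU by (intro borel_measurable_scaleR borel_measurable_indicator)
    show "(\<lambda>x. partial i \<phi> x *\<^sub>R w x) \<in> borel_measurable lebesgue" using int2 by (rule borel_measurable_integrable)
    show "AE x in lebesgue. indicator U x *\<^sub>R (partial i \<phi> x *\<^sub>R u x) = partial i \<phi> x *\<^sub>R w x"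
      using uw
    proof eventually_elim
      case (elim x)
      then show ?case using out[of x] A(2) by (cases "x \<in> U") auto
    qed
  qed
  moreover have "(LINT x:U|lebesgue. \<phi> x *\<^sub>R partial i w x) = (LINT x|lebesgue. \<phi> x *\<^sub>R partial i w x)"
  proof -
    have "indicator U x *\<^sub>R (\<phi> x *\<^sub>R partial i w x) = \<phi> x *\<^sub>R partial i w x" for x
      using A by (cases "\<phi> x = 0") (auto simp: indicator_def)
    then show ?thesis by (simp only: set_lebesgue_integral_def)
  qed
  ultimately show "(LINT x:U|lebesgue. partial i \<phi> x *\<^sub>R u x) = - (LINT x:U|lebesgue. \<phi> x *\<^sub>R partial i w x)"
    using I by simp
qed

text \<open>The derivative selected by \<open>SOME\<close> agrees almost everywhere with the
  classical one by uniqueness, and this agreement also gives the measurability of the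
  integrand.\<close>

lemma grad_norm2_C1:
  fixes w :: "('n::finite) point \<Rightarrow> 'b::euclidean_space"
  assumes U: "open U" and w: "cdiff 1 w" and u: "u \<in> borel_measurable lebesgue"
    and uw: "AE x in lebesgue. x \<in> U \<longrightarrow> u x = w x"
  shows "grad_norm2 U u = (\<Sum>i\<in>UNIV. LINT x:U|lebesgue. (norm (partial i w x))\<^sup>2)"
  unfolding grad_norm2_def
proof (rule sum.cong[OF refl])
  fix i
  let ?g = "SOME g. weak_partial U i u g"
  have mU: "U \<in> sets lebesgue" using U by (simp add: lebesgue_openin)
  have "weak_partial U i u (partial i w)" by (rule weak_partial_C1[OF assms])
  then have "weak_partial U i u ?g" by (rule someI[of "weak_partial U i u"])
  from weak_partial_unique[OF U this \<open>weak_partial U i u (partial i w)\<close>]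
  have eq: "AE x in lebesgue. indicator U x *\<^sub>R (norm (?g x))\<^sup>2 = indicator U x *\<^sub>R (norm (partial i w x))\<^sup>2"
    by eventually_elim (auto simp: indicator_def)
  have m: "(\<lambda>x. indicator U x *\<^sub>R (norm (partial i w x))\<^sup>2) \<in> borel_measurable lebesgue"
  proof -
    have "(\<lambda>x. (norm (partial i w x))\<^sup>2) \<in> borel_measurable lebesgue"
      using borel_measurable_continuous_onI[OF cdiff_1_continuous_partial[OF w, of UNIV i]]
      by (intro measurable_completion) simp
    then show ?thesis using mU by (intro borel_measurable_scaleR borel_measurable_indicator)
  qed
  show "(LINT x:U|lebesgue. (norm (?g x))\<^sup>2) = (LINT x:U|lebesgue. (norm (partial i w x))\<^sup>2)"
    unfolding set_lebesgue_integral_def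
    by (rule integral_cong_AE[OF borel_measurable_lebesgue_AE_eq[OF m eq] m eq])
qed

section \<open>Lipschitz cells\<close>

text \<open>A point of the sphere in a relatively open set could be pushed radially outwards, out of
  the unit ball.\<close>

lemma openin_subspace_cball_subset_ball:
  fixes V :: "'a::euclidean_space set"
  assumes V: "subspace V" and S: "openin (top_of_set V) S" and sub: "S \<subseteq> cball 0 1"
  shows "S \<subseteq> ball 0 1"
proof
  fix x assume x: "x \<in> S"
  show "x \<in> ball 0 1"
  proof (rule ccontr)
    assume "x \<notin> ball 0 1"
    then have n: "norm x = 1" using x sub by force
    obtain \<epsilon> where \<epsilon>: "\<epsilon> > 0" "ball x \<epsilon> \<inter> V \<subseteq> S" using S x unfolding openin_contains_ball by blast
    have "x \<in> V" using S x openin_imp_subset by blast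
    then have "(1 + \<epsilon> / 2) *\<^sub>R x \<in> V" using V by (simp add: subspace_scale)
    moreover have "dist x ((1 + \<epsilon> / 2) *\<^sub>R x) = \<epsilon> / 2"
      using n \<epsilon>(1) by (simp add: dist_norm algebra_simps)
    ultimately have "(1 + \<epsilon> / 2) *\<^sub>R x \<in> ball x \<epsilon> \<inter> V" using \<epsilon>(1) by simp
    then have "(1 + \<epsilon> / 2) *\<^sub>R x \<in> cball 0 1" using \<epsilon>(2) sub by blast
    then have "\<bar>1 + \<epsilon> / 2\<bar> * norm x \<le> 1" by simp
    then show False using n \<epsilon>(1) by simp
  qed
qed

lemma lip_cellE:
  fixes T :: "('n::finite) point set"
  assumes "lip_cell d T B"
  obtains V :: "'n point set" and g g' :: "'n point \<Rightarrow> 'n point" and L where "subspace V" "dim V = d" "continuous_on (cball 0 1 \<inter> V) g" "continuous_on T g'"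
    "g ` (cball 0 1 \<inter> V) = T" "g' ` T = cball 0 1 \<inter> V" "\<forall>x\<in>cball 0 1 \<inter> V. g' (g x) = x"
    "\<forall>y\<in>T. g (g' y) = y" "L-lipschitz_on (cball 0 1 \<inter> V) g" "B = g ` (sphere 0 1 \<inter> V)"
    "T - B = g ` (ball 0 1 \<inter> V)" "inj_on g (cball 0 1 \<inter> V)" "inj_on g' T"
proof -
  obtain V :: "'n point set" and g g' L where V: "subspace V" "dim V = d" and hom: "homeomorphism (cball 0 1 \<inter> V) T g g'"
    and L: "L-lipschitz_on (cball 0 1 \<inter> V) g" and B: "B = g ` (sphere 0 1 \<inter> V)"
    using assms unfolding lip_cell_def by (elim exE conjE) (rule that; assumption)
  have h: "continuous_on (cball 0 1 \<inter> V) g" "continuous_on T g'"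
    "g ` (cball 0 1 \<inter> V) = T" "g' ` T = cball 0 1 \<inter> V" "\<forall>x\<in>cball 0 1 \<inter> V. g' (g x) = x"
    "\<forall>y\<in>T. g (g' y) = y" using hom by (auto simp: homeomorphism_def)
  have inj: "inj_on g (cball 0 1 \<inter> V)" using h(5) by (auto intro: inj_on_inverseI)
  have inj': "inj_on g' T" using h(6) by (auto intro: inj_on_inverseI)
  have "T - B = g ` ((cball 0 1 \<inter> V) - (sphere 0 1 \<inter> V))"
    unfolding B h(3)[symmetric] using inj by (intro inj_on_image_set_diff[symmetric]) auto
  also have "(cball 0 1 \<inter> V) - (sphere 0 1 \<inter> V) = ball 0 1 \<inter> V" by auto
  finally show ?thesis using that[OF V h L B _ inj inj'] by simp
qed

text \<open>Invariance of dimension gives the inequality. If the dimensions agree, invariance of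
  domain makes the image relatively open in \<open>V\<close>, so it cannot touch the sphere.\<close>

lemma lip_cell_chart_image:
  fixes g' :: "'a::euclidean_space \<Rightarrow> 'a"
  assumes W: "openin (top_of_set U) W" "affine U" "W \<noteq> {}" and V: "subspace V" "dim V = d"
    and g': "continuous_on W g'" "inj_on g' W" "g' ` W \<subseteq> cball 0 1 \<inter> V"
  shows "aff_dim U \<le> int d" and "aff_dim U = int d \<Longrightarrow> g' ` W \<subseteq> ball 0 1 \<inter> V"
proof -
  have aV: "affine V" "aff_dim V = int d" using V by (auto simp: subspace_imp_affine aff_dim_subspace)
  show "aff_dim U \<le> int d"
    using invariance_of_dimension_affine_sets[OF W(1,2) aV(1) g'(1) _ g'(2) W(3)] g'(3) aV(2) by auto
  assume "aff_dim U = int d"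
  then have "openin (top_of_set V) (g' ` W)"
    using invariance_of_domain_affine_sets[OF W(1,2) aV(1) _ g'(1) _ g'(2)] g'(3) aV(2) by auto
  from openin_subspace_cball_subset_ball[OF V(1) this] g'(3) show "g' ` W \<subseteq> ball 0 1 \<inter> V" by auto
qed

text \<open>The inverse chart maps \<open>W\<close> into the unit ball of \<open>V\<close>. Applied
  to the relative interior of a facet, this locates the facet inside a boundary cell.\<close>

lemma lip_cell_openin_subset:
  fixes T :: "('n::finite) point set"
  assumes c: "lip_cell d T B" and W: "openin (top_of_set U) W" "affine U" "W \<noteq> {}" "W \<subseteq> T"
  shows "aff_dim U \<le> int d" and "aff_dim U = int d \<Longrightarrow> W \<inter> B = {}"
proof -
  obtain V :: "'n point set" and g g' :: "'n point \<Rightarrow> 'n point" and L where g: "subspace V" "dim V = d" "continuous_on (cball 0 1 \<inter> V) g" "continuous_on T g'"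
    "g ` (cball 0 1 \<inter> V) = T" "g' ` T = cball 0 1 \<inter> V" "\<forall>x\<in>cball 0 1 \<inter> V. g' (g x) = x"
    "\<forall>y\<in>T. g (g' y) = y" "L-lipschitz_on (cball 0 1 \<inter> V) g" "B = g ` (sphere 0 1 \<inter> V)"
    "T - B = g ` (ball 0 1 \<inter> V)" "inj_on g (cball 0 1 \<inter> V)" "inj_on g' T"
    using c by (rule lip_cellE) (rule that; assumption)
  have c': "continuous_on W g'" "inj_on g' W" "g' ` W \<subseteq> cball 0 1 \<inter> V"
    using g(4,6,13) W(4) by (auto intro: continuous_on_subset inj_on_subset)
  note chart = lip_cell_chart_image[OF W(1-3) g(1,2) c']
  show "aff_dim U \<le> int d" by (rule chart)
  assume "aff_dim U = int d"
  then have sub: "g' ` W \<subseteq> ball 0 1 \<inter> V" by (rule chart)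
  show "W \<inter> B = {}"
  proof (rule ccontr)
    assume "W \<inter> B \<noteq> {}"
    then obtain x where x: "x \<in> W" "x \<in> B" by auto
    then obtain y where y: "y \<in> sphere 0 1 \<inter> V" "x = g y" using g(10) by auto
    then have "g' x = y" using g(7) by auto
    then show False using sub x(1) y(1) by auto
  qed
qed

text \<open>Invariance of dimension forces equal dimensions; then the change of charts sends the
  open ball of one model to a relatively open set of the other, hence off its sphere. This justifies
  the definite descriptions in \<open>cell_dim\<close> and \<open>cell_boundary\<close>.\<close>

lemma lip_cell_unique:
  fixes T :: "('n::finite) point set"
  assumes c: "lip_cell d T B" and c2: "lip_cell d2 T B2"
  shows "d = d2" and "B = B2"
proof -
  have *: "d \<le> d2 \<and> (d = d2 \<longrightarrow> T - B \<subseteq> T - B2)" if c: "lip_cell d T B" and c2: "lip_cell d2 T B2" for d d2 B B2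
  proof -
    obtain V :: "'n point set" and g g' :: "'n point \<Rightarrow> 'n point" and L where g: "subspace V" "dim V = d" "continuous_on (cball 0 1 \<inter> V) g" "continuous_on T g'"
      "g ` (cball 0 1 \<inter> V) = T" "g' ` T = cball 0 1 \<inter> V" "\<forall>x\<in>cball 0 1 \<inter> V. g' (g x) = x"
      "\<forall>y\<in>T. g (g' y) = y" "L-lipschitz_on (cball 0 1 \<inter> V) g" "B = g ` (sphere 0 1 \<inter> V)"
      "T - B = g ` (ball 0 1 \<inter> V)" "inj_on g (cball 0 1 \<inter> V)" "inj_on g' T"
      using c by (rule lip_cellE) (rule that; assumption)
    obtain V2 :: "'n point set" and g2 g2' :: "'n point \<Rightarrow> 'n point" and L2 where g2: "subspace V2" "dim V2 = d2" "continuous_on (cball 0 1 \<inter> V2) g2" "continuous_on T g2'"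
      "g2 ` (cball 0 1 \<inter> V2) = T" "g2' ` T = cball 0 1 \<inter> V2" "\<forall>x\<in>cball 0 1 \<inter> V2. g2' (g2 x) = x"
      "\<forall>y\<in>T. g2 (g2' y) = y" "L2-lipschitz_on (cball 0 1 \<inter> V2) g2" "B2 = g2 ` (sphere 0 1 \<inter> V2)"
      "T - B2 = g2 ` (ball 0 1 \<inter> V2)" "inj_on g2 (cball 0 1 \<inter> V2)" "inj_on g2' T"
      using c2 by (rule lip_cellE) (rule that; assumption)
    let ?W = "ball 0 1 \<inter> V"
    have sub: "?W \<subseteq> cball 0 1 \<inter> V" by auto
    have W: "openin (top_of_set V) ?W" by (simp add: Int_commute openin_open_Int)
    have "0 \<in> ?W" using g(1) by (simp add: subspace_0)
    then have ne: "?W \<noteq> {}" by blast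
    have gW: "g ` ?W \<subseteq> T" using g(5) sub by blast
    have cg: "continuous_on ?W g" using g(3) sub by (rule continuous_on_subset)
    have cont: "continuous_on ?W (g2' \<circ> g)"
      using continuous_on_compose[OF cg continuous_on_subset[OF g2(4) gW]] .
    have inj: "inj_on (g2' \<circ> g) ?W"
      using comp_inj_on[OF inj_on_subset[OF g(12) sub] inj_on_subset[OF g2(13) gW]] .
    have im: "(g2' \<circ> g) ` ?W \<subseteq> cball 0 1 \<inter> V2" using gW g2(6) by (auto simp: image_comp[symmetric])
    have aff: "affine V" "aff_dim V = int d" using g by (auto simp: subspace_imp_affine aff_dim_subspace)
    note ch = lip_cell_chart_image[OF W aff(1) ne g2(1,2) cont inj im]
    have "d \<le> d2" using ch(1) aff(2) by simp
    moreover have "T - B \<subseteq> T - B2" if "d = d2"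
    proof
      fix x assume "x \<in> T - B"
      then obtain y where y: "y \<in> ?W" "x = g y" using g(11) by blast
      have "(g2' \<circ> g) ` ?W \<subseteq> ball 0 1 \<inter> V2" using ch(2) aff(2) that by simp
      from subsetD[OF this imageI[OF y(1)]] have "g2' x \<in> ball 0 1 \<inter> V2" unfolding o_def y(2) .
      moreover have "x \<in> T" using y gW by blast
      ultimately show "x \<in> T - B2" using g2(8) unfolding g2(11) by (metis imageI)
    qed
    ultimately show ?thesis by blast
  qed
  have B: "B \<subseteq> T" if "lip_cell d T B" for d B
    using that unfolding lip_cell_def homeomorphism_def by fastforce
  from *[OF c c2] *[OF c2 c] show d: "d = d2" by simp
  from *[OF c c2] *[OF c2 c] d B[OF c] B[OF c2] show "B = B2" by blast
qed

lemma cell_dim_eq: "lip_cell d T B \<Longrightarrow> cell_dim T = d"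
  unfolding cell_dim_def using lip_cell_unique(1) by (intro the_equality) blast+

lemma cell_boundary_eq: "lip_cell d T B \<Longrightarrow> cell_boundary T = B"
  unfolding cell_boundary_def using lip_cell_unique(2) by (intro the_equality) blast+

lemma
  fixes T :: "('n::finite) point set"
  assumes c: "lip_cell d T B"
  shows lip_cell_compact: "compact T" and lip_cell_connected: "connected T"
    and lip_cell_nonempty: "T \<noteq> {}" and lip_cell_boundary_subset: "B \<subseteq> T"
proof -
  from c obtain V :: "'n point set" and g g' :: "'n point \<Rightarrow> 'n point" and L where g: "subspace V" "dim V = d" "continuous_on (cball 0 1 \<inter> V) g" "continuous_on T g'"
      "g ` (cball 0 1 \<inter> V) = T" "g' ` T = cball 0 1 \<inter> V" "\<forall>x\<in>cball 0 1 \<inter> V. g' (g x) = x"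
      "\<forall>y\<in>T. g (g' y) = y" "L-lipschitz_on (cball 0 1 \<inter> V) g" "B = g ` (sphere 0 1 \<inter> V)"
      "T - B = g ` (ball 0 1 \<inter> V)" "inj_on g (cball 0 1 \<inter> V)" "inj_on g' T"
      by (rule lip_cellE) (rule that; assumption)
  have "compact (cball 0 1 \<inter> V)" using g(1) by (intro compact_Int_closed compact_cball closed_subspace)
  then show "compact T" using compact_continuous_image[OF g(3)] g(5) by simp
  have "convex (cball 0 1 \<inter> V)" using g(1) by (intro convex_Int convex_cball subspace_imp_convex)
  then show "connected T" using connected_continuous_image[OF g(3) convex_connected] g(5) by simp
  have "0 \<in> cball 0 1 \<inter> V" using g(1) by (simp add: subspace_0)
  then show "T \<noteq> {}" using g(5) by blast
  show "B \<subseteq> T" unfolding g(10) g(5)[symmetric] by (intro image_mono) auto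
qed

lemma negligible_lipschitz_image:
  fixes g :: "'a::euclidean_space \<Rightarrow> 'a"
  assumes "L-lipschitz_on S g" "negligible S" shows "negligible (g ` S)"
proof (rule negligible_locally_Lipschitz_image)
  fix x assume "x \<in> S"
  then have "\<forall>y\<in>S \<inter> UNIV. norm (g y - g x) \<le> L * norm (y - x)"
    using assms(1) by (auto simp: lipschitz_on_def dist_norm)
  then show "\<exists>T B. open T \<and> x \<in> T \<and> (\<forall>y\<in>S \<inter> T. norm (g y - g x) \<le> B * norm (y - x))" by blast
qed (use assms in auto)

text \<open>A merely homeomorphic image of a sphere can have positive volume; the Lipschitz bound on
  the chart excludes this.\<close>

lemma lip_cell_boundary_negligible:
  fixes T :: "('n::finite) point set"
  assumes "lip_cell d T B" shows "negligible B"
proof -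
  obtain V :: "'n point set" and g g' :: "'n point \<Rightarrow> 'n point" and L where g: "subspace V" "dim V = d" "continuous_on (cball 0 1 \<inter> V) g" "continuous_on T g'"
      "g ` (cball 0 1 \<inter> V) = T" "g' ` T = cball 0 1 \<inter> V" "\<forall>x\<in>cball 0 1 \<inter> V. g' (g x) = x"
      "\<forall>y\<in>T. g (g' y) = y" "L-lipschitz_on (cball 0 1 \<inter> V) g" "B = g ` (sphere 0 1 \<inter> V)"
      "T - B = g ` (ball 0 1 \<inter> V)" "inj_on g (cball 0 1 \<inter> V)" "inj_on g' T"
    using assms by (rule lip_cellE) (rule that; assumption)
  have "negligible (sphere 0 1 \<inter> V)" by (rule negligible_subset[OF negligible_sphere]) auto
  moreover have "L-lipschitz_on (sphere 0 1 \<inter> V) g" by (rule lipschitz_on_subset[OF g(9)]) auto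
  ultimately show ?thesis unfolding g(10) by (intro negligible_lipschitz_image)
qed

lemma lip_cell_lowdim_negligible:
  fixes T :: "('n::finite) point set"
  assumes "lip_cell d T B" "d < CARD('n)" shows "negligible T"
proof -
  obtain V :: "'n point set" and g g' :: "'n point \<Rightarrow> 'n point" and L where g: "subspace V" "dim V = d" "continuous_on (cball 0 1 \<inter> V) g" "continuous_on T g'"
      "g ` (cball 0 1 \<inter> V) = T" "g' ` T = cball 0 1 \<inter> V" "\<forall>x\<in>cball 0 1 \<inter> V. g' (g x) = x"
      "\<forall>y\<in>T. g (g' y) = y" "L-lipschitz_on (cball 0 1 \<inter> V) g" "B = g ` (sphere 0 1 \<inter> V)"
      "T - B = g ` (ball 0 1 \<inter> V)" "inj_on g (cball 0 1 \<inter> V)" "inj_on g' T"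
    using assms(1) by (rule lip_cellE) (rule that; assumption)
  have "negligible V" using g(2) assms(2) by (intro negligible_lowdim) simp
  then have "negligible (cball 0 1 \<inter> V)" by (rule negligible_subset) auto
  then show ?thesis using negligible_lipschitz_image[OF g(9)] g(5) by simp
qed

text \<open>The chart of a full-dimensional cell is injective and continuous on an open ball of the
  whole space, so invariance of domain applies. The cell is thus the closure of its interior, and
  almost everywhere identities between continuous functions extend to all of it.\<close>

lemma lip_cell_fulldim:
  fixes T :: "('n::finite) point set"
  assumes "lip_cell CARD('n) T B"
  shows "open (T - B)" "T - B \<noteq> {}" "T \<subseteq> closure (T - B)" "T - B \<subseteq> interior T"
    "T = closure (interior T)"
proof -
  obtain V :: "'n point set" and g g' :: "'n point \<Rightarrow> 'n point" and L where g: "subspace V" "dim V = CARD('n)" "continuous_on (cball 0 1 \<inter> V) g" "continuous_on T g'"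
      "g ` (cball 0 1 \<inter> V) = T" "g' ` T = cball 0 1 \<inter> V" "\<forall>x\<in>cball 0 1 \<inter> V. g' (g x) = x"
      "\<forall>y\<in>T. g (g' y) = y" "L-lipschitz_on (cball 0 1 \<inter> V) g" "B = g ` (sphere 0 1 \<inter> V)"
      "T - B = g ` (ball 0 1 \<inter> V)" "inj_on g (cball 0 1 \<inter> V)" "inj_on g' T"
    using assms by (rule lip_cellE) (rule that; assumption)
  have V: "V = UNIV" using g(1,2) by (metis DIM_cart DIM_real dim_eq_full mult.right_neutral span_eq_iff)
  have sub: "ball 0 1 \<subseteq> cball (0::'n point) 1" by auto
  show op: "open (T - B)" unfolding g(11) V Int_UNIV_right
    by (rule invariance_of_domain[OF continuous_on_subset[OF g(3)] open_ball inj_on_subset[OF g(12)]]) (use sub V in auto)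
  show "T - B \<noteq> {}" unfolding g(11) V by simp
  have "T = g ` closure (ball 0 1)" using g(5) V by simp
  also have "\<dots> \<subseteq> closure (g ` ball 0 1)"
    using g(3) V by (intro image_closure_subset) (auto intro: closure_subset[THEN subsetD])
  finally show cl: "T \<subseteq> closure (T - B)" unfolding g(11) V by simp
  show int: "T - B \<subseteq> interior T" using op by (intro interior_maximal) auto
  have "closed T" using assms lip_cell_compact compact_imp_closed by blast
  then have "closure (interior T) \<subseteq> T" by (simp add: closure_minimal interior_subset)
  then show "T = closure (interior T)" using cl closure_mono[OF int] by blast
qed

section \<open>Simplices\<close>

definition unit_vol :: "'n::finite itself \<Rightarrow> real" where
  "unit_vol TYPE('n) = measure lborel (ball (0 :: 'n point) 1)"

lemma unit_vol_pos: "0 < unit_vol TYPE('n::finite)"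
  unfolding unit_vol_def by (rule content_ball_pos) simp

lemma measure_ball_unit_vol: "0 \<le> r \<Longrightarrow> measure lborel (ball (x :: ('n::finite) point) r) = r ^ CARD('n) * unit_vol TYPE('n)"
  unfolding unit_vol_def using content_ball_conv_unit_ball[of r x] by simp

lemma measure_cball_unit_vol: "0 \<le> r \<Longrightarrow> measure lborel (cball (x :: ('n::finite) point) r) = r ^ CARD('n) * unit_vol TYPE('n)"
  using measure_ball_unit_vol[of r x] content_cball_conv_ball[of x r] by simp

lemma measure_mono_bounded:
  fixes A B :: "('n::finite) point set"
  assumes "A \<subseteq> B" "A \<in> sets borel" "B \<in> sets borel" "bounded B"
  shows "measure lborel A \<le> measure lborel B"
proof -
  have "emeasure lborel B < \<infinity>" using assms(4) emeasure_bounded_finite by blast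
  then show ?thesis using assms(1-3) by (intro measure_mono_fmeasurable) (auto simp: fmeasurable_def)
qed

lemma emeasure_lborel_bounded:
  fixes A :: "('n::finite) point set"
  shows "bounded A \<Longrightarrow> emeasure lborel A = ennreal (measure lborel A)"
  using emeasure_bounded_finite[of A] by (intro emeasure_eq_ennreal_measure) auto

lemma simplex_interior_nonempty:
  "int CARD('n::finite) simplex (\<sigma> :: 'n point set) \<Longrightarrow> interior \<sigma> \<noteq> {}"
proof -
  assume s: "int CARD('n) simplex \<sigma>"
  have "aff_dim \<sigma> = int DIM('n point)" using aff_dim_simplex[OF s] by simp
  then have "rel_interior \<sigma> = interior \<sigma>" by (rule interior_rel_interior)
  moreover have "\<sigma> \<noteq> {}"
  proof
    assume "\<sigma> = {}"
    then have "aff_dim \<sigma> = -1" by simp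
    then show False using aff_dim_simplex[OF s] by simp
  qed
  ultimately show ?thesis using convex_simplex[OF s] rel_interior_eq_empty by metis
qed

text \<open>On a full-dimensional simplex every vector is tangent, so pullback keeps all
  coefficients of a form.\<close>

lemma span_differences_UNIV:
  fixes \<sigma> :: "'a::euclidean_space set"
  assumes "interior \<sigma> \<noteq> {}"
  shows "span {y - z | y z. y \<in> \<sigma> \<and> z \<in> \<sigma>} = UNIV"
proof -
  obtain x \<epsilon> where \<epsilon>: "\<epsilon> > 0" "ball x \<epsilon> \<subseteq> \<sigma>" using assms by (metis ex_in_conv mem_interior)
  have "v \<in> span {y - z | y z. y \<in> \<sigma> \<and> z \<in> \<sigma>}" for v
  proof -
    define c where "c = \<epsilon> / (norm v + 1)"
    have c: "c > 0" using \<epsilon>(1) by (simp add: c_def add_nonneg_pos)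
    have "c * norm v < \<epsilon>" using \<epsilon>(1) by (simp add: c_def divide_less_eq add_nonneg_pos)
    then have "x + c *\<^sub>R v \<in> ball x \<epsilon>" using c by (simp add: dist_norm)
    then have "x + c *\<^sub>R v \<in> \<sigma>" "x \<in> \<sigma>" using \<epsilon> by auto
    then have "c *\<^sub>R v \<in> {y - z | y z. y \<in> \<sigma> \<and> z \<in> \<sigma>}"
      by (intro CollectI exI[of _ "x + c *\<^sub>R v"] exI[of _ x]) simp
    then have "(1 / c) *\<^sub>R (c *\<^sub>R v) \<in> span {y - z | y z. y \<in> \<sigma> \<and> z \<in> \<sigma>}"
      by (intro span_scale span_base)
    then show ?thesis using c by simp
  qed
  then show ?thesis by blast
qed

text \<open>If the intersection were all of \<open>\<sigma>\<close>, then \<open>\<sigma>\<close>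
  would be a face of \<open>\<tau>\<close> of the same dimension, hence equal to it. A proper face
  is disjoint from the interior.\<close>

lemma simplices_meet_in_face:
  fixes \<sigma> \<tau> :: "('n::finite) point set"
  assumes s: "int CARD('n) simplex \<sigma>" and t: "int CARD('n) simplex \<tau>" and ne: "\<sigma> \<noteq> \<tau>"
    and f: "(\<sigma> \<inter> \<tau>) face_of \<sigma>" "(\<sigma> \<inter> \<tau>) face_of \<tau>"
  shows "interior \<sigma> \<inter> \<tau> = {}" "aff_dim (\<sigma> \<inter> \<tau>) < int CARD('n)"
proof -
  have *: "\<sigma> \<inter> \<tau> \<noteq> \<sigma>"
  proof
    assume eq: "\<sigma> \<inter> \<tau> = \<sigma>"
    then have "\<sigma> face_of \<tau>" using f(2) by simp
    from face_of_aff_dim_lt[OF convex_simplex[OF t] this ne]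
    show False using aff_dim_simplex[OF s] aff_dim_simplex[OF t] by simp
  qed
  then show "interior \<sigma> \<inter> \<tau> = {}" using face_of_disjoint_interior[OF f(1)] interior_subset by blast
  show "aff_dim (\<sigma> \<inter> \<tau>) < int CARD('n)"
    using face_of_aff_dim_lt[OF convex_simplex[OF s] f(1) *] aff_dim_simplex[OF s] by simp
qed

text \<open>
  If \<open>x\<close> belongs to the copy of \<open>\<sigma>\<close> shrunk by the factor \<open>1 - |y| / r\<close> towards the centre of an
  inscribed ball of radius \<open>r\<close>, then \<open>x + y\<close> is still in \<open>\<sigma>\<close>.
\<close>

lemma nn_integral_translation_layer:
  fixes \<sigma> :: "('n::finite) point set" and f :: "'n point \<Rightarrow> ennreal"
  assumes conv: "convex \<sigma>" and comp: "compact \<sigma>" and r: "cball x0 r \<subseteq> \<sigma>" "0 < r" and y: "norm y \<le> r"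
    and ab: "0 \<le> a" "0 \<le> b"
    and fa: "AE x in lborel. x \<in> \<sigma> \<and> x + y \<in> \<sigma> \<longrightarrow> f x \<le> ennreal a"
    and fb: "AE x in lborel. x \<in> \<sigma> \<longrightarrow> f x \<le> ennreal b"
  shows "(\<integral>\<^sup>+x\<in>\<sigma>. f x \<partial>lborel) \<le> ennreal ((a + b * (real CARD('n) * norm y / r)) * measure lborel \<sigma>)"
proof -
  define l where "l = norm y / r"
  have l: "0 \<le> l" "l \<le> 1" using r y by (auto simp: l_def)
  define S where "S = (\<lambda>z. (1 - l) *\<^sub>R z + l *\<^sub>R x0) ` \<sigma>"
  have "continuous_on \<sigma> (\<lambda>z. (1 - l) *\<^sub>R z + l *\<^sub>R x0)" by (intro continuous_intros)
  then have cS: "compact S" unfolding S_def using comp by (rule compact_continuous_image)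
  have x0: "x0 \<in> \<sigma>" using r by (auto simp: subset_iff)
  have S\<sigma>: "S \<subseteq> \<sigma>"
    unfolding S_def using convexD[OF conv _ x0, of _ "1 - l" l] l by auto
  have Sy: "z + y \<in> \<sigma>" if zS: "z \<in> S" for z
  proof (cases "l = 0")
    case True
    then have "y = 0" using r by (simp add: l_def)
    then show ?thesis using zS S\<sigma> by auto
  next
    case False
    obtain z' where z': "z' \<in> \<sigma>" "z = (1 - l) *\<^sub>R z' + l *\<^sub>R x0" using zS unfolding S_def by blast
    have y0: "y \<noteq> 0" using False by (auto simp: l_def)
    have "norm ((1 / l) *\<^sub>R y) = r" using l False r y0 by (simp add: l_def field_simps)
    then have "x0 + (1 / l) *\<^sub>R y \<in> cball x0 r" by (simp add: dist_norm)
    then have "x0 + (1 / l) *\<^sub>R y \<in> \<sigma>" using r by blast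
    from convexD[OF conv z'(1) this, of "1 - l" l] l have "(1 - l) *\<^sub>R z' + l *\<^sub>R (x0 + (1 / l) *\<^sub>R y) \<in> \<sigma>" by simp
    also have "(1 - l) *\<^sub>R z' + l *\<^sub>R (x0 + (1 / l) *\<^sub>R y) = z + y" using False z'(2) by (simp add: algebra_simps)
    finally show ?thesis .
  qed
  have mS: "measure lborel S = (1 - l) ^ CARD('n) * measure lborel \<sigma>"
  proof -
    have "measure lebesgue S = \<bar>1 - l\<bar> ^ DIM('n point) * measure lebesgue \<sigma>"
      unfolding S_def by (rule measure_lebesgue_affine)
    then show ?thesis using cS comp l by (simp add: measure_completion borel_compact)
  qed
  have b\<sigma>: "\<sigma> \<in> sets borel" "S \<in> sets borel" using comp cS by (auto intro: borel_compact)
  have fin: "emeasure lborel \<sigma> = ennreal (measure lborel \<sigma>)" "emeasure lborel S = ennreal (measure lborel S)"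
    using comp cS by (auto intro!: emeasure_lborel_bounded compact_imp_bounded)
  have "(\<integral>\<^sup>+x\<in>\<sigma>. f x \<partial>lborel) \<le> (\<integral>\<^sup>+x. ennreal a * indicator \<sigma> x + ennreal b * indicator (\<sigma> - S) x \<partial>lborel)"
  proof (rule nn_integral_mono_AE)
    show "AE x in lborel. f x * indicator \<sigma> x \<le> ennreal a * indicator \<sigma> x + ennreal b * indicator (\<sigma> - S) x"
      using fa fb
    proof eventually_elim
      case (elim x)
      show ?case
      proof (cases "x \<in> S")
        case True
        then show ?thesis using elim Sy[of x] S\<sigma> by (auto simp: indicator_def)
      next
        case False
        then show ?thesis using elim(2) by (auto simp: indicator_def intro: add_increasing)
      qed
    qed
  qed
  also have "\<dots> = ennreal a * emeasure lborel \<sigma> + ennreal b * emeasure lborel (\<sigma> - S)"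
    using b\<sigma> by (simp add: nn_integral_add nn_integral_cmult)
  also have "emeasure lborel (\<sigma> - S) = ennreal (measure lborel \<sigma> - measure lborel S)"
    using b\<sigma> S\<sigma> fin by (subst emeasure_Diff) (auto simp: ennreal_minus)
  also have "ennreal a * emeasure lborel \<sigma> + ennreal b * ennreal (measure lborel \<sigma> - measure lborel S)
    = ennreal (a * measure lborel \<sigma> + b * (measure lborel \<sigma> - measure lborel S))"
  proof -
    have "measure lborel S \<le> measure lborel \<sigma>"
      by (rule measure_mono_bounded[OF S\<sigma>]) (use b\<sigma> comp compact_imp_bounded in auto)
    then show ?thesis using ab fin by (simp add: ennreal_mult ennreal_plus)
  qed
  also have "\<dots> \<le> ennreal ((a + b * (real CARD('n) * norm y / r)) * measure lborel \<sigma>)"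
  proof (rule ennreal_leI)
    \<comment> \<open>Bernoulli's inequality bounds the relative volume of the layer, 1 - (1 - l)^n,
      by n l, which is linear in the length of the translation.\<close>
    have "1 + real CARD('n) * (- l) \<le> (1 + (- l)) ^ CARD('n)" using l by (intro Bernoulli_inequality) simp
    then have "1 - (1 - l) ^ CARD('n) \<le> real CARD('n) * l" by simp
    then have "b * (1 - (1 - l) ^ CARD('n)) * measure lborel \<sigma> \<le> b * (real CARD('n) * l) * measure lborel \<sigma>"
      using ab by (intro mult_right_mono mult_left_mono) auto
    then show "a * measure lborel \<sigma> + b * (measure lborel \<sigma> - measure lborel S) \<le> (a + b * (real CARD('n) * norm y / r)) * measure lborel \<sigma>"
      by (simp add: mS l_def algebra_simps)
  qed
  finally show ?thesis .
qed

text \<open>Shrink towards \<open>x\<close> with ratio \<open>\<theta>\<close>: convexity keeps the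
  image of the inscribed ball in \<open>\<sigma>\<close>. Hence a fixed share of volume lies near
  each point of the simplex, also near its vertices.\<close>

lemma convex_contains_near_ball:
  fixes \<sigma> :: "'a::euclidean_space set"
  assumes "convex \<sigma>" "cball x0 r \<subseteq> \<sigma>" "x \<in> \<sigma>" "\<sigma> \<subseteq> cball x D" "0 < \<theta>" "\<theta> \<le> 1"
  shows "cball (x + \<theta> *\<^sub>R (x0 - x)) (\<theta> * r) \<subseteq> \<sigma> \<inter> cball x (\<theta> * D)"
proof
  fix z assume z: "z \<in> cball (x + \<theta> *\<^sub>R (x0 - x)) (\<theta> * r)"
  define p where "p = x + (1 / \<theta>) *\<^sub>R (z - x)"
  have "\<theta> *\<^sub>R (x0 - p) = x + \<theta> *\<^sub>R (x0 - x) - z" using assms(5) by (simp add: p_def algebra_simps)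
  then have "\<theta> * norm (x0 - p) = norm (x + \<theta> *\<^sub>R (x0 - x) - z)" using assms(5)
    by (metis abs_of_pos norm_scaleR)
  then have "\<theta> * norm (x0 - p) \<le> \<theta> * r" using z by (simp add: dist_norm)
  then have "p \<in> \<sigma>" using assms by (auto simp: dist_norm)
  have zp: "z = (1 - \<theta>) *\<^sub>R x + \<theta> *\<^sub>R p" using assms(5) by (simp add: p_def algebra_simps)
  then have "z \<in> \<sigma>" using convexD[OF assms(1,3) \<open>p \<in> \<sigma>\<close>, of "1 - \<theta>" \<theta>] assms by simp
  moreover have "norm (x - z) \<le> \<theta> * D"
  proof -
    have "x - z = \<theta> *\<^sub>R (x - p)" using zp by (simp add: algebra_simps)
    then have "norm (x - z) = \<theta> * norm (x - p)" using assms(5) by simp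
    moreover have "norm (x - p) \<le> D" using assms(4) \<open>p \<in> \<sigma>\<close> by (auto simp: dist_norm)
    ultimately show ?thesis using assms(5) by simp
  qed
  ultimately show "z \<in> \<sigma> \<inter> cball x (\<theta> * D)" by (simp add: dist_norm)
qed

text \<open>The inscribed balls are disjoint and lie in one ball, so their number is at most the
  ratio of the volumes. The bound for finite subfamilies also gives finiteness.\<close>

lemma packing_bound:
  fixes \<S> :: "('n::finite) point set set"
  assumes r: "0 < r" "0 \<le> \<rho>" and ball: "\<And>\<sigma>. \<sigma> \<in> \<S> \<Longrightarrow> \<exists>x. cball x r \<subseteq> \<sigma>" and sub: "\<And>\<sigma>. \<sigma> \<in> \<S> \<Longrightarrow> \<sigma> \<subseteq> cball q \<rho>"
    and disj: "\<And>\<sigma> \<tau>. \<sigma> \<in> \<S> \<Longrightarrow> \<tau> \<in> \<S> \<Longrightarrow> \<sigma> \<noteq> \<tau> \<Longrightarrow> interior \<sigma> \<inter> \<tau> = {}"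
  shows "finite \<S>" "real (card \<S>) \<le> (\<rho> / r) ^ CARD('n)"
proof -
  obtain c where c: "\<And>\<sigma>. \<sigma> \<in> \<S> \<Longrightarrow> cball (c \<sigma>) r \<subseteq> \<sigma>" using ball by metis
  have bd: "real (card \<F>) \<le> (\<rho> / r) ^ CARD('n)" if F: "\<F> \<subseteq> \<S>" "finite \<F>" for \<F>
  proof (cases "\<F> = {}")
    case True
    then show ?thesis using r by simp
  next
    case False
    have "ball (c \<sigma>) r \<subseteq> interior \<sigma>" if "\<sigma> \<in> \<S>" for \<sigma>
      using c[OF that] by (intro interior_maximal) (auto simp: subset_iff)
    then have disj': "disjoint_family_on (\<lambda>\<sigma>. ball (c \<sigma>) r) \<F>"
      unfolding disjoint_family_on_def
    proof (intro ballI impI)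
      fix \<sigma> \<tau> assume st: "\<sigma> \<in> \<F>" "\<tau> \<in> \<F>" "\<sigma> \<noteq> \<tau>"
      then have "\<sigma> \<in> \<S>" "\<tau> \<in> \<S>" using F(1) by auto
      then have "interior \<sigma> \<inter> \<tau> = {}" "ball (c \<sigma>) r \<subseteq> interior \<sigma>" "ball (c \<tau>) r \<subseteq> \<tau>"
        using disj[of \<sigma> \<tau>] st(3) \<open>\<And>\<sigma>. \<sigma> \<in> \<S> \<Longrightarrow> ball (c \<sigma>) r \<subseteq> interior \<sigma>\<close> interior_subset by blast+
      then show "ball (c \<sigma>) r \<inter> ball (c \<tau>) r = {}" by blast
    qed
    have "real (card \<F>) * (r ^ CARD('n) * unit_vol TYPE('n)) = (\<Sum>\<sigma>\<in>\<F>. measure lborel (ball (c \<sigma>) r))"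
      using r by (simp add: measure_ball_unit_vol)
    also have "\<dots> = measure lborel (\<Union>\<sigma>\<in>\<F>. ball (c \<sigma>) r)"
      using F(2) disj' by (intro measure_finite_Union[symmetric]) (auto simp: emeasure_lborel_bounded)
    also have "\<dots> \<le> measure lborel (cball q \<rho>)"
    proof (rule measure_mono_bounded)
      show "(\<Union>\<sigma>\<in>\<F>. ball (c \<sigma>) r) \<subseteq> cball q \<rho>"
      proof (rule UN_least)
        fix \<sigma> assume "\<sigma> \<in> \<F>"
        then have "\<sigma> \<in> \<S>" using F(1) by auto
        then show "ball (c \<sigma>) r \<subseteq> cball q \<rho>" using c[of \<sigma>] sub[of \<sigma>] ball_subset_cball[of "c \<sigma>" r] by blast
      qed
      show "(\<Union>\<sigma>\<in>\<F>. ball (c \<sigma>) r) \<in> sets borel" by (intro borel_open open_UN) simp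
    qed auto
    also have "\<dots> = \<rho> ^ CARD('n) * unit_vol TYPE('n)" using r(2) by (rule measure_cball_unit_vol)
    finally have "real (card \<F>) * r ^ CARD('n) \<le> \<rho> ^ CARD('n)" using unit_vol_pos[where 'n='n] by (simp add: mult.assoc[symmetric])
    then show ?thesis using r by (simp add: power_divide le_divide_eq)
  qed
  show fin: "finite \<S>"
  proof (rule finite_if_finite_subsets_card_bdd[of _ "nat \<lceil>(\<rho> / r) ^ CARD('n)\<rceil>", THEN conjunct1])
    fix \<F> assume "\<F> \<subseteq> \<S>" "finite \<F>"
    from bd[OF this] show "card \<F> \<le> nat \<lceil>(\<rho> / r) ^ CARD('n)\<rceil>" by linarith
  qed
  show "real (card \<S>) \<le> (\<rho> / r) ^ CARD('n)" using bd fin by blast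
qed

section \<open>Facets\<close>

text \<open>A set of lower dimension lies in a hyperplane, whose unit normal is a witness for the
  choice in \<open>unit_normal\<close>.\<close>

lemma unit_normal:
  fixes F :: "('n::finite) point set"
  assumes "aff_dim F < int CARD('n)"
  shows "norm (unit_normal F) = 1" "x \<in> F \<Longrightarrow> y \<in> F \<Longrightarrow> (x - y) \<bullet> unit_normal F = 0"
proof -
  obtain a b where ab: "a \<noteq> 0" "F \<subseteq> {x. a \<bullet> x = b}"
    using aff_lowdim_subset_hyperplane[of F] assms by auto
  have "norm (a /\<^sub>R norm a) = 1 \<and> (\<forall>x\<in>F. \<forall>y\<in>F. (x - y) \<bullet> (a /\<^sub>R norm a) = 0)"
    using ab by (auto simp: inner_diff_left inner_diff_right inner_commute[of _ a] subset_iff)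
  from someI[of "\<lambda>\<nu>. norm \<nu> = 1 \<and> (\<forall>x\<in>F. \<forall>y\<in>F. (x - y) \<bullet> \<nu> = 0)", OF this]
  show "norm (unit_normal F) = 1" "x \<in> F \<Longrightarrow> y \<in> F \<Longrightarrow> (x - y) \<bullet> unit_normal F = 0"
    unfolding unit_normal_def by auto
qed

text \<open>The domain of integration in \<open>facet_integral\<close>, isolated because its volume
  plays the part of the area of the facet.\<close>

definition prism :: "('n::finite) point set \<Rightarrow> 'n point set" where
  "prism F = {x + t *\<^sub>R unit_normal F | x t. x \<in> F \<and> 0 \<le> t \<and> t \<le> 1}"

lemma compact_prism: "compact F \<Longrightarrow> compact (prism F)"
proof -
  assume F: "compact F"
  have "prism F = (\<lambda>z. fst z + snd z *\<^sub>R unit_normal F) ` (F \<times> {0..1})"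
    unfolding prism_def by (fastforce simp: image_iff)
  moreover have "continuous_on (F \<times> {0..1::real}) (\<lambda>z. fst z + snd z *\<^sub>R unit_normal F)"
    by (intro continuous_intros)
  moreover have "compact (F \<times> {0..1::real})" using F by (intro compact_Times compact_Icc)
  ultimately show ?thesis using compact_continuous_image by simp
qed

text \<open>Project from the vertex opposite to \<open>F\<close>. The slice of the inscribed ball
  parallel to \<open>F\<close> is enlarged by the factor 1 / \<open>t0\<close> \<ge> 1, so a disc of
  the same radius \<open>r\<close> fits into \<open>F\<close>.\<close>

lemma facet_contains_disc:
  fixes \<sigma> :: "('n::finite) point set"
  assumes s: "int CARD('n) simplex \<sigma>" and F: "F face_of \<sigma>" "aff_dim F = int CARD('n) - 1"
    and r: "cball x0 r \<subseteq> \<sigma>" "0 < r"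
  shows "\<exists>p\<in>F. \<forall>\<zeta>. \<zeta> \<bullet> unit_normal F = 0 \<and> norm \<zeta> \<le> r \<longrightarrow> p + \<zeta> \<in> F"
proof -
  define \<nu> where "\<nu> = unit_normal F"
  have \<nu>: "norm \<nu> = 1" "\<And>x y. x \<in> F \<Longrightarrow> y \<in> F \<Longrightarrow> (x - y) \<bullet> \<nu> = 0"
    using unit_normal[of F] F(2) by (auto simp: \<nu>_def)
  obtain C where C: "finite C" "\<not> affine_dependent C" "card C = CARD('n) + 1" "\<sigma> = convex hull C"
    using s unfolding simplex by auto
  have FC: "F face_of (convex hull C)" using F(1) C(4) by simp
  then obtain C' where C': "C' \<subseteq> C" "F = convex hull C'"
    using face_of_convex_hull_affine_independent[OF C(2)] by auto
  have aC': "\<not> affine_dependent C'" using affine_independent_subset[OF C(2) C'(1)] .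
  have "int (card C') = int CARD('n)"
    using aff_dim_affine_independent[OF aC'] F(2) C'(2) by (simp add: aff_dim_convex_hull)
  then have cC': "card C' = CARD('n)" by simp
  then have "card (C - C') = 1" using C C' by (simp add: card_Diff_subset finite_subset)
  then obtain v where v: "C - C' = {v}" by (auto simp: card_1_singleton_iff)
  have Cv: "C = insert v C'" using v C'(1) by auto
  have C'0: "C' \<noteq> {}" using cC' by (metis card.empty zero_less_card_finite less_irrefl)
  have rep: "\<exists>t f. 0 \<le> t \<and> t \<le> 1 \<and> f \<in> F \<and> x = (1 - t) *\<^sub>R v + t *\<^sub>R f" if "x \<in> \<sigma>" for x
    using that C'0 unfolding C(4) Cv convex_hull_insert_alt C'(2) by auto
  have cF: "convex F" using C'(2) by simp
  obtain f0 where f0: "f0 \<in> F" using C'0 C'(2) hull_inc[of _ C'] by blast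
  \<comment> \<open>Signed height of the facet above the opposite vertex \<open>v\<close>; a point
    with parameter \<open>t\<close> has height \<open>t * H\<close>.\<close>
  define H where "H = (f0 - v) \<bullet> \<nu>"
  have HF: "(f - v) \<bullet> \<nu> = H" if "f \<in> F" for f
    using \<nu>(2)[OF that f0] by (simp add: H_def inner_diff_left)
  have height: "(x - v) \<bullet> \<nu> = t * H" if "f \<in> F" "x = (1 - t) *\<^sub>R v + t *\<^sub>R f" for x t f
  proof -
    have "x - v = t *\<^sub>R (f - v)" using that(2) by (simp add: algebra_simps)
    then show ?thesis using HF[OF that(1)] by simp
  qed
  have mem: "x0 + \<zeta> \<in> \<sigma>" if "norm \<zeta> \<le> r" for \<zeta>
    using that r(1) by (auto simp: subset_iff dist_norm)
  have m0: "x0 \<in> \<sigma>" and m1: "x0 + r *\<^sub>R \<nu> \<in> \<sigma>" and m2: "x0 - r *\<^sub>R \<nu> \<in> \<sigma>"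
    using mem[of 0] mem[of "r *\<^sub>R \<nu>"] mem[of "- (r *\<^sub>R \<nu>)"] r \<nu>(1) by simp_all
  obtain t0 f1 where t0: "0 \<le> t0" "t0 \<le> 1" "f1 \<in> F" "x0 = (1 - t0) *\<^sub>R v + t0 *\<^sub>R f1"
    using rep[OF m0] by blast
  obtain t1 f2 where t1: "0 \<le> t1" "t1 \<le> 1" "f2 \<in> F" "x0 + r *\<^sub>R \<nu> = (1 - t1) *\<^sub>R v + t1 *\<^sub>R f2"
    using rep[OF m1] by blast
  obtain t2 f3 where t2: "0 \<le> t2" "t2 \<le> 1" "f3 \<in> F" "x0 - r *\<^sub>R \<nu> = (1 - t2) *\<^sub>R v + t2 *\<^sub>R f3"
    using rep[OF m2] by blast
  have \<nu>\<nu>: "\<nu> \<bullet> \<nu> = 1" using \<nu>(1) by (simp add: dot_square_norm)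
  have h0: "(x0 - v) \<bullet> \<nu> = t0 * H" by (rule height[OF t0(3,4)])
  have h1: "(x0 - v) \<bullet> \<nu> + r = t1 * H"
    using height[OF t1(3,4)] \<nu>\<nu> by (simp add: inner_diff_left inner_add_left)
  have h2: "(x0 - v) \<bullet> \<nu> - r = t2 * H"
    using height[OF t2(3,4)] \<nu>\<nu> by (simp add: inner_diff_left inner_add_left)
  have "r = (t1 - t0) * H" "r = (t0 - t2) * H" using h0 h1 h2 by (simp_all add: algebra_simps)
  \<comment> \<open>The inscribed ball contains points above and below its centre with respect to
    the normal. This rules out \<open>H = 0\<close>, and also a centre at the vertex
    \<open>v\<close>, that is \<open>t0 = 0\<close>.\<close>
  then have "H \<noteq> 0" "t0 \<noteq> 0"
  proof -
    show H: "H \<noteq> 0" using r(2) \<open>r = (t1 - t0) * H\<close> by auto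
    show "t0 \<noteq> 0"
    proof
      assume "t0 = 0"
      then have "r = t1 * H" "r = - (t2 * H)" using \<open>r = (t1 - t0) * H\<close> \<open>r = (t0 - t2) * H\<close> by auto
      then have "0 < t1 * H" "t2 * H < 0" using r(2) by auto
      then show False using t1(1) t2(1) by (auto simp: zero_less_mult_iff mult_less_0_iff)
    qed
  qed
  then have t0p: "0 < t0" using t0(1) by simp
  have "f1 + \<zeta> \<in> F" if \<zeta>: "\<zeta> \<bullet> \<nu> = 0" "norm \<zeta> \<le> r" for \<zeta>
  proof -
    obtain t f where tf: "0 \<le> t" "t \<le> 1" "f \<in> F" "x0 + \<zeta> = (1 - t) *\<^sub>R v + t *\<^sub>R f" using rep[OF mem[OF \<zeta>(2)]] by blast
    have "t * H = t0 * H" using height[OF tf(3,4)] h0 \<zeta>(1) by (simp add: inner_diff_left inner_add_left)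
    then have "t = t0" using \<open>H \<noteq> 0\<close> by simp
    then have "t0 *\<^sub>R f = t0 *\<^sub>R f1 + \<zeta>" using tf(4) t0(4) by (simp add: algebra_simps)
    then have "(1 / t0) *\<^sub>R (t0 *\<^sub>R f) = (1 / t0) *\<^sub>R (t0 *\<^sub>R f1 + \<zeta>)" by (rule arg_cong)
    then have "f = f1 + (1 / t0) *\<^sub>R \<zeta>" using t0p by (simp add: scaleR_add_right)
    then have "(1 - t0) *\<^sub>R f1 + t0 *\<^sub>R f = f1 + \<zeta>" using t0p by (simp add: algebra_simps)
    moreover have "(1 - t0) *\<^sub>R f1 + t0 *\<^sub>R f \<in> F" using convexD[OF cF t0(3) tf(3), of "1 - t0" t0] t0(1,2) by simp
    ultimately show ?thesis by simp
  qed
  then show ?thesis using t0(3) unfolding \<nu>_def by blast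
qed

text \<open>Instead of computing the area of the facet, disjoint balls of radius
  \<open>r / 2\<close> are stacked along the normal over the disc from
  \<open>facet_contains_disc\<close>; at least 1 / (2 r) of them fit into the prism of height
  1.\<close>

lemma measure_prism_ge:
  fixes \<sigma> :: "('n::finite) point set"
  assumes s: "int CARD('n) simplex \<sigma>" and F: "F face_of \<sigma>" "aff_dim F = int CARD('n) - 1" "compact F"
    and r: "cball x0 r \<subseteq> \<sigma>" "0 < r" "r \<le> 1"
  shows "unit_vol TYPE('n) * r ^ (CARD('n) - 1) / 2 ^ (CARD('n) + 1) \<le> measure lborel (prism F)"
proof -
  define \<nu> where "\<nu> = unit_normal F"
  have \<nu>: "norm \<nu> = 1" using unit_normal[of F] F(2) by (auto simp: \<nu>_def)
  then have \<nu>\<nu>: "\<nu> \<bullet> \<nu> = 1" by (simp add: dot_square_norm)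
  obtain p where p: "p \<in> F" "\<And>\<zeta>. \<zeta> \<bullet> \<nu> = 0 \<Longrightarrow> norm \<zeta> \<le> r \<Longrightarrow> p + \<zeta> \<in> F"
    using facet_contains_disc[OF s F(1,2) r(1,2)] unfolding \<nu>_def by blast
  \<comment> \<open>Since \<open>r \<le> 1\<close>, rounding 1 / r down loses at most a factor
    2.\<close>
  define N where "N = nat \<lfloor>1 / r\<rfloor>"
  have "1 \<le> 1 / r" using r by simp
  then have "1 \<le> \<lfloor>1 / r\<rfloor>" by (simp add: le_floor_iff)
  then have N: "real N \<le> 1 / r" "1 / r < real N + 1" "1 \<le> real N" unfolding N_def by linarith+
  have N2: "1 / (2 * r) \<le> real N" using N by (simp add: field_simps)
  define c where "c j = p + ((real j + 1 / 2) * r) *\<^sub>R \<nu>" for j :: nat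
  have comp: "real j * r < (z - p) \<bullet> \<nu> \<and> (z - p) \<bullet> \<nu> < (real j + 1) * r \<and>
      norm ((z - p) - ((z - p) \<bullet> \<nu>) *\<^sub>R \<nu>) \<le> r" if "z \<in> ball (c j) (r / 2)" for z j
  proof -
    define d where "d = z - c j"
    have nd: "norm d < r / 2" using that by (simp add: d_def dist_norm norm_minus_commute)
    have zp: "z - p = d + ((real j + 1 / 2) * r) *\<^sub>R \<nu>" by (simp add: d_def c_def)
    have i: "(z - p) \<bullet> \<nu> = d \<bullet> \<nu> + (real j + 1 / 2) * r" unfolding zp by (simp add: inner_add_left \<nu>\<nu>)
    have "\<bar>d \<bullet> \<nu>\<bar> \<le> norm d" using Cauchy_Schwarz_ineq2[of d \<nu>] \<nu> by simp
    then have 1: "\<bar>d \<bullet> \<nu>\<bar> < r / 2" using nd by simp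
    have "(z - p) - ((z - p) \<bullet> \<nu>) *\<^sub>R \<nu> = d - (d \<bullet> \<nu>) *\<^sub>R \<nu>" unfolding i zp by (simp add: algebra_simps \<nu>\<nu>)
    moreover have "norm (d - (d \<bullet> \<nu>) *\<^sub>R \<nu>) \<le> norm d + \<bar>d \<bullet> \<nu>\<bar>"
      using norm_triangle_ineq4[of d "(d \<bullet> \<nu>) *\<^sub>R \<nu>"] \<nu> by simp
    ultimately show ?thesis using 1 nd i by (auto simp: algebra_simps abs_if split: if_splits)
  qed
  have sub: "ball (c j) (r / 2) \<subseteq> prism F" if "j < N" for j
  proof
    fix z assume "z \<in> ball (c j) (r / 2)"
    note z = comp[OF this]
    define t where "t = (z - p) \<bullet> \<nu>"
    have "(real j + 1) * r \<le> real N * r" using that r(2) by (intro mult_right_mono) auto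
    also have "\<dots> \<le> 1" using N(1) r(2) by (simp add: field_simps)
    finally have t: "0 \<le> t" "t \<le> 1" using z mult_nonneg_nonneg[of "real j" r] r(2) unfolding t_def by linarith+
    have "((z - p) - t *\<^sub>R \<nu>) \<bullet> \<nu> = 0" by (simp add: t_def inner_diff_left \<nu>\<nu>)
    then have "p + ((z - p) - t *\<^sub>R \<nu>) \<in> F" using z p(2) unfolding t_def by blast
    then show "z \<in> prism F" unfolding prism_def using t
      by (intro CollectI exI[of _ "p + ((z - p) - t *\<^sub>R \<nu>)"] exI[of _ t]) (simp add: \<nu>_def)
  qed
  have disj: "disjoint_family_on (\<lambda>j. ball (c j) (r / 2)) {..<N}"
    unfolding disjoint_family_on_def
  proof (intro ballI impI)
    fix i j :: nat assume ij: "i \<noteq> j"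
    show "ball (c i) (r / 2) \<inter> ball (c j) (r / 2) = {}"
    proof (rule ccontr)
      assume "ball (c i) (r / 2) \<inter> ball (c j) (r / 2) \<noteq> {}"
      then obtain z where "z \<in> ball (c i) (r / 2)" "z \<in> ball (c j) (r / 2)" by blast
      from comp[OF this(1)] comp[OF this(2)] have "real i * r < (real j + 1) * r" "real j * r < (real i + 1) * r" by linarith+
      then have "real i < real j + 1" "real j < real i + 1" using r(2) by simp_all
      then show False using ij by linarith
    qed
  qed
  have "unit_vol TYPE('n) * r ^ (CARD('n) - 1) / 2 ^ (CARD('n) + 1) = 1 / (2 * r) * ((r / 2) ^ CARD('n) * unit_vol TYPE('n))"
    using r(2) by (simp add: power_divide power_eq_if[of r "CARD('n)"])
  also have "\<dots> \<le> real N * ((r / 2) ^ CARD('n) * unit_vol TYPE('n))"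
    using N2 r(2) unit_vol_pos[where 'n='n] by (intro mult_right_mono) auto
  also have "\<dots> = (\<Sum>j<N. measure lborel (ball (c j) (r / 2)))"
    using r(2) by (simp add: measure_ball_unit_vol)
  also have "\<dots> = measure lborel (\<Union>j<N. ball (c j) (r / 2))"
    using disj by (intro measure_finite_Union[symmetric]) (auto simp: emeasure_lborel_bounded)
  also have "\<dots> \<le> measure lborel (prism F)"
    using sub compact_prism[OF F(3)] by (intro measure_mono_bounded) (auto intro: borel_compact compact_imp_bounded)
  finally show ?thesis .
qed

text \<open>The integrand at the foot of a point of the prism is at least the minimum of
  \<open>f\<close> on the facet, and a continuous function attains it. This extracts a pointwise
  bound from the integrated jump.\<close>

lemma facet_integral_lower:
  fixes F :: "('n::finite) point set"
  assumes dim: "aff_dim F < int CARD('n)" and F: "compact F" "F \<noteq> {}"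
    and f: "continuous_on F f" "\<And>x. x \<in> F \<Longrightarrow> 0 \<le> f x"
  shows "\<exists>z\<in>F. f z * measure lborel (prism F) \<le> facet_integral F f"
proof -
  define \<nu> where "\<nu> = unit_normal F"
  define a where "a = (SOME a. a \<in> F)"
  have a: "a \<in> F" unfolding a_def using F(2) by (simp add: some_in_eq)
  define foot where "foot y = y - ((y - a) \<bullet> \<nu>) *\<^sub>R \<nu>" for y
  have \<nu>: "norm \<nu> = 1" "\<And>x y. x \<in> F \<Longrightarrow> y \<in> F \<Longrightarrow> (x - y) \<bullet> \<nu> = 0"
    using unit_normal[OF dim] by (auto simp: \<nu>_def)
  then have \<nu>\<nu>: "\<nu> \<bullet> \<nu> = 1" by (simp add: dot_square_norm)
  have foot: "foot y \<in> F" if yP: "y \<in> prism F" for y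
  proof -
    obtain x t where x: "x \<in> F" "y = x + t *\<^sub>R \<nu>" using yP unfolding prism_def \<nu>_def by blast
    have "(y - a) \<bullet> \<nu> = t" using \<nu>(2)[OF x(1) a] x(2) \<nu>\<nu> by (simp add: inner_diff_left inner_add_left)
    then show ?thesis using x by (simp add: foot_def)
  qed
  obtain z where z: "z \<in> F" "\<And>x. x \<in> F \<Longrightarrow> f z \<le> f x" using continuous_attains_inf[OF F f(1)] by blast
  have cP: "compact (prism F)" using compact_prism[OF F(1)] .
  have cf: "continuous_on (prism F) (\<lambda>y. f (foot y))"
    by (rule continuous_on_compose2[OF f(1)]) (use foot in \<open>auto simp: foot_def intro!: continuous_intros\<close>)
  have i1: "integrable lborel (\<lambda>y. indicator (prism F) y *\<^sub>R f (foot y))"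
    by (rule borel_integrable_compact[OF cP cf])
  have i2: "integrable lborel (\<lambda>y. indicator (prism F) y *\<^sub>R f z)"
    by (rule borel_integrable_compact[OF cP]) simp
  have "f z * measure lborel (prism F) = (LINT y|lborel. indicator (prism F) y *\<^sub>R f z)"
    using cP by (simp add: mult.commute)
  also have "\<dots> \<le> (LINT y|lborel. indicator (prism F) y *\<^sub>R f (foot y))"
    by (intro integral_mono i1 i2) (use foot z in \<open>auto simp: indicator_def\<close>)
  also have "\<dots> = (LINT y:prism F|lebesgue. f (foot y))"
    unfolding set_lebesgue_integral_def using borel_measurable_integrable[OF i1] by (simp add: integral_completion)
  also have "\<dots> = facet_integral F f"
    unfolding facet_integral_def Let_def prism_def foot_def \<nu>_def a_def ..
  finally show ?thesis using z(1) by blast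
qed

section \<open>Meshes\<close>

lemma negligible_aff_dim:
  fixes S :: "'a::euclidean_space set"
  assumes "aff_dim S < int DIM('a)" shows "negligible S"
proof -
  obtain a b where "a \<noteq> 0" "S \<subseteq> {x. a \<bullet> x = b}" using aff_lowdim_subset_hyperplane[OF assms] .
  then show ?thesis using negligible_hyperplane[of a b] negligible_subset by blast
qed

lemma open_negligible_empty:
  fixes S :: "'a::euclidean_space set"
  assumes "open S" "S \<subseteq> N" "negligible N" shows "S = {}"
  using assms open_not_negligible negligible_subset by blast

lemma lip_cell_dim_le: "lip_cell d (T :: ('n::finite) point set) B \<Longrightarrow> d \<le> CARD('n)"
proof -
  assume "lip_cell d T B"
  then obtain V :: "'n point set" where "dim V = d" unfolding lip_cell_def by (elim exE conjE) (rule that; assumption)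
  then show ?thesis using dim_subset_UNIV[of V] by simp
qed

lemma lip_cell_translation:
  fixes T :: "('n::finite) point set"
  assumes "lip_cell d T B" shows "lip_cell d ((+) l ` T) ((+) l ` B)"
proof -
  obtain V :: "'n point set" and g g' c c' where V: "subspace V" "dim V = d" and hom: "homeomorphism (cball 0 1 \<inter> V) T g g'"
    and L: "c-lipschitz_on (cball 0 1 \<inter> V) g" "c'-lipschitz_on T g'" and B: "B = g ` (sphere 0 1 \<inter> V)"
    using assms unfolding lip_cell_def by (elim exE conjE) (rule that; assumption)
  have tr: "homeomorphism T ((+) l ` T) ((+) l) (\<lambda>x. x - l)"
    unfolding homeomorphism_def by (auto intro!: continuous_intros simp: image_image)
  have 1: "homeomorphism (cball 0 1 \<inter> V) ((+) l ` T) ((+) l \<circ> g) (g' \<circ> (\<lambda>x. x - l))"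
    by (rule homeomorphism_compose[OF hom tr])
  have 2: "c-lipschitz_on (cball 0 1 \<inter> V) ((+) l \<circ> g)"
    using L(1) unfolding lipschitz_on_def by (auto simp: dist_norm)
  have 3: "c'-lipschitz_on ((+) l ` T) (g' \<circ> (\<lambda>x. x - l))"
    using L(2) unfolding lipschitz_on_def by (auto simp: dist_norm)
  have 4: "(+) l ` B = ((+) l \<circ> g) ` (sphere 0 1 \<inter> V)" unfolding B by (simp add: image_comp)
  show ?thesis unfolding lip_cell_def by (intro exI conjI) (rule V 1 2 3 4)+
qed

text \<open>A single mesh. Along the family \<open>\<kappa>\<close> and \<open>N\<close> stay fixed
  while \<open>h\<close> varies, so constants built from \<open>\<kappa>\<close>, \<open>N\<close>
  and the dimension are uniform.\<close>

locale mesh =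
  fixes e :: "'n::{finite,linorder} \<Rightarrow> 'n point" and C K :: "'n point set set" and \<kappa> h :: real and N :: nat
  assumes basis: "lattice_basis e"
    and complex: "cellular_complex e C"
    and refinement: "simplicial_refinement e C K"
    and kappa: "0 < \<kappa>"
    and shape: "\<And>\<sigma>. \<sigma> \<in> K \<Longrightarrow> int CARD('n) simplex \<sigma> \<Longrightarrow> \<exists>x. cball x (\<kappa> * diameter \<sigma>) \<subseteq> \<sigma>"
    and diam_lower: "\<And>\<sigma>. \<sigma> \<in> K \<Longrightarrow> int CARD('n) simplex \<sigma> \<Longrightarrow> \<kappa> * h \<le> diameter \<sigma>"
    and diam_upper: "\<And>\<sigma>. \<sigma> \<in> K \<Longrightarrow> int CARD('n) simplex \<sigma> \<Longrightarrow> \<kappa> * diameter \<sigma> \<le> h"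
    and few: "\<And>T. T \<in> C \<Longrightarrow> finite (simplices_in K T) \<and> card (simplices_in K T) \<le> N"
    and h_def: "h = mesh_width e C"
begin

definition ncells :: "'n point set set" where
  "ncells = {T \<in> C. cell_dim T = CARD('n)}"

text \<open>The containment in an \<open>n\<close>-cell is recorded so that a field can be attached
  to each simplex; \<open>simplicial_refinement\<close> does not state it.\<close>

definition nsimps :: "'n point set set" where
  "nsimps = {\<sigma> \<in> K. int CARD('n) simplex \<sigma> \<and> (\<exists>T\<in>ncells. \<sigma> \<subseteq> T)}"

lemma complexD:
  "\<forall>T\<in>C. \<exists>d B. lip_cell d T B"
  "\<forall>T\<in>C. \<forall>l\<in>lattice e. (+) l ` T \<in> C"
  "\<forall>T\<in>C. \<forall>l\<in>lattice e. l \<noteq> 0 \<longrightarrow> T \<inter> (+) l ` T = {}"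
  "finite (orbit e ` C)"
  "\<forall>T\<in>C. \<forall>T'\<in>C. T \<noteq> T' \<longrightarrow> cell_interior T \<inter> cell_interior T' = {}"
  "\<forall>T\<in>C. \<exists>D\<subseteq>C. cell_boundary T = \<Union>D"
  "\<Union>C = UNIV"
  by (insert complex[unfolded cellular_complex_def], elim conjE, assumption)+

lemma refinementD:
  "\<forall>\<sigma>\<in>K. \<exists>d::nat. int d simplex \<sigma>"
  "\<forall>\<sigma>\<in>K. \<forall>\<tau>. \<tau> face_of \<sigma> \<and> \<tau> \<noteq> {} \<longrightarrow> \<tau> \<in> K"
  "\<forall>\<sigma>\<in>K. \<forall>\<tau>\<in>K. (\<sigma> \<inter> \<tau>) face_of \<sigma> \<and> (\<sigma> \<inter> \<tau>) face_of \<tau>"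
  "\<forall>\<sigma>\<in>K. \<forall>l\<in>lattice e. (+) l ` \<sigma> \<in> K"
  "finite (orbit e ` K)"
  "\<forall>T\<in>C. \<exists>D\<subseteq>K. T = \<Union>D"
  by (insert refinement[unfolded simplicial_refinement_def], elim conjE, assumption)+

lemma cell_lip: "T \<in> C \<Longrightarrow> lip_cell (cell_dim T) T (cell_boundary T)"
proof -
  assume "T \<in> C"
  then obtain d B where B: "lip_cell d T B" using complexD(1) by blast
  then show ?thesis using cell_dim_eq[OF B] cell_boundary_eq[OF B] by simp
qed

lemma ncell_lip: "T \<in> ncells \<Longrightarrow> lip_cell CARD('n) T (cell_boundary T)"
  using cell_lip[of T] by (simp add: ncells_def)

lemma ncells_C: "T \<in> ncells \<Longrightarrow> T \<in> C" by (simp add: ncells_def)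

lemma cell_translate: "T \<in> C \<Longrightarrow> l \<in> lattice e \<Longrightarrow> (+) l ` T \<in> C"
  using complexD(2) by simp

lemma cell_dim_translate: "T \<in> C \<Longrightarrow> cell_dim ((+) l ` T) = cell_dim T"
  using cell_dim_eq[OF lip_cell_translation[OF cell_lip]] .

lemma ncell_translate: "T \<in> ncells \<Longrightarrow> l \<in> lattice e \<Longrightarrow> (+) l ` T \<in> ncells"
  using cell_translate cell_dim_translate by (simp add: ncells_def)

lemma cell_embedded: "T \<in> C \<Longrightarrow> l \<in> lattice e \<Longrightarrow> l \<noteq> 0 \<Longrightarrow> T \<inter> (+) l ` T = {}"
  using complexD(3) by simp

lemma cell_interiors_disjoint: "T \<in> C \<Longrightarrow> T' \<in> C \<Longrightarrow> x \<in> cell_interior T \<Longrightarrow> x \<in> cell_interior T' \<Longrightarrow> T = T'"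
  using complexD(5) by blast

lemma cell_compact: "T \<in> C \<Longrightarrow> compact T"
  using cell_lip lip_cell_compact by blast

lemma countable_cells: "countable C"
proof -
  have "countable (orbit e T)" for T unfolding orbit_def using countable_lattice[OF basis] by (rule countable_image)
  moreover have "finite (orbit e ` C)" by (rule complexD(4))
  ultimately have "countable (\<Union>Q\<in>orbit e ` C. Q)" by (intro countable_UN countable_finite[of "orbit e ` C"]) auto
  then have "countable (\<Union>(orbit e ` C))" by simp
  moreover have "C \<subseteq> \<Union>(orbit e ` C)"
  proof
    fix T assume "T \<in> C"
    moreover have "T = (+) 0 ` T" by simp
    then have "T \<in> orbit e T" unfolding orbit_def using lattice_0[OF basis] by (rule image_eqI)
    ultimately show "T \<in> \<Union>(orbit e ` C)" by blast
  qed
  ultimately show ?thesis using countable_subset by blast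
qed

section \<open>Decomposition of the torus into n-cells and n-simplices\<close>

lemma cell_simplices: "T \<in> C \<Longrightarrow> T = \<Union>(simplices_in K T)"
proof -
  assume "T \<in> C"
  then obtain D where "D \<subseteq> K" "T = \<Union>D" using refinementD(6) by blast
  then show ?thesis unfolding simplices_in_def by blast
qed

lemma K_simplex: "\<sigma> \<in> K \<Longrightarrow> \<exists>d::nat. int d simplex \<sigma>"
  using refinementD(1) by simp

lemma K_face: "\<sigma> \<in> K \<Longrightarrow> \<tau> face_of \<sigma> \<Longrightarrow> \<tau> \<noteq> {} \<Longrightarrow> \<tau> \<in> K"
  using refinementD(2) by simp

lemma K_inter: "\<sigma> \<in> K \<Longrightarrow> \<tau> \<in> K \<Longrightarrow> (\<sigma> \<inter> \<tau>) face_of \<sigma> \<and> (\<sigma> \<inter> \<tau>) face_of \<tau>"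
  using refinementD(3) by simp

lemma K_translate: "\<sigma> \<in> K \<Longrightarrow> l \<in> lattice e \<Longrightarrow> (+) l ` \<sigma> \<in> K"
  using refinementD(4) by simp

lemma K_negligible: "\<sigma> \<in> K \<Longrightarrow> \<not> int CARD('n) simplex \<sigma> \<Longrightarrow> negligible \<sigma>"
proof -
  assume s: "\<sigma> \<in> K" "\<not> int CARD('n) simplex \<sigma>"
  then obtain d :: nat where d: "int d simplex \<sigma>" using K_simplex by blast
  then have "aff_dim \<sigma> = int d" by (rule aff_dim_simplex)
  moreover have "d \<noteq> CARD('n)" using d s(2) by metis
  moreover have "aff_dim \<sigma> \<le> int DIM('n point)" by (rule aff_dim_le_DIM)
  ultimately have "aff_dim \<sigma> < int DIM('n point)" by simp
  then show ?thesis by (rule negligible_aff_dim)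
qed

text \<open>The simplices of lower dimension contribute a null set, and the finite union of the
  others is closed; as an \<open>n\<close>-cell is the closure of its interior, nothing is lost by
  dropping the former.\<close>

lemma ncell_simplices: "T \<in> ncells \<Longrightarrow> T = \<Union>{\<sigma> \<in> simplices_in K T. int CARD('n) simplex \<sigma>}"
proof
  assume T: "T \<in> ncells"
  let ?P = "{\<sigma> \<in> simplices_in K T. int CARD('n) simplex \<sigma>}"
  show "\<Union>?P \<subseteq> T" by (auto simp: simplices_in_def)
  have fin: "finite (simplices_in K T)" using few ncells_C[OF T] by blast
  have cl: "closed (\<Union>?P)" using fin closed_simplex by (intro closed_Union) auto
  have "negligible (\<Union>(simplices_in K T - ?P))"
    using fin K_negligible by (intro negligible_Union) (auto simp: simplices_in_def)
  moreover have "T - \<Union>?P \<subseteq> \<Union>(simplices_in K T - ?P)" using cell_simplices[OF ncells_C[OF T]] by blast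
  moreover have "interior T - \<Union>?P \<subseteq> T - \<Union>?P" using interior_subset by blast
  moreover have "open (interior T - \<Union>?P)" using cl by (intro open_Diff) auto
  ultimately have "interior T - \<Union>?P = {}" using open_negligible_empty by (meson order_trans)
  then have "closure (interior T) \<subseteq> \<Union>?P" using cl by (intro closure_minimal) auto
  then show "T \<subseteq> \<Union>?P" using lip_cell_fulldim(5)[OF ncell_lip[OF T]] by simp
qed

text \<open>The complex only separates cell interiors in the sense of charts. The common part of two
  topological interiors lies in the union of two null boundaries and is open, hence empty.\<close>

lemma ncell_interior_disjoint: "T \<in> ncells \<Longrightarrow> T' \<in> ncells \<Longrightarrow> T \<noteq> T' \<Longrightarrow> interior T \<inter> T' = {}"
proof -
  assume T: "T \<in> ncells" "T' \<in> ncells" "T \<noteq> T'"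
  have sub: "interior T \<inter> interior T' \<subseteq> cell_boundary T \<union> cell_boundary T'"
  proof
    fix x assume "x \<in> interior T \<inter> interior T'"
    then have "x \<in> T" "x \<in> T'" using interior_subset by blast+
    then show "x \<in> cell_boundary T \<union> cell_boundary T'"
      using cell_interiors_disjoint[of T T' x] T ncells_C unfolding cell_interior_def by blast
  qed
  have neg: "negligible (cell_boundary T \<union> cell_boundary T')"
    using lip_cell_boundary_negligible[OF ncell_lip] T by (intro negligible_Un) auto
  have "interior T \<inter> interior T' = {}"
    by (rule open_negligible_empty[OF open_Int[OF open_interior open_interior] sub neg])
  then have "interior T \<inter> closure (interior T') = {}" using open_Int_closure_eq_empty open_interior by blast
  then show ?thesis using lip_cell_fulldim(5)[OF ncell_lip[OF T(2)]] by simp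
qed

lemma ncell_interior_unique: "T \<in> ncells \<Longrightarrow> T' \<in> ncells \<Longrightarrow> x \<in> interior T \<Longrightarrow> x \<in> T' \<Longrightarrow> T = T'"
  using ncell_interior_disjoint by blast

text \<open>Up to boundaries of \<open>n\<close>-cells and cells of lower dimension, which are
  countably many null sets, the \<open>n\<close>-cells exhaust the space.\<close>

lemma negligible_outside_ncells: "negligible (- \<Union>(interior ` ncells))"
proof -
  have neg: "negligible (\<Union>T\<in>C. if T \<in> ncells then cell_boundary T else T)"
  proof (rule negligible_countable_Union)
    show "countable ((\<lambda>T. if T \<in> ncells then cell_boundary T else T) ` C)"
      using countable_cells by (rule countable_image)
    fix S assume "S \<in> (\<lambda>T. if T \<in> ncells then cell_boundary T else T) ` C"
    then obtain T where T: "T \<in> C" "S = (if T \<in> ncells then cell_boundary T else T)" by blast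
    show "negligible S"
    proof (cases "T \<in> ncells")
      case True
      then show ?thesis using T lip_cell_boundary_negligible[OF ncell_lip] by simp
    next
      case False
      then have "cell_dim T < CARD('n)" using T(1) lip_cell_dim_le[OF cell_lip[OF T(1)]] by (simp add: ncells_def)
      then show ?thesis using T False lip_cell_lowdim_negligible[OF cell_lip[OF T(1)]] by simp
    qed
  qed
  moreover have "- \<Union>(interior ` ncells) \<subseteq> (\<Union>T\<in>C. if T \<in> ncells then cell_boundary T else T)"
  proof
    fix x assume x: "x \<in> - \<Union>(interior ` ncells)"
    have "\<Union>C = UNIV" by (rule complexD(7))
    then obtain T where T: "T \<in> C" "x \<in> T" by blast
    show "x \<in> (\<Union>T\<in>C. if T \<in> ncells then cell_boundary T else T)"
    proof (cases "T \<in> ncells")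
      case True
      then have "x \<notin> interior T" using x by blast
      then have "x \<in> cell_boundary T" using lip_cell_fulldim(4)[OF ncell_lip[OF True]] T(2) by blast
      then show ?thesis using T True by (intro UN_I[of T]) auto
    qed (use T in \<open>auto intro!: UN_I[of T]\<close>)
  qed
  ultimately show ?thesis using negligible_subset by blast
qed

text \<open>A radius inscribed in every \<open>n\<close>-simplex: one factor \<open>\<kappa>\<close>
  comes from shape regularity, the other from the lower bound for diameters. It is also the length
  that separates short from long translations.\<close>

definition \<rho>\<^sub>0 :: real where "\<rho>\<^sub>0 = \<kappa> ^ 2 * h"

lemma nsimps_D: "\<sigma> \<in> nsimps \<Longrightarrow> \<sigma> \<in> K" "\<sigma> \<in> nsimps \<Longrightarrow> int CARD('n) simplex \<sigma>"
  "\<sigma> \<in> nsimps \<Longrightarrow> \<exists>T\<in>ncells. \<sigma> \<subseteq> T"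
  by (auto simp: nsimps_def)

lemma ncell_nsimps: "T \<in> ncells \<Longrightarrow> x \<in> T \<Longrightarrow> \<exists>\<sigma>\<in>nsimps. x \<in> \<sigma> \<and> \<sigma> \<subseteq> T"
proof -
  assume T: "T \<in> ncells" "x \<in> T"
  then obtain \<sigma> where "\<sigma> \<in> simplices_in K T" "int CARD('n) simplex \<sigma>" "x \<in> \<sigma>"
    using ncell_simplices[OF T(1)] by blast
  then show ?thesis using T(1) by (intro bexI[of _ \<sigma>]) (auto simp: nsimps_def simplices_in_def)
qed

lemma nsimps_nonempty: "nsimps \<noteq> {}"
proof
  assume e: "nsimps = {}"
  have "ncells = {}"
  proof (rule ccontr)
    assume "ncells \<noteq> {}"
    then obtain T where T: "T \<in> ncells" by blast
    then obtain x where "x \<in> T" using lip_cell_nonempty[OF ncell_lip] by blast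
    then show False using ncell_nsimps[OF T] e by blast
  qed
  then have "negligible (UNIV :: 'n point set)" using negligible_outside_ncells by simp
  then show False by simp
qed

lemma nsimps_diameter: "\<sigma> \<in> nsimps \<Longrightarrow> diameter \<sigma> \<le> h / \<kappa>"
  using diam_upper[of \<sigma>] nsimps_D[of \<sigma>] kappa by (simp add: field_simps)

lemma nsimps_norm: "\<sigma> \<in> nsimps \<Longrightarrow> x \<in> \<sigma> \<Longrightarrow> y \<in> \<sigma> \<Longrightarrow> norm (x - y) \<le> h / \<kappa>"
proof -
  assume s: "\<sigma> \<in> nsimps" "x \<in> \<sigma>" "y \<in> \<sigma>"
  have "bounded \<sigma>" using compact_simplex[OF nsimps_D(2)[OF s(1)]] by (rule compact_imp_bounded)
  from diameter_bounded_bound[OF this s(2,3)] show ?thesis using nsimps_diameter[OF s(1)] by (simp add: dist_norm)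
qed

text \<open>A full-dimensional simplex contains two distinct points, and their distance is at most
  \<open>h / \<kappa>\<close>; positivity of the mesh width is a consequence and not a
  hypothesis.\<close>

lemma h_pos: "0 < h"
proof -
  obtain \<sigma> where s: "\<sigma> \<in> nsimps" using nsimps_nonempty by blast
  note n = simplex_interior_nonempty[OF nsimps_D(2)[OF s]]
  obtain x \<epsilon> where e: "\<epsilon> > 0" "ball x \<epsilon> \<subseteq> \<sigma>" using n by (metis ex_in_conv mem_interior)
  define v :: "'n point" where "v = (\<epsilon> / 2) *\<^sub>R axis undefined 1"
  have n1: "norm v = \<epsilon> / 2" using e(1) by (simp add: v_def)
  have "x \<in> ball x \<epsilon>" "x + v \<in> ball x \<epsilon>"
    using e(1) n1 by (simp_all add: dist_norm)
  then have "x \<in> \<sigma>" "x + v \<in> \<sigma>" using e(2) by blast+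
  from nsimps_norm[OF s this(2,1)] have "\<epsilon> / 2 \<le> h / \<kappa>" using n1 by simp
  then have "0 < h / \<kappa>" using e(1) by linarith
  then show ?thesis using kappa by (simp add: zero_less_divide_iff)
qed

lemma rho0_pos: "0 < \<rho>\<^sub>0" unfolding \<rho>\<^sub>0_def using h_pos kappa by simp

lemma nsimps_ball: "\<sigma> \<in> nsimps \<Longrightarrow> \<exists>x. cball x \<rho>\<^sub>0 \<subseteq> \<sigma>"
proof -
  assume s: "\<sigma> \<in> nsimps"
  obtain x where x: "cball x (\<kappa> * diameter \<sigma>) \<subseteq> \<sigma>" using shape nsimps_D[OF s] by blast
  have "\<kappa> * (\<kappa> * h) \<le> \<kappa> * diameter \<sigma>" using diam_lower[OF nsimps_D(1)[OF s] nsimps_D(2)[OF s]] kappa by (intro mult_left_mono) auto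
  then have "cball x \<rho>\<^sub>0 \<subseteq> cball x (\<kappa> * diameter \<sigma>)"
    by (intro subset_cball) (simp add: \<rho>\<^sub>0_def power2_eq_square mult.assoc)
  then show ?thesis using x by blast
qed

lemma nsimps_inter: "\<sigma> \<in> nsimps \<Longrightarrow> \<tau> \<in> nsimps \<Longrightarrow> \<sigma> \<noteq> \<tau> \<Longrightarrow> interior \<sigma> \<inter> \<tau> = {} \<and> aff_dim (\<sigma> \<inter> \<tau>) < int CARD('n)"
proof -
  assume s: "\<sigma> \<in> nsimps" "\<tau> \<in> nsimps" "\<sigma> \<noteq> \<tau>"
  have i: "(\<sigma> \<inter> \<tau>) face_of \<sigma>" "(\<sigma> \<inter> \<tau>) face_of \<tau>"
    using K_inter[OF nsimps_D(1)[OF s(1)] nsimps_D(1)[OF s(2)]] by auto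
  note m = simplices_meet_in_face[OF nsimps_D(2)[OF s(1)] nsimps_D(2)[OF s(2)] s(3) i]
  show ?thesis using m by simp
qed

text \<open>Bound by volumes for the number of disjoint balls of radius
  \<open>\<kappa> ^ 2 * h\<close> in a ball of radius \<open>(\<rho> + 1 / \<kappa>) * h\<close>;
  \<open>h\<close> has cancelled.\<close>

definition pack :: "real \<Rightarrow> real" where
  "pack \<rho> = ((\<rho> + 1 / \<kappa>) / \<kappa> ^ 2) ^ CARD('n)"

lemma nsimps_locally_finite:
  assumes "0 \<le> \<rho>"
  shows "finite {\<sigma> \<in> nsimps. \<sigma> \<inter> cball q (\<rho> * h) \<noteq> {}}"
    and "real (card {\<sigma> \<in> nsimps. \<sigma> \<inter> cball q (\<rho> * h) \<noteq> {}}) \<le> pack \<rho>"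
proof -
  let ?S = "{\<sigma> \<in> nsimps. \<sigma> \<inter> cball q (\<rho> * h) \<noteq> {}}"
  have sub: "\<sigma> \<subseteq> cball q (\<rho> * h + h / \<kappa>)" if "\<sigma> \<in> ?S" for \<sigma>
  proof
    fix x assume x: "x \<in> \<sigma>"
    obtain y where y: "y \<in> \<sigma>" "dist q y \<le> \<rho> * h" using \<open>\<sigma> \<in> ?S\<close> by auto
    have "dist y x \<le> h / \<kappa>" using nsimps_norm[of \<sigma> y x] x y \<open>\<sigma> \<in> ?S\<close> by (simp add: dist_norm)
    then show "x \<in> cball q (\<rho> * h + h / \<kappa>)" using y(2) dist_triangle[of q x y] by simp
  qed
  have ge: "0 \<le> \<rho> * h + h / \<kappa>" using assms h_pos kappa by simp
  have b: "\<exists>x. cball x \<rho>\<^sub>0 \<subseteq> \<sigma>" if "\<sigma> \<in> ?S" for \<sigma> using that nsimps_ball by blast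
  have d: "interior \<sigma> \<inter> \<tau> = {}" if "\<sigma> \<in> ?S" "\<tau> \<in> ?S" "\<sigma> \<noteq> \<tau>" for \<sigma> \<tau> using that nsimps_inter by blast
  show "finite ?S" by (rule packing_bound(1)[OF rho0_pos ge b sub d])
  have "real (card ?S) \<le> ((\<rho> * h + h / \<kappa>) / \<rho>\<^sub>0) ^ CARD('n)" by (rule packing_bound(2)[OF rho0_pos ge b sub d])
  also have "(\<rho> * h + h / \<kappa>) / \<rho>\<^sub>0 = (\<rho> + 1 / \<kappa>) / \<kappa> ^ 2"
  proof -
    have "\<rho> * h + h / \<kappa> = (\<rho> + 1 / \<kappa>) * h" by (simp add: algebra_simps)
    then show ?thesis using h_pos by (simp add: \<rho>\<^sub>0_def)
  qed
  finally show "real (card ?S) \<le> pack \<rho>" unfolding pack_def .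
qed

lemma nsimps_compact: "\<sigma> \<in> nsimps \<Longrightarrow> compact \<sigma>" "\<sigma> \<in> nsimps \<Longrightarrow> convex \<sigma>"
  using nsimps_D compact_simplex convex_simplex by blast+

text \<open>Near a point the \<open>n\<close>-simplices form a finite, hence closed, union. What it
  leaves uncovered in a ball is open and null.\<close>

lemma nsimps_cover: "\<Union>nsimps = UNIV"
proof -
  have "x \<in> \<Union>nsimps" for x
  proof (rule ccontr)
    assume x: "x \<notin> \<Union>nsimps"
    let ?S = "{\<sigma> \<in> nsimps. \<sigma> \<inter> cball x (1 * h) \<noteq> {}}"
    have "closed (\<Union>?S)" using nsimps_locally_finite(1)[of 1 x] nsimps_compact(1) by (intro closed_Union) (auto intro: compact_imp_closed)
    then have op: "open (ball x h - \<Union>?S)" by (intro open_Diff) auto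
    have "ball x h - \<Union>?S \<subseteq> - \<Union>(interior ` ncells)"
    proof
      fix y assume y: "y \<in> ball x h - \<Union>?S"
      show "y \<in> - \<Union>(interior ` ncells)"
      proof
        assume "y \<in> \<Union>(interior ` ncells)"
        then obtain T where "T \<in> ncells" "y \<in> T" using interior_subset by blast
        then obtain \<sigma> where "\<sigma> \<in> nsimps" "y \<in> \<sigma>" using ncell_nsimps by blast
        then have "\<sigma> \<in> ?S" using y by auto
        then show False using y \<open>y \<in> \<sigma>\<close> by blast
      qed
    qed
    then have "ball x h - \<Union>?S = {}" using open_negligible_empty[OF op] negligible_outside_ncells by blast
    moreover have "x \<in> ball x h - \<Union>?S" using x h_pos by auto
    ultimately show False by blast
  qed
  then show ?thesis by blast
qed

definition cell_of :: "'n point set \<Rightarrow> 'n point set" where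
  "cell_of \<sigma> = (SOME T. T \<in> ncells \<and> \<sigma> \<subseteq> T)"

lemma cell_of: "\<sigma> \<in> nsimps \<Longrightarrow> cell_of \<sigma> \<in> ncells" "\<sigma> \<in> nsimps \<Longrightarrow> \<sigma> \<subseteq> cell_of \<sigma>"
proof -
  assume "\<sigma> \<in> nsimps"
  then have "\<exists>T. T \<in> ncells \<and> \<sigma> \<subseteq> T" using nsimps_D(3) by blast
  from someI_ex[OF this] show "cell_of \<sigma> \<in> ncells" "\<sigma> \<subseteq> cell_of \<sigma>" unfolding cell_of_def by auto
qed

lemma cell_of_eq: "\<sigma> \<in> nsimps \<Longrightarrow> T \<in> ncells \<Longrightarrow> \<sigma> \<subseteq> T \<Longrightarrow> cell_of \<sigma> = T"
proof -
  assume s: "\<sigma> \<in> nsimps" "T \<in> ncells" "\<sigma> \<subseteq> T"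
  obtain x where x: "x \<in> interior \<sigma>" using simplex_interior_nonempty[OF nsimps_D(2)[OF s(1)]] by blast
  have "x \<in> interior (cell_of \<sigma>)" using interior_mono[OF cell_of(2)[OF s(1)]] x by blast
  moreover have "x \<in> T" using x interior_subset s(3) by blast
  ultimately show ?thesis using ncell_interior_unique[OF cell_of(1)[OF s(1)] s(2)] by blast
qed

subsection \<open>Interfaces\<close>

text \<open>The simplex through \<open>x\<close> inside a boundary cell meets the relative interior
  of \<open>F\<close>, so it contains \<open>F\<close>. The cell has dimension at least n-1 because
  it contains \<open>F\<close>, and less than n because the boundary is null; equality of dimensions
  then places \<open>x\<close> off the boundary of the cell.\<close>

lemma facet_in_boundary_cell:
  assumes T: "T \<in> ncells" and F: "F \<in> K" "aff_dim F = int CARD('n) - 1" "F \<subseteq> cell_boundary T"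
    and x: "x \<in> rel_interior F"
  shows "\<exists>T'\<in>C. cell_dim T' = CARD('n) - 1 \<and> F \<subseteq> T' \<and> T' \<subseteq> T \<and> x \<in> cell_interior T'"
proof -
  have TC: "T \<in> C" using T by (rule ncells_C)
  obtain D where D: "D \<subseteq> C" "cell_boundary T = \<Union>D"
    using complexD(6) TC by blast
  have xF: "x \<in> F" using x rel_interior_subset by blast
  then obtain T' where T': "T' \<in> D" "x \<in> T'" using F(3) D(2) by blast
  then have T'C: "T' \<in> C" using D(1) by blast
  obtain \<tau> where \<tau>: "\<tau> \<in> simplices_in K T'" "x \<in> \<tau>" using cell_simplices[OF T'C] T'(2) by blast
  then have "(F \<inter> \<tau>) face_of F" using K_inter[OF F(1)] by (auto simp: simplices_in_def)
  moreover have "x \<in> (F \<inter> \<tau>) \<inter> rel_interior F" using x xF \<tau> by blast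
  ultimately have "F \<inter> \<tau> = F" using face_of_disjoint_rel_interior by blast
  then have FT': "F \<subseteq> T'" using \<tau>(1) by (auto simp: simplices_in_def)
  have T'B: "T' \<subseteq> cell_boundary T" using D(2) T'(1) by blast
  note lip = cell_lip[OF T'C]
  have W: "openin (top_of_set (affine hull F)) (rel_interior F)" "affine (affine hull F)" "rel_interior F \<noteq> {}" "rel_interior F \<subseteq> T'"
    using x FT' rel_interior_subset by (auto simp: openin_rel_interior)
  note dims = lip_cell_openin_subset[OF lip W]
  have 1: "int CARD('n) - 1 \<le> int (cell_dim T')" using dims(1) F(2) by (simp add: aff_dim_affine_hull)
  have 2: "cell_dim T' \<noteq> CARD('n)"
  proof
    assume "cell_dim T' = CARD('n)"
    then have l: "lip_cell CARD('n) T' (cell_boundary T')" using lip by simp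
    have "T' - cell_boundary T' \<subseteq> cell_boundary T" using T'B by blast
    from open_negligible_empty[OF lip_cell_fulldim(1)[OF l] this lip_cell_boundary_negligible[OF ncell_lip[OF T]]]
    show False using lip_cell_fulldim(2)[OF l] by blast
  qed
  have 3: "cell_dim T' = CARD('n) - 1" using 1 2 lip_cell_dim_le[OF lip] by linarith
  have "0 < CARD('n)" by simp
  then have "aff_dim (affine hull F) = int (cell_dim T')" using F(2) 3 by (simp add: aff_dim_affine_hull of_nat_diff)
  from dims(2)[OF this] have "x \<in> cell_interior T'" using x T'(2) unfolding cell_interior_def by blast
  moreover have "T' \<subseteq> T" using T'B lip_cell_boundary_subset[OF cell_lip[OF TC]] by blast
  ultimately show ?thesis using T'C 3 FT' by blast
qed

lemma face_in_boundary:
  assumes T: "T \<in> ncells" "T1 \<in> ncells" "T \<noteq> T1" and F: "F \<subseteq> T" "F \<subseteq> T1"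
  shows "F \<subseteq> cell_boundary T"
proof
  fix x assume x: "x \<in> F"
  show "x \<in> cell_boundary T"
  proof (rule ccontr)
    assume "x \<notin> cell_boundary T"
    then have "x \<in> interior T" using x F(1) lip_cell_fulldim(4)[OF ncell_lip[OF T(1)]] by blast
    then show False using ncell_interior_disjoint[OF T] x F(2) by blast
  qed
qed

text \<open>Each side provides a boundary cell that has the same point of the facet in its interior;
  cell interiors are disjoint, so the two cells coincide.\<close>

lemma interface_exists:
  assumes \<sigma>: "\<sigma> \<in> nsimps" "\<tau> \<in> nsimps" and T: "T \<in> ncells" "T1 \<in> ncells" "T \<noteq> T1" "\<sigma> \<subseteq> T" "\<tau> \<subseteq> T1"
    and F: "aff_dim (\<sigma> \<inter> \<tau>) = int CARD('n) - 1"
  shows "\<exists>T'\<in>C. cell_dim T' = CARD('n) - 1 \<and> \<sigma> \<inter> \<tau> \<in> simplices_in K T' \<and>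
    (int CARD('n) - 1) simplex (\<sigma> \<inter> \<tau>) \<and> T' \<subseteq> T \<and> T' \<subseteq> T1"
proof -
  let ?F = "\<sigma> \<inter> \<tau>"
  have "?F \<noteq> {}"
  proof
    assume "?F = {}"
    then have "aff_dim ?F = -1" by simp
    then show False using F by simp
  qed
  moreover have "?F face_of \<sigma>" using K_inter nsimps_D(1) \<sigma> by blast
  ultimately have FK: "?F \<in> K" using K_face nsimps_D(1) \<sigma>(1) by blast
  have "convex ?F" using nsimps_compact(2) \<sigma> by (intro convex_Int) auto
  then obtain x where x: "x \<in> rel_interior ?F" using \<open>?F \<noteq> {}\<close> rel_interior_eq_empty by blast
  have "?F \<subseteq> T" "?F \<subseteq> T1" using T by auto
  then have B: "?F \<subseteq> cell_boundary T" "?F \<subseteq> cell_boundary T1" using face_in_boundary T by metis+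
  obtain T' where T': "T' \<in> C" "cell_dim T' = CARD('n) - 1" "?F \<subseteq> T'" "T' \<subseteq> T" "x \<in> cell_interior T'"
    using facet_in_boundary_cell[OF T(1) FK F B(1) x] by blast
  obtain T'' where T'': "T'' \<in> C" "?F \<subseteq> T''" "T'' \<subseteq> T1" "x \<in> cell_interior T''"
    using facet_in_boundary_cell[OF T(2) FK F B(2) x] by blast
  have "T' = T''" using cell_interiors_disjoint T' T'' by blast
  moreover obtain d :: nat where d: "int d simplex ?F" using K_simplex[OF FK] by blast
  then have "int d = int CARD('n) - 1" using aff_dim_simplex[OF d] F by simp
  ultimately show ?thesis using T' T'' FK d by (intro bexI[of _ T']) (auto simp: simplices_in_def)
qed

subsection \<open>Chains of adjacent simplices\<close>

lemma negligible_finite_avoid: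
  fixes U :: "'a::euclidean_space set"
  assumes "open U" "U \<noteq> {}" "finite \<N>" "\<And>G. G \<in> \<N> \<Longrightarrow> negligible G"
  shows "\<exists>x\<in>U. \<forall>G\<in>\<N>. x \<notin> G"
proof (rule ccontr)
  assume "\<not> ?thesis"
  then have "U \<subseteq> \<Union>\<N>" by blast
  moreover have "negligible (\<Union>\<N>)" using assms(3,4) by (rule negligible_Union)
  ultimately show False using open_negligible_empty[OF assms(1)] assms(2) by blast
qed

definition adj :: "'n point set set \<Rightarrow> ('n point set \<times> 'n point set) set" where
  "adj \<S> = {(\<sigma>, \<tau>). \<sigma> \<in> \<S> \<and> \<tau> \<in> \<S> \<and> aff_dim (\<sigma> \<inter> \<tau>) = int CARD('n) - 1}"

text \<open>
  A segment that avoids all intersections of codimension at least two passes from one simplex to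
  the next through facets.
\<close>

lemma chain_exists:
  assumes \<sigma>: "\<sigma> \<in> nsimps" "\<tau> \<in> nsimps" and pq: "p \<in> \<sigma>" "q \<in> \<tau>" "norm (p - q) \<le> \<rho> * h" and \<rho>: "0 \<le> \<rho>"
  defines "\<S> \<equiv> {s \<in> nsimps. s \<inter> cball p ((\<rho> + 1 / \<kappa>) * h) \<noteq> {}}"
  shows "(\<sigma>, \<tau>) \<in> (adj \<S>)\<^sup>*"
proof -
  let ?n = "int CARD('n)"
  have \<rho>': "0 \<le> \<rho> + 1 / \<kappa>" using \<rho> kappa by simp
  have fin: "finite \<S>" unfolding \<S>_def by (rule nsimps_locally_finite[OF \<rho>'])
  define \<G> where "\<G> = {G \<in> (\<lambda>(a, b). a \<inter> b) ` (\<S> \<times> \<S>). aff_dim G < ?n - 1}"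
  have finG: "finite \<G>" unfolding \<G>_def using fin by auto
  have negG: "negligible G" if "G \<in> \<G>" for G
    using that by (intro negligible_aff_dim) (auto simp: \<G>_def)
  obtain x where x: "x \<in> interior \<sigma>" "\<forall>G\<in>\<G>. x \<notin> G"
    using negligible_finite_avoid[OF open_interior simplex_interior_nonempty[OF nsimps_D(2)[OF \<sigma>(1)]] finG negG] by blast
  \<comment> \<open>A segment from \<open>x\<close> can meet \<open>G\<close> only if its other end
    lies in the affine hull of \<open>x\<close> and \<open>G\<close>, which has dimension at most
    n-1 and is therefore null.\<close>
  have "negligible H" if "H \<in> (\<lambda>G. affine hull (insert x G)) ` \<G>" for H
  proof -
    obtain G where G: "G \<in> \<G>" "H = affine hull (insert x G)" using \<open>H \<in> _\<close> by blast
    have "aff_dim (insert x G) \<le> aff_dim G + 1" by (simp add: aff_dim_insert)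
    then have "aff_dim H < ?n" using G by (simp add: \<G>_def aff_dim_affine_hull)
    then show ?thesis by (intro negligible_aff_dim) simp
  qed
  then obtain x' where x': "x' \<in> interior \<tau>" "\<forall>H\<in>(\<lambda>G. affine hull (insert x G)) ` \<G>. x' \<notin> H"
    using negligible_finite_avoid[OF open_interior simplex_interior_nonempty[OF nsimps_D(2)[OF \<sigma>(2)]] finite_imageI[OF finG]] by blast
  have x\<sigma>: "x \<in> \<sigma>" and x'\<tau>: "x' \<in> \<tau>" using x(1) x'(1) interior_subset by blast+
  define S where "S = closed_segment x x'"
  have avoid: "y \<notin> G" if "y \<in> S" "G \<in> \<G>" for y G
  proof
    assume yG: "y \<in> G"
    obtain t where t: "y = (1 - t) *\<^sub>R x + t *\<^sub>R x'" "0 \<le> t" "t \<le> 1" using \<open>y \<in> S\<close> by (auto simp: S_def closed_segment_def)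
    have "t \<noteq> 0" using t(1) yG x(2) \<open>G \<in> \<G>\<close> by auto
    have "t *\<^sub>R x' = y - (1 - t) *\<^sub>R x" using t(1) by simp
    then have "(1 / t) *\<^sub>R (t *\<^sub>R x') = (1 / t) *\<^sub>R (y - (1 - t) *\<^sub>R x)" by simp
    moreover have "(1 / t) * (1 - t) = 1 / t - 1" using \<open>t \<noteq> 0\<close> by (simp add: field_simps)
    ultimately have "x' = (1 - 1 / t) *\<^sub>R x + (1 / t) *\<^sub>R y"
      using \<open>t \<noteq> 0\<close> by (simp add: scaleR_diff_right scaleR_diff_left)
    moreover have "(1 - 1 / t) *\<^sub>R x + (1 / t) *\<^sub>R y \<in> affine hull (insert x G)"
      using yG by (intro mem_affine[OF affine_affine_hull]) (auto intro: hull_inc)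
    ultimately show False using x'(2) \<open>G \<in> \<G>\<close> by auto
  qed
  \<comment> \<open>Both ends have been moved inside their simplices, hence by at most
    \<open>h / \<kappa>\<close>; this explains the radius in \<open>\<S>\<close>.\<close>
  have "dist p x \<le> h / \<kappa>" using nsimps_norm[OF \<sigma>(1) pq(1) x\<sigma>] by (simp add: dist_norm)
  then have xb: "x \<in> cball p ((\<rho> + 1 / \<kappa>) * h)" using \<rho> h_pos by (simp add: distrib_right add_increasing)
  have "dist p x' \<le> dist p q + dist q x'" by (rule dist_triangle)
  also have "\<dots> \<le> \<rho> * h + h / \<kappa>" using pq(3) nsimps_norm[OF \<sigma>(2) pq(2) x'\<tau>] by (simp add: dist_norm)
  finally have x'b: "x' \<in> cball p ((\<rho> + 1 / \<kappa>) * h)" by (simp add: distrib_right)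
  have Sb: "S \<subseteq> cball p ((\<rho> + 1 / \<kappa>) * h)" unfolding S_def by (rule closed_segment_subset[OF xb x'b convex_cball])
  have \<sigma>S: "\<sigma> \<in> \<S>" and \<tau>S: "\<tau> \<in> \<S>" using \<sigma> x\<sigma> xb x'\<tau> x'b unfolding \<S>_def by blast+
  \<comment> \<open>Simplices reachable from \<open>\<sigma>\<close>. Were the others to meet the
    segment, connectedness would give a point of the segment common to a reachable and an
    unreachable simplex, and there the two share a facet.\<close>
  define R where "R = {s \<in> \<S>. (\<sigma>, s) \<in> (adj \<S>)\<^sup>*}"
  have clo: "closed (\<Union>A)" if "A \<subseteq> \<S>" for A
    using finite_subset[OF that fin] that nsimps_compact(1) compact_imp_closed unfolding \<S>_def by (intro closed_Union) auto
  have cover: "S \<subseteq> \<Union>R \<union> \<Union>(\<S> - R)"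
  proof
    fix y assume y: "y \<in> S"
    obtain s where s: "s \<in> nsimps" "y \<in> s" using nsimps_cover by blast
    then have "s \<in> \<S>" using y Sb unfolding \<S>_def by blast
    then show "y \<in> \<Union>R \<union> \<Union>(\<S> - R)" using s(2) by blast
  qed
  have disj: "\<Union>R \<inter> \<Union>(\<S> - R) \<inter> S = {}"
  proof (rule ccontr)
    assume "\<Union>R \<inter> \<Union>(\<S> - R) \<inter> S \<noteq> {}"
    then obtain y a b where y: "y \<in> S" "a \<in> R" "y \<in> a" "b \<in> \<S>" "b \<notin> R" "y \<in> b" by blast
    have aS: "a \<in> \<S>" using y(2) by (simp add: R_def)
    have "a \<inter> b \<notin> \<G>" using avoid[OF y(1), of "a \<inter> b"] y(3,6) by blast
    moreover have "a \<inter> b \<in> (\<lambda>(a, b). a \<inter> b) ` (\<S> \<times> \<S>)" using aS y(4) by auto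
    ultimately have 1: "\<not> aff_dim (a \<inter> b) < ?n - 1" unfolding \<G>_def by blast
    have "a \<noteq> b" using y by blast
    then have "aff_dim (a \<inter> b) < ?n" using nsimps_inter aS y(4) unfolding \<S>_def by blast
    then have "aff_dim (a \<inter> b) = ?n - 1" using 1 by linarith
    then have "(a, b) \<in> adj \<S>" unfolding adj_def using aS y(4) by blast
    then have "b \<in> R" using y(2,4) unfolding R_def by (auto intro: rtrancl_into_rtrancl)
    then show False using y(5) by blast
  qed
  have "connected S" unfolding S_def by (rule connected_segment)
  then have "\<Union>R \<inter> S = {} \<or> \<Union>(\<S> - R) \<inter> S = {}"
    using clo[of R] clo[of "\<S> - R"] cover disj unfolding connected_closed R_def by blast
  moreover have "\<sigma> \<in> R" using \<sigma>S by (simp add: R_def)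
  then have "x \<in> \<Union>R \<inter> S" using x\<sigma> by (auto simp: S_def)
  ultimately have "\<Union>(\<S> - R) \<inter> S = {}" by blast
  moreover have "x' \<in> S" by (simp add: S_def)
  ultimately have "\<tau> \<in> R" using x'\<tau> \<tau>S by blast
  then show ?thesis by (simp add: R_def)
qed

end

section \<open>Lattice orbits\<close>

lemma translate_translate: "(+) l ` (+) m ` T = (+) (l + m) ` (T :: 'a::ab_group_add set)"
  by (auto simp: image_image algebra_simps)

lemma translate_inverse: "(+) (- l) ` (+) l ` T = (T :: 'a::ab_group_add set)" "(+) l ` (+) (- l) ` T = T"
  unfolding translate_translate by simp_all

lemma mem_translate_iff: "x \<in> (+) l ` T \<longleftrightarrow> x - l \<in> (T :: 'a::ab_group_add set)"
  by (auto simp: image_iff intro!: bexI[of _ "x - l"])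

lemma mem_translate_uminus_iff: "x \<in> (+) (- l) ` T \<longleftrightarrow> x + l \<in> (T :: 'a::ab_group_add set)"
  unfolding mem_translate_iff by simp

definition orep :: "'a set \<Rightarrow> 'a" where "orep Q = (SOME T. T \<in> Q)"

lemma sum_mod_orep: "sum_mod e f A = (\<Sum>Q\<in>orbit e ` A. f (orep Q))"
  unfolding sum_mod_def orep_def ..

context mesh
begin

lemma orbit_self: "T \<in> orbit e T"
  unfolding orbit_def using lattice_0[OF basis] by (intro image_eqI[of _ _ 0]) auto

lemma orbit_mem_iff: "T' \<in> orbit e T \<longleftrightarrow> (\<exists>l\<in>lattice e. T' = (+) l ` T)"
  unfolding orbit_def by blast

lemma orbit_translate: "l \<in> lattice e \<Longrightarrow> orbit e ((+) l ` T) = orbit e T"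
proof -
  assume l: "l \<in> lattice e"
  have "(\<lambda>m. (+) m ` (+) l ` T) ` lattice e = (\<lambda>m. (+) m ` T) ` lattice e"
  proof
    show "(\<lambda>m. (+) m ` (+) l ` T) ` lattice e \<subseteq> (\<lambda>m. (+) m ` T) ` lattice e"
      using lattice_add[OF basis _ l] by (auto simp: translate_translate)
    show "(\<lambda>m. (+) m ` T) ` lattice e \<subseteq> (\<lambda>m. (+) m ` (+) l ` T) ` lattice e"
    proof (rule image_subsetI)
      fix m assume "m \<in> lattice e"
      then have "m - l \<in> lattice e" using lattice_diff[OF basis _ l] by simp
      then show "(+) m ` T \<in> (\<lambda>m. (+) m ` (+) l ` T) ` lattice e"
        by (rule rev_image_eqI) (simp add: translate_translate)
    qed
  qed
  then show ?thesis unfolding orbit_def .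
qed

lemma orep_orbit: "\<exists>l\<in>lattice e. orep (orbit e T) = (+) l ` T"
proof -
  have "orep (orbit e T) \<in> orbit e T" unfolding orep_def by (rule someI[of _ T]) (rule orbit_self)
  then show ?thesis by (simp add: orbit_mem_iff)
qed

lemma orbit_orep: "orbit e (orep (orbit e T)) = orbit e T"
  using orep_orbit[of T] orbit_translate by metis

definition invariant :: "'n point set set \<Rightarrow> bool" where
  "invariant S \<longleftrightarrow> (\<forall>T\<in>S. \<forall>l\<in>lattice e. (+) l ` T \<in> S)"

lemma orep_mem: "invariant S \<Longrightarrow> Q \<in> orbit e ` S \<Longrightarrow> orep Q \<in> S \<and> orbit e (orep Q) = Q"
proof -
  assume S: "invariant S" and "Q \<in> orbit e ` S"
  then obtain T where T: "T \<in> S" "Q = orbit e T" by blast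
  obtain l where l: "l \<in> lattice e" "orep Q = (+) l ` T" using orep_orbit[of T] T(2) by blast
  then have "orep Q \<in> S" using S T(1) unfolding invariant_def by simp
  then show ?thesis using orbit_orep[of T] T(2) by simp
qed

lemma invariant_ncells: "invariant ncells"
  unfolding invariant_def using ncell_translate by blast

lemma invariant_faces: "invariant {T \<in> C. cell_dim T = d}"
  unfolding invariant_def using cell_translate cell_dim_translate by simp

lemma simplex_translate: "d simplex \<sigma> \<Longrightarrow> d simplex ((+) l ` \<sigma> :: 'n point set)"
proof -
  assume "d simplex \<sigma>"
  then obtain V where V: "\<not> affine_dependent V" "int (card V) = d + 1" "\<sigma> = convex hull V" unfolding simplex_def by blast
  have "\<not> affine_dependent ((+) l ` V)" using V(1) affine_dependent_translation_eq[of V l] by simp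
  moreover have "card ((+) l ` V) = card V" by (simp add: card_image)
  moreover have "(+) l ` \<sigma> = convex hull ((+) l ` V)" using V(3) by (simp add: convex_hull_translation)
  ultimately show ?thesis unfolding simplex_def using V(2) by (intro exI[of _ "(+) l ` V"]) simp
qed

lemma nsimps_translate: "\<sigma> \<in> nsimps \<Longrightarrow> l \<in> lattice e \<Longrightarrow> (+) l ` \<sigma> \<in> nsimps"
proof -
  assume s: "\<sigma> \<in> nsimps" "l \<in> lattice e"
  obtain T where T: "T \<in> ncells" "\<sigma> \<subseteq> T" using nsimps_D(3)[OF s(1)] by blast
  have "(+) l ` \<sigma> \<subseteq> (+) l ` T" using T(2) by blast
  then show ?thesis unfolding nsimps_def
    using K_translate[OF nsimps_D(1)[OF s(1)] s(2)] simplex_translate[OF nsimps_D(2)[OF s(1)]] ncell_translate[OF T(1) s(2)] by blast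
qed

lemma invariant_nsimps: "invariant nsimps"
  unfolding invariant_def using nsimps_translate by blast

lemma translates_meet:
  assumes T: "T \<in> C" and l: "l \<in> lattice e" "m \<in> lattice e" and x: "x \<in> (+) l ` T" "x \<in> (+) m ` T"
  shows "l = m"
proof (rule ccontr)
  assume "l \<noteq> m"
  then have ne: "m - l \<noteq> 0" and lat: "m - l \<in> lattice e" using lattice_diff[OF basis l(2,1)] by auto
  have "x - l \<in> T" using x(1) by (simp add: mem_translate_iff)
  moreover have "x - l \<in> (+) (m - l) ` T" using x(2) by (simp add: mem_translate_iff)
  ultimately show False using cell_embedded[OF T lat ne] by blast
qed

lemma finite_orbits_nsimps: "finite (orbit e ` nsimps)"
proof (rule finite_subset)
  show "orbit e ` nsimps \<subseteq> orbit e ` K" using nsimps_D(1) by blast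
qed (rule refinementD(5))

lemma finite_orbits: "S \<subseteq> C \<Longrightarrow> finite (orbit e ` S)"
  using complexD(4) by (meson finite_subset image_mono)

text \<open>Two such cells in one orbit share a point and are translates of each other, so they
  coincide because cells are embedded in the torus; and there are finitely many orbits.\<close>

lemma finite_cells_containing: "\<tau> \<noteq> {} \<Longrightarrow> finite {T \<in> C. \<tau> \<subseteq> T}"
proof -
  assume "\<tau> \<noteq> {}"
  then obtain x where x: "x \<in> \<tau>" by blast
  have "inj_on (orbit e) {T \<in> C. \<tau> \<subseteq> T}"
  proof (rule inj_onI)
    fix T T' assume T: "T \<in> {T \<in> C. \<tau> \<subseteq> T}" "T' \<in> {T \<in> C. \<tau> \<subseteq> T}" "orbit e T = orbit e T'"
    then have "T' \<in> orbit e T" using orbit_self[of T'] by simp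
    then obtain l where l: "l \<in> lattice e" "T' = (+) l ` T" by (auto simp: orbit_mem_iff)
    have "x \<in> T'" "x \<in> T" using T x by auto
    then have "x \<in> (+) l ` T" "x \<in> (+) 0 ` T" using l(2) by auto
    then have "l = 0" using translates_meet[of T l 0 x] T(1) l(1) lattice_0[OF basis] by simp
    then show "T = T'" using l(2) by simp
  qed
  moreover have "finite (orbit e ` {T \<in> C. \<tau> \<subseteq> T})" by (rule finite_orbits) blast
  ultimately show ?thesis by (rule finite_imageD[rotated])
qed

section \<open>Integrals over the torus as sums over orbits of cells\<close>

lemma ncell_borel: "T \<in> ncells \<Longrightarrow> T \<in> sets borel"
  using cell_compact ncells_C borel_compact by blast

lemma measurable_lattice_count:
  fixes P :: "'n point set"
  assumes [measurable]: "P \<in> sets borel"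
  shows "(\<lambda>x. \<integral>\<^sup>+l. indicator P (x + l) \<partial>count_space (lattice e)) \<in> borel_measurable lborel"
proof -
  interpret sigma_finite_measure "count_space (lattice e)"
    by (rule sigma_finite_measure_count_space_countable[OF countable_lattice[OF basis]])
  have "(\<lambda>z. indicator P (snd z + fst z) :: ennreal) \<in> borel_measurable (count_space (lattice e) \<Otimes>\<^sub>M lborel)"
    by (rule measurable_pair_measure_countable1[OF countable_lattice[OF basis]]) simp
  from measurable_compose[OF measurable_pair_swap' this]
  have "(\<lambda>(x, l). indicator P (x + l) :: ennreal) \<in> borel_measurable (lborel \<Otimes>\<^sub>M count_space (lattice e))"
    by (simp add: case_prod_unfold)
  then show ?thesis by (rule borel_measurable_nn_integral)
qed

text \<open>The simplices cover the space, so every point has at least one lift in some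
  representative: the counting weights add up to at least 1.\<close>

lemma nn_integral_le_sum_nsimps:
  fixes f :: "'n point \<Rightarrow> ennreal"
  assumes f[measurable]: "f \<in> borel_measurable borel" and per: "periodic e f"
  shows "(\<integral>\<^sup>+x\<in>fund_domain e. f x \<partial>lborel) \<le> (\<Sum>Q\<in>orbit e ` nsimps. \<integral>\<^sup>+x\<in>orep Q. f x \<partial>lborel)"
proof -
  note [measurable] = borel_fund_domain[OF basis]
  let ?O = "orbit e ` nsimps"
  define c where "c Q x = (\<integral>\<^sup>+l. indicator (orep Q) (x + l) \<partial>count_space (lattice e))" for Q x
  have rep: "orep Q \<in> nsimps" "orbit e (orep Q) = Q" if "Q \<in> ?O" for Q
    using orep_mem[OF invariant_nsimps that] by auto
  have rb: "orep Q \<in> sets borel" if "Q \<in> ?O" for Q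
    using nsimps_compact(1)[OF rep(1)[OF that]] by (rule borel_compact)
  have one: "1 \<le> (\<Sum>Q\<in>?O. c Q x)" for x
  proof -
    obtain \<sigma> where s: "\<sigma> \<in> nsimps" "x \<in> \<sigma>" using nsimps_cover by blast
    obtain l where l: "l \<in> lattice e" "orep (orbit e \<sigma>) = (+) l ` \<sigma>" using orep_orbit[of \<sigma>] by blast
    have "x + l \<in> orep (orbit e \<sigma>)" using s(2) l(2) by (simp add: mem_translate_iff)
    then have "1 \<le> c (orbit e \<sigma>) x"
      unfolding c_def using nn_integral_ge_point[OF l(1), of "\<lambda>l. indicator (orep (orbit e \<sigma>)) (x + l)"] by simp
    also have "\<dots> \<le> (\<Sum>Q\<in>?O. c Q x)" using s(1) finite_orbits_nsimps by (intro member_le_sum) auto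
    finally show ?thesis .
  qed
  have m: "(\<lambda>x. f x * c Q x * indicator (fund_domain e) x) \<in> borel_measurable lborel" if "Q \<in> ?O" for Q
  proof -
    have [measurable]: "orep Q \<in> sets borel" using rb[OF that] .
    have "(\<lambda>x. c Q x) \<in> borel_measurable lborel" unfolding c_def by (rule measurable_lattice_count) simp
    then show ?thesis by measurable
  qed
  have "(\<integral>\<^sup>+x\<in>fund_domain e. f x \<partial>lborel) \<le> (\<integral>\<^sup>+x. (\<Sum>Q\<in>?O. f x * c Q x * indicator (fund_domain e) x) \<partial>lborel)"
  proof (rule nn_integral_mono)
    fix x
    have "f x * 1 \<le> f x * (\<Sum>Q\<in>?O. c Q x)" by (rule mult_left_mono[OF one]) simp
    then show "f x * indicator (fund_domain e) x \<le> (\<Sum>Q\<in>?O. f x * c Q x * indicator (fund_domain e) x)"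
      by (auto simp: indicator_def sum_distrib_left)
  qed
  also have "\<dots> = (\<Sum>Q\<in>?O. \<integral>\<^sup>+x. f x * c Q x * indicator (fund_domain e) x \<partial>lborel)"
    by (rule nn_integral_sum) (rule m)
  also have "\<dots> = (\<Sum>Q\<in>?O. \<integral>\<^sup>+x\<in>orep Q. f x \<partial>lborel)"
    unfolding c_def by (intro sum.cong refl nn_integral_periodic[OF basis f rb per, symmetric])
  finally show ?thesis .
qed

text \<open>Here the weights add up to at most 1, because interiors of \<open>n\<close>-cells are
  disjoint and so are the distinct lifts of one cell.\<close>

lemma sum_ncells_le_nn_integral:
  fixes f :: "'n point \<Rightarrow> ennreal"
  assumes f[measurable]: "f \<in> borel_measurable borel" and per: "periodic e f"
  shows "(\<Sum>Q\<in>orbit e ` ncells. \<integral>\<^sup>+x\<in>interior (orep Q). f x \<partial>lborel) \<le> (\<integral>\<^sup>+x\<in>fund_domain e. f x \<partial>lborel)"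
proof -
  note [measurable] = borel_fund_domain[OF basis]
  let ?O = "orbit e ` ncells"
  define c where "c Q x = (\<integral>\<^sup>+l. indicator (interior (orep Q)) (x + l) \<partial>count_space (lattice e))" for Q x
  have rep: "orep Q \<in> ncells" "orbit e (orep Q) = Q" if "Q \<in> ?O" for Q
    using orep_mem[OF invariant_ncells that] by auto
  have fin: "finite ?O" by (rule finite_orbits) (simp add: ncells_C subsetI)
  have one: "(\<Sum>Q\<in>?O. c Q x) \<le> 1" for x
  proof (cases "\<exists>Q\<in>?O. \<exists>l\<in>lattice e. x + l \<in> interior (orep Q)")
    case False
    have "c Q x = 0" if "Q \<in> ?O" for Q
    proof -
      have "c Q x = (\<integral>\<^sup>+l. 0 \<partial>count_space (lattice e))" unfolding c_def
        by (rule nn_integral_cong) (use False that in auto)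
      then show ?thesis by simp
    qed
    then show ?thesis by simp
  next
    case True
    then obtain Q0 l0 where Q0: "Q0 \<in> ?O" "l0 \<in> lattice e" "x + l0 \<in> interior (orep Q0)" by blast
    have uniq: "Q = Q0 \<and> l = l0" if Q: "Q \<in> ?O" "l \<in> lattice e" "x + l \<in> interior (orep Q)" for Q l
    proof -
      let ?S = "(+) (- l0) ` orep Q0" and ?T = "(+) (- l) ` orep Q"
      have nl: "- l0 \<in> lattice e" "- l \<in> lattice e" using lattice_uminus[OF basis] Q0(2) Q(2) by auto
      have n: "?S \<in> ncells" "?T \<in> ncells" using ncell_translate[OF rep(1)[OF Q0(1)] nl(1)] ncell_translate[OF rep(1)[OF Q(1)] nl(2)] .
      have "x \<in> interior ?S" unfolding interior_translation mem_translate_uminus_iff by (rule Q0(3))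
      moreover have xT: "x \<in> ?T" unfolding mem_translate_uminus_iff using Q(3) interior_subset by blast
      ultimately have eq: "?S = ?T" using ncell_interior_unique n by blast
      then have "orbit e (orep Q0) = orbit e (orep Q)"
        using orbit_translate[OF nl(1), of "orep Q0"] orbit_translate[OF nl(2), of "orep Q"] by (simp only:)
      then have "Q = Q0" using rep(2) Q0(1) Q(1) by simp
      moreover from this have "- l = - l0" using translates_meet[OF ncells_C[OF rep(1)[OF Q(1)]] nl(2,1) xT] xT[folded eq] by (simp only:)
      ultimately show ?thesis by simp
    qed
    have "c Q x = (if Q = Q0 then 1 else 0)" if Q: "Q \<in> ?O" for Q
    proof -
      have "indicator (interior (orep Q)) (x + l) = (indicator (if Q = Q0 then {l0} else {}) l :: ennreal)" if l: "l \<in> lattice e" for l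
      proof (cases "x + l \<in> interior (orep Q)")
        case True
        have "Q = Q0" "l = l0" using uniq[OF Q l True] by blast+
        then show ?thesis using True by simp
      next
        case False
        then have "\<not> (Q = Q0 \<and> l = l0)" using Q0(3) by blast
        then show ?thesis using False by auto
      qed
      then have "c Q x = (\<integral>\<^sup>+l. indicator (if Q = Q0 then {l0} else {}) l \<partial>count_space (lattice e))"
        unfolding c_def by (intro nn_integral_cong) auto
      also have "\<dots> = (if Q = Q0 then 1 else 0)" using Q0(2) by simp
      finally show ?thesis .
    qed
    then have "(\<Sum>Q\<in>?O. c Q x) = (\<Sum>Q\<in>?O. if Q = Q0 then 1 else 0)" by (rule sum.cong[OF refl])
    also have "\<dots> \<le> 1" using fin by simp
    finally show ?thesis .
  qed
  have "(\<Sum>Q\<in>?O. \<integral>\<^sup>+x\<in>interior (orep Q). f x \<partial>lborel) = (\<Sum>Q\<in>?O. \<integral>\<^sup>+x. f x * c Q x * indicator (fund_domain e) x \<partial>lborel)"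
    unfolding c_def by (intro sum.cong refl nn_integral_periodic[OF basis f _ per]) auto
  also have "\<dots> = (\<integral>\<^sup>+x. (\<Sum>Q\<in>?O. f x * c Q x * indicator (fund_domain e) x) \<partial>lborel)"
  proof (rule nn_integral_sum[symmetric])
    fix Q
    have "(\<lambda>x. c Q x) \<in> borel_measurable lborel" unfolding c_def by (rule measurable_lattice_count) simp
    then show "(\<lambda>x. f x * c Q x * indicator (fund_domain e) x) \<in> borel_measurable lborel" by measurable
  qed
  also have "\<dots> \<le> (\<integral>\<^sup>+x\<in>fund_domain e. f x \<partial>lborel)"
  proof (rule nn_integral_mono)
    fix x
    have "f x * (\<Sum>Q\<in>?O. c Q x) \<le> f x * 1" by (rule mult_left_mono[OF one]) simp
    then show "(\<Sum>Q\<in>?O. f x * c Q x * indicator (fund_domain e) x) \<le> f x * indicator (fund_domain e) x"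
      by (auto simp: indicator_def sum_distrib_left)
  qed
  finally show ?thesis .
qed

text \<open>Tailored to cells of any dimension: an interface counts as near if it contains a simplex
  of \<open>K\<close> that is part of a near \<open>n\<close>-simplex. For an \<open>n\<close>-cell
  this part can be the whole \<open>n\<close>-simplex.\<close>

definition near :: "real \<Rightarrow> 'n point set \<Rightarrow> 'n point set \<Rightarrow> bool" where
  "near \<rho> \<sigma> T \<longleftrightarrow> (\<exists>\<tau>\<in>simplices_in K T. \<exists>\<tau>'\<in>nsimps. \<tau> \<subseteq> \<tau>' \<and> (\<exists>p\<in>\<sigma>. \<exists>q\<in>\<tau>'. norm (p - q) \<le> \<rho> * h))"

lemma K_nonempty: "\<tau> \<in> K \<Longrightarrow> \<tau> \<noteq> {}"
proof
  assume "\<tau> \<in> K" "\<tau> = {}"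
  then obtain d :: nat where "int d simplex ({} :: 'n point set)" using K_simplex by blast
  from aff_dim_simplex[OF this] show False by simp
qed

lemma simplices_in_translate: "l \<in> lattice e \<Longrightarrow> \<tau> \<in> simplices_in K T \<Longrightarrow> (+) l ` \<tau> \<in> simplices_in K ((+) l ` T)"
  unfolding simplices_in_def using K_translate by blast

lemma near_translate: "l \<in> lattice e \<Longrightarrow> near \<rho> \<sigma> T \<Longrightarrow> near \<rho> ((+) l ` \<sigma>) ((+) l ` T)"
proof -
  assume l: "l \<in> lattice e" and "near \<rho> \<sigma> T"
  then obtain \<tau> \<tau>' p q where n: "\<tau> \<in> simplices_in K T" "\<tau>' \<in> nsimps" "\<tau> \<subseteq> \<tau>'" "p \<in> \<sigma>" "q \<in> \<tau>'" "norm (p - q) \<le> \<rho> * h"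
    unfolding near_def by blast
  have "norm ((l + p) - (l + q)) \<le> \<rho> * h" using n(6) by simp
  moreover have "(+) l ` \<tau> \<subseteq> (+) l ` \<tau>'" using n(3) by blast
  ultimately show ?thesis unfolding near_def
    using simplices_in_translate[OF l n(1)] nsimps_translate[OF n(2) l] n(4,5) by blast
qed

text \<open>Finitely many \<open>n\<close>-simplices are close, each has finitely many faces, and
  each face lies in finitely many cells.\<close>

lemma finite_near: "0 \<le> \<rho> \<Longrightarrow> \<sigma> \<in> nsimps \<Longrightarrow> finite {T \<in> C. near \<rho> \<sigma> T}"
proof -
  assume \<rho>: "0 \<le> \<rho>" and s: "\<sigma> \<in> nsimps"
  obtain p0 where p0: "p0 \<in> \<sigma>" using K_nonempty[OF nsimps_D(1)[OF s]] by blast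
  define \<S> where "\<S> = {\<tau>' \<in> nsimps. \<tau>' \<inter> cball p0 ((\<rho> + 1 / \<kappa>) * h) \<noteq> {}}"
  have "0 \<le> \<rho> + 1 / \<kappa>" using \<rho> kappa by simp
  then have fin: "finite \<S>" unfolding \<S>_def by (rule nsimps_locally_finite)
  define \<T> where "\<T> = (\<Union>\<tau>'\<in>\<S>. {\<tau>. \<tau> face_of \<tau>' \<and> \<tau> \<noteq> {}})"
  have "finite {\<tau>. \<tau> face_of \<tau>' \<and> \<tau> \<noteq> {}}" if "\<tau>' \<in> \<S>" for \<tau>'
  proof -
    have "polytope \<tau>'" using that nsimps_D(2) simplex_imp_polytope unfolding \<S>_def by blast
    from finite_polytope_faces[OF this] show ?thesis by (rule rev_finite_subset) auto
  qed
  then have "finite \<T>" unfolding \<T>_def using fin by blast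
  then have "finite (\<Union>\<tau>\<in>\<T>. {T \<in> C. \<tau> \<subseteq> T})"
  proof (rule finite_UN_I)
    fix \<tau> assume "\<tau> \<in> \<T>"
    then have "\<tau> \<noteq> {}" unfolding \<T>_def by blast
    then show "finite {T \<in> C. \<tau> \<subseteq> T}" by (rule finite_cells_containing)
  qed
  moreover have "{T \<in> C. near \<rho> \<sigma> T} \<subseteq> (\<Union>\<tau>\<in>\<T>. {T \<in> C. \<tau> \<subseteq> T})"
  proof
    fix T assume T: "T \<in> {T \<in> C. near \<rho> \<sigma> T}"
    then obtain \<tau> \<tau>' p q where n: "\<tau> \<in> simplices_in K T" "\<tau>' \<in> nsimps" "\<tau> \<subseteq> \<tau>'" "p \<in> \<sigma>" "q \<in> \<tau>'" "norm (p - q) \<le> \<rho> * h"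
      unfolding near_def by blast
    have \<tau>: "\<tau> \<in> K" "\<tau> \<subseteq> T" using n(1) by (auto simp: simplices_in_def)
    have "norm (p0 - q) \<le> norm (p0 - p) + norm (p - q)" using norm_triangle_ineq[of "p0 - p" "p - q"] by simp
    also have "\<dots> \<le> (\<rho> + 1 / \<kappa>) * h" using nsimps_norm[OF s p0 n(4)] n(6) by (simp add: distrib_right)
    finally have "\<tau>' \<in> \<S>" unfolding \<S>_def using n(2,5) by (auto simp: dist_norm)
    moreover have "\<tau> \<inter> \<tau>' = \<tau>" using n(3) by blast
    then have "\<tau> face_of \<tau>'" using K_inter[OF \<tau>(1) nsimps_D(1)[OF n(2)]] by simp
    ultimately have "\<tau> \<in> \<T>" unfolding \<T>_def using K_nonempty[OF \<tau>(1)] by blast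
    then show "T \<in> (\<Union>\<tau>\<in>\<T>. {T \<in> C. \<tau> \<subseteq> T})" using T \<tau>(2) by blast
  qed
  ultimately show ?thesis by (rule finite_subset[rotated])
qed

text \<open>Counting from the side of the cell: it consists of at most \<open>N\<close> simplices,
  and each of them has boundedly many \<open>n\<close>-simplices nearby. The shift of
  \<open>\<rho>\<close> by 1 / \<open>\<kappa>\<close> passes from the point \<open>q\<close> to a
  fixed point of the simplex \<open>\<tau>\<close>.\<close>

lemma card_near:
  assumes \<rho>: "0 \<le> \<rho>" and T: "T \<in> C"
  shows "finite {\<sigma> \<in> nsimps. near \<rho> \<sigma> T}" "real (card {\<sigma> \<in> nsimps. near \<rho> \<sigma> T}) \<le> real N * pack (\<rho> + 1 / \<kappa>)"
proof -
  have \<rho>': "0 \<le> \<rho> + 1 / \<kappa>" using \<rho> kappa by simp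
  define b where "b \<tau> = {\<sigma> \<in> nsimps. \<sigma> \<inter> cball (SOME x. x \<in> \<tau>) ((\<rho> + 1 / \<kappa>) * h) \<noteq> {}}" for \<tau>
  have b: "finite (b \<tau>)" "real (card (b \<tau>)) \<le> pack (\<rho> + 1 / \<kappa>)" for \<tau>
    unfolding b_def using nsimps_locally_finite[OF \<rho>'] by auto
  have fin: "finite (simplices_in K T)" and N: "card (simplices_in K T) \<le> N" using few[OF T] by auto
  have sub: "{\<sigma> \<in> nsimps. near \<rho> \<sigma> T} \<subseteq> (\<Union>\<tau>\<in>simplices_in K T. b \<tau>)"
  proof
    fix \<sigma> assume s: "\<sigma> \<in> {\<sigma> \<in> nsimps. near \<rho> \<sigma> T}"
    then obtain \<tau> \<tau>' p q where n: "\<tau> \<in> simplices_in K T" "\<tau>' \<in> nsimps" "\<tau> \<subseteq> \<tau>'" "p \<in> \<sigma>" "q \<in> \<tau>'" "norm (p - q) \<le> \<rho> * h"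
      unfolding near_def by blast
    have "\<tau> \<noteq> {}" using n(1) K_nonempty by (auto simp: simplices_in_def)
    then have q0: "(SOME x. x \<in> \<tau>) \<in> \<tau>" by (simp add: some_in_eq)
    have "norm ((SOME x. x \<in> \<tau>) - p) \<le> norm ((SOME x. x \<in> \<tau>) - q) + norm (p - q)"
      using norm_triangle_ineq4[of "(SOME x. x \<in> \<tau>) - q" "p - q"] by simp
    also have "\<dots> \<le> (\<rho> + 1 / \<kappa>) * h"
      using nsimps_norm[OF n(2), of "SOME x. x \<in> \<tau>" q] q0 n(3,5,6) by (auto simp: distrib_right)
    finally have "\<sigma> \<in> b \<tau>" unfolding b_def using s n(4) by (auto simp: dist_norm)
    then show "\<sigma> \<in> (\<Union>\<tau>\<in>simplices_in K T. b \<tau>)" using n(1) by blast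
  qed
  have finU: "finite (\<Union>\<tau>\<in>simplices_in K T. b \<tau>)" using fin b(1) by blast
  show "finite {\<sigma> \<in> nsimps. near \<rho> \<sigma> T}" using finite_subset[OF sub finU] .
  have "card {\<sigma> \<in> nsimps. near \<rho> \<sigma> T} \<le> card (\<Union>\<tau>\<in>simplices_in K T. b \<tau>)" by (rule card_mono[OF finU sub])
  also have "\<dots> \<le> (\<Sum>\<tau>\<in>simplices_in K T. card (b \<tau>))" by (rule card_UN_le[OF fin])
  finally have "real (card {\<sigma> \<in> nsimps. near \<rho> \<sigma> T}) \<le> real (\<Sum>\<tau>\<in>simplices_in K T. card (b \<tau>))" by (rule of_nat_mono)
  also have "\<dots> = (\<Sum>\<tau>\<in>simplices_in K T. real (card (b \<tau>)))" by simp
  also have "\<dots> \<le> (\<Sum>\<tau>\<in>simplices_in K T. pack (\<rho> + 1 / \<kappa>))" by (intro sum_mono b)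
  also have "\<dots> = real (card (simplices_in K T)) * pack (\<rho> + 1 / \<kappa>)" by simp
  also have "\<dots> \<le> real N * pack (\<rho> + 1 / \<kappa>)"
  proof (rule mult_right_mono)
    show "0 \<le> pack (\<rho> + 1 / \<kappa>)" using \<rho> kappa unfolding pack_def by (intro zero_le_power divide_nonneg_nonneg add_nonneg_nonneg) auto
  qed (use N in simp)
  finally show "real (card {\<sigma> \<in> nsimps. near \<rho> \<sigma> T}) \<le> real N * pack (\<rho> + 1 / \<kappa>)" .
qed

text \<open>Group the pairs of a simplex and a near cell by the orbit of the cell. Translating a
  pair until its cell is the representative embeds each group into the simplices near that
  representative, whose number \<open>card_near\<close> bounds.\<close>

lemma double_count:
  fixes f :: "'n point set \<Rightarrow> real"
  assumes S: "invariant S" "S \<subseteq> C" and \<rho>: "0 \<le> \<rho>" and f: "\<And>Q. Q \<in> orbit e ` S \<Longrightarrow> 0 \<le> f (orep Q)"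
  shows "(\<Sum>Q\<in>orbit e ` nsimps. \<Sum>T | T \<in> S \<and> near \<rho> (orep Q) T. f (orep (orbit e T)))
    \<le> real N * pack (\<rho> + 1 / \<kappa>) * sum_mod e f S"
proof -
  let ?O = "orbit e ` nsimps" and ?M = "real N * pack (\<rho> + 1 / \<kappa>)"
  have rep: "orep Q \<in> nsimps" "orbit e (orep Q) = Q" if "Q \<in> ?O" for Q
    using orep_mem[OF invariant_nsimps that] by auto
  define P where "P = (SIGMA Q:?O. {T. T \<in> S \<and> near \<rho> (orep Q) T})"
  have finT: "finite {T. T \<in> S \<and> near \<rho> (orep Q) T}" if "Q \<in> ?O" for Q
    by (rule finite_subset[OF _ finite_near[OF \<rho> rep(1)[OF that]]]) (use S(2) in auto)
  then have finP: "finite P" unfolding P_def using finite_orbits_nsimps by (intro finite_SigmaI)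
  have "(\<Sum>Q\<in>?O. \<Sum>T | T \<in> S \<and> near \<rho> (orep Q) T. f (orep (orbit e T))) = (\<Sum>z\<in>P. f (orep (orbit e (snd z))))"
    unfolding P_def using finite_orbits_nsimps finT by (subst sum.Sigma) (auto simp: case_prod_unfold)
  also have "\<dots> = (\<Sum>R\<in>orbit e ` S. \<Sum>z | z \<in> P \<and> orbit e (snd z) = R. f (orep (orbit e (snd z))))"
    by (rule sum.group[symmetric, OF finP finite_orbits[OF S(2)]]) (auto simp: P_def)
  also have "\<dots> \<le> (\<Sum>R\<in>orbit e ` S. ?M * f (orep R))"
  proof (rule sum_mono)
    fix R assume R: "R \<in> orbit e ` S"
    define T0 where "T0 = orep R"
    have T0: "T0 \<in> S" "orbit e T0 = R" using orep_mem[OF S(1) R] by (auto simp: T0_def)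
    let ?Z = "{z. z \<in> P \<and> orbit e (snd z) = R}"
    have ex: "\<exists>l. l \<in> lattice e \<and> snd z = (+) l ` T0" if "z \<in> ?Z" for z
    proof -
      have "snd z \<in> orbit e T0" using that orbit_self[of "snd z"] T0(2) by simp
      then show ?thesis by (auto simp: orbit_mem_iff)
    qed
    define l where "l z = (SOME l. l \<in> lattice e \<and> snd z = (+) l ` T0)" for z :: "'n point set set \<times> 'n point set"
    have l: "l z \<in> lattice e \<and> snd z = (+) (l z) ` T0" if "z \<in> ?Z" for z
      unfolding l_def by (rule someI_ex[OF ex[OF that]])
    have nl: "- l z \<in> lattice e" if "z \<in> ?Z" for z using l[OF that] lattice_uminus[OF basis] by blast
    have zP: "fst z \<in> ?O" "near \<rho> (orep (fst z)) (snd z)" if "z \<in> ?Z" for z using that by (auto simp: P_def)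
    \<comment> \<open>This map is injective: the orbit of the simplex is visible in the image, and
      the translation is determined because the simplex lies in a cell that is embedded in the
      torus.\<close>
    define \<phi> where "\<phi> z = (+) (- l z) ` orep (fst z)" for z
    have im: "\<phi> ` ?Z \<subseteq> {\<sigma> \<in> nsimps. near \<rho> \<sigma> T0}"
    proof (rule image_subsetI)
      fix z assume z: "z \<in> ?Z"
      have "\<phi> z \<in> nsimps" unfolding \<phi>_def by (rule nsimps_translate[OF rep(1)[OF zP(1)[OF z]] nl[OF z]])
      moreover have "near \<rho> (\<phi> z) ((+) (- l z) ` snd z)" unfolding \<phi>_def by (rule near_translate[OF nl[OF z] zP(2)[OF z]])
      moreover have "(+) (- l z) ` snd z = T0" using translate_inverse(1)[of "l z" T0] l[OF z] by (simp only:)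
      ultimately show "\<phi> z \<in> {\<sigma> \<in> nsimps. near \<rho> \<sigma> T0}" by (simp only: mem_Collect_eq simp_thms)
    qed
    have inj: "inj_on \<phi> ?Z"
    proof (rule inj_onI)
      fix z z' assume z: "z \<in> ?Z" "z' \<in> ?Z" "\<phi> z = \<phi> z'"
      have "orbit e (orep (fst z)) = orbit e (orep (fst z'))"
        using z(3) orbit_translate[OF nl[OF z(1)], of "orep (fst z)"] orbit_translate[OF nl[OF z(2)], of "orep (fst z')"]
        unfolding \<phi>_def by (simp only:)
      then have f: "fst z = fst z'" using rep(2)[OF zP(1)[OF z(1)]] rep(2)[OF zP(1)[OF z(2)]] by (simp only:)
      have s: "orep (fst z) \<in> nsimps" by (rule rep(1)[OF zP(1)[OF z(1)]])
      obtain x where x: "x \<in> \<phi> z" using K_nonempty[OF nsimps_D(1)[OF s]] unfolding \<phi>_def by blast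
      have "orep (fst z) \<subseteq> cell_of (orep (fst z))" by (rule cell_of(2)[OF s])
      then have "\<phi> z \<subseteq> (+) (- l z) ` cell_of (orep (fst z))" "\<phi> z' \<subseteq> (+) (- l z') ` cell_of (orep (fst z))"
        unfolding \<phi>_def f by blast+
      then have "- l z = - l z'"
        using translates_meet[OF ncells_C[OF cell_of(1)[OF s]] nl[OF z(1)] nl[OF z(2)], of x] x z(3) by blast
      then have "l z = l z'" by simp
      then have "snd z = snd z'" using l[OF z(1)] l[OF z(2)] by (simp only:)
      with f show "z = z'" by (simp add: prod_eq_iff)
    qed
    have T0C: "T0 \<in> C" using T0(1) S(2) by blast
    have "card ?Z \<le> card {\<sigma> \<in> nsimps. near \<rho> \<sigma> T0}" by (rule card_inj_on_le[OF inj im card_near(1)[OF \<rho> T0C]])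
    then have "real (card ?Z) \<le> ?M" using card_near(2)[OF \<rho> T0C] by linarith
    then have "real (card ?Z) * f (orep R) \<le> ?M * f (orep R)" using f[OF R] by (rule mult_right_mono)
    then show "(\<Sum>z\<in>?Z. f (orep (orbit e (snd z)))) \<le> ?M * f (orep R)" by simp
  qed
  also have "\<dots> = ?M * sum_mod e f S" unfolding sum_mod_orep by (simp add: sum_distrib_left)
  finally show ?thesis .
qed

end

section \<open>Piecewise smooth fields on a mesh\<close>

lemma negligible_translate: "negligible N \<Longrightarrow> negligible {x. x + y \<in> (N :: 'a::euclidean_space set)}"
proof -
  assume "negligible N"
  then have "negligible ((+) (- y) ` N)" by (rule negligible_translation)
  moreover have "{x. x + y \<in> N} = (+) (- y) ` N" by (auto simp: image_iff intro!: bexI[of _ "_ + y"])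
  ultimately show ?thesis by simp
qed

lemma AE_lborel_iff_negligible: "(\<exists>N. negligible N \<and> (\<forall>x. x \<notin> N \<longrightarrow> P x)) \<Longrightarrow> AE x in lborel. P x"
proof -
  assume "\<exists>N. negligible N \<and> (\<forall>x. x \<notin> N \<longrightarrow> P x)"
  then have "AE x in lebesgue. P x" unfolding eventually_ae_filter_negligible by blast
  then show ?thesis by (simp add: AE_completion_iff)
qed

text \<open>The finite element field enters the analysis only through these inverse estimates, with
  a constant \<open>c\<^sub>1\<close> that will be the same for all meshes. The bound
  \<open>H\<close> on \<open>\<kappa> ^ 2 * h\<close> serves to keep a radius below 1 in
  \<open>measure_prism_ge\<close>.\<close>

locale broken = mesh e C K \<kappa> h N
  for e :: "'n::{finite,linorder} \<Rightarrow> 'n point" and C K :: "'n point set set" and \<kappa> h :: real and N :: nat +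
  fixes w :: "'n point set \<Rightarrow> 'n form" and u :: "'n form" and c\<^sub>1 H :: real
  assumes w_C1: "\<And>T. T \<in> ncells \<Longrightarrow> cdiff 1 (w T)"
    and u_L2: "u \<in> L2_forms e"
    and u_w: "\<And>T. T \<in> ncells \<Longrightarrow> AE x in lebesgue. x \<in> T \<longrightarrow> u x = w T x"
    and c1: "0 \<le> c\<^sub>1" and H: "1 \<le> H" "\<kappa> ^ 2 * h \<le> H"
    and inv_val: "\<And>T x. T \<in> ncells \<Longrightarrow> x \<in> T \<Longrightarrow>
      (norm (w T x))\<^sup>2 * h ^ CARD('n) \<le> c\<^sub>1 * (LINT y:T|lborel. (norm (w T y))\<^sup>2)"
    and inv_der: "\<And>T x i. T \<in> ncells \<Longrightarrow> x \<in> T \<Longrightarrow>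
      (h * norm (partial i (w T) x))\<^sup>2 * h ^ CARD('n) \<le> c\<^sub>1 * (LINT y:T|lborel. (norm (w T y))\<^sup>2)"
    and inv_grad: "\<And>T x i. T \<in> ncells \<Longrightarrow> x \<in> T \<Longrightarrow>
      (norm (partial i (w T) x))\<^sup>2 * h ^ CARD('n) \<le> c\<^sub>1 * (\<Sum>j\<in>UNIV. LINT y:T|lborel. (norm (partial j (w T) y))\<^sup>2)"
begin

lemma u_periodic: "periodic e u" and u_meas: "u \<in> borel_measurable lebesgue"
  and u_int: "set_integrable lebesgue (fund_domain e) (\<lambda>x. (norm (u x))\<^sup>2)"
  using u_L2 by (simp_all add: L2_forms_def)

text \<open>The set where the two sides differ is open in the interior and null, hence empty there;
  and the cell is the closure of its interior.\<close>

lemma ncell_interior_eq: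
  assumes T: "T \<in> ncells" and c: "continuous_on UNIV f" "continuous_on UNIV g"
    and eq: "AE x in lebesgue. x \<in> T \<longrightarrow> f x = (g x :: real^('n set))" and x: "x \<in> T"
  shows "f x = g x"
proof -
  have cl: "closed {x. f x = g x}" using c by (rule closed_Collect_eq)
  obtain N where N: "negligible N" "{x. \<not> (x \<in> T \<longrightarrow> f x = g x)} \<subseteq> N"
    using eq unfolding eventually_ae_filter_negligible by blast
  have "interior T - {x. f x = g x} \<subseteq> N" using N(2) interior_subset by blast
  then have "interior T - {x. f x = g x} = {}"
    using open_negligible_empty[OF _ _ N(1)] cl by (meson open_Diff open_interior)
  then have "closure (interior T) \<subseteq> {x. f x = g x}" using cl by (intro closure_minimal) auto
  then show ?thesis using lip_cell_fulldim(5)[OF ncell_lip[OF T]] x by blast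
qed

text \<open>The fields on different lifts of a cell are chosen independently; they correspond
  because both represent the periodic field \<open>u\<close>.\<close>

lemma w_translate: "T \<in> ncells \<Longrightarrow> l \<in> lattice e \<Longrightarrow> x \<in> T \<Longrightarrow> w ((+) l ` T) (x + l) = w T x"
proof -
  assume T: "T \<in> ncells" and l: "l \<in> lattice e" and x: "x \<in> T"
  note T' = ncell_translate[OF T l]
  show ?thesis
  proof (rule ncell_interior_eq[OF T _ _ _ x])
    show "continuous_on UNIV (\<lambda>x. w ((+) l ` T) (x + l))"
      by (rule continuous_on_compose2[OF cdiff_1_continuous[OF w_C1[OF T'], of UNIV]]) (auto intro!: continuous_intros)
    show "continuous_on UNIV (w T)" by (rule cdiff_1_continuous[OF w_C1[OF T]])
    obtain N where N: "negligible N" "{x. \<not> (x \<in> (+) l ` T \<longrightarrow> u x = w ((+) l ` T) x)} \<subseteq> N"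
      using u_w[OF T'] unfolding eventually_ae_filter_negligible by blast
    have "AE x in lebesgue. x + l \<notin> N"
      using negligible_translate[OF N(1), of l] unfolding eventually_ae_filter_negligible by blast
    with u_w[OF T] show "AE x in lebesgue. x \<in> T \<longrightarrow> w ((+) l ` T) (x + l) = w T x"
    proof eventually_elim
      case (elim x)
      show ?case
      proof
        assume xT: "x \<in> T"
        then have "x + l \<in> (+) l ` T" by (simp add: mem_translate_iff)
        then have "u (x + l) = w ((+) l ` T) (x + l)" using N(2) elim(2) by blast
        moreover have "u (x + l) = u x" using u_periodic l unfolding periodic_def by blast
        ultimately show "w ((+) l ` T) (x + l) = w T x" using elim(1) xT by simp
      qed
    qed
  qed
qed

text \<open>At interior points derivatives are determined by values on the cell; continuity carries
  the identity to the boundary.\<close>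

lemma partial_translate:
  assumes T: "T \<in> ncells" and l: "l \<in> lattice e" and x: "x \<in> T"
  shows "partial i (w ((+) l ` T)) (x + l) = partial i (w T) x"
proof (rule ncell_interior_eq[OF T _ _ _ x])
  note T' = ncell_translate[OF T l]
  show "continuous_on UNIV (\<lambda>x. partial i (w ((+) l ` T)) (x + l))"
    by (rule continuous_on_compose2[OF cdiff_1_continuous_partial[OF w_C1[OF T'], of UNIV]]) (auto intro!: continuous_intros)
  show "continuous_on UNIV (partial i (w T))" by (rule cdiff_1_continuous_partial[OF w_C1[OF T]])
  have int: "partial i (w ((+) l ` T)) (y + l) = partial i (w T) y" if y: "y \<in> interior T" for y
  proof -
    have "((\<lambda>z. w ((+) l ` T) (z + l)) has_derivative frechet_derivative (w ((+) l ` T)) (at (y + l))) (at y)"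
      using has_derivative_compose[of "\<lambda>z. z + l" "\<lambda>z. z" y UNIV "w ((+) l ` T)"] cdiff_1_has_derivative[OF w_C1[OF T'], of "y + l"]
      by (simp add: has_derivative_add_const)
    then have "(w T has_derivative frechet_derivative (w ((+) l ` T)) (at (y + l))) (at y)"
    proof (rule has_derivative_transform_within_open[OF _ open_interior y])
      fix z assume "z \<in> interior T"
      then have "z \<in> T" using interior_subset by blast
      then show "w ((+) l ` T) (z + l) = w T z" by (rule w_translate[OF T l])
    qed
    then show ?thesis by (metis partial_def partial_eqI)
  qed
  have "negligible (cell_boundary T)" by (rule lip_cell_boundary_negligible[OF ncell_lip[OF T]])
  then show "AE x in lebesgue. x \<in> T \<longrightarrow> partial i (w ((+) l ` T)) (x + l) = partial i (w T) x"
    unfolding eventually_ae_filter_negligible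
    using int lip_cell_fulldim(4)[OF ncell_lip[OF T]] by (intro exI[of _ "cell_boundary T"]) blast
qed

definition \<Omega> :: "'n point set" where "\<Omega> = \<Union>(interior ` ncells)"

text \<open>A Borel and exactly periodic representative of \<open>u\<close>, equal to a C^1 field
  inside each \<open>n\<close>-cell. The value 0 off \<open>\<Omega>\<close> is a default on a null
  set that respects periodicity.\<close>

definition U :: "'n form" where
  "U x = (if x \<in> \<Omega> then w (SOME T. T \<in> ncells \<and> x \<in> interior T) x else 0)"

lemma U_eq: "T \<in> ncells \<Longrightarrow> x \<in> interior T \<Longrightarrow> U x = w T x"
proof -
  assume T: "T \<in> ncells" "x \<in> interior T"
  have "(SOME T. T \<in> ncells \<and> x \<in> interior T) = T"
  proof (rule some_equality)
    fix T' assume "T' \<in> ncells \<and> x \<in> interior T'"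
    then show "T' = T" using ncell_interior_unique[of T' T x] T interior_subset by blast
  qed (use T in simp)
  then show ?thesis using T unfolding U_def \<Omega>_def by auto
qed

lemma U_eq_T: "T \<in> ncells \<Longrightarrow> x \<in> \<Omega> \<Longrightarrow> x \<in> T \<Longrightarrow> U x = w T x"
proof -
  assume T: "T \<in> ncells" "x \<in> \<Omega>" "x \<in> T"
  then obtain T' where T': "T' \<in> ncells" "x \<in> interior T'" unfolding \<Omega>_def by blast
  then have "T' = T" using ncell_interior_unique T by blast
  then show ?thesis using U_eq[OF T'] by simp
qed

lemma negligible_Omega: "negligible (- \<Omega>)"
  unfolding \<Omega>_def by (rule negligible_outside_ncells)

lemma U_borel [measurable]: "U \<in> borel_measurable borel"
proof -
  have op: "open \<Omega>" unfolding \<Omega>_def by blast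
  have "continuous_on \<Omega> U" unfolding \<Omega>_def
  proof (rule continuous_on_open_Union)
    fix S assume "S \<in> interior ` ncells"
    then obtain T where T: "T \<in> ncells" "S = interior T" by blast
    show "open S" using T by simp
    show "continuous_on S U"
      using continuous_on_cong[OF refl U_eq[OF T(1)], of S] cdiff_1_continuous[OF w_C1[OF T(1)], of S] T(2) by simp
  qed
  then have "(\<lambda>x. indicator \<Omega> x *\<^sub>R U x) \<in> borel_measurable borel"
    using op by (intro borel_measurable_continuous_on_indicator) auto
  moreover have "(\<lambda>x. indicator \<Omega> x *\<^sub>R U x) = U" by (auto simp: U_def indicator_def)
  ultimately show ?thesis by simp
qed

lemma Omega_translate: "l \<in> lattice e \<Longrightarrow> x \<in> \<Omega> \<Longrightarrow> x + l \<in> \<Omega>"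
proof -
  assume l: "l \<in> lattice e" and "x \<in> \<Omega>"
  then obtain T where T: "T \<in> ncells" "x \<in> interior T" unfolding \<Omega>_def by blast
  have "x + l \<in> interior ((+) l ` T)" using T(2) by (simp add: interior_translation mem_translate_iff)
  then show ?thesis unfolding \<Omega>_def using ncell_translate[OF T(1) l] by blast
qed

lemma U_periodic: "periodic e U"
  unfolding periodic_def
proof (intro ballI allI)
  fix l x assume l: "l \<in> lattice e"
  show "U (x + l) = U x"
  proof (cases "x \<in> \<Omega>")
    case True
    then obtain T where T: "T \<in> ncells" "x \<in> interior T" unfolding \<Omega>_def by blast
    have "x + l \<in> interior ((+) l ` T)" using T(2) by (simp add: interior_translation mem_translate_iff)
    then have "U (x + l) = w ((+) l ` T) (x + l)" by (rule U_eq[OF ncell_translate[OF T(1) l]])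
    also have "\<dots> = w T x" using T interior_subset by (intro w_translate l) auto
    finally show ?thesis using U_eq[OF T] by simp
  next
    case False
    have "x + l \<notin> \<Omega>"
    proof
      assume "x + l \<in> \<Omega>"
      from Omega_translate[OF lattice_uminus[OF basis l] this] False show False by simp
    qed
    with False show ?thesis by (simp add: U_def)
  qed
qed

lemma u_eq_U: "AE x in lebesgue. u x = U x"
proof -
  have "AE x in lebesgue. \<forall>T\<in>ncells. x \<in> T \<longrightarrow> u x = w T x"
    using countable_cells u_w by (subst AE_ball_countable) (auto simp: ncells_def)
  moreover have "AE x in lebesgue. x \<in> \<Omega>"
    using negligible_Omega unfolding eventually_ae_filter_negligible by (intro exI[of _ "- \<Omega>"]) auto
  ultimately show ?thesis
  proof eventually_elim
    case (elim x)
    then obtain T where T: "T \<in> ncells" "x \<in> interior T" unfolding \<Omega>_def by blast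
    then have "x \<in> T" using interior_subset by blast
    then show ?case using elim(1) T U_eq[OF T] by simp
  qed
qed

section \<open>Global energies and their decomposition over cells and interfaces\<close>

definition E\<^sub>0 :: real where "E\<^sub>0 = (L2_norm e u)\<^sup>2"

lemma E0_nonneg: "0 \<le> E\<^sub>0" by (simp add: E\<^sub>0_def)

lemma E0_eq: "(\<integral>\<^sup>+x\<in>fund_domain e. ennreal ((norm (U x))\<^sup>2) \<partial>lborel) = ennreal E\<^sub>0"
proof -
  have i: "integrable lebesgue (\<lambda>x. indicator (fund_domain e) x *\<^sub>R (norm (u x))\<^sup>2)"
    using u_int by (simp add: set_integrable_def)
  have "(\<integral>\<^sup>+x\<in>fund_domain e. ennreal ((norm (U x))\<^sup>2) \<partial>lborel) = (\<integral>\<^sup>+x\<in>fund_domain e. ennreal ((norm (U x))\<^sup>2) \<partial>lebesgue)"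
    by (simp add: nn_integral_completion)
  also have "\<dots> = (\<integral>\<^sup>+x. ennreal (indicator (fund_domain e) x *\<^sub>R (norm (u x))\<^sup>2) \<partial>lebesgue)"
    by (rule nn_integral_cong_AE) (use u_eq_U in eventually_elim, auto simp: indicator_def)
  also have "\<dots> = ennreal (LINT x|lebesgue. indicator (fund_domain e) x *\<^sub>R (norm (u x))\<^sup>2)"
    by (rule nn_integral_eq_integral[OF i]) (auto simp: indicator_def)
  also have "(LINT x|lebesgue. indicator (fund_domain e) x *\<^sub>R (norm (u x))\<^sup>2) = E\<^sub>0"
    unfolding E\<^sub>0_def L2_norm_def set_lebesgue_integral_def
    by (subst real_sqrt_pow2) (auto intro!: integral_nonneg_AE simp: indicator_def)
  finally show ?thesis .
qed

definition a :: "'n point set \<Rightarrow> real" where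
  "a T = (LINT y:T|lborel. (norm (w T y))\<^sup>2)"

definition g :: "'n point set \<Rightarrow> real" where
  "g T = (\<Sum>j\<in>UNIV. LINT y:T|lborel. (norm (partial j (w T) y))\<^sup>2)"

lemma a_nonneg: "0 \<le> a T" and g_nonneg: "0 \<le> g T"
  unfolding a_def g_def set_lebesgue_integral_def
  by (auto intro!: sum_nonneg integral_nonneg_AE simp: indicator_def)

lemma cell_integral_interior:
  assumes T: "T \<in> ncells" and c: "continuous_on UNIV (f :: 'n point \<Rightarrow> real)" and nn: "\<And>x. 0 \<le> f x"
  shows "(\<integral>\<^sup>+x\<in>interior T. ennreal (f x) \<partial>lborel) = ennreal (LINT x:T|lborel. f x)"
    and "(LINT x:interior T|lebesgue. f x) = (LINT x:T|lborel. f x)"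
proof -
  have TC: "compact T" "T \<in> sets borel" using cell_compact[OF ncells_C[OF T]] ncell_borel[OF T] by auto
  have fb[measurable]: "f \<in> borel_measurable borel" using c by (rule borel_measurable_continuous_onI)
  have i: "integrable lborel (\<lambda>x. indicator T x *\<^sub>R f x)"
    by (rule borel_integrable_compact[OF TC(1) continuous_on_subset[OF c subset_UNIV]])
  have sub: "x \<in> interior T \<longleftrightarrow> x \<in> T" if "x \<notin> cell_boundary T" for x
    using that lip_cell_fulldim(4)[OF ncell_lip[OF T]] interior_subset by blast
  have ae: "AE x in lborel. indicator (interior T) x = (indicator T x :: real)"
    by (rule AE_lborel_iff_negligible)
      (use sub lip_cell_boundary_negligible[OF ncell_lip[OF T]] in \<open>auto simp: indicator_def intro!: exI[of _ "cell_boundary T"]\<close>)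
  have "(\<integral>\<^sup>+x\<in>interior T. ennreal (f x) \<partial>lborel) = (\<integral>\<^sup>+x. ennreal (indicator T x *\<^sub>R f x) \<partial>lborel)"
    by (rule nn_integral_cong_AE) (use ae in eventually_elim, auto simp: indicator_def split: if_splits)
  also have "\<dots> = ennreal (LINT x|lborel. indicator T x *\<^sub>R f x)"
    by (rule nn_integral_eq_integral[OF i]) (auto simp: indicator_def nn)
  finally show "(\<integral>\<^sup>+x\<in>interior T. ennreal (f x) \<partial>lborel) = ennreal (LINT x:T|lborel. f x)"
    by (simp add: set_lebesgue_integral_def)
  have m1: "(\<lambda>x. indicator (interior T) x *\<^sub>R f x) \<in> borel_measurable lborel" by measurable
  have "(LINT x:interior T|lebesgue. f x) = (LINT x|lborel. indicator (interior T) x *\<^sub>R f x)"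
    unfolding set_lebesgue_integral_def by (rule integral_completion[OF m1])
  also have "\<dots> = (LINT x|lborel. indicator T x *\<^sub>R f x)"
    by (rule integral_cong_AE[OF m1 borel_measurable_integrable[OF i]]) (use ae in eventually_elim, simp)
  finally show "(LINT x:interior T|lebesgue. f x) = (LINT x:T|lborel. f x)" by (simp add: set_lebesgue_integral_def)
qed

lemma sum_a_le: "sum_mod e a ncells \<le> E\<^sub>0"
proof -
  let ?O = "orbit e ` ncells"
  have n2: "(\<lambda>x. ennreal ((norm (U x))\<^sup>2)) \<in> borel_measurable borel" by measurable
  have per: "periodic e (\<lambda>x. ennreal ((norm (U x))\<^sup>2))" using U_periodic by (simp add: periodic_def)
  have "ennreal (sum_mod e a ncells) = (\<Sum>Q\<in>?O. ennreal (a (orep Q)))"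
    unfolding sum_mod_orep using a_nonneg by (simp add: sum_ennreal)
  also have "\<dots> = (\<Sum>Q\<in>?O. \<integral>\<^sup>+x\<in>interior (orep Q). ennreal ((norm (U x))\<^sup>2) \<partial>lborel)"
  proof (rule sum.cong[OF refl])
    fix Q assume "Q \<in> ?O"
    then have T: "orep Q \<in> ncells" using orep_mem[OF invariant_ncells] by blast
    have c: "continuous_on UNIV (\<lambda>x. (norm (w (orep Q) x))\<^sup>2)"
      by (intro continuous_intros cdiff_1_continuous[OF w_C1[OF T]])
    have "ennreal (a (orep Q)) = (\<integral>\<^sup>+x\<in>interior (orep Q). ennreal ((norm (w (orep Q) x))\<^sup>2) \<partial>lborel)"
      unfolding a_def by (rule cell_integral_interior(1)[OF T c, symmetric]) simp
    also have "\<dots> = (\<integral>\<^sup>+x\<in>interior (orep Q). ennreal ((norm (U x))\<^sup>2) \<partial>lborel)"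
      by (rule nn_integral_cong) (use U_eq[OF T] in \<open>auto simp: indicator_def\<close>)
    finally show "ennreal (a (orep Q)) = (\<integral>\<^sup>+x\<in>interior (orep Q). ennreal ((norm (U x))\<^sup>2) \<partial>lborel)" .
  qed
  also have "\<dots> \<le> (\<integral>\<^sup>+x\<in>fund_domain e. ennreal ((norm (U x))\<^sup>2) \<partial>lborel)"
    by (rule sum_ncells_le_nn_integral[OF n2 per])
  also have "\<dots> = ennreal E\<^sub>0" by (rule E0_eq)
  finally show ?thesis using E0_nonneg by (simp add: ennreal_le_iff)
qed

lemma grad_norm2_cell: "T \<in> ncells \<Longrightarrow> grad_norm2 (interior T) u = g T"
proof -
  assume T: "T \<in> ncells"
  have "AE x in lebesgue. x \<in> interior T \<longrightarrow> u x = w T x"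
    using u_w[OF T] by eventually_elim (use interior_subset in blast)
  then have "grad_norm2 (interior T) u = (\<Sum>i\<in>UNIV. LINT x:interior T|lebesgue. (norm (partial i (w T) x))\<^sup>2)"
    by (rule grad_norm2_C1[OF open_interior w_C1[OF T] u_meas])
  also have "\<dots> = g T" unfolding g_def
    by (intro sum.cong refl cell_integral_interior(2)[OF T] continuous_intros cdiff_1_continuous_partial[OF w_C1[OF T]]) simp
  finally show ?thesis .
qed

definition faces :: "'n point set set" where "faces = {T \<in> C. cell_dim T = CARD('n) - 1}"

definition fj :: "'n point set \<Rightarrow> real" where
  "fj T' = 1 / interface_size e C T' *
         (\<Sum>\<sigma> | \<sigma> \<in> simplices_in K T' \<and> (int CARD('n) - 1) simplex \<sigma>.
            facet_integral \<sigma> (jump_norm2 C T' u))"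

definition E\<^sub>1 :: real where "E\<^sub>1 = (discrete_H1 e C K u)\<^sup>2"

lemma jump_norm2_nonneg: "0 \<le> jump_norm2 D T' v x"
  unfolding jump_norm2_def Let_def by (intro divide_nonneg_nonneg sum_nonneg) auto

lemma facet_integral_nonneg: "(\<And>x. 0 \<le> f x) \<Longrightarrow> 0 \<le> facet_integral F f"
  unfolding facet_integral_def Let_def set_lebesgue_integral_def
  by (intro integral_nonneg_AE AE_I2) (simp add: indicator_def)

lemma tdiam_props: "T \<in> C \<Longrightarrow> tdiam e T \<le> h" "x \<in> T \<Longrightarrow> y \<in> T \<Longrightarrow> tdist e x y \<le> tdiam e T"
proof -
  obtain D where D: "\<And>x y. tdist e x y \<le> D" using tdist_bounded[OF basis] by blast
  have bd: "bdd_above ((\<lambda>(x, y). tdist e x y) ` (T \<times> T))" for T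
    using D by (intro bdd_aboveI[of _ D]) auto
  show "x \<in> T \<Longrightarrow> y \<in> T \<Longrightarrow> tdist e x y \<le> tdiam e T"
    unfolding tdiam_def using cSUP_upper[OF _ bd, of "(x, y)" T] by simp
  have le: "tdiam e T \<le> D" if "T \<in> C" for T
    unfolding tdiam_def using lip_cell_nonempty[OF cell_lip[OF that]] D by (intro cSUP_least) auto
  then have "bdd_above (tdiam e ` C)" by (intro bdd_aboveI[of _ D]) auto
  then show "T \<in> C \<Longrightarrow> tdiam e T \<le> h" unfolding h_def mesh_width_def by (rule cSUP_upper[rotated])
qed

lemma tdiam_nonneg: "T \<in> C \<Longrightarrow> 0 \<le> tdiam e T"
proof -
  assume T: "T \<in> C"
  obtain x where "x \<in> T" using lip_cell_nonempty[OF cell_lip[OF T]] by blast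
  then show ?thesis using tdiam_props(2)[of x T x] tdist_nonneg[OF basis, of x x] by linarith
qed

lemma interface_size_nonneg: "T \<in> C \<Longrightarrow> 0 \<le> interface_size e C T"
  unfolding interface_size_def using tdiam_nonneg h_pos h_def by auto

lemma interface_size_le: "T \<in> C \<Longrightarrow> interface_size e C T \<le> h"
  unfolding interface_size_def using tdiam_props(1) h_def by auto

text \<open>The diameter is taken on the torus, where distinct points of the space may be
  identified. In dimension at least 2 a facet contains two distinct points so close that no lattice
  vector can identify them.\<close>

lemma interface_size_pos:
  assumes T: "T \<in> C" and F: "F \<in> simplices_in K T" "aff_dim F = int CARD('n) - 1"
  shows "0 < interface_size e C T"
proof (cases "CARD('n) = 1")
  case True
  then show ?thesis unfolding interface_size_def using h_pos h_def by simp
next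
  case False
  then have n: "2 \<le> CARD('n)" using zero_less_card_finite[where 'a='n] by linarith
  obtain d :: nat where d: "int d simplex F" using F(1) K_simplex by (auto simp: simplices_in_def)
  have cF: "convex F" by (rule convex_simplex[OF d])
  obtain x where x: "x \<in> F" using F(1) K_nonempty by (auto simp: simplices_in_def)
  have "F \<noteq> {x}" using F(2) n by auto
  then obtain y where y: "y \<in> F" "y \<noteq> x" using x by blast
  obtain \<delta> where \<delta>: "\<delta> > 0" "\<forall>l\<in>lattice e. l \<noteq> 0 \<longrightarrow> \<delta> \<le> norm l" using lattice_min_norm[OF basis] by blast
  \<comment> \<open>This moves \<open>y\<close> along the facet to within half the minimal norm of a
    lattice vector from \<open>x\<close>.\<close>
  define t where "t = min 1 (\<delta> / (4 * norm (y - x)))"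
  have nxy: "0 < norm (y - x)" using y(2) by simp
  have t: "0 < t" "t \<le> 1" using \<delta>(1) nxy by (auto simp: t_def)
  have "t * norm (y - x) \<le> \<delta> / (4 * norm (y - x)) * norm (y - x)" using nxy by (intro mult_right_mono) (auto simp: t_def)
  then have small: "t * norm (y - x) < \<delta> / 2" using nxy \<delta>(1) by simp
  define z where "z = (1 - t) *\<^sub>R x + t *\<^sub>R y"
  have zF: "z \<in> F" unfolding z_def using convexD[OF cF x y(1), of "1 - t" t] t by simp
  have zx: "z - x = t *\<^sub>R (y - x)" by (simp add: z_def algebra_simps)
  then have "norm (z - x) = t * norm (y - x)" using t(1) by simp
  then have "0 < tdist e z x" using small nxy t(1) y(2) zx by (intro tdist_pos[OF basis \<delta>(2)]) auto
  also have "\<dots> \<le> tdiam e T" using zF x F(1) by (intro tdiam_props(2)) (auto simp: simplices_in_def)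
  finally show ?thesis unfolding interface_size_def using False by simp
qed

lemma fj_nonneg: "T \<in> C \<Longrightarrow> 0 \<le> fj T"
  unfolding fj_def using interface_size_nonneg
  by (intro mult_nonneg_nonneg sum_nonneg facet_integral_nonneg jump_norm2_nonneg) auto

lemma
  shows sum_g_nonneg: "0 \<le> sum_mod e g ncells" and sum_fj_nonneg: "0 \<le> sum_mod e fj faces"
proof -
  show "0 \<le> sum_mod e g ncells" unfolding sum_mod_orep using g_nonneg by (intro sum_nonneg) auto
  show "0 \<le> sum_mod e fj faces"
    unfolding sum_mod_orep faces_def using orep_mem[OF invariant_faces] by (intro sum_nonneg fj_nonneg) blast
qed

lemma discrete_H1_eq: "discrete_H1 e C K u = sqrt (sum_mod e g ncells + sum_mod e fj faces)"
proof -
  have "sum_mod e (\<lambda>T. grad_norm2 (interior T) u) ncells = sum_mod e g ncells"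
    unfolding sum_mod_orep using grad_norm2_cell orep_mem[OF invariant_ncells] by (intro sum.cong refl) auto
  then show ?thesis unfolding discrete_H1_def fj_def[symmetric] faces_def[symmetric] ncells_def[symmetric] by simp
qed

lemma discrete_H1_nonneg: "0 \<le> discrete_H1 e C K u"
  unfolding discrete_H1_eq using sum_g_nonneg sum_fj_nonneg by simp

lemma E1_eq: "E\<^sub>1 = sum_mod e g ncells + sum_mod e fj faces"
  unfolding E\<^sub>1_def discrete_H1_eq using sum_g_nonneg sum_fj_nonneg by simp

subsection \<open>Traces and jumps\<close>

text \<open>The field is continuous, so its averages converge to its value; they are proper averages
  because a cell has positive volume near each of its points.\<close>

lemma trace_eq:
  assumes T: "T \<in> ncells" and x: "x \<in> T"
  shows "trace T u x = w T x"
proof -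
  have TC: "compact T" using cell_compact[OF ncells_C[OF T]] .
  have cw: "continuous_on UNIV (w T)" by (rule cdiff_1_continuous[OF w_C1[OF T]])
  define m where "m r = measure lebesgue (T \<inter> ball x r)" for r
  have mpos: "0 < m r" if r: "0 < r" for r
  proof -
    have "x \<in> closure (interior T)" using lip_cell_fulldim(5)[OF ncell_lip[OF T]] x by simp
    then have ne: "interior T \<inter> ball x r \<noteq> {}" proof -
      have "x \<in> ball x r" using r by simp
      with \<open>x \<in> closure (interior T)\<close> have "ball x r \<inter> closure (interior T) \<noteq> {}" by blast
      then have "ball x r \<inter> interior T \<noteq> {}" using open_Int_closure_eq_empty[of "ball x r" "interior T"] by simp
      then show ?thesis by (simp add: Int_commute)
    qed
    have "\<not> negligible (T \<inter> ball x r)"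
    proof
      assume "negligible (T \<inter> ball x r)"
      moreover have "interior T \<inter> ball x r \<subseteq> T \<inter> ball x r" using interior_subset by blast
      ultimately show False using open_negligible_empty[of "interior T \<inter> ball x r"] ne by blast
    qed
    moreover have "T \<inter> ball x r \<in> lmeasurable" using TC by (intro lmeasurable_compact fmeasurable_Int_fmeasurable) auto
    ultimately show ?thesis unfolding m_def using negligible_iff_measure0 zero_less_measure_iff by blast
  qed
  have avg: "((\<lambda>r. (1 / m r) *\<^sub>R (LINT y:T \<inter> ball x r|lebesgue. u y)) \<longlongrightarrow> w T x) (at_right 0)"
  proof (rule tendstoI)
    fix \<epsilon> :: real assume \<epsilon>: "0 < \<epsilon>"
    have "isCont (w T) x" using cw by (simp add: continuous_on_eq_continuous_at)
    then obtain \<delta> where \<delta>: "0 < \<delta>" "\<And>y. norm (y - x) < \<delta> \<Longrightarrow> norm (w T y - w T x) < \<epsilon> / 2"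
      using \<epsilon> unfolding continuous_at_eps_delta dist_norm by (metis half_gt_zero)
    have "norm ((1 / m r) *\<^sub>R (LINT y:T \<inter> ball x r|lebesgue. u y) - w T x) < \<epsilon>" if r: "0 < r" "r < \<delta>" for r
    proof -
      let ?S = "T \<inter> ball x r"
      have S: "?S \<in> lmeasurable" using TC by (intro lmeasurable_compact fmeasurable_Int_fmeasurable) auto
      have i: "set_integrable lebesgue ?S (w T)"
        by (rule set_integrable_subset[OF set_integrable_lebesgue_continuous[OF cw TC]]) (use S in auto)
      have ic: "set_integrable lebesgue ?S (\<lambda>y. w T x)"
        unfolding set_integrable_def using S by (intro integrable_scaleR_left integrable_real_indicator) (auto simp: fmeasurable_def)
      have "(LINT y:?S|lebesgue. u y) = (LINT y:?S|lebesgue. w T y)"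
        unfolding set_lebesgue_integral_def
      proof (rule integral_cong_AE)
        show "(\<lambda>y. indicator ?S y *\<^sub>R u y) \<in> borel_measurable lebesgue"
          using u_meas S by (intro borel_measurable_scaleR borel_measurable_indicator) auto
        show "(\<lambda>y. indicator ?S y *\<^sub>R w T y) \<in> borel_measurable lebesgue"
          using i by (simp add: set_integrable_def borel_measurable_integrable)
        show "AE y in lebesgue. indicator ?S y *\<^sub>R u y = indicator ?S y *\<^sub>R w T y"
          using u_w[OF T] by eventually_elim (auto simp: indicator_def)
      qed
      moreover have "(LINT y:?S|lebesgue. w T x) = m r *\<^sub>R w T x"
        unfolding m_def set_lebesgue_integral_def using S by (subst integral_scaleR_left) (auto simp: fmeasurable_def)
      ultimately have "(LINT y:?S|lebesgue. u y) - m r *\<^sub>R w T x = (LINT y:?S|lebesgue. w T y - w T x)"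
        using set_integral_diff(2)[OF i ic] by simp
      moreover have "norm (LINT y:?S|lebesgue. w T y - w T x) \<le> (LINT y:?S|lebesgue. \<epsilon> / 2)"
        unfolding set_lebesgue_integral_def
      proof (rule Bochner_Integration.integral_norm_bound_integral)
        show "integrable lebesgue (\<lambda>y. indicator ?S y *\<^sub>R (w T y - w T x))"
          using set_integral_diff(1)[OF i ic] by (simp add: set_integrable_def)
        show "integrable lebesgue (\<lambda>y. indicator ?S y *\<^sub>R (\<epsilon> / 2))"
          using S by (intro integrable_scaleR_left integrable_real_indicator) (auto simp: fmeasurable_def)
        fix y show "norm (indicator ?S y *\<^sub>R (w T y - w T x)) \<le> indicator ?S y *\<^sub>R (\<epsilon> / 2)"
          using \<delta>(2)[of y] r by (auto simp: indicator_def dist_norm norm_minus_commute)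
      qed
      moreover have "(LINT y:?S|lebesgue. \<epsilon> / 2) = m r * (\<epsilon> / 2)"
        unfolding m_def set_lebesgue_integral_def using S by (subst integral_scaleR_left) (auto simp: fmeasurable_def)
      ultimately have b: "norm ((LINT y:?S|lebesgue. u y) - m r *\<^sub>R w T x) \<le> m r * (\<epsilon> / 2)" by simp
      have mr: "0 < m r" by (rule mpos[OF r(1)])
      have "(1 / m r) *\<^sub>R (LINT y:?S|lebesgue. u y) - w T x = (1 / m r) *\<^sub>R ((LINT y:?S|lebesgue. u y) - m r *\<^sub>R w T x)"
        using mr by (simp add: scaleR_diff_right)
      then have "norm ((1 / m r) *\<^sub>R (LINT y:?S|lebesgue. u y) - w T x) = (1 / m r) * norm ((LINT y:?S|lebesgue. u y) - m r *\<^sub>R w T x)"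
        using mr by simp
      also have "\<dots> \<le> (1 / m r) * (m r * (\<epsilon> / 2))" using b mr by (intro mult_left_mono) auto
      also have "\<dots> < \<epsilon>" using mr \<epsilon> by simp
      finally show ?thesis .
    qed
    then show "\<forall>\<^sub>F r in at_right 0. dist ((1 / m r) *\<^sub>R (LINT y:T \<inter> ball x r|lebesgue. u y)) (w T x) < \<epsilon>"
      unfolding eventually_at_right_field dist_norm using \<delta>(1) by (intro exI[of _ \<delta>]) auto
  qed
  show ?thesis unfolding trace_def using tendsto_Lim[OF _ avg] unfolding m_def by simp
qed

text \<open>Coefficient of \<open>h ^ (CARD('n) - 1)\<close> in the lower bound of
  \<open>measure_prism_ge\<close> for the radius \<open>\<rho>\<^sub>0 / H\<close>.\<close>

definition cJ :: real where
  "cJ = unit_vol TYPE('n) * (\<kappa> ^ 2 / H) ^ (CARD('n) - 1) / 2 ^ (CARD('n) + 1)"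

lemma cJ_pos: "0 < cJ"
  unfolding cJ_def using unit_vol_pos[where 'n='n] kappa H by (intro divide_pos_pos mult_pos_pos zero_less_power) auto

text \<open>The jump term of one facet is part of \<open>fj T'\<close>. By
  \<open>facet_integral_lower\<close> it dominates the squared jump at some point times the volume
  of the prism, and the weight of the interface is at least 1 / \<open>h\<close>.\<close>

lemma jump_bound_rep:
  assumes \<sigma>: "\<sigma> \<in> nsimps" "\<tau> \<in> nsimps" and T: "T \<in> ncells" "T1 \<in> ncells" "\<sigma> \<subseteq> T" "\<tau> \<subseteq> T1"
    and F: "aff_dim (\<sigma> \<inter> \<tau>) = int CARD('n) - 1"
    and T': "T' \<in> C" "\<sigma> \<inter> \<tau> \<in> simplices_in K T'" "(int CARD('n) - 1) simplex (\<sigma> \<inter> \<tau>)" "T' \<subseteq> T" "T' \<subseteq> T1"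
  shows "\<exists>z\<in>\<sigma> \<inter> \<tau>. (norm (w T z - w T1 z))\<^sup>2 * (cJ * h ^ (CARD('n) - 1)) \<le> h * fj T'"
proof -
  let ?F = "\<sigma> \<inter> \<tau>" and ?J = "jump_norm2 C T' u"
  define A where "A = {T \<in> C. cell_dim T = CARD('n) \<and> T' \<subseteq> T}"
  have FK: "?F \<in> K" "?F \<subseteq> T'" using T'(2) by (auto simp: simplices_in_def)
  have Fne: "?F \<noteq> {}" using K_nonempty[OF FK(1)] .
  have "T' \<noteq> {}" using lip_cell_nonempty[OF cell_lip[OF T'(1)]] .
  from finite_cells_containing[OF this] have finA: "finite A" by (rule rev_finite_subset) (auto simp: A_def)
  have An: "S \<in> ncells" if "S \<in> A" for S using that by (simp add: A_def ncells_def)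
  have TA: "T \<in> A" "T1 \<in> A" using T T' by (auto simp: A_def ncells_def)
  have J: "?J x = (\<Sum>S1\<in>A. \<Sum>S2\<in>A. (norm (w S1 x - w S2 x))\<^sup>2) / 2" if "x \<in> ?F" for x
  proof -
    have tr: "trace S u x = w S x" if "S \<in> A" for S
      by (rule trace_eq[OF An[OF that]]) (use that \<open>x \<in> ?F\<close> FK(2) in \<open>auto simp: A_def\<close>)
    show ?thesis unfolding jump_norm2_def Let_def A_def[symmetric] by (simp add: tr cong: sum.cong)
  qed
  \<comment> \<open>Both orders of the pair occur in the double sum, which compensates the division
    by 2.\<close>
  have Jge: "(norm (w T x - w T1 x))\<^sup>2 \<le> ?J x" if x: "x \<in> ?F" for x
  proof (cases "T = T1")
    case True
    then show ?thesis using jump_norm2_nonneg by simp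
  next
    case False
    let ?d = "\<lambda>S1 S2. (norm (w S1 x - w S2 x))\<^sup>2"
    have "?d T T1 \<le> (\<Sum>S2\<in>A. ?d T S2)" by (rule member_le_sum[OF TA(2) _ finA]) simp
    moreover have "?d T1 T \<le> (\<Sum>S2\<in>A. ?d T1 S2)" by (rule member_le_sum[OF TA(1) _ finA]) simp
    moreover have "(\<Sum>S1\<in>{T, T1}. \<Sum>S2\<in>A. ?d S1 S2) \<le> (\<Sum>S1\<in>A. \<Sum>S2\<in>A. ?d S1 S2)"
      using TA finA by (intro sum_mono2 sum_nonneg) auto
    ultimately show ?thesis unfolding J[OF x] using False by (simp add: norm_minus_commute)
  qed
  have cJ: "continuous_on ?F ?J"
  proof -
    have "continuous_on ?F (\<lambda>x. (\<Sum>S1\<in>A. \<Sum>S2\<in>A. (norm (w S1 x - w S2 x))\<^sup>2) / 2)"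
      by (intro continuous_on_divide continuous_on_sum continuous_on_power continuous_on_norm continuous_on_diff
        continuous_on_const cdiff_1_continuous[OF w_C1[OF An]]) simp_all
    moreover have "continuous_on ?F ?J \<longleftrightarrow> continuous_on ?F (\<lambda>x. (\<Sum>S1\<in>A. \<Sum>S2\<in>A. (norm (w S1 x - w S2 x))\<^sup>2) / 2)"
      by (rule continuous_on_cong[OF refl J])
    ultimately show ?thesis by (simp only:)
  qed
  have compF: "compact ?F" by (rule compact_simplex[OF T'(3)])
  have "aff_dim ?F < int CARD('n)" using F by simp
  then obtain z where z: "z \<in> ?F" "?J z * measure lborel (prism ?F) \<le> facet_integral ?F ?J"
    using facet_integral_lower[OF _ compF Fne cJ] jump_norm2_nonneg by blast
  \<comment> \<open>Division by \<open>H\<close> makes the radius at most 1, as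
    \<open>measure_prism_ge\<close> requires, and costs a constant factor only.\<close>
  define r where "r = \<rho>\<^sub>0 / H"
  have r: "0 < r" "r \<le> 1" "r \<le> \<rho>\<^sub>0" using rho0_pos H unfolding r_def \<rho>\<^sub>0_def by (auto simp: divide_le_eq mult_le_cancel_left1)
  obtain x0 where x0: "cball x0 \<rho>\<^sub>0 \<subseteq> \<sigma>" using nsimps_ball[OF \<sigma>(1)] by blast
  have x0r: "cball x0 r \<subseteq> \<sigma>" using x0 subset_cball[OF r(3), of x0] by blast
  have face: "?F face_of \<sigma>" using K_inter[OF nsimps_D(1)[OF \<sigma>(1)] nsimps_D(1)[OF \<sigma>(2)]] by simp
  have "unit_vol TYPE('n) * r ^ (CARD('n) - 1) / 2 ^ (CARD('n) + 1) = cJ * h ^ (CARD('n) - 1)"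
    unfolding cJ_def r_def \<rho>\<^sub>0_def by (simp add: power_mult_distrib power_divide)
  then have prism: "cJ * h ^ (CARD('n) - 1) \<le> measure lborel (prism ?F)"
    using measure_prism_ge[OF nsimps_D(2)[OF \<sigma>(1)] face F compF x0r r(1,2)] by simp
  have sz: "0 < interface_size e C T'" "interface_size e C T' \<le> h"
    using interface_size_pos[OF T'(1,2) F] interface_size_le[OF T'(1)] by auto
  have "(norm (w T z - w T1 z))\<^sup>2 * (cJ * h ^ (CARD('n) - 1)) \<le> ?J z * measure lborel (prism ?F)"
    using Jge[OF z(1)] prism cJ_pos h_pos by (intro mult_mono) (auto intro: jump_norm2_nonneg)
  also have "\<dots> \<le> facet_integral ?F ?J" by (rule z(2))
  also have "\<dots> \<le> (\<Sum>\<sigma> | \<sigma> \<in> simplices_in K T' \<and> (int CARD('n) - 1) simplex \<sigma>. facet_integral \<sigma> ?J)" (is "_ \<le> ?S")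
    using few[OF T'(1)] T'(2,3) by (intro member_le_sum) (auto intro: facet_integral_nonneg jump_norm2_nonneg)
  also have "\<dots> \<le> h * fj T'"
  proof -
    have S0: "0 \<le> ?S" by (intro sum_nonneg facet_integral_nonneg jump_norm2_nonneg)
    have "1 \<le> h * (1 / interface_size e C T')" using sz by (simp add: le_divide_eq)
    from mult_right_mono[OF this S0] show ?thesis unfolding fj_def by simp
  qed
  finally show ?thesis using z(1) by blast
qed

text \<open>The energy is evaluated at the representative of the orbit, so the configuration is
  translated there, estimated, and translated back.\<close>

lemma jump_bound:
  assumes \<sigma>: "\<sigma> \<in> nsimps" "\<tau> \<in> nsimps" and T: "T \<in> ncells" "T1 \<in> ncells" "T \<noteq> T1" "\<sigma> \<subseteq> T" "\<tau> \<subseteq> T1"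
    and F: "aff_dim (\<sigma> \<inter> \<tau>) = int CARD('n) - 1"
  shows "\<exists>T'\<in>faces. \<sigma> \<inter> \<tau> \<in> simplices_in K T' \<and> (\<exists>z\<in>\<sigma> \<inter> \<tau>.
    (norm (w T z - w T1 z))\<^sup>2 * (cJ * h ^ (CARD('n) - 1)) \<le> h * fj (orep (orbit e T')))"
proof -
  obtain T' where T': "T' \<in> C" "cell_dim T' = CARD('n) - 1" "\<sigma> \<inter> \<tau> \<in> simplices_in K T'"
    "(int CARD('n) - 1) simplex (\<sigma> \<inter> \<tau>)" "T' \<subseteq> T" "T' \<subseteq> T1"
    using interface_exists[OF \<sigma> T F] by blast
  obtain l where l: "l \<in> lattice e" "orep (orbit e T') = (+) l ` T'" using orep_orbit[of T'] by blast
  have inter: "(+) l ` \<sigma> \<inter> (+) l ` \<tau> = (+) l ` (\<sigma> \<inter> \<tau>)" by (rule image_Int[symmetric]) simp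
  have "\<exists>z\<in>(+) l ` \<sigma> \<inter> (+) l ` \<tau>. (norm (w ((+) l ` T) z - w ((+) l ` T1) z))\<^sup>2 * (cJ * h ^ (CARD('n) - 1)) \<le> h * fj ((+) l ` T')"
  proof (rule jump_bound_rep)
    show "(+) l ` \<sigma> \<in> nsimps" "(+) l ` \<tau> \<in> nsimps" using nsimps_translate \<sigma> l by auto
    show "(+) l ` T \<in> ncells" "(+) l ` T1 \<in> ncells" using ncell_translate T l by auto
    show "aff_dim ((+) l ` \<sigma> \<inter> (+) l ` \<tau>) = int CARD('n) - 1" unfolding inter using F by (simp add: aff_dim_translation_eq)
    show "(+) l ` T' \<in> C" using cell_translate T' l by auto
    show "(+) l ` \<sigma> \<inter> (+) l ` \<tau> \<in> simplices_in K ((+) l ` T')" unfolding inter using simplices_in_translate[OF l(1) T'(3)] .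
    show "(int CARD('n) - 1) simplex ((+) l ` \<sigma> \<inter> (+) l ` \<tau>)" unfolding inter using simplex_translate[OF T'(4)] .
  qed (use T T' in blast)+
  then obtain z where z: "z \<in> (+) l ` (\<sigma> \<inter> \<tau>)"
    "(norm (w ((+) l ` T) z - w ((+) l ` T1) z))\<^sup>2 * (cJ * h ^ (CARD('n) - 1)) \<le> h * fj ((+) l ` T')" unfolding inter by blast
  then obtain z0 where z0: "z0 \<in> \<sigma> \<inter> \<tau>" "z = z0 + l" by (auto simp: add.commute)
  have "w ((+) l ` T) z = w T z0" "w ((+) l ` T1) z = w T1 z0"
    unfolding z0(2) using w_translate[OF T(1) l(1)] w_translate[OF T(2) l(1)] z0(1) T(4,5) by blast+
  then show ?thesis using z(2) z0(1) T'(1,2,3) l(2) unfolding faces_def by (intro bexI[of _ T']) auto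
qed

end

section \<open>Translation estimates\<close>

context broken
begin

definition \<Phi> :: "'n point \<Rightarrow> ennreal" where
  "\<Phi> y = (\<integral>\<^sup>+x\<in>fund_domain e. ennreal ((norm (U (x + y) - U x))\<^sup>2) \<partial>lborel)"

lemma diff_measurable [measurable]: "(\<lambda>x. ennreal ((norm (U (x + y) - U x))\<^sup>2)) \<in> borel_measurable borel"
proof -
  have [measurable]: "(\<lambda>x. U (x + y)) \<in> borel_measurable borel"
    by (rule measurable_compose[OF _ U_borel]) measurable
  show ?thesis by measurable
qed

lemma diff_periodic: "periodic e (\<lambda>x. ennreal ((norm (U (x + y) - U x))\<^sup>2))"
  unfolding periodic_def
proof (intro ballI allI)
  fix l x assume l: "l \<in> lattice e"
  have "U (x + l) = U x" "U (x + l + y) = U (x + y)"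
    using U_periodic l unfolding periodic_def by (auto simp: algebra_simps)
  then show "ennreal ((norm (U (x + l + y) - U (x + l)))\<^sup>2) = ennreal ((norm (U (x + y) - U x))\<^sup>2)" by simp
qed

lemma Phi_le_sum: "\<Phi> y \<le> (\<Sum>Q\<in>orbit e ` nsimps. \<integral>\<^sup>+x\<in>orep Q. ennreal ((norm (U (x + y) - U x))\<^sup>2) \<partial>lborel)"
  unfolding \<Phi>_def by (rule nn_integral_le_sum_nsimps[OF diff_measurable diff_periodic])

text \<open>Squaring the triangle inequality costs a factor 2, and shift invariance makes both terms
  equal to \<open>E\<^sub>0\<close>.\<close>

lemma Phi_le_4E0: "\<Phi> y \<le> ennreal (4 * E\<^sub>0)"
proof -
  note [measurable] = borel_fund_domain[OF basis]
  have m2: "(\<lambda>x. ennreal ((norm (U x))\<^sup>2)) \<in> borel_measurable borel" by measurable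
  have per: "periodic e (\<lambda>x. ennreal ((norm (U x))\<^sup>2))" using U_periodic by (simp add: periodic_def)
  have [measurable]: "(\<lambda>x. U (x + y)) \<in> borel_measurable borel"
    by (rule measurable_compose[OF _ U_borel]) measurable
  have "\<Phi> y \<le> (\<integral>\<^sup>+x. 2 * (ennreal ((norm (U (x + y)))\<^sup>2) * indicator (fund_domain e) x) + 2 * (ennreal ((norm (U x))\<^sup>2) * indicator (fund_domain e) x) \<partial>lborel)"
    unfolding \<Phi>_def
  proof (rule nn_integral_mono)
    fix x
    have "(norm (U (x + y) - U x))\<^sup>2 \<le> (norm (U (x + y)) + norm (U x))\<^sup>2" by (intro power_mono norm_triangle_ineq4) simp
    also have "\<dots> \<le> 2 * (norm (U (x + y)))\<^sup>2 + 2 * (norm (U x))\<^sup>2"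
      using sum_squares_bound[of "norm (U (x + y))" "norm (U x)"] by (simp add: power2_sum)
    finally have "ennreal ((norm (U (x + y) - U x))\<^sup>2) \<le> ennreal (2 * (norm (U (x + y)))\<^sup>2 + 2 * (norm (U x))\<^sup>2)" by (rule ennreal_leI)
    also have "\<dots> = 2 * ennreal ((norm (U (x + y)))\<^sup>2) + 2 * ennreal ((norm (U x))\<^sup>2)"
      by (simp add: ennreal_plus ennreal_mult)
    finally show "ennreal ((norm (U (x + y) - U x))\<^sup>2) * indicator (fund_domain e) x \<le>
      2 * (ennreal ((norm (U (x + y)))\<^sup>2) * indicator (fund_domain e) x) + 2 * (ennreal ((norm (U x))\<^sup>2) * indicator (fund_domain e) x)"
      by (auto simp: indicator_def)
  qed
  also have "\<dots> = 2 * (\<integral>\<^sup>+x\<in>fund_domain e. ennreal ((norm (U (x + y)))\<^sup>2) \<partial>lborel) + 2 * (\<integral>\<^sup>+x\<in>fund_domain e. ennreal ((norm (U x))\<^sup>2) \<partial>lborel)"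
    by (subst nn_integral_add) (simp_all add: nn_integral_cmult)
  also have "(\<integral>\<^sup>+x\<in>fund_domain e. ennreal ((norm (U (x + y)))\<^sup>2) \<partial>lborel) = (\<integral>\<^sup>+x\<in>fund_domain e. ennreal ((norm (U x))\<^sup>2) \<partial>lborel)"
    by (rule nn_integral_fund_domain_shift[OF basis m2 per])
  also have "2 * (\<integral>\<^sup>+x\<in>fund_domain e. ennreal ((norm (U x))\<^sup>2) \<partial>lborel) + 2 * (\<integral>\<^sup>+x\<in>fund_domain e. ennreal ((norm (U x))\<^sup>2) \<partial>lborel) = ennreal (4 * E\<^sub>0)"
    unfolding E0_eq using E0_nonneg by (simp add: ennreal_mult[symmetric] ennreal_plus[symmetric] del: ennreal_plus flip: ennreal_numeral)
  finally show ?thesis .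
qed

text \<open>Energies are stored at orbit representatives; fields and derivatives are unchanged by
  the translation to them.\<close>

lemma inv_rep:
  assumes T: "T \<in> ncells" and x: "x \<in> T"
  shows "(norm (w T x))\<^sup>2 * h ^ CARD('n) \<le> c\<^sub>1 * a (orep (orbit e T))"
    and "(h * norm (partial i (w T) x))\<^sup>2 * h ^ CARD('n) \<le> c\<^sub>1 * a (orep (orbit e T))"
    and "(norm (partial i (w T) x))\<^sup>2 * h ^ CARD('n) \<le> c\<^sub>1 * g (orep (orbit e T))"
proof -
  obtain l where l: "l \<in> lattice e" "orep (orbit e T) = (+) l ` T" using orep_orbit[of T] by blast
  have xl: "x + l \<in> (+) l ` T" using x by (simp add: mem_translate_iff)
  note n = ncell_translate[OF T l(1)]
  show "(norm (w T x))\<^sup>2 * h ^ CARD('n) \<le> c\<^sub>1 * a (orep (orbit e T))"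
    using inv_val[OF n xl] unfolding w_translate[OF T l(1) x] a_def l(2) .
  show "(h * norm (partial i (w T) x))\<^sup>2 * h ^ CARD('n) \<le> c\<^sub>1 * a (orep (orbit e T))"
    using inv_der[OF n xl, of i] unfolding partial_translate[OF T l(1) x] a_def l(2) .
  show "(norm (partial i (w T) x))\<^sup>2 * h ^ CARD('n) \<le> c\<^sub>1 * g (orep (orbit e T))"
    using inv_grad[OF n xl, of i] unfolding partial_translate[OF T l(1) x] g_def l(2) .
qed

lemma near_face:
  assumes "\<sigma>' \<in> nsimps" "\<tau> \<in> simplices_in K T" "\<tau> \<subseteq> \<sigma>'" "p \<in> \<sigma>" "q \<in> \<sigma>'" "norm (p - q) \<le> \<rho> * h"
  shows "near \<rho> \<sigma> T"
  unfolding near_def using assms by blast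

lemma near_cell:
  assumes "\<sigma>' \<in> nsimps" "p \<in> \<sigma>" "q \<in> \<sigma>'" "norm (p - q) \<le> \<rho> * h"
  shows "near \<rho> \<sigma> (cell_of \<sigma>')"
proof (rule near_face[OF assms(1) _ order_refl assms(2-4)])
  show "\<sigma>' \<in> simplices_in K (cell_of \<sigma>')"
    unfolding simplices_in_def using nsimps_D(1)[OF assms(1)] cell_of(2)[OF assms(1)] by blast
qed

lemma simplex_oscillation:
  assumes \<sigma>: "\<sigma> \<in> nsimps" and D: "\<And>x i. x \<in> \<sigma> \<Longrightarrow> h * norm (partial i (w (cell_of \<sigma>)) x) \<le> q"
    and xy: "x \<in> \<sigma>" "x' \<in> \<sigma>"
  shows "norm (w (cell_of \<sigma>) x - w (cell_of \<sigma>) x') \<le> real CARD('n) * (q / h) * norm (x - x')"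
proof (rule lipschitz_on_partial_bound[OF w_C1[OF cell_of(1)[OF \<sigma>]] nsimps_compact(2)[OF \<sigma>] _ xy])
  fix x i assume "x \<in> \<sigma>"
  from D[OF this, of i] show "norm (partial i (w (cell_of \<sigma>)) x) \<le> q / h" using h_pos by (simp add: le_divide_eq mult.commute)
qed

text \<open>Volume bound of a simplex times two contributions: the first from the Lipschitz
  estimate, with one of its two factors \<open>norm y / h\<close> bounded by
  \<open>\<kappa>\<^sup>2\<close>, the second from the layer, where
  \<open>norm y / \<rho>\<^sub>0\<close> appears.\<close>

definition cS :: real where
  "cS = unit_vol TYPE('n) / \<kappa> ^ CARD('n) * ((real CARD('n))\<^sup>2 * \<kappa>\<^sup>2 + real CARD('n) / \<kappa>\<^sup>2)"

lemma cS_nonneg: "0 \<le> cS"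
  unfolding cS_def using unit_vol_pos[where 'n='n] kappa by (intro mult_nonneg_nonneg divide_nonneg_nonneg add_nonneg_nonneg) auto

text \<open>Here \<open>q\<close> bounds the scaled derivatives and the oscillation towards
  neighbouring simplices. The first is used where \<open>x\<close> and \<open>x + y\<close> are in
  the same simplex, the second in the remaining layer.\<close>

lemma simplex_translation_estimate:
  assumes \<sigma>: "\<sigma> \<in> nsimps" and q: "0 \<le> q" and y: "norm y \<le> \<rho>\<^sub>0"
    and D: "\<And>x i. x \<in> \<sigma> \<Longrightarrow> h * norm (partial i (w (cell_of \<sigma>)) x) \<le> q"
    and O: "\<And>\<sigma>' x x'. \<sigma>' \<in> nsimps \<Longrightarrow> x \<in> \<sigma> \<Longrightarrow> x' \<in> \<sigma>' \<Longrightarrow> norm (x - x') \<le> \<rho>\<^sub>0 \<Longrightarrow>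
      norm (w (cell_of \<sigma>) x - w (cell_of \<sigma>') x') \<le> q"
  shows "(\<integral>\<^sup>+x\<in>\<sigma>. ennreal ((norm (U (x + y) - U x))\<^sup>2) \<partial>lborel) \<le> ennreal (cS * (norm y / h) * (h ^ CARD('n) * q\<^sup>2))"
proof -
  let ?n = "real CARD('n)"
  obtain x0 where x0: "cball x0 \<rho>\<^sub>0 \<subseteq> \<sigma>" using nsimps_ball[OF \<sigma>] by blast
  define A where "A = (?n * (q / h) * norm y)\<^sup>2"
  have T: "cell_of \<sigma> \<in> ncells" "\<sigma> \<subseteq> cell_of \<sigma>" using cell_of[OF \<sigma>] by auto
  have U\<sigma>: "U x = w (cell_of \<sigma>) x" if "x \<in> \<Omega>" "x \<in> \<sigma>" for x
    using U_eq_T[OF T(1) that(1)] T(2) that(2) by blast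
  have N: "negligible (- \<Omega> \<union> {x. x + y \<in> - \<Omega>})"
    using negligible_Omega negligible_translate[OF negligible_Omega] by (intro negligible_Un)
  have fa: "AE x in lborel. x \<in> \<sigma> \<and> x + y \<in> \<sigma> \<longrightarrow> ennreal ((norm (U (x + y) - U x))\<^sup>2) \<le> ennreal A"
  proof (rule AE_lborel_iff_negligible, intro exI conjI allI impI, rule N)
    fix x assume x: "x \<notin> - \<Omega> \<union> {x. x + y \<in> - \<Omega>}" "x \<in> \<sigma> \<and> x + y \<in> \<sigma>"
    have "norm (w (cell_of \<sigma>) (x + y) - w (cell_of \<sigma>) x) \<le> ?n * (q / h) * norm (x + y - x)"
      using x(2) by (intro simplex_oscillation[OF \<sigma> D]) auto
    then have "norm (U (x + y) - U x) \<le> ?n * (q / h) * norm y" using U\<sigma> x by simp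
    then show "ennreal ((norm (U (x + y) - U x))\<^sup>2) \<le> ennreal A" unfolding A_def by (intro ennreal_leI power_mono) auto
  qed
  have fb: "AE x in lborel. x \<in> \<sigma> \<longrightarrow> ennreal ((norm (U (x + y) - U x))\<^sup>2) \<le> ennreal (q\<^sup>2)"
  proof (rule AE_lborel_iff_negligible, intro exI conjI allI impI, rule N)
    fix x assume x: "x \<notin> - \<Omega> \<union> {x. x + y \<in> - \<Omega>}" "x \<in> \<sigma>"
    then obtain T1 where T1: "T1 \<in> ncells" "x + y \<in> interior T1" unfolding \<Omega>_def by blast
    then have "x + y \<in> T1" using interior_subset by blast
    \<comment> \<open>The simplex is chosen inside the cell whose interior contains
      \<open>x + y\<close>, so that its field is the one that defines \<open>U\<close>
      there.\<close>
    then obtain \<sigma>' where s': "\<sigma>' \<in> nsimps" "x + y \<in> \<sigma>'" "\<sigma>' \<subseteq> T1" using ncell_nsimps[OF T1(1)] by blast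
    have "cell_of \<sigma>' = T1" by (rule cell_of_eq[OF s'(1) T1(1) s'(3)])
    then have "U (x + y) = w (cell_of \<sigma>') (x + y)" using U_eq[OF T1] by simp
    moreover have "norm (w (cell_of \<sigma>) x - w (cell_of \<sigma>') (x + y)) \<le> q" by (rule O[OF s'(1) x(2) s'(2)]) (use y in simp)
    ultimately have "norm (U (x + y) - U x) \<le> q" using U\<sigma>[of x] x by (simp add: norm_minus_commute)
    then show "ennreal ((norm (U (x + y) - U x))\<^sup>2) \<le> ennreal (q\<^sup>2)" by (intro ennreal_leI power_mono) auto
  qed
  have "(\<integral>\<^sup>+x\<in>\<sigma>. ennreal ((norm (U (x + y) - U x))\<^sup>2) \<partial>lborel)
    \<le> ennreal ((A + q\<^sup>2 * (?n * norm y / \<rho>\<^sub>0)) * measure lborel \<sigma>)"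
    by (rule nn_integral_translation_layer[OF nsimps_compact(2)[OF \<sigma>] nsimps_compact(1)[OF \<sigma>] x0 rho0_pos y _ _ fa fb])
      (auto simp: A_def)
  also have "\<dots> \<le> ennreal (cS * (norm y / h) * (h ^ CARD('n) * q\<^sup>2))"
  proof (rule ennreal_leI)
    have "x0 \<in> \<sigma>" using x0 rho0_pos by (auto simp: subset_iff)
    then have "\<sigma> \<subseteq> cball x0 (h / \<kappa>)" using nsimps_norm[OF \<sigma>] by (auto simp: dist_norm)
    then have "measure lborel \<sigma> \<le> measure lborel (cball x0 (h / \<kappa>))"
      using nsimps_compact(1)[OF \<sigma>] by (intro measure_mono_bounded) (auto intro: borel_compact)
    also have "\<dots> = (h / \<kappa>) ^ CARD('n) * unit_vol TYPE('n)" using h_pos kappa by (intro measure_cball_unit_vol) simp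
    finally have m: "measure lborel \<sigma> \<le> (h / \<kappa>) ^ CARD('n) * unit_vol TYPE('n)" .
    have yh: "norm y / h \<le> \<kappa>\<^sup>2" using y h_pos by (simp add: \<rho>\<^sub>0_def divide_le_eq)
    have "A = q\<^sup>2 * (?n\<^sup>2 * ((norm y / h) * (norm y / h)))" by (simp add: A_def power2_eq_square)
    also have "\<dots> \<le> q\<^sup>2 * (?n\<^sup>2 * (\<kappa>\<^sup>2 * (norm y / h)))"
      using yh h_pos by (intro mult_left_mono mult_right_mono) auto
    finally have "A + q\<^sup>2 * (?n * norm y / \<rho>\<^sub>0) \<le> q\<^sup>2 * (norm y / h) * (?n\<^sup>2 * \<kappa>\<^sup>2 + ?n / \<kappa>\<^sup>2)"
      by (simp add: \<rho>\<^sub>0_def algebra_simps)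
    then have "(A + q\<^sup>2 * (?n * norm y / \<rho>\<^sub>0)) * measure lborel \<sigma>
      \<le> (q\<^sup>2 * (norm y / h) * (?n\<^sup>2 * \<kappa>\<^sup>2 + ?n / \<kappa>\<^sup>2)) * ((h / \<kappa>) ^ CARD('n) * unit_vol TYPE('n))"
      using m h_pos kappa by (intro mult_mono) (auto intro!: mult_nonneg_nonneg)
    also have "\<dots> = cS * (norm y / h) * (h ^ CARD('n) * q\<^sup>2)" by (simp add: cS_def power_divide mult_ac)
    finally show "(A + q\<^sup>2 * (?n * norm y / \<rho>\<^sub>0)) * measure lborel \<sigma> \<le> cS * (norm y / h) * (h ^ CARD('n) * q\<^sup>2)" .
  qed
  finally show ?thesis .
qed

text \<open>Common frame for the two bounds at short range. The size q of a simplex is chosen with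
  q^2 h^n = \<open>Z * E \<sigma>\<close>, so that the volumes cancel and the local energies can be
  summed.\<close>

lemma Phi_from_simplices:
  assumes y: "norm y \<le> \<rho>\<^sub>0" and Z: "0 \<le> Z" and E: "\<And>\<sigma>. \<sigma> \<in> nsimps \<Longrightarrow> 0 \<le> E \<sigma>"
    and D: "\<And>\<sigma> x i. \<sigma> \<in> nsimps \<Longrightarrow> x \<in> \<sigma> \<Longrightarrow> h * norm (partial i (w (cell_of \<sigma>)) x) \<le> sqrt (Z * E \<sigma> / h ^ CARD('n))"
    and O: "\<And>\<sigma> \<sigma>' x x'. \<sigma> \<in> nsimps \<Longrightarrow> \<sigma>' \<in> nsimps \<Longrightarrow> x \<in> \<sigma> \<Longrightarrow> x' \<in> \<sigma>' \<Longrightarrow> norm (x - x') \<le> \<rho>\<^sub>0 \<Longrightarrow>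
      norm (w (cell_of \<sigma>) x - w (cell_of \<sigma>') x') \<le> sqrt (Z * E \<sigma> / h ^ CARD('n))"
    and sumE: "(\<Sum>Q\<in>orbit e ` nsimps. E (orep Q)) \<le> S"
  shows "\<Phi> y \<le> ennreal (cS * (norm y / h) * (Z * S))"
proof -
  have rep: "orep Q \<in> nsimps" if "Q \<in> orbit e ` nsimps" for Q using orep_mem[OF invariant_nsimps that] by simp
  have "\<Phi> y \<le> (\<Sum>Q\<in>orbit e ` nsimps. \<integral>\<^sup>+x\<in>orep Q. ennreal ((norm (U (x + y) - U x))\<^sup>2) \<partial>lborel)" by (rule Phi_le_sum)
  also have "\<dots> \<le> (\<Sum>Q\<in>orbit e ` nsimps. ennreal (cS * (norm y / h) * (Z * E (orep Q))))"
  proof (rule sum_mono)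
    fix Q assume "Q \<in> orbit e ` nsimps"
    note s = rep[OF this]
    have nn: "0 \<le> Z * E (orep Q) / h ^ CARD('n)" using Z E[OF s] h_pos by simp
    have "(\<integral>\<^sup>+x\<in>orep Q. ennreal ((norm (U (x + y) - U x))\<^sup>2) \<partial>lborel)
      \<le> ennreal (cS * (norm y / h) * (h ^ CARD('n) * (sqrt (Z * E (orep Q) / h ^ CARD('n)))\<^sup>2))"
      by (rule simplex_translation_estimate[OF s _ y D[OF s] O[OF s]]) (use nn in auto)
    also have "h ^ CARD('n) * (sqrt (Z * E (orep Q) / h ^ CARD('n)))\<^sup>2 = Z * E (orep Q)"
      using nn h_pos by simp
    finally show "(\<integral>\<^sup>+x\<in>orep Q. ennreal ((norm (U (x + y) - U x))\<^sup>2) \<partial>lborel) \<le> ennreal (cS * (norm y / h) * (Z * E (orep Q)))" .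
  qed
  also have "\<dots> = ennreal (\<Sum>Q\<in>orbit e ` nsimps. cS * (norm y / h) * (Z * E (orep Q)))"
    using cS_nonneg h_pos Z E rep by (intro sum_ennreal mult_nonneg_nonneg) auto
  also have "(\<Sum>Q\<in>orbit e ` nsimps. cS * (norm y / h) * (Z * E (orep Q))) = cS * (norm y / h) * (Z * (\<Sum>Q\<in>orbit e ` nsimps. E (orep Q)))"
    by (simp add: sum_distrib_left)
  also have "ennreal \<dots> \<le> ennreal (cS * (norm y / h) * (Z * S))"
    using sumE cS_nonneg h_pos Z by (intro ennreal_leI mult_left_mono mult_nonneg_nonneg) auto
  finally show ?thesis .
qed

lemma sqrt_bound: "0 \<le> b \<Longrightarrow> 0 < d \<Longrightarrow> b\<^sup>2 * d \<le> c \<Longrightarrow> b \<le> sqrt (c / d)"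
  by (intro real_le_rsqrt) (simp add: le_divide_eq)

text \<open>Each neighbouring cell contributes the value at the representative of its orbit, to
  match \<open>double_count\<close>.\<close>

definition near_sum :: "real \<Rightarrow> 'n point set set \<Rightarrow> ('n point set \<Rightarrow> real) \<Rightarrow> 'n point set \<Rightarrow> real" where
  "near_sum \<rho> S f \<sigma> = (\<Sum>T | T \<in> S \<and> near \<rho> \<sigma> T. f (orep (orbit e T)))"

lemma near_sum_ge:
  assumes S: "S \<subseteq> C" "0 \<le> \<rho>" "\<sigma> \<in> nsimps" and f: "\<And>T. T \<in> S \<Longrightarrow> 0 \<le> f (orep (orbit e T))"
    and T: "T \<in> S" "near \<rho> \<sigma> T"
  shows "f (orep (orbit e T)) \<le> near_sum \<rho> S f \<sigma>"
proof -
  have "finite {T. T \<in> S \<and> near \<rho> \<sigma> T}" by (rule finite_subset[OF _ finite_near[OF S(2,3)]]) (use S(1) in auto)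
  then show ?thesis unfolding near_sum_def using T f by (intro member_le_sum) auto
qed

lemma near_sum_nonneg: "(\<And>T. T \<in> S \<Longrightarrow> 0 \<le> f (orep (orbit e T))) \<Longrightarrow> 0 \<le> near_sum \<rho> S f \<sigma>"
  unfolding near_sum_def by (rule sum_nonneg) auto

definition K1 :: real where
  "K1 = cS * (4 * c\<^sub>1 * (real N * pack (\<kappa>\<^sup>2 + 1 / \<kappa>)))"

text \<open>Oscillation is bounded by the sum of the values at the two points, and values as well as
  scaled derivatives by the L^2 energy of the cells nearby.\<close>

lemma Phi_small_L2:
  assumes y: "norm y \<le> \<rho>\<^sub>0"
  shows "\<Phi> y \<le> ennreal (K1 * (norm y / h) * E\<^sub>0)"
proof -
  have k2: "0 \<le> \<kappa>\<^sup>2" by simp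
  have nC: "ncells \<subseteq> C" using ncells_C by blast
  let ?E = "near_sum (\<kappa>\<^sup>2) ncells a"
  have E0: "0 \<le> ?E \<sigma>" for \<sigma> by (rule near_sum_nonneg) (rule a_nonneg)
  have hn: "0 < h ^ CARD('n)" using h_pos by simp
  have ge: "a (orep (orbit e (cell_of \<sigma>'))) \<le> ?E \<sigma>" if "\<sigma> \<in> nsimps" "\<sigma>' \<in> nsimps" "x \<in> \<sigma>" "x' \<in> \<sigma>'" "norm (x - x') \<le> \<rho>\<^sub>0" for \<sigma> \<sigma>' x x'
    by (rule near_sum_ge[OF nC k2 that(1) a_nonneg cell_of(1)[OF that(2)]], rule near_cell[OF that(2-4)])
      (use that(5) in \<open>simp add: \<rho>\<^sub>0_def\<close>)
  have val: "norm (w (cell_of \<sigma>') x') \<le> sqrt (c\<^sub>1 * ?E \<sigma> / h ^ CARD('n))"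
    if s: "\<sigma> \<in> nsimps" "\<sigma>' \<in> nsimps" "x \<in> \<sigma>" "x' \<in> \<sigma>'" "norm (x - x') \<le> \<rho>\<^sub>0" for \<sigma> \<sigma>' x x'
  proof (rule sqrt_bound[OF norm_ge_zero hn])
    have "x' \<in> cell_of \<sigma>'" using s(4) cell_of(2)[OF s(2)] by blast
    from inv_rep(1)[OF cell_of(1)[OF s(2)] this]
    have "(norm (w (cell_of \<sigma>') x'))\<^sup>2 * h ^ CARD('n) \<le> c\<^sub>1 * a (orep (orbit e (cell_of \<sigma>')))" .
    also have "\<dots> \<le> c\<^sub>1 * ?E \<sigma>" using ge[OF s] c1 by (rule mult_left_mono)
    finally show "(norm (w (cell_of \<sigma>') x'))\<^sup>2 * h ^ CARD('n) \<le> c\<^sub>1 * ?E \<sigma>" .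
  qed
  \<comment> \<open>The factor 4 under the root allows for two values, each bounded by the root
    without it.\<close>
  have four: "sqrt (4 * c\<^sub>1 * ?E \<sigma> / h ^ CARD('n)) = 2 * sqrt (c\<^sub>1 * ?E \<sigma> / h ^ CARD('n))" for \<sigma>
  proof -
    have "4 * c\<^sub>1 * ?E \<sigma> / h ^ CARD('n) = 4 * (c\<^sub>1 * ?E \<sigma> / h ^ CARD('n))" by simp
    then show ?thesis by (simp only: real_sqrt_mult real_sqrt_four)
  qed
  have sum: "(\<Sum>Q\<in>orbit e ` nsimps. ?E (orep Q)) \<le> real N * pack (\<kappa>\<^sup>2 + 1 / \<kappa>) * E\<^sub>0"
  proof -
    have "(\<Sum>Q\<in>orbit e ` nsimps. ?E (orep Q)) \<le> real N * pack (\<kappa>\<^sup>2 + 1 / \<kappa>) * sum_mod e a ncells"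
      unfolding near_sum_def by (rule double_count[OF invariant_ncells nC k2 a_nonneg])
    also have "\<dots> \<le> real N * pack (\<kappa>\<^sup>2 + 1 / \<kappa>) * E\<^sub>0"
      using sum_a_le kappa by (intro mult_left_mono mult_nonneg_nonneg) (auto simp: pack_def intro!: zero_le_power divide_nonneg_nonneg add_nonneg_nonneg)
    finally show ?thesis .
  qed
  have "\<Phi> y \<le> ennreal (cS * (norm y / h) * (4 * c\<^sub>1 * (real N * pack (\<kappa>\<^sup>2 + 1 / \<kappa>) * E\<^sub>0)))"
  proof (rule Phi_from_simplices[OF y _ E0 _ _ sum])
    show "0 \<le> 4 * c\<^sub>1" using c1 by simp
    fix \<sigma> x i assume s: "\<sigma> \<in> nsimps" "x \<in> \<sigma>"
    have "h * norm (partial i (w (cell_of \<sigma>)) x) \<le> sqrt (c\<^sub>1 * ?E \<sigma> / h ^ CARD('n))"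
    proof (rule sqrt_bound[OF _ hn])
      have "x \<in> cell_of \<sigma>" using s cell_of(2) by blast
      from inv_rep(2)[OF cell_of(1)[OF s(1)] this, of i]
      have "(h * norm (partial i (w (cell_of \<sigma>)) x))\<^sup>2 * h ^ CARD('n) \<le> c\<^sub>1 * a (orep (orbit e (cell_of \<sigma>)))" .
      also have "\<dots> \<le> c\<^sub>1 * ?E \<sigma>" using ge[OF s(1) s(1) s(2) s(2)] rho0_pos c1 by (intro mult_left_mono) auto
      finally show "(h * norm (partial i (w (cell_of \<sigma>)) x))\<^sup>2 * h ^ CARD('n) \<le> c\<^sub>1 * ?E \<sigma>" .
    qed (use h_pos in simp)
    moreover have "0 \<le> sqrt (c\<^sub>1 * ?E \<sigma> / h ^ CARD('n))" using c1 E0 h_pos by simp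
    ultimately show "h * norm (partial i (w (cell_of \<sigma>)) x) \<le> sqrt (4 * c\<^sub>1 * ?E \<sigma> / h ^ CARD('n))" unfolding four by linarith
  next
    fix \<sigma> \<sigma>' x x' assume s: "\<sigma> \<in> nsimps" "\<sigma>' \<in> nsimps" "x \<in> \<sigma>" "x' \<in> \<sigma>'" "norm (x - x') \<le> \<rho>\<^sub>0"
    have "norm (w (cell_of \<sigma>) x - w (cell_of \<sigma>') x') \<le> norm (w (cell_of \<sigma>) x) + norm (w (cell_of \<sigma>') x')" by (rule norm_triangle_ineq4)
    also have "\<dots> \<le> sqrt (c\<^sub>1 * ?E \<sigma> / h ^ CARD('n)) + sqrt (c\<^sub>1 * ?E \<sigma> / h ^ CARD('n))"
      using rho0_pos by (intro add_mono val[OF s] val[OF s(1,1,3,3)]) simp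
    finally show "norm (w (cell_of \<sigma>) x - w (cell_of \<sigma>') x') \<le> sqrt (4 * c\<^sub>1 * ?E \<sigma> / h ^ CARD('n))" unfolding four by simp
  qed
  then show ?thesis by (simp add: K1_def mult_ac)
qed

text \<open>Number of steps times cost per step. A chain has at most as many steps as there are
  ordered pairs of nearby simplices, whence the square of \<open>pack\<close>; n /
  \<open>\<kappa>\<close> is the oscillation across a simplex of diameter
  \<open>h / \<kappa>\<close>, and 1 stands for a jump.\<close>

definition KP :: real where
  "KP = (2 * (pack (\<kappa>\<^sup>2 + 1 / \<kappa>))\<^sup>2 + 1) * (real CARD('n) / \<kappa> + 1)"

definition K2 :: real where
  "K2 = cS * (KP\<^sup>2 * (c\<^sub>1 + 1 / cJ) * (real N * pack (\<kappa>\<^sup>2 + 1 / \<kappa> + 1 / \<kappa>)))"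

text \<open>Each step passes through a point of the common facet with a jump of at most
  \<open>q\<close> and then crosses the next simplex: two units per step, and one for the first
  simplex.\<close>

lemma chain_oscillation:
  assumes \<sigma>: "\<sigma> \<in> \<S>" "\<S> \<subseteq> nsimps" and q: "0 \<le> q"
    and D: "\<And>s x i. s \<in> \<S> \<Longrightarrow> x \<in> s \<Longrightarrow> h * norm (partial i (w (cell_of s)) x) \<le> q"
    and J: "\<And>s t. (s, t) \<in> adj \<S> \<Longrightarrow> \<exists>z\<in>s \<inter> t. norm (w (cell_of s) z - w (cell_of t) z) \<le> q"
    and st: "(\<sigma>, \<tau>) \<in> adj \<S> ^^ k" and x: "x \<in> \<sigma>"
  shows "\<tau> \<in> \<S> \<and> (\<forall>z\<in>\<tau>. norm (w (cell_of \<sigma>) x - w (cell_of \<tau>) z) \<le> (2 * real k + 1) * ((real CARD('n) / \<kappa> + 1) * q))"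
proof -
  define m where "m = (real CARD('n) / \<kappa> + 1) * q"
  have m: "0 \<le> m" "q \<le> m" using q kappa by (auto simp: m_def algebra_simps)
  have osc: "norm (w (cell_of s) x - w (cell_of s) z) \<le> m" if "s \<in> \<S>" "x \<in> s" "z \<in> s" for s x z
  proof -
    have s: "s \<in> nsimps" using that \<sigma>(2) by blast
    have "norm (w (cell_of s) x - w (cell_of s) z) \<le> real CARD('n) * (q / h) * norm (x - z)"
      by (rule simplex_oscillation[OF s D[OF that(1)] that(2,3)])
    also have "\<dots> \<le> real CARD('n) * (q / h) * (h / \<kappa>)"
      using nsimps_norm[OF s that(2,3)] q h_pos by (intro mult_left_mono) auto
    also have "\<dots> = real CARD('n) / \<kappa> * q" using h_pos by simp
    also have "\<dots> \<le> m" using q by (simp add: m_def algebra_simps)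
    finally show ?thesis .
  qed
  have "\<tau> \<in> \<S> \<and> (\<forall>z\<in>\<tau>. norm (w (cell_of \<sigma>) x - w (cell_of \<tau>) z) \<le> (2 * real k + 1) * m)"
    using st
  proof (induction k arbitrary: \<tau>)
    case 0
    then show ?case using osc[OF \<sigma>(1) x] \<sigma>(1) by simp
  next
    case (Suc k)
    then obtain s where s: "(\<sigma>, s) \<in> adj \<S> ^^ k" "(s, \<tau>) \<in> adj \<S>" by auto
    note IH = Suc.IH[OF s(1)]
    have \<tau>: "\<tau> \<in> \<S>" using s(2) by (simp add: adj_def)
    obtain v where v: "v \<in> s" "v \<in> \<tau>" "norm (w (cell_of s) v - w (cell_of \<tau>) v) \<le> q" using J[OF s(2)] by blast
    have "norm (w (cell_of \<sigma>) x - w (cell_of \<tau>) z) \<le> (2 * real (Suc k) + 1) * m" if z: "z \<in> \<tau>" for z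
    proof -
      have 1: "norm (w (cell_of \<sigma>) x - w (cell_of s) v) \<le> (2 * real k + 1) * m" using IH v(1) by blast
      have 2: "norm (w (cell_of \<tau>) v - w (cell_of \<tau>) z) \<le> m" by (rule osc[OF \<tau> v(2) z])
      have "norm (w (cell_of \<sigma>) x - w (cell_of \<tau>) z) \<le> norm (w (cell_of \<sigma>) x - w (cell_of s) v)
        + norm (w (cell_of s) v - w (cell_of \<tau>) v) + norm (w (cell_of \<tau>) v - w (cell_of \<tau>) z)"
        using norm_triangle_ineq[of "w (cell_of \<sigma>) x - w (cell_of s) v" "w (cell_of s) v - w (cell_of \<tau>) z"]
          norm_triangle_ineq[of "w (cell_of s) v - w (cell_of \<tau>) v" "w (cell_of \<tau>) v - w (cell_of \<tau>) z"] by simp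
      also have "\<dots> \<le> (2 * real k + 1) * m + m + m" using 1 2 v(3) m by linarith
      finally show ?thesis by (simp add: algebra_simps)
    qed
    then show ?case using \<tau> by blast
  qed
  then show ?thesis unfolding m_def .
qed

text \<open>Values are not controlled by \<open>E\<^sub>1\<close>, so the oscillation between two
  simplices is followed along a chain of adjacent ones, using derivatives inside simplices and jumps
  between cells.\<close>

lemma Phi_small_H1:
  assumes y: "norm y \<le> \<rho>\<^sub>0"
  shows "\<Phi> y \<le> ennreal (K2 * (norm y / h) * (h\<^sup>2 * E\<^sub>1))"
proof -
  \<comment> \<open>Range of the chain: \<open>\<kappa>\<^sup>2\<close> for the translation and 1 /
    \<open>\<kappa>\<close> for the diameter of the simplices at its ends.\<close>
  define \<rho> where "\<rho> = \<kappa>\<^sup>2 + 1 / \<kappa>"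
  have \<rho>: "0 \<le> \<rho>" using kappa by (simp add: \<rho>_def)
  have nC: "ncells \<subseteq> C" "faces \<subseteq> C" using ncells_C by (auto simp: faces_def)
  define E where "E \<sigma> = near_sum \<rho> ncells g \<sigma> + near_sum \<rho> faces fj \<sigma>" for \<sigma>
  have invf: "invariant faces" unfolding faces_def by (rule invariant_faces)
  have fjr: "0 \<le> fj (orep (orbit e T))" if "T \<in> faces" for T
    using orep_mem[OF invf imageI[OF that]] nC(2) by (intro fj_nonneg) blast
  have En: "0 \<le> near_sum \<rho> ncells g \<sigma>" "0 \<le> near_sum \<rho> faces fj \<sigma>" for \<sigma>
    by (auto intro!: near_sum_nonneg g_nonneg fjr)
  then have E0: "0 \<le> E \<sigma>" for \<sigma> by (simp add: E_def)
  have hn: "0 < h ^ CARD('n)" using h_pos by simp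
  \<comment> \<open>One constant for both sources: \<open>c\<^sub>1\<close> belongs to the
    derivatives, 1 / \<open>cJ\<close> to the jumps, and both carry the factor
    \<open>h\<^sup>2\<close>.\<close>
  define Z where "Z = (c\<^sub>1 + 1 / cJ) * h\<^sup>2"
  have Z: "c\<^sub>1 * h\<^sup>2 \<le> Z" "h\<^sup>2 / cJ \<le> Z" "0 \<le> Z" using c1 cJ_pos by (auto simp: Z_def distrib_right)
  define q where "q \<sigma> = sqrt (Z * E \<sigma> / h ^ CARD('n))" for \<sigma>
  have q0: "0 \<le> q \<sigma>" for \<sigma> using Z E0 h_pos by (simp add: q_def)
  have nh: "h ^ CARD('n) = h * h ^ (CARD('n) - 1)" by (simp add: power_eq_if)
  have D: "h * norm (partial i (w (cell_of s)) z) \<le> q \<sigma>"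
    if \<sigma>: "\<sigma> \<in> nsimps" "x \<in> \<sigma>" and s: "s \<in> nsimps" "z' \<in> s" "norm (x - z') \<le> \<rho> * h" "z \<in> s" for \<sigma> x s z z' i
    unfolding q_def
  proof (rule sqrt_bound[OF _ hn])
    have "z \<in> cell_of s" using s cell_of(2) by blast
    from inv_rep(3)[OF cell_of(1)[OF s(1)] this, of i]
    have "(norm (partial i (w (cell_of s)) z))\<^sup>2 * h ^ CARD('n) \<le> c\<^sub>1 * g (orep (orbit e (cell_of s)))" .
    also have "\<dots> \<le> c\<^sub>1 * E \<sigma>"
      using near_sum_ge[where f=g, OF nC(1) \<rho> \<sigma>(1) g_nonneg cell_of(1)[OF s(1)] near_cell[OF s(1) \<sigma>(2) s(2,3)]] En[of \<sigma>] c1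
      by (intro mult_left_mono) (auto simp: E_def)
    finally have "h\<^sup>2 * ((norm (partial i (w (cell_of s)) z))\<^sup>2 * h ^ CARD('n)) \<le> h\<^sup>2 * (c\<^sub>1 * E \<sigma>)" by (intro mult_left_mono) auto
    also have "\<dots> = (c\<^sub>1 * h\<^sup>2) * E \<sigma>" by simp
    also have "\<dots> \<le> Z * E \<sigma>" using Z E0 by (intro mult_right_mono) auto
    finally show "(h * norm (partial i (w (cell_of s)) z))\<^sup>2 * h ^ CARD('n) \<le> Z * E \<sigma>" by (simp add: power_mult_distrib mult_ac)
  qed (use h_pos in simp)
  have J: "\<exists>z\<in>s \<inter> t. norm (w (cell_of s) z - w (cell_of t) z) \<le> q \<sigma>"
    if \<sigma>: "\<sigma> \<in> nsimps" "x \<in> \<sigma>" and s: "s \<in> nsimps" "z' \<in> s" "norm (x - z') \<le> \<rho> * h" and t: "t \<in> nsimps"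
      and dim: "aff_dim (s \<inter> t) = int CARD('n) - 1" for \<sigma> x s t z'
  proof (cases "cell_of s = cell_of t")
    \<comment> \<open>Inside one cell the field is continuous across the facet: the jump is 0 and
      any common point will do.\<close>
    case True
    have "s \<inter> t \<noteq> {}"
    proof
      assume "s \<inter> t = {}"
      then have "aff_dim (s \<inter> t) = -1" by simp
      then show False using dim by simp
    qed
    then show ?thesis using True q0 by auto
  next
    case False
    obtain T' z where T': "T' \<in> faces" "s \<inter> t \<in> simplices_in K T'" and z: "z \<in> s \<inter> t"
      "(norm (w (cell_of s) z - w (cell_of t) z))\<^sup>2 * (cJ * h ^ (CARD('n) - 1)) \<le> h * fj (orep (orbit e T'))"
      using jump_bound[OF s(1) t cell_of(1)[OF s(1)] cell_of(1)[OF t] False cell_of(2)[OF s(1)] cell_of(2)[OF t] dim] by blast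
    have "near \<rho> \<sigma> T'" by (rule near_face[OF s(1) T'(2) _ \<sigma>(2) s(2,3)]) blast
    then have "fj (orep (orbit e T')) \<le> E \<sigma>"
      using near_sum_ge[where f=fj, OF nC(2) \<rho> \<sigma>(1) fjr T'(1)] En[of \<sigma>] by (simp add: E_def)
    then have "h * fj (orep (orbit e T')) \<le> h * E \<sigma>" using h_pos by simp
    then have le: "(norm (w (cell_of s) z - w (cell_of t) z))\<^sup>2 * (cJ * h ^ (CARD('n) - 1)) \<le> h * E \<sigma>" using z(2) by linarith
    have "norm (w (cell_of s) z - w (cell_of t) z) \<le> q \<sigma>" unfolding q_def
    proof (rule sqrt_bound[OF norm_ge_zero hn])
      have "(norm (w (cell_of s) z - w (cell_of t) z))\<^sup>2 * h ^ CARD('n)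
        = (h / cJ) * ((norm (w (cell_of s) z - w (cell_of t) z))\<^sup>2 * (cJ * h ^ (CARD('n) - 1)))"
        using cJ_pos unfolding nh by simp
      also have "\<dots> \<le> (h / cJ) * (h * E \<sigma>)" using le h_pos cJ_pos by (intro mult_left_mono) auto
      also have "\<dots> = (h\<^sup>2 / cJ) * E \<sigma>" by (simp add: power2_eq_square)
      also have "\<dots> \<le> Z * E \<sigma>" using Z E0 by (intro mult_right_mono) auto
      finally show "(norm (w (cell_of s) z - w (cell_of t) z))\<^sup>2 * h ^ CARD('n) \<le> Z * E \<sigma>" .
    qed
    then show ?thesis using z(1) by blast
  qed
  have KP1: "1 \<le> KP" "0 \<le> KP" unfolding KP_def using kappa
    by (auto simp: distrib_right distrib_left intro!: add_increasing add_nonneg_nonneg mult_nonneg_nonneg)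
  have KPq: "sqrt (KP\<^sup>2 * Z * E \<sigma> / h ^ CARD('n)) = KP * q \<sigma>" for \<sigma>
  proof -
    have "KP\<^sup>2 * Z * E \<sigma> / h ^ CARD('n) = KP\<^sup>2 * (Z * E \<sigma> / h ^ CARD('n))" by simp
    then show ?thesis unfolding q_def using KP1 by (simp only: real_sqrt_mult real_sqrt_abs abs_of_nonneg)
  qed
  have sum: "(\<Sum>Q\<in>orbit e ` nsimps. E (orep Q)) \<le> real N * pack (\<rho> + 1 / \<kappa>) * E\<^sub>1"
  proof -
    have "(\<Sum>Q\<in>orbit e ` nsimps. near_sum \<rho> ncells g (orep Q)) \<le> real N * pack (\<rho> + 1 / \<kappa>) * sum_mod e g ncells"
      unfolding near_sum_def by (rule double_count[OF invariant_ncells nC(1) \<rho> g_nonneg])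
    moreover have "(\<Sum>Q\<in>orbit e ` nsimps. near_sum \<rho> faces fj (orep Q)) \<le> real N * pack (\<rho> + 1 / \<kappa>) * sum_mod e fj faces"
      unfolding near_sum_def
    proof (rule double_count[OF invf nC(2) \<rho>])
      fix Q assume "Q \<in> orbit e ` faces"
      then show "0 \<le> fj (orep Q)" using fjr by blast
    qed
    ultimately show ?thesis unfolding E_def E1_eq by (simp add: sum.distrib distrib_left)
  qed
  have "\<Phi> y \<le> ennreal (cS * (norm y / h) * (KP\<^sup>2 * Z * (real N * pack (\<rho> + 1 / \<kappa>) * E\<^sub>1)))"
  proof (rule Phi_from_simplices[OF y _ E0 _ _ sum])
    show "0 \<le> KP\<^sup>2 * Z" using Z by simp
    fix \<sigma> x i assume s: "\<sigma> \<in> nsimps" "x \<in> \<sigma>"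
    have "h * norm (partial i (w (cell_of \<sigma>)) x) \<le> q \<sigma>" using D[OF s s] \<rho> h_pos s by simp
    also have "\<dots> \<le> KP * q \<sigma>" using KP1 q0[of \<sigma>] by (simp add: mult_le_cancel_right1)
    finally show "h * norm (partial i (w (cell_of \<sigma>)) x) \<le> sqrt (KP\<^sup>2 * Z * E \<sigma> / h ^ CARD('n))" unfolding KPq .
  next
    fix \<sigma> \<sigma>' x x' assume s: "\<sigma> \<in> nsimps" "\<sigma>' \<in> nsimps" "x \<in> \<sigma>" "x' \<in> \<sigma>'" "norm (x - x') \<le> \<rho>\<^sub>0"
    define \<S> where "\<S> = {s \<in> nsimps. s \<inter> cball x (\<rho> * h) \<noteq> {}}"
    have fin: "finite \<S>" and card: "real (card \<S>) \<le> pack \<rho>" unfolding \<S>_def using nsimps_locally_finite[OF \<rho>] by auto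
    have "x \<in> cball x (\<rho> * h)" using \<rho> h_pos by simp
    then have \<sigma>S: "\<sigma> \<in> \<S>" unfolding \<S>_def using s(1,3) by blast
    have "(\<sigma>, \<sigma>') \<in> (adj \<S>)\<^sup>*" unfolding \<S>_def \<rho>_def
      by (rule chain_exists[OF s(1,2,3,4)]) (use s(5) in \<open>auto simp: \<rho>\<^sub>0_def\<close>)
    moreover have adjsub: "adj \<S> \<subseteq> \<S> \<times> \<S>" unfolding adj_def by blast
    then have finadj: "finite (adj \<S>)" using fin by (meson finite_SigmaI finite_subset)
    \<comment> \<open>A path in a finite relation can be shortened to at most as many steps as the
      relation has pairs.\<close>
    ultimately obtain k where k: "k \<le> card (adj \<S>)" "(\<sigma>, \<sigma>') \<in> adj \<S> ^^ k"
      using rtrancl_finite_eq_relpow[OF finadj] by auto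
    have "card (adj \<S>) \<le> card (\<S> \<times> \<S>)" using adjsub fin by (intro card_mono) auto
    then have "real k \<le> real (card \<S>) * real (card \<S>)" using k(1) by (simp add: card_cartesian_product flip: of_nat_mult)
    also have "\<dots> \<le> pack \<rho> * pack \<rho>" using card by (intro mult_mono) auto
    finally have kP: "real k \<le> (pack \<rho>)\<^sup>2" by (simp add: power2_eq_square)
    have pt: "\<exists>z'\<in>s. norm (x - z') \<le> \<rho> * h" "s \<in> nsimps" if "s \<in> \<S>" for s
      using that unfolding \<S>_def by (auto simp: dist_norm)
    have "\<sigma>' \<in> \<S> \<and> (\<forall>z\<in>\<sigma>'. norm (w (cell_of \<sigma>) x - w (cell_of \<sigma>') z) \<le> (2 * real k + 1) * ((real CARD('n) / \<kappa> + 1) * q \<sigma>))"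
    proof (rule chain_oscillation[OF \<sigma>S _ q0 _ _ k(2) s(3)])
      show "\<S> \<subseteq> nsimps" unfolding \<S>_def by blast
      show "h * norm (partial i (w (cell_of s')) z) \<le> q \<sigma>" if "s' \<in> \<S>" "z \<in> s'" for s' z i
        using pt[OF that(1)] D[OF s(1,3)] that(2) by blast
      show "\<exists>z\<in>s' \<inter> t. norm (w (cell_of s') z - w (cell_of t) z) \<le> q \<sigma>" if "(s', t) \<in> adj \<S>" for s' t
      proof -
        have st: "s' \<in> \<S>" "t \<in> \<S>" "aff_dim (s' \<inter> t) = int CARD('n) - 1" using that by (auto simp: adj_def)
        obtain z' where "z' \<in> s'" "norm (x - z') \<le> \<rho> * h" using pt(1)[OF st(1)] by blast
        from J[OF s(1,3) pt(2)[OF st(1)] this pt(2)[OF st(2)] st(3)] show ?thesis .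
      qed
    qed
    then have "norm (w (cell_of \<sigma>) x - w (cell_of \<sigma>') x') \<le> (2 * real k + 1) * ((real CARD('n) / \<kappa> + 1) * q \<sigma>)" using s(4) by blast
    also have "\<dots> \<le> (2 * (pack \<rho>)\<^sup>2 + 1) * ((real CARD('n) / \<kappa> + 1) * q \<sigma>)"
      using kP q0[of \<sigma>] kappa by (intro mult_right_mono mult_nonneg_nonneg add_nonneg_nonneg) auto
    also have "\<dots> = KP * q \<sigma>" by (simp add: KP_def \<rho>_def)
    finally show "norm (w (cell_of \<sigma>) x - w (cell_of \<sigma>') x') \<le> sqrt (KP\<^sup>2 * Z * E \<sigma> / h ^ CARD('n))" unfolding KPq .
  qed
  also have "cS * (norm y / h) * (KP\<^sup>2 * Z * (real N * pack (\<rho> + 1 / \<kappa>) * E\<^sub>1)) = K2 * (norm y / h) * (h\<^sup>2 * E\<^sub>1)"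
    unfolding K2_def Z_def \<rho>_def by (simp only: mult_ac)
  finally show ?thesis .
qed

text \<open>Split into \<open>M\<close> equal steps: Cauchy-Schwarz contributes one factor
  \<open>M\<close>, and the \<open>M\<close> shifted terms, equal by shift invariance, the
  other.\<close>

lemma Phi_telescope: "\<Phi> (real M *\<^sub>R z) \<le> ennreal ((real M)\<^sup>2) * \<Phi> z"
proof -
  note [measurable] = borel_fund_domain[OF basis]
  let ?d = "\<lambda>x. ennreal ((norm (U (x + z) - U x))\<^sup>2)"
  have sh[measurable]: "(\<lambda>x. ?d (x + v)) \<in> borel_measurable borel" for v
    by (rule measurable_compose[OF _ diff_measurable]) measurable
  have pt: "(norm (U (x + real M *\<^sub>R z) - U x))\<^sup>2 \<le> real M * (\<Sum>i<M. (norm (U (x + real i *\<^sub>R z + z) - U (x + real i *\<^sub>R z)))\<^sup>2)" for x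
  proof -
    have "U (x + real M *\<^sub>R z) - U x = (\<Sum>i<M. U (x + real (Suc i) *\<^sub>R z) - U (x + real i *\<^sub>R z))"
      using sum_lessThan_telescope[of "\<lambda>i. U (x + real i *\<^sub>R z)" M] by simp
    also have "\<dots> = (\<Sum>i<M. U (x + real i *\<^sub>R z + z) - U (x + real i *\<^sub>R z))"
      by (intro sum.cong refl) (simp add: algebra_simps)
    finally have "norm (U (x + real M *\<^sub>R z) - U x) \<le> (\<Sum>i<M. norm (U (x + real i *\<^sub>R z + z) - U (x + real i *\<^sub>R z)))"
      by (simp add: norm_sum)
    then have "(norm (U (x + real M *\<^sub>R z) - U x))\<^sup>2 \<le> (\<Sum>i<M. norm (U (x + real i *\<^sub>R z + z) - U (x + real i *\<^sub>R z)))\<^sup>2"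
      by (intro power_mono) auto
    also have "\<dots> \<le> (\<Sum>i<M. (norm (U (x + real i *\<^sub>R z + z) - U (x + real i *\<^sub>R z)))\<^sup>2) * real (card {..<M})"
      by (rule sum_squared_le_sum_of_squares)
    finally show ?thesis by (simp add: mult.commute)
  qed
  have "\<Phi> (real M *\<^sub>R z) \<le> (\<integral>\<^sup>+x. (\<Sum>i<M. ennreal (real M) * (?d (x + real i *\<^sub>R z) * indicator (fund_domain e) x)) \<partial>lborel)"
    unfolding \<Phi>_def
  proof (rule nn_integral_mono)
    fix x
    have "ennreal ((norm (U (x + real M *\<^sub>R z) - U x))\<^sup>2) \<le> ennreal (real M * (\<Sum>i<M. (norm (U (x + real i *\<^sub>R z + z) - U (x + real i *\<^sub>R z)))\<^sup>2))"
      by (rule ennreal_leI[OF pt])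
    also have "\<dots> = ennreal (real M) * (\<Sum>i<M. ?d (x + real i *\<^sub>R z))"
      by (subst ennreal_mult) (auto simp: sum_nonneg)
    also have "\<dots> = (\<Sum>i<M. ennreal (real M) * ?d (x + real i *\<^sub>R z))" by (rule sum_distrib_left)
    finally show "ennreal ((norm (U (x + real M *\<^sub>R z) - U x))\<^sup>2) * indicator (fund_domain e) x
      \<le> (\<Sum>i<M. ennreal (real M) * (?d (x + real i *\<^sub>R z) * indicator (fund_domain e) x))"
      by (cases "x \<in> fund_domain e") (simp_all del: sum_ennreal)
  qed
  also have "\<dots> = (\<Sum>i<M. ennreal (real M) * (\<integral>\<^sup>+x\<in>fund_domain e. ?d (x + real i *\<^sub>R z) \<partial>lborel))"
    by (subst nn_integral_sum) (simp_all add: nn_integral_cmult)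
  also have "\<dots> = (\<Sum>i<M. ennreal (real M) * \<Phi> z)"
    unfolding \<Phi>_def by (intro sum.cong refl arg_cong2[where f="(*)"] nn_integral_fund_domain_shift[OF basis diff_measurable diff_periodic])
  also have "\<dots> = ennreal ((real M)\<^sup>2) * \<Phi> z"
    by (simp add: power2_eq_square ennreal_mult ennreal_of_nat_eq_real_of_nat mult.assoc)
  finally show ?thesis .
qed

text \<open>The entries serve, in this order, the trivial bound for long translations, the two
  bounds for short ones, and the telescoped bound, where rounding the number of steps up costs the
  factor 2.\<close>

definition KL :: real where "KL = max 4 (max (max K1 K2) (2 * K2 / \<kappa>\<^sup>2))"

lemma E1_nonneg: "0 \<le> E\<^sub>1" by (simp add: E\<^sub>1_def)

lemma Phi_small:
  assumes y: "norm y \<le> \<rho>\<^sub>0"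
  shows "\<Phi> y \<le> ennreal (KL * (norm y / h) * min E\<^sub>0 (h\<^sup>2 * E\<^sub>1))"
proof -
  have K: "K1 \<le> KL" "K2 \<le> KL" by (auto simp: KL_def)
  have yh: "0 \<le> norm y / h" using h_pos by simp
  have "\<Phi> y \<le> ennreal (KL * (norm y / h) * E\<^sub>0)"
    using Phi_small_L2[OF y] K(1) yh E0_nonneg by (elim order_trans) (intro ennreal_leI mult_right_mono, auto)
  moreover have "\<Phi> y \<le> ennreal (KL * (norm y / h) * (h\<^sup>2 * E\<^sub>1))"
    using Phi_small_H1[OF y] K(2) yh E1_nonneg by (elim order_trans) (intro ennreal_leI mult_right_mono, auto)
  ultimately show ?thesis by (cases "E\<^sub>0 \<le> h\<^sup>2 * E\<^sub>1") (simp_all add: min_def)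
qed

lemma Phi_large:
  assumes y: "\<rho>\<^sub>0 \<le> norm y"
  shows "\<Phi> y \<le> ennreal (KL * min E\<^sub>0 ((norm y)\<^sup>2 * E\<^sub>1))"
proof -
  have 1: "\<Phi> y \<le> ennreal (KL * E\<^sub>0)"
  proof -
    have "4 * E\<^sub>0 \<le> KL * E\<^sub>0" using E0_nonneg by (intro mult_right_mono) (auto simp: KL_def)
    then show ?thesis using Phi_le_4E0[of y] ennreal_leI order_trans by blast
  qed
  \<comment> \<open>Rounding up keeps each step within \<open>\<rho>\<^sub>0\<close>; as
    \<open>norm y\<close> is at least \<open>\<rho>\<^sub>0\<close>, the number of steps is at most
    twice the quotient.\<close>
  define M where "M = nat \<lceil>norm y / \<rho>\<^sub>0\<rceil>"
  have r1: "1 \<le> norm y / \<rho>\<^sub>0" using y rho0_pos by simp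
  have M: "norm y / \<rho>\<^sub>0 \<le> real M" "real M \<le> norm y / \<rho>\<^sub>0 + 1" "1 \<le> real M" unfolding M_def using r1 by linarith+
  define z where "z = (1 / real M) *\<^sub>R y"
  have Mz: "real M *\<^sub>R z = y" using M(3) by (simp add: z_def)
  have nz: "norm z = norm y / real M" by (simp add: z_def)
  have "norm y \<le> real M * \<rho>\<^sub>0" using M(1) rho0_pos by (simp add: divide_le_eq)
  then have z\<rho>: "norm z \<le> \<rho>\<^sub>0" unfolding nz using M(3) by (simp add: divide_le_eq mult.commute)
  have K2_nn: "0 \<le> K2" unfolding K2_def using cS_nonneg c1 cJ_pos kappa
    by (intro mult_nonneg_nonneg add_nonneg_nonneg) (auto simp: pack_def intro!: zero_le_power divide_nonneg_nonneg add_nonneg_nonneg)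
  have "\<Phi> y \<le> ennreal ((real M)\<^sup>2) * \<Phi> z" using Phi_telescope[of M z] unfolding Mz .
  also have "\<dots> \<le> ennreal ((real M)\<^sup>2) * ennreal (K2 * (norm z / h) * (h\<^sup>2 * E\<^sub>1))"
    by (intro mult_left_mono Phi_small_H1[OF z\<rho>]) simp
  also have "\<dots> = ennreal ((real M)\<^sup>2 * (K2 * (norm z / h) * (h\<^sup>2 * E\<^sub>1)))"
    using K2_nn h_pos E1_nonneg by (subst ennreal_mult) auto
  also have "\<dots> \<le> ennreal (KL * ((norm y)\<^sup>2 * E\<^sub>1))"
  proof (rule ennreal_leI)
    have "(real M)\<^sup>2 * (K2 * (norm z / h) * (h\<^sup>2 * E\<^sub>1)) = real M * (K2 * norm y * h * E\<^sub>1)"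
      unfolding nz using M(3) h_pos by (simp add: power2_eq_square)
    also have "\<dots> \<le> (2 * (norm y / \<rho>\<^sub>0)) * (K2 * norm y * h * E\<^sub>1)"
      using M(2) r1 K2_nn h_pos E1_nonneg by (intro mult_right_mono mult_nonneg_nonneg) auto
    also have "\<dots> = (2 * K2 / \<kappa>\<^sup>2) * ((norm y)\<^sup>2 * E\<^sub>1)"
      using h_pos kappa by (simp add: \<rho>\<^sub>0_def power2_eq_square field_simps)
    also have "\<dots> \<le> KL * ((norm y)\<^sup>2 * E\<^sub>1)" using E1_nonneg by (intro mult_right_mono) (auto simp: KL_def)
    finally show "(real M)\<^sup>2 * (K2 * (norm z / h) * (h\<^sup>2 * E\<^sub>1)) \<le> KL * ((norm y)\<^sup>2 * E\<^sub>1)" .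
  qed
  finally have 2: "\<Phi> y \<le> ennreal (KL * ((norm y)\<^sup>2 * E\<^sub>1))" .
  show ?thesis using 1 2 by (cases "E\<^sub>0 \<le> (norm y)\<^sup>2 * E\<^sub>1") (simp_all add: min_def)
qed

end

section \<open>The Slobodetskij semi-norm from translation estimates\<close>

text \<open>On such a shell the weight exceeds its value at radius \<open>t\<close> by at most the
  factor \<open>2 powr \<bar>q\<bar>\<close>, and the shell lies in a ball of radius
  \<open>t\<close>.\<close>

lemma nn_integral_shell:
  fixes q t :: real
  assumes t: "0 < t"
  shows "(\<integral>\<^sup>+z. ennreal (norm (z :: ('n::finite) point) powr (- q)) * indicator {z. t / 2 < norm z \<and> norm z \<le> t} z \<partial>lborel)
    \<le> ennreal (2 powr \<bar>q\<bar> * unit_vol TYPE('n) * t powr (real CARD('n) - q))"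
proof -
  have "(\<integral>\<^sup>+z. ennreal (norm (z :: 'n point) powr (- q)) * indicator {z. t / 2 < norm z \<and> norm z \<le> t} z \<partial>lborel)
    \<le> (\<integral>\<^sup>+z. ennreal (2 powr \<bar>q\<bar> * t powr (- q)) * indicator (cball (0 :: 'n point) t) z \<partial>lborel)"
  proof (rule nn_integral_mono)
    fix z :: "'n point"
    show "ennreal (norm z powr (- q)) * indicator {z. t / 2 < norm z \<and> norm z \<le> t} z
       \<le> ennreal (2 powr \<bar>q\<bar> * t powr (- q)) * indicator (cball 0 t) z"
    proof (cases "t / 2 < norm z \<and> norm z \<le> t")
      case True
      have "norm z powr (- q) \<le> 2 powr \<bar>q\<bar> * t powr (- q)"
      proof (cases "0 \<le> q")
        case True
        have "norm z powr (- q) \<le> (t / 2) powr (- q)"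
          using \<open>t / 2 < norm z \<and> norm z \<le> t\<close> t True by (intro powr_mono2') auto
        also have "\<dots> = 2 powr \<bar>q\<bar> * t powr (- q)" using t True by (simp add: powr_divide powr_minus divide_simps)
        finally show ?thesis .
      next
        case False
        have "norm z powr (- q) \<le> t powr (- q)"
          using \<open>t / 2 < norm z \<and> norm z \<le> t\<close> t False by (intro powr_mono2) auto
        also have "\<dots> \<le> 2 powr \<bar>q\<bar> * t powr (- q)" by (simp add: mult_le_cancel_right1 ge_one_powr_ge_zero)
        finally show ?thesis .
      qed
      then show ?thesis using True by (simp add: ennreal_leI)
    qed simp
  qed
  also have "\<dots> = ennreal (2 powr \<bar>q\<bar> * t powr (- q)) * emeasure lborel (cball (0 :: 'n point) t)"
    by (rule nn_integral_cmult_indicator) simp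
  also have "emeasure lborel (cball (0 :: 'n point) t) = ennreal (t ^ CARD('n) * unit_vol TYPE('n))"
    using measure_cball_unit_vol[of t "0 :: 'n point"] t
    by (subst emeasure_eq_ennreal_measure) (auto simp: emeasure_lborel_bounded less_top[symmetric])
  also have "ennreal (2 powr \<bar>q\<bar> * t powr (- q)) * ennreal (t ^ CARD('n) * unit_vol TYPE('n))
    = ennreal (2 powr \<bar>q\<bar> * unit_vol TYPE('n) * t powr (real CARD('n) - q))"
  proof -
    have "t powr (real CARD('n) - q) = t ^ CARD('n) * t powr (- q)"
      using t powr_add[of t "real CARD('n)" "- q"] by (simp add: powr_realpow)
    then show ?thesis using t unit_vol_pos[where 'n='n] by (subst ennreal_mult[symmetric]) (auto simp: mult_ac)
  qed
  finally show ?thesis .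
qed

text \<open>Shells of radii \<open>\<rho> * b ^ k\<close> contribute a geometric series. Later
  \<open>b\<close> is 1/2 for a ball and 2 for the exterior of a ball; in both cases the hypothesis
  on the power of \<open>b\<close> expresses convergence.\<close>

lemma nn_integral_shells:
  fixes q \<rho> b :: real
  assumes \<rho>: "0 < \<rho>" and b: "0 < b" and x: "b powr (real CARD('n) - q) < 1"
    and A: "\<And>z. z \<in> A \<Longrightarrow> z \<noteq> 0 \<Longrightarrow> \<exists>k. \<rho> * b ^ k / 2 < norm z \<and> norm z \<le> \<rho> * b ^ k"
  shows "(\<integral>\<^sup>+z. ennreal (norm (z :: ('n::finite) point) powr (- q)) * indicator A z \<partial>lborel)
    \<le> ennreal (2 powr \<bar>q\<bar> * unit_vol TYPE('n) / (1 - b powr (real CARD('n) - q)) * \<rho> powr (real CARD('n) - q))"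
proof -
  let ?c = "2 powr \<bar>q\<bar> * unit_vol TYPE('n)" and ?x = "b powr (real CARD('n) - q)"
  define S :: "nat \<Rightarrow> 'n point set" where "S k = {z. \<rho> * b ^ k / 2 < norm z \<and> norm z \<le> \<rho> * b ^ k}" for k
  have [measurable]: "S k \<in> sets borel" for k unfolding S_def by measurable
  have "(\<integral>\<^sup>+z. ennreal (norm (z :: 'n point) powr (- q)) * indicator A z \<partial>lborel)
    \<le> (\<integral>\<^sup>+z. (\<Sum>k. ennreal (norm z powr (- q)) * indicator (S k) z) \<partial>lborel)"
  proof (rule nn_integral_mono)
    fix z :: "'n point"
    show "ennreal (norm z powr (- q)) * indicator A z \<le> (\<Sum>k. ennreal (norm z powr (- q)) * indicator (S k) z)"
    proof (cases "z \<in> A \<and> z \<noteq> 0")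
      case True
      then obtain k where "z \<in> S k" using A[of z] by (auto simp: S_def)
      then have "ennreal (norm z powr (- q)) * indicator A z \<le> ennreal (norm z powr (- q)) * indicator (S k) z"
        using True by simp
      also have "\<dots> = (\<Sum>k\<in>{k}. ennreal (norm z powr (- q)) * indicator (S k) z)"
        by (subst sum.insert) auto
      also have "\<dots> \<le> (\<Sum>k. ennreal (norm z powr (- q)) * indicator (S k) z)"
        by (rule sum_le_suminf) (auto intro: summableI)
      finally show ?thesis .
    qed (auto simp: indicator_def)
  qed
  also have "\<dots> = (\<Sum>k. \<integral>\<^sup>+z. ennreal (norm z powr (- q)) * indicator (S k) z \<partial>lborel)"
    by (rule nn_integral_suminf) measurable
  also have "\<dots> \<le> (\<Sum>k. ennreal (?c * \<rho> powr (real CARD('n) - q) * ?x ^ k))"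
  proof (rule suminf_le)
    fix k
    have "(\<rho> * b ^ k) powr (real CARD('n) - q) = \<rho> powr (real CARD('n) - q) * ?x ^ k"
      using \<rho> b by (simp add: powr_mult powr_realpow[symmetric] powr_powr mult.commute)
    then show "(\<integral>\<^sup>+z. ennreal (norm z powr (- q)) * indicator (S k) z \<partial>lborel) \<le> ennreal (?c * \<rho> powr (real CARD('n) - q) * ?x ^ k)"
      using nn_integral_shell[where 'n='n, of "\<rho> * b ^ k" q] \<rho> b unfolding S_def by (simp add: mult.assoc)
  qed (auto intro: summableI)
  also have "\<dots> = ennreal (?c * \<rho> powr (real CARD('n) - q) * (1 / (1 - ?x)))"
    using unit_vol_pos[where 'n='n] x geometric_sums[of ?x]
    by (intro suminf_ennreal_eq sums_mult) (auto simp: less_imp_le)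
  finally show ?thesis by (simp add: mult_ac)
qed

text \<open>One constant for both radial integrals: with the modulus of the exponent the ratio of
  the series is \<open>2 powr (- a)\<close> in both cases, and the last factor covers the outside
  case, where the radii begin at twice \<open>\<rho>\<close>.\<close>

definition radial_const :: "'n::finite itself \<Rightarrow> real \<Rightarrow> real" where
  "radial_const T q = (let a = \<bar>real CARD('n) - q\<bar> in 2 powr \<bar>q\<bar> * unit_vol T / (1 - 2 powr (- a)) * 2 powr a)"

lemma radial_const_nonneg: "q \<noteq> real CARD('n) \<Longrightarrow> 0 \<le> radial_const TYPE('n::finite) q"
  using unit_vol_pos[where 'n='n] by (simp add: radial_const_def Let_def powr_less_one less_imp_le)

lemma nn_integral_radial_inside:
  assumes \<rho>: "0 < \<rho>" and q: "q < real CARD('n)"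
  shows "(\<integral>\<^sup>+z. ennreal (norm (z :: ('n::finite) point) powr (- q)) * indicator (cball 0 \<rho>) z \<partial>lborel)
    \<le> ennreal (radial_const TYPE('n) q * \<rho> powr (real CARD('n) - q))"
proof -
  let ?a = "real CARD('n) - q"
  have x: "(1/2) powr ?a = 2 powr (- ?a)" by (simp add: powr_divide powr_minus_divide[symmetric] del: minus_diff_eq)
  have x1: "2 powr (- ?a) < 1" using q by (simp add: powr_less_one del: minus_diff_eq)
  have "(\<integral>\<^sup>+z. ennreal (norm (z :: 'n point) powr (- q)) * indicator (cball 0 \<rho>) z \<partial>lborel)
    \<le> ennreal (2 powr \<bar>q\<bar> * unit_vol TYPE('n) / (1 - (1/2) powr ?a) * \<rho> powr ?a)"
  proof (rule nn_integral_shells[OF \<rho>])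
    fix z :: "'n point" assume z: "z \<in> cball 0 \<rho>" "z \<noteq> 0"
    obtain k0 where k0: "(1/2::real) ^ k0 < norm z / \<rho>"
      using real_arch_pow_inv[of "norm z / \<rho>" "1/2"] z(2) \<rho> by auto
    \<comment> \<open>Minimality gives the outer bound of the shell, because the inequality fails
      for the preceding index.\<close>
    define k where "k = (LEAST k. \<rho> * (1/2) ^ Suc k < norm z)"
    have "\<rho> * (1/2) ^ Suc k0 < norm z"
    proof -
      have "(1/2::real) ^ k0 * \<rho> < norm z" using k0 \<rho> by (simp add: pos_less_divide_eq)
      moreover have "0 < (1/2::real) ^ k0 * \<rho>" using \<rho> by simp
      moreover have "\<rho> * (1/2) ^ Suc k0 = (1/2) ^ k0 * \<rho> / 2" by simp
      ultimately show ?thesis by linarith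
    qed
    then have k: "\<rho> * (1/2) ^ Suc k < norm z" unfolding k_def by (rule LeastI)
    have "norm z \<le> \<rho> * (1/2) ^ k"
    proof (cases k)
      case 0 then show ?thesis using z(1) by simp
    next
      case (Suc j)
      then have "\<not> \<rho> * (1/2) ^ Suc j < norm z"
        using not_less_Least[of j "\<lambda>k. \<rho> * (1/2) ^ Suc k < norm z"] unfolding k_def by auto
      then show ?thesis using Suc by simp
    qed
    then show "\<exists>k. \<rho> * (1/2) ^ k / 2 < norm z \<and> norm z \<le> \<rho> * (1/2) ^ k" using k by (intro exI[of _ k]) simp
  qed (use x x1 in auto)
  also have "\<dots> \<le> ennreal (radial_const TYPE('n) q * \<rho> powr ?a)"
  proof (rule ennreal_leI, rule mult_right_mono)
    have "1 \<le> (2::real) powr ?a" using q by (intro ge_one_powr_ge_zero) auto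
    then show "2 powr \<bar>q\<bar> * unit_vol TYPE('n) / (1 - (1/2) powr ?a) \<le> radial_const TYPE('n) q"
      using mult_left_mono[of 1 "2 powr ?a" "2 powr \<bar>q\<bar> * unit_vol TYPE('n) / (1 - 2 powr (- ?a))"]
        q x1 unit_vol_pos[where 'n='n] unfolding x radial_const_def Let_def
      by (simp add: less_imp_le del: minus_diff_eq)
  qed simp
  finally show ?thesis .
qed

lemma nn_integral_radial_outside:
  assumes \<rho>: "0 < \<rho>" and q: "real CARD('n) < q"
  shows "(\<integral>\<^sup>+z. ennreal (norm (z :: ('n::finite) point) powr (- q)) * indicator {z. \<rho> < norm z} z \<partial>lborel)
    \<le> ennreal (radial_const TYPE('n) q * \<rho> powr (real CARD('n) - q))"
proof -
  let ?a = "real CARD('n) - q"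
  have x1: "2 powr ?a < (1::real)" using q by (simp add: powr_less_one)
  have "(\<integral>\<^sup>+z. ennreal (norm (z :: 'n point) powr (- q)) * indicator {z. \<rho> < norm z} z \<partial>lborel)
    \<le> ennreal (2 powr \<bar>q\<bar> * unit_vol TYPE('n) / (1 - 2 powr ?a) * (2 * \<rho>) powr ?a)"
  proof (rule nn_integral_shells)
    fix z :: "'n point" assume z: "z \<in> {z. \<rho> < norm z}" "z \<noteq> 0"
    obtain k0 where k0: "norm z / \<rho> < 2 ^ k0" using real_arch_pow[of 2 "norm z / \<rho>"] by auto
    define k where "k = (LEAST k. norm z \<le> 2 * \<rho> * 2 ^ k)"
    have "norm z \<le> 2 * \<rho> * 2 ^ k0"
    proof -
      have "norm z < 2 ^ k0 * \<rho>" using k0 \<rho> by (simp add: pos_divide_less_eq)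
      moreover have "0 < 2 ^ k0 * \<rho>" using \<rho> by simp
      moreover have "2 * \<rho> * 2 ^ k0 = 2 * (2 ^ k0 * \<rho>)" by simp
      ultimately show ?thesis by linarith
    qed
    then have k: "norm z \<le> 2 * \<rho> * 2 ^ k" unfolding k_def by (rule LeastI)
    have "\<rho> * 2 ^ k < norm z"
    proof (cases k)
      case 0 then show ?thesis using z(1) by simp
    next
      case (Suc j)
      then have "\<not> norm z \<le> 2 * \<rho> * 2 ^ j"
        using not_less_Least[of j "\<lambda>k. norm z \<le> 2 * \<rho> * 2 ^ k"] unfolding k_def by auto
      then show ?thesis using Suc by simp
    qed
    then show "\<exists>k. 2 * \<rho> * 2 ^ k / 2 < norm z \<and> norm z \<le> 2 * \<rho> * 2 ^ k" using k by (intro exI[of _ k]) simp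
  qed (use \<rho> x1 in auto)
  also have "\<dots> \<le> ennreal (radial_const TYPE('n) q * \<rho> powr ?a)"
  proof (rule ennreal_leI)
    have "(2 * \<rho>) powr ?a = 2 powr ?a * \<rho> powr ?a" using \<rho> by (simp add: powr_mult)
    moreover have "2 powr ?a \<le> (2::real) powr (- ?a)" using q by (intro powr_mono) auto
    then have "2 powr \<bar>q\<bar> * unit_vol TYPE('n) / (1 - 2 powr ?a) * (2 powr ?a * \<rho> powr ?a)
        \<le> 2 powr \<bar>q\<bar> * unit_vol TYPE('n) / (1 - 2 powr ?a) * (2 powr (- ?a) * \<rho> powr ?a)"
      using x1 unit_vol_pos[where 'n='n] by (intro mult_left_mono mult_right_mono) (auto simp: less_imp_le)
    moreover have "\<bar>?a\<bar> = - ?a" using q by simp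
    ultimately show "2 powr \<bar>q\<bar> * unit_vol TYPE('n) / (1 - 2 powr ?a) * (2 * \<rho>) powr ?a \<le> radial_const TYPE('n) q * \<rho> powr ?a"
      unfolding radial_const_def Let_def \<open>(2 * \<rho>) powr ?a = _\<close> by (simp only: minus_minus mult.assoc)
  qed
  finally show ?thesis .
qed

text \<open>The three terms belong, in this order, to short translations, to those up to the
  balancing radius, and to the remaining ones.\<close>

definition interp_const :: "'n::finite itself \<Rightarrow> real \<Rightarrow> real \<Rightarrow> real \<Rightarrow> real" where
  "interp_const T s L \<kappa> = L * (radial_const T (real CARD('n) + 2 * s - 1) * (\<kappa>\<^sup>2) powr (1 - 2 * s)
      + radial_const T (real CARD('n) + 2 * s - 2) + radial_const T (real CARD('n) + 2 * s))"

text \<open>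
  The kernel is integrated over \<open>|z| \<le> \<kappa>\<^sup>2h\<close>, \<open>|z| \<le> R\<close> and \<open>|z| > R\<close> with \<open>R\<^sup>2 = E\<^sub>0 / E\<^sub>1\<close>.  The first
  integral converges because \<open>2s < 1\<close>.
\<close>

lemma kernel_interpolation:
  fixes \<Phi> :: "('n::finite) point \<Rightarrow> ennreal"
  assumes h: "0 < h" and \<kappa>: "0 < \<kappa>" and E: "0 \<le> E\<^sub>0" "0 \<le> E\<^sub>1" and L: "0 \<le> L" and s: "0 < s" "s < 1 / 2"
    and small: "\<And>z. norm z \<le> \<kappa>\<^sup>2 * h \<Longrightarrow> \<Phi> z \<le> ennreal (L * (norm z / h) * min E\<^sub>0 (h\<^sup>2 * E\<^sub>1))"
    and large: "\<And>z. \<kappa>\<^sup>2 * h \<le> norm z \<Longrightarrow> \<Phi> z \<le> ennreal (L * min E\<^sub>0 ((norm z)\<^sup>2 * E\<^sub>1))"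
  shows "(\<integral>\<^sup>+z. ennreal (norm z powr (- (real CARD('n) + 2 * s))) * \<Phi> z \<partial>lborel)
     \<le> ennreal (interp_const TYPE('n) s L \<kappa> * E\<^sub>0 powr (1 - s) * E\<^sub>1 powr s)"
proof (cases "E\<^sub>0 = 0 \<or> E\<^sub>1 = 0")
  \<comment> \<open>In the degenerate case no balancing radius is available, but the two bounds make
    \<open>\<Phi>\<close> vanish identically.\<close>
  case True
  have "\<Phi> z = 0" for z
  proof (cases "norm z \<le> \<kappa>\<^sup>2 * h")
    case True
    have "min E\<^sub>0 (h\<^sup>2 * E\<^sub>1) = 0" using \<open>E\<^sub>0 = 0 \<or> E\<^sub>1 = 0\<close> E h by (auto simp: min_def)
    then show ?thesis using small[OF True] by simp
  next
    case False
    have "min E\<^sub>0 ((norm z)\<^sup>2 * E\<^sub>1) = 0" using \<open>E\<^sub>0 = 0 \<or> E\<^sub>1 = 0\<close> E by (auto simp: min_def)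
    then show ?thesis using large[of z] False by simp
  qed
  then show ?thesis by simp
next
  case False
  then have pos: "0 < E\<^sub>0" "0 < E\<^sub>1" using E by auto
  let ?p = "real CARD('n) + 2 * s" and ?c = "radial_const TYPE('n)"
  \<comment> \<open>At this radius the two arguments of the minimum in \<open>large\<close> are
    equal.\<close>
  define R where "R = sqrt (E\<^sub>0 / E\<^sub>1)"
  have R: "0 < R" using pos by (simp add: R_def)
  have Rp: "R powr t = (E\<^sub>0 / E\<^sub>1) powr (t / 2)" for t
    unfolding R_def using pos by (simp add: powr_half_sqrt[symmetric] powr_powr)
  let ?I = "E\<^sub>0 powr (1 - s) * E\<^sub>1 powr s"
  let ?m = "min E\<^sub>0 (h\<^sup>2 * E\<^sub>1)"
  define A :: "'n point \<Rightarrow> ennreal" where "A z = ennreal (L / h * ?m) * (ennreal (norm z powr (- (?p - 1))) * indicator (cball 0 (\<kappa>\<^sup>2 * h)) z)" for z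
  define B :: "'n point \<Rightarrow> ennreal" where "B z = ennreal (L * E\<^sub>1) * (ennreal (norm z powr (- (?p - 2))) * indicator (cball 0 R) z)" for z
  define D :: "'n point \<Rightarrow> ennreal" where "D z = ennreal (L * E\<^sub>0) * (ennreal (norm z powr (- ?p)) * indicator {z. R < norm z} z)" for z
  have [measurable]: "A \<in> borel_measurable borel" "B \<in> borel_measurable borel" "D \<in> borel_measurable borel"
    unfolding A_def[abs_def] B_def[abs_def] D_def[abs_def]
    by (auto intro!: borel_measurable_times_ennreal borel_measurable_indicator borel_measurable_const)
  have rad_meas: "(\<lambda>z :: 'n point. ennreal (norm z powr q) * indicator S z) \<in> borel_measurable lborel" if "S \<in> sets borel" for q S
    using that by measurable
  have m_nonneg: "0 \<le> ?m" using pos h by simp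
  have "(\<integral>\<^sup>+z. ennreal (norm z powr (- ?p)) * \<Phi> z \<partial>lborel) \<le> (\<integral>\<^sup>+z. A z + (B z + D z) \<partial>lborel)"
  proof (rule nn_integral_mono)
    fix z :: "'n point"
    show "ennreal (norm z powr (- ?p)) * \<Phi> z \<le> A z + (B z + D z)"
    proof (cases "z = 0")
      case False
      then have nz: "0 < norm z" by simp
      consider "norm z \<le> \<kappa>\<^sup>2 * h" | "\<kappa>\<^sup>2 * h \<le> norm z" "norm z \<le> R" | "\<kappa>\<^sup>2 * h \<le> norm z" "R < norm z" by linarith
      then show ?thesis
      proof cases
        case 1
        have "norm z powr (- ?p) * (L * (norm z / h) * ?m) = (L / h * ?m) * norm z powr (- (?p - 1))"
          using powr_add[of "norm z" "- ?p" 1] nz by (simp add: algebra_simps)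
        then have "ennreal (norm z powr (- ?p)) * ennreal (L * (norm z / h) * ?m) = A z"
          using 1 L h m_nonneg by (simp add: A_def ennreal_mult[symmetric])
        then have "ennreal (norm z powr (- ?p)) * \<Phi> z \<le> A z" using mult_left_mono[OF small[OF 1], of "ennreal (norm z powr (- ?p))"] by simp
        then show ?thesis by (rule order_trans) simp
      next
        case 2
        have "norm z powr (- ?p) * (L * ((norm z)\<^sup>2 * E\<^sub>1)) = (L * E\<^sub>1) * norm z powr (- (?p - 2))"
          using powr_add[of "norm z" "- ?p" 2] nz by (simp add: powr_numeral algebra_simps)
        then have "ennreal (norm z powr (- ?p)) * ennreal (L * ((norm z)\<^sup>2 * E\<^sub>1)) = B z"
          using 2 L pos by (simp add: B_def ennreal_mult[symmetric])
        moreover have "\<Phi> z \<le> ennreal (L * ((norm z)\<^sup>2 * E\<^sub>1))"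
          using large[OF 2(1)] by (rule order_trans) (use L in \<open>auto intro!: ennreal_leI mult_left_mono\<close>)
        ultimately have "ennreal (norm z powr (- ?p)) * \<Phi> z \<le> B z" by (metis mult_left_mono zero_le)
        also have "\<dots> \<le> A z + (B z + D z)" by (metis add.left_commute add.commute le_iff_add)
        finally show ?thesis .
      next
        case 3
        have "ennreal (norm z powr (- ?p)) * ennreal (L * E\<^sub>0) = D z"
          using 3 L pos by (simp add: D_def ennreal_mult[symmetric] mult.commute)
        moreover have "\<Phi> z \<le> ennreal (L * E\<^sub>0)"
          using large[OF 3(1)] by (rule order_trans) (use L in \<open>auto intro!: ennreal_leI mult_left_mono\<close>)
        ultimately have "ennreal (norm z powr (- ?p)) * \<Phi> z \<le> D z" by (metis mult_left_mono zero_le)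
        also have "\<dots> \<le> A z + (B z + D z)" by (metis add.left_commute add.commute le_iff_add)
        finally show ?thesis .
      qed
    qed simp
  qed
  also have "\<dots> = (\<integral>\<^sup>+z. A z \<partial>lborel) + ((\<integral>\<^sup>+z. B z \<partial>lborel) + (\<integral>\<^sup>+z. D z \<partial>lborel))"
    by (simp add: nn_integral_add)
  also have "\<dots> \<le> ennreal (L * (?c (?p - 1) * (\<kappa>\<^sup>2) powr (1 - 2 * s)) * ?I) + (ennreal (L * ?c (?p - 2) * ?I) + ennreal (L * ?c ?p * ?I))"
  proof (intro add_mono)
    have "(\<integral>\<^sup>+z. A z \<partial>lborel) \<le> ennreal (L / h * ?m) * ennreal (?c (?p - 1) * (\<kappa>\<^sup>2 * h) powr (real CARD('n) - (?p - 1)))"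
      unfolding A_def using \<kappa> h s 
      by (subst nn_integral_cmult[OF rad_meas]; (intro mult_left_mono nn_integral_radial_inside)?) simp_all
    also have "\<dots> = ennreal (L / h * ?m * (?c (?p - 1) * (\<kappa>\<^sup>2 * h) powr (1 - 2 * s)))"
      using L h m_nonneg s radial_const_nonneg[where 'n='n, of "?p - 1"] by (subst ennreal_mult) (auto simp: algebra_simps)
    also have "\<dots> \<le> ennreal (L * (?c (?p - 1) * (\<kappa>\<^sup>2) powr (1 - 2 * s)) * ?I)"
    proof (rule ennreal_leI)
      \<comment> \<open>The minimum is split as a product of powers of itself, and each factor is
        bounded by a different argument; the powers of \<open>h\<close> that appear then
        cancel.\<close>
      have "?m = ?m powr (1 - s) * ?m powr s" using m_nonneg by (cases "?m = 0") (auto simp: powr_add[symmetric])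
      also have "\<dots> \<le> E\<^sub>0 powr (1 - s) * (h\<^sup>2 * E\<^sub>1) powr s"
        using m_nonneg s by (intro mult_mono powr_mono2) auto
      also have "\<dots> = ?I * h powr (2 * s)"
      proof -
        have "(h\<^sup>2) powr s = h powr (2 * s)" using h by (simp add: powr_numeral[symmetric] powr_powr del: powr_numeral)
        then show ?thesis using h pos by (simp add: powr_mult)
      qed
      finally have "?m * h powr (1 - 2 * s) \<le> ?I * h powr (2 * s) * h powr (1 - 2 * s)" by (rule mult_right_mono) simp
      also have "\<dots> = ?I * h" using h by (simp add: powr_add[symmetric] mult.assoc)
      finally have *: "?m * h powr (1 - 2 * s) \<le> ?I * h" .
      have "L / h * ?m * (?c (?p - 1) * (\<kappa>\<^sup>2 * h) powr (1 - 2 * s))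
         = L / h * (?c (?p - 1) * (\<kappa>\<^sup>2) powr (1 - 2 * s)) * (?m * h powr (1 - 2 * s))"
        using h \<kappa> by (simp add: powr_mult)
      also have "\<dots> \<le> L / h * (?c (?p - 1) * (\<kappa>\<^sup>2) powr (1 - 2 * s)) * (?I * h)"
        using L h radial_const_nonneg[where 'n='n, of "?p - 1"] s by (intro mult_left_mono[OF *] mult_nonneg_nonneg) auto
      also have "\<dots> = L * (?c (?p - 1) * (\<kappa>\<^sup>2) powr (1 - 2 * s)) * ?I" using h by simp
      finally show "L / h * ?m * (?c (?p - 1) * (\<kappa>\<^sup>2 * h) powr (1 - 2 * s)) \<le> L * (?c (?p - 1) * (\<kappa>\<^sup>2) powr (1 - 2 * s)) * ?I" .
    qed
    finally show "(\<integral>\<^sup>+z. A z \<partial>lborel) \<le> ennreal (L * (?c (?p - 1) * (\<kappa>\<^sup>2) powr (1 - 2 * s)) * ?I)" .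
    have "(\<integral>\<^sup>+z. B z \<partial>lborel) \<le> ennreal (L * E\<^sub>1) * ennreal (?c (?p - 2) * R powr (real CARD('n) - (?p - 2)))"
      unfolding B_def using R s 
      by (subst nn_integral_cmult[OF rad_meas]; (intro mult_left_mono nn_integral_radial_inside)?) simp_all
    also have "\<dots> = ennreal (L * E\<^sub>1 * (?c (?p - 2) * R powr (2 - 2 * s)))"
      using L pos s radial_const_nonneg[where 'n='n, of "?p - 2"] by (subst ennreal_mult) (auto simp: algebra_simps)
    also have "L * E\<^sub>1 * (?c (?p - 2) * R powr (2 - 2 * s)) = L * ?c (?p - 2) * ?I"
    proof -
      have eq: "(2 - 2 * s) / 2 = 1 - s" by simp
      have "R powr (2 - 2 * s) = E\<^sub>0 powr (1 - s) / E\<^sub>1 powr (1 - s)" unfolding Rp eq using pos by (simp add: powr_divide)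
      moreover have "E\<^sub>1 = E\<^sub>1 powr (1 - s) * E\<^sub>1 powr s" using pos by (simp add: powr_add[symmetric])
      then have "E\<^sub>1 / E\<^sub>1 powr (1 - s) = E\<^sub>1 powr s" using pos by (simp add: divide_eq_eq mult.commute)
      moreover have "L * E\<^sub>1 * (?c (?p - 2) * (E\<^sub>0 powr (1 - s) / E\<^sub>1 powr (1 - s)))
        = L * ?c (?p - 2) * (E\<^sub>0 powr (1 - s) * (E\<^sub>1 / E\<^sub>1 powr (1 - s)))" by simp
      ultimately show ?thesis by presburger
    qed
    finally show "(\<integral>\<^sup>+z. B z \<partial>lborel) \<le> ennreal (L * ?c (?p - 2) * ?I)" .
    have "(\<integral>\<^sup>+z. D z \<partial>lborel) \<le> ennreal (L * E\<^sub>0) * ennreal (?c ?p * R powr (real CARD('n) - ?p))"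
      unfolding D_def using R s 
      by (subst nn_integral_cmult[OF rad_meas]; (intro mult_left_mono nn_integral_radial_outside)?) simp_all
    also have "\<dots> = ennreal (L * E\<^sub>0 * (?c ?p * R powr (- 2 * s)))"
      using L pos s radial_const_nonneg[where 'n='n, of ?p] by (subst ennreal_mult) (auto simp: algebra_simps)
    also have "L * E\<^sub>0 * (?c ?p * R powr (- 2 * s)) = L * ?c ?p * ?I"
    proof -
      have eq: "(- 2 * s) / 2 = - s" by simp
      have "R powr (- 2 * s) = E\<^sub>1 powr s / E\<^sub>0 powr s" unfolding Rp eq using pos by (simp add: powr_divide powr_minus_divide)
      moreover have "E\<^sub>0 = E\<^sub>0 powr (1 - s) * E\<^sub>0 powr s" using pos by (simp add: powr_add[symmetric])
      then have "E\<^sub>0 / E\<^sub>0 powr s = E\<^sub>0 powr (1 - s)" using pos by (simp add: divide_eq_eq)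
      moreover have "L * E\<^sub>0 * (?c ?p * (E\<^sub>1 powr s / E\<^sub>0 powr s))
        = L * ?c ?p * ((E\<^sub>0 / E\<^sub>0 powr s) * E\<^sub>1 powr s)" by simp
      ultimately show ?thesis by presburger
    qed
    finally show "(\<integral>\<^sup>+z. D z \<partial>lborel) \<le> ennreal (L * ?c ?p * ?I)" .
  qed
  also have "\<dots> = ennreal (interp_const TYPE('n) s L \<kappa> * E\<^sub>0 powr (1 - s) * E\<^sub>1 powr s)"
  proof -
    have "0 \<le> ?c (?p - 1)" "0 \<le> ?c (?p - 2)" "0 \<le> ?c ?p" using s by (auto intro: radial_const_nonneg)
    then show ?thesis using L unfolding interp_const_def
      by (subst ennreal_plus[symmetric], simp, simp, subst ennreal_plus[symmetric], simp, simp) (simp add: algebra_simps)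
  qed
  finally show ?thesis .
qed

text \<open>Replace the torus distance by a lattice translate that is at most twice as long,
  majorise by the sum over all translates, unfold the integral in \<open>y\<close>, and substitute z
  = y - x.\<close>

lemma slobodetskij2_le_kernel:
  fixes e :: "'n::finite \<Rightarrow> 'n point" and U u :: "'n form"
  assumes e: "lattice_basis e" and [measurable]: "U \<in> borel_measurable borel" and per: "periodic e U"
    and uU: "AE x in lebesgue. u x = U x" and s: "0 < s"
  shows "slobodetskij2 e s u \<le> ennreal (2 powr (real CARD('n) + 2 * s)) *
    (\<integral>\<^sup>+z. ennreal (norm z powr (- (real CARD('n) + 2 * s))) *
       (\<integral>\<^sup>+x\<in>fund_domain e. ennreal ((norm (U (x + z) - U x))\<^sup>2) \<partial>lborel) \<partial>lborel)"
proof -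
  let ?p = "real CARD('n) + 2 * s"
  let ?D = "fund_domain e"
  note borel_fund_domain[OF e, measurable]
  define G where "G x z = ennreal (2 powr ?p) * (ennreal (norm z powr (- ?p)) * ennreal ((norm (U (x + z) - U x))\<^sup>2))" for x z :: "'n point"
  have [measurable]: "(\<lambda>(x, z). G x z) \<in> borel_measurable (lborel \<Otimes>\<^sub>M lborel)" unfolding G_def by measurable
  have "slobodetskij2 e s u = (\<integral>\<^sup>+x\<in>?D. (\<integral>\<^sup>+y\<in>?D.
        ennreal ((norm (U x - U y))\<^sup>2 / tdist e x y powr ?p) \<partial>lebesgue) \<partial>lebesgue)"
    unfolding slobodetskij2_def using uU
  proof (intro nn_integral_cong_AE, eventually_elim)
    case (elim x)
    have "(\<integral>\<^sup>+y\<in>?D. ennreal ((norm (u x - u y))\<^sup>2 / tdist e x y powr ?p) \<partial>lebesgue)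
        = (\<integral>\<^sup>+y\<in>?D. ennreal ((norm (U x - U y))\<^sup>2 / tdist e x y powr ?p) \<partial>lebesgue)"
      using uU elim by (intro nn_integral_cong_AE) (auto elim!: eventually_mono)
    then show ?case by simp
  qed
  also have "\<dots> = (\<integral>\<^sup>+x\<in>?D. (\<integral>\<^sup>+y\<in>?D. ennreal ((norm (U x - U y))\<^sup>2 / tdist e x y powr ?p) \<partial>lborel) \<partial>lborel)"
    by (simp add: nn_integral_completion)
  also have "\<dots> \<le> (\<integral>\<^sup>+x\<in>?D. (\<integral>\<^sup>+z. G x z \<partial>lborel) \<partial>lborel)"
  proof (rule nn_integral_mono, rule mult_right_mono)
    fix x :: "'n point"
    have "(\<integral>\<^sup>+y\<in>?D. ennreal ((norm (U x - U y))\<^sup>2 / tdist e x y powr ?p) \<partial>lborel)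
      \<le> (\<integral>\<^sup>+y\<in>?D. (\<integral>\<^sup>+l. G x (y + l - x) \<partial>count_space (lattice e)) \<partial>lborel)"
    proof (intro nn_integral_mono mult_right_mono)
      fix y :: "'n point"
      show "ennreal ((norm (U x - U y))\<^sup>2 / tdist e x y powr ?p) \<le> (\<integral>\<^sup>+l. G x (y + l - x) \<partial>count_space (lattice e))"
      \<comment> \<open>At distance 0 the quotient is 0, by the conventions for \<open>powr\<close>
        and division.\<close>
      proof (cases "tdist e x y = 0")
        case False
        then have t: "0 < tdist e x y" using tdist_nonneg[OF e, of x y] by simp
        \<comment> \<open>A lattice vector that nearly realises the infimum is enough; the loss is
          the factor \<open>2 powr ?p\<close>.\<close>
        then obtain l where l: "l \<in> lattice e" "norm (x - y + l) < 2 * tdist e x y"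
          using tdist_less_ex[OF e, of x y "2 * tdist e x y"] by auto
        have nl: "norm (y + (- l) - x) = norm (x - y + l)" using norm_minus_commute[of "y + (- l)" x] by (simp add: algebra_simps)
        have ml: "- l \<in> lattice e" using lattice_uminus[OF e l(1)] .
        have Uy: "U (x + (y + (- l) - x)) = U y" using per ml unfolding periodic_def by (metis add.commute diff_add_cancel add.assoc)
        have n0: "0 < norm (x - y + l)" using tdist_le[OF e l(1), of x y] t by linarith
        have "norm (x - y + l) powr ?p \<le> (2 * tdist e x y) powr ?p" using l(2) s by (intro powr_mono2) auto
        also have "\<dots> = 2 powr ?p * tdist e x y powr ?p" using t by (simp add: powr_mult)
        finally have "1 / tdist e x y powr ?p \<le> 2 powr ?p * norm (x - y + l) powr (- ?p)"
          using t n0 unfolding powr_minus_divide[of "norm (x - y + l)" ?p] by (simp add: divide_simps mult.commute)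
        then have "(norm (U x - U y))\<^sup>2 * (1 / tdist e x y powr ?p) \<le> (norm (U x - U y))\<^sup>2 * (2 powr ?p * norm (x - y + l) powr (- ?p))"
          by (rule mult_left_mono) simp
        then have "ennreal ((norm (U x - U y))\<^sup>2 / tdist e x y powr ?p) \<le> G x (y + (- l) - x)"
          unfolding G_def Uy nl by (subst ennreal_mult[symmetric], simp, simp)+ (auto intro!: ennreal_leI simp: norm_minus_commute mult_ac)
        also have "\<dots> \<le> (\<integral>\<^sup>+l. G x (y + l - x) \<partial>count_space (lattice e))"
          using ml by (rule nn_integral_ge_point)
        finally show ?thesis .
      qed simp
    qed simp
    also have "\<dots> = (\<integral>\<^sup>+y. G x (y - x) \<partial>lborel)"
      by (rule nn_integral_fund_domain_lattice[OF e, of "\<lambda>y. G x (y - x)"]) (simp add: G_def)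
    also have "\<dots> = (\<integral>\<^sup>+z. G x z \<partial>lborel)"
      using nn_integral_translate[OF e, of "\<lambda>z. G x z" "- x"] by (simp add: G_def)
    finally show "(\<integral>\<^sup>+y\<in>?D. ennreal ((norm (U x - U y))\<^sup>2 / tdist e x y powr ?p) \<partial>lborel) \<le> (\<integral>\<^sup>+z. G x z \<partial>lborel)" .
  qed simp
  also have "\<dots> = (\<integral>\<^sup>+x. (\<integral>\<^sup>+z. G x z * indicator ?D x \<partial>lborel) \<partial>lborel)"
    by (intro nn_integral_cong nn_integral_multc[symmetric]) (simp add: G_def)
  also have "\<dots> = (\<integral>\<^sup>+z. (\<integral>\<^sup>+x. G x z * indicator ?D x \<partial>lborel) \<partial>lborel)"
    by (rule lborel_pair.Fubini'[symmetric]) measurable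
  also have "\<dots> = (\<integral>\<^sup>+z. ennreal (2 powr ?p) * (ennreal (norm z powr (- ?p)) *
       (\<integral>\<^sup>+x\<in>?D. ennreal ((norm (U (x + z) - U x))\<^sup>2) \<partial>lborel)) \<partial>lborel)"
    unfolding G_def mult.assoc by (simp add: nn_integral_cmult)
  also have "\<dots> = ennreal (2 powr ?p) * (\<integral>\<^sup>+z. ennreal (norm z powr (- ?p)) *
       (\<integral>\<^sup>+x\<in>?D. ennreal ((norm (U (x + z) - U x))\<^sup>2) \<partial>lborel) \<partial>lborel)"
    by (rule nn_integral_cmult) measurable
  finally show ?thesis .
qed

context broken
begin

definition slob_const :: "real \<Rightarrow> real" where
  "slob_const s = 2 powr (real CARD('n) + 2 * s) * interp_const TYPE('n) s KL \<kappa>"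

theorem slobodetskij2_bound:
  assumes s: "0 < s" "s < 1 / 2"
  shows "slobodetskij2 e s u \<le> ennreal (slob_const s * E\<^sub>0 powr (1 - s) * E\<^sub>1 powr s)"
proof -
  have KL: "0 \<le> KL" by (simp add: KL_def)
  have "slobodetskij2 e s u \<le> ennreal (2 powr (real CARD('n) + 2 * s)) *
    (\<integral>\<^sup>+z. ennreal (norm z powr (- (real CARD('n) + 2 * s))) * \<Phi> z \<partial>lborel)"
    unfolding \<Phi>_def by (rule slobodetskij2_le_kernel[OF basis U_borel U_periodic u_eq_U s(1)])
  also have "\<dots> \<le> ennreal (2 powr (real CARD('n) + 2 * s)) *
      ennreal (interp_const TYPE('n) s KL \<kappa> * E\<^sub>0 powr (1 - s) * E\<^sub>1 powr s)"
    using kernel_interpolation[where \<Phi>=\<Phi>, OF h_pos kappa E0_nonneg E1_nonneg KL s] Phi_small Phi_large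
    by (intro mult_left_mono) (simp_all add: \<rho>\<^sub>0_def)
  also have "\<dots> = ennreal (slob_const s * E\<^sub>0 powr (1 - s) * E\<^sub>1 powr s)"
    by (subst ennreal_mult'[symmetric]) (simp_all add: slob_const_def mult.assoc)
  finally show ?thesis .
qed

end

section \<open>Inverse estimates\<close>

text \<open>Quantitative inverse estimates for one cell of a shape. The lower bounds hold on a whole
  \<delta>-neighbourhood inside the cell, because a bound at one point would not give L^2 mass;
  everything is homogeneous in the coefficients.\<close>

definition shape_inverse :: "('n::{finite,linorder}) shape \<Rightarrow> nat set set \<Rightarrow> nat \<Rightarrow> real \<Rightarrow> real \<Rightarrow> real \<Rightarrow> bool" where
  "shape_inverse R D k \<eta> \<delta> L \<longleftrightarrow> (\<forall>a.
     (\<exists>z\<in>\<Union>(geo R D). \<forall>z'\<in>\<Union>(geo R D). norm (z - z') < \<delta> \<longrightarrow>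
        \<eta> * coeff_norm R k D a \<le> norm (sh_comb R k D a z')) \<and>
     (linked D \<and> (\<exists>v\<in>\<Union>D. sh_comb R k D a (sh_pos R v) = 0) \<longrightarrow>
        (\<exists>z\<in>\<Union>(geo R D). \<exists>i. \<forall>z'\<in>\<Union>(geo R D). norm (z - z') < \<delta> \<longrightarrow>
          \<eta> * coeff_norm R k D a \<le> norm (partial i (sh_comb R k D a) z'))) \<and>
     (\<forall>z\<in>\<Union>(geo R D). \<forall>i. norm (sh_comb R k D a z) \<le> L * coeff_norm R k D a \<and>
        norm (partial i (sh_comb R k D a) z) \<le> L * coeff_norm R k D a))"

text \<open>Half of the nondegeneracy constants is sacrificed to equicontinuity, which spreads the
  lower bound from one point to a neighbourhood. General coefficients are divided by their
  norm.\<close>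

lemma compact_family_inverse:
  fixes F :: "('n::{finite,linorder}) shape set"
  assumes F: "compact_family F"
  obtains \<eta> \<delta> L where "0 < \<eta>" "0 < \<delta>" "0 < L"
    "\<And>R D k. R \<in> F \<Longrightarrow> D \<in> sh_cells R \<Longrightarrow> D \<noteq> {} \<Longrightarrow> k \<le> CARD('n) \<Longrightarrow> shape_inverse R D k \<eta> \<delta> L"
proof -
  obtain \<eta>1 where \<eta>1: "\<eta>1 > 0" and nd1: "\<forall>R\<in>F. \<forall>D\<in>sh_cells R. \<forall>k\<le>CARD('n). \<forall>a. coeff_norm R k D a = 1 \<longrightarrow>
     (\<exists>z\<in>\<Union>(geo R D). \<eta>1 \<le> norm (sh_comb R k D a z))"
    using shape_comb_nondegenerate[OF F] by (elim exE conjE) (rule that; assumption)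
  obtain \<eta>2 where \<eta>2: "\<eta>2 > 0" and nd2: "\<forall>R\<in>F. \<forall>D\<in>sh_cells R. \<forall>k\<le>CARD('n). \<forall>a. coeff_norm R k D a = 1 \<and> linked D \<and>
      (\<exists>v\<in>\<Union>D. sh_comb R k D a (sh_pos R v) = 0) \<longrightarrow>
     (\<exists>z\<in>\<Union>(geo R D). \<exists>i. \<eta>2 \<le> norm (partial i (sh_comb R k D a) z))"
    using shape_partial_nondegenerate[OF F] by (elim exE conjE) (rule that; assumption)
  define \<eta> where "\<eta> = min \<eta>1 \<eta>2 / 2"
  have \<eta>: "0 < \<eta>" "2 * \<eta> \<le> \<eta>1" "2 * \<eta> \<le> \<eta>2" using \<eta>1 \<eta>2 by (auto simp: \<eta>_def)
  obtain \<delta> where \<delta>: "\<delta> > 0" and eq: "\<forall>R\<in>F. \<forall>D\<in>sh_cells R. \<forall>k\<le>CARD('n). \<forall>a z z' i. coeff_norm R k D a \<le> 1 \<and>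
      z \<in> \<Union>(geo R D) \<and> z' \<in> \<Union>(geo R D) \<and> norm (z - z') < \<delta> \<longrightarrow>
      norm (sh_comb R k D a z - sh_comb R k D a z') < \<eta> \<and>
      norm (partial i (sh_comb R k D a) z - partial i (sh_comb R k D a) z') < \<eta>"
    using shape_equicontinuous[OF F \<eta>(1)] by (elim exE conjE) (rule that; assumption)
  obtain L where L: "L > 0" and bd: "\<forall>R\<in>F. \<forall>D\<in>sh_cells R. \<forall>k\<le>CARD('n). \<forall>a z i. coeff_norm R k D a \<le> 1 \<and>
      z \<in> \<Union>(geo R D) \<longrightarrow> norm (sh_comb R k D a z) \<le> L \<and> norm (partial i (sh_comb R k D a) z) \<le> L"
    using shape_bounded[OF F] by (elim exE conjE) (rule that; assumption)
  have "shape_inverse R D k \<eta> \<delta> L" if R: "R \<in> F" and D: "D \<in> sh_cells R" and D0: "D \<noteq> {}" and k: "k \<le> CARD('n)" for R D k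
    unfolding shape_inverse_def
  proof (intro allI)
    fix a
    let ?S = "\<Union>(geo R D)"
    have ok: "shape_ok R" using F R by (simp add: compact_family_def)
    note cd = shape_ok_cdiff[OF ok D]
    define \<nu> where "\<nu> = coeff_norm R k D a"
    have \<nu>0: "0 \<le> \<nu>" by (simp add: \<nu>_def coeff_norm_def sum_nonneg)
    define b where "b i = a i / \<nu>" for i
    have ab: "sh_comb R k D a = (\<lambda>z. \<nu> *\<^sub>R sh_comb R k D b z)"
    proof (cases "\<nu> = 0")
      case True
      then have "\<forall>i<sh_rank R k D. a i = 0" by (auto simp: \<nu>_def coeff_norm_def sum_nonneg_eq_0_iff)
      then show ?thesis using True by (auto simp: sh_comb_def)
    qed (auto simp: b_def sh_comb_def scaleR_sum_right)
    have cb: "cdiff 1 (sh_comb R k D b)" by (rule cdiff_1_sh_comb) (rule cd)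
    have pab: "partial i (sh_comb R k D a) z = \<nu> *\<^sub>R partial i (sh_comb R k D b) z" for i z
      unfolding ab using has_derivative_scaleR_right[OF cdiff_1_has_derivative[OF cb], of \<nu> z]
      by (subst partial_eqI) (auto simp: partial_def)
    have nb: "coeff_norm R k D b = 1" if "\<nu> \<noteq> 0"
      using that \<nu>0 unfolding coeff_norm_def b_def abs_divide sum_divide_distrib[symmetric] by (simp add: \<nu>_def coeff_norm_def)
    \<comment> \<open>For zero coefficients every point serves, but a point has to exist; this is
      where \<open>D0\<close> enters.\<close>
    obtain s where s: "s \<in> D" using D0 by blast
    have "sh_pos R ` s \<noteq> {}" using shape_cell_finite(4)[OF ok D s] by simp
    then have "convex hull (sh_pos R ` s) \<noteq> {}" by simp
    then obtain p where p: "p \<in> ?S" using s unfolding geo_Union by blast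
    show "(\<exists>z\<in>?S. \<forall>z'\<in>?S. norm (z - z') < \<delta> \<longrightarrow> \<eta> * coeff_norm R k D a \<le> norm (sh_comb R k D a z')) \<and>
       (linked D \<and> (\<exists>v\<in>\<Union>D. sh_comb R k D a (sh_pos R v) = 0) \<longrightarrow>
        (\<exists>z\<in>?S. \<exists>i. \<forall>z'\<in>?S. norm (z - z') < \<delta> \<longrightarrow> \<eta> * coeff_norm R k D a \<le> norm (partial i (sh_comb R k D a) z'))) \<and>
       (\<forall>z\<in>?S. \<forall>i. norm (sh_comb R k D a z) \<le> L * coeff_norm R k D a \<and> norm (partial i (sh_comb R k D a) z) \<le> L * coeff_norm R k D a)"
    proof (cases "\<nu> = 0")
      case True
      then show ?thesis unfolding \<nu>_def[symmetric] pab using p by (auto simp: ab)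
    next
      case False
      then have \<nu>: "0 < \<nu>" using \<nu>0 by simp
      note nb = nb[OF False]
      show ?thesis unfolding \<nu>_def[symmetric] pab unfolding ab
      proof (intro conjI impI)
        obtain z where z: "z \<in> ?S" "\<eta>1 \<le> norm (sh_comb R k D b z)" using nd1[rule_format, OF R D k nb] by blast
        have "\<eta> * \<nu> \<le> norm (\<nu> *\<^sub>R sh_comb R k D b z')" if "z' \<in> ?S" "norm (z - z') < \<delta>" for z'
        proof -
          have "norm (sh_comb R k D b z - sh_comb R k D b z') < \<eta>" using eq[rule_format, OF R D k conjI[OF eq_refl[OF nb] conjI[OF z(1) conjI[OF that]]]] by simp
          then have "\<eta> \<le> norm (sh_comb R k D b z')" using z(2) \<eta>(2) norm_triangle_ineq2[of "sh_comb R k D b z" "sh_comb R k D b z'"] by linarith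
          then show ?thesis using \<nu> by (simp add: mult.commute)
        qed
        then show "\<exists>z\<in>?S. \<forall>z'\<in>?S. norm (z - z') < \<delta> \<longrightarrow> \<eta> * \<nu> \<le> norm (\<nu> *\<^sub>R sh_comb R k D b z')" using z(1) by blast
      next
        assume "linked D \<and> (\<exists>v\<in>\<Union>D. \<nu> *\<^sub>R sh_comb R k D b (sh_pos R v) = 0)"
        then have "linked D" "\<exists>v\<in>\<Union>D. sh_comb R k D b (sh_pos R v) = 0" using \<nu> by auto
        from nd2[rule_format, OF R D k conjI[OF nb conjI[OF this]]] obtain z i where z: "z \<in> ?S" "\<eta>2 \<le> norm (partial i (sh_comb R k D b) z)" by blast
        have "\<eta> * \<nu> \<le> norm (\<nu> *\<^sub>R partial i (sh_comb R k D b) z')" if "z' \<in> ?S" "norm (z - z') < \<delta>" for z'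
        proof -
          have "norm (partial i (sh_comb R k D b) z - partial i (sh_comb R k D b) z') < \<eta>" using eq[rule_format, OF R D k conjI[OF eq_refl[OF nb] conjI[OF z(1) conjI[OF that]]]] by simp
          then have "\<eta> \<le> norm (partial i (sh_comb R k D b) z')"
            using z(2) \<eta>(3) norm_triangle_ineq2[of "partial i (sh_comb R k D b) z" "partial i (sh_comb R k D b) z'"] by linarith
          then show ?thesis using \<nu> by (simp add: mult.commute)
        qed
        then show "\<exists>z\<in>?S. \<exists>i. \<forall>z'\<in>?S. norm (z - z') < \<delta> \<longrightarrow> \<eta> * \<nu> \<le> norm (\<nu> *\<^sub>R partial i (sh_comb R k D b) z')"
          using z(1) by blast
      next
        show "\<forall>z\<in>?S. \<forall>i. norm (\<nu> *\<^sub>R sh_comb R k D b z) \<le> L * \<nu> \<and> norm (\<nu> *\<^sub>R partial i (sh_comb R k D b) z) \<le> L * \<nu>"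
          using bd[rule_format, OF R D k conjI[OF eq_refl[OF nb]]] \<nu> by (simp add: mult.commute)
      qed
    qed
  qed
  then show ?thesis using that[OF \<eta>(1) \<delta> L] by blast
qed

text \<open>A constant form is a polynomial whose only coefficient sits at the multi-index 0.
  Constants will be subtracted to normalise a form at a vertex.\<close>

lemma contains_polys_const:
  fixes v :: "real^('n::finite set)"
  assumes X: "contains_polys p C X" and T: "T \<in> C" and v: "\<And>I. card I \<noteq> k \<Longrightarrow> v $ I = 0"
  shows "(\<lambda>x. v) \<in> X k T"
proof -
  have fin: "finite {\<alpha> :: 'n \<Rightarrow> nat. sum \<alpha> UNIV \<le> p}"
  proof (rule finite_subset)
    show "{\<alpha> :: 'n \<Rightarrow> nat. sum \<alpha> UNIV \<le> p} \<subseteq> Pi\<^sub>E UNIV (\<lambda>_. {..p})"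
    proof
      fix \<alpha> :: "'n \<Rightarrow> nat" assume \<alpha>: "\<alpha> \<in> {\<alpha>. sum \<alpha> UNIV \<le> p}"
      have "\<alpha> i \<le> p" for i using member_le_sum[of i UNIV \<alpha>] \<alpha> by auto
      then show "\<alpha> \<in> Pi\<^sub>E UNIV (\<lambda>_. {..p})" by auto
    qed
  qed (simp add: finite_PiE)
  have "(\<Sum>\<alpha> :: 'n \<Rightarrow> nat | sum \<alpha> UNIV \<le> p. (\<Prod>i\<in>UNIV. (x $ i) ^ \<alpha> i) *\<^sub>R (if \<alpha> = (\<lambda>_. 0) then v else 0)) = v" for x :: "'n point"
  proof -
    have "(\<Sum>\<alpha> :: 'n \<Rightarrow> nat | sum \<alpha> UNIV \<le> p. (\<Prod>i\<in>UNIV. (x $ i) ^ \<alpha> i) *\<^sub>R (if \<alpha> = (\<lambda>_. 0) then v else 0))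
      = (\<Sum>\<alpha> :: 'n \<Rightarrow> nat | sum \<alpha> UNIV \<le> p. if \<alpha> = (\<lambda>_. 0) then v else 0)"
      by (rule sum.cong[OF refl]) auto
    also have "\<dots> = v" using fin by (simp add: sum.delta)
    finally show ?thesis .
  qed
  then have "poly_form p k (\<lambda>x :: 'n point. v)"
    unfolding poly_form_def deg_form_def using v by (intro conjI exI[of _ "\<lambda>\<alpha>. if \<alpha> = (\<lambda>_. 0) then v else 0"]) auto
  then show ?thesis using X T unfolding contains_polys_def by blast
qed

lemma deg_form_partial:
  assumes \<omega>: "deg_form k \<omega>" and d: "\<omega> differentiable (at x)" and I: "card I \<noteq> k"
  shows "partial i \<omega> x $ I = 0"
proof -
  have "((\<lambda>y. \<omega> y $ I) has_derivative (\<lambda>v. frechet_derivative \<omega> (at x) v $ I)) (at x)"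
    using d frechet_derivative_works by (intro bounded_linear.has_derivative[OF bounded_linear_vec_nth]) blast
  moreover have "(\<lambda>y. \<omega> y $ I) = (\<lambda>_. 0)" using \<omega> I by (auto simp: deg_form_def)
  ultimately have "(\<lambda>v. frechet_derivative \<omega> (at x) v $ I) = (\<lambda>_. 0)"
    by (metis has_derivative_const has_derivative_unique)
  then show ?thesis unfolding partial_def by meson
qed

text \<open>Forms of different degrees have disjoint sets of coefficients, so squared norms add up
  without mixed terms.\<close>

lemma norm_sum_degrees:
  fixes v :: "nat \<Rightarrow> real^('n::finite set)"
  assumes v: "\<And>k I. k \<in> A \<Longrightarrow> card I \<noteq> k \<Longrightarrow> v k $ I = 0" and A: "finite A"
  shows "(norm (\<Sum>k\<in>A. v k))\<^sup>2 = (\<Sum>k\<in>A. (norm (v k))\<^sup>2)"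
proof (rule norm_sum_Pythagorean[OF A])
  show "pairwise (\<lambda>i j. orthogonal (v i) (v j)) A"
    unfolding pairwise_def orthogonal_def
  proof (intro ballI impI)
    fix i j assume ij: "i \<in> A" "j \<in> A" "i \<noteq> j"
    have "v i $ I \<bullet> v j $ I = 0" for I using v[OF ij(1), of I] v[OF ij(2), of I] ij(3) by (cases "card I = i") auto
    then show "v i \<bullet> v j = 0" unfolding inner_vec_def by (intro sum.neutral) blast
  qed
qed

context mesh
begin

text \<open>The cell \<open>T\<close> belongs to its own macro-element, so the shape contains a
  numbered cell that describes \<open>T\<close> and its local spaces.\<close>

lemma cell_shape:
  assumes T: "T \<in> C" and R: "has_shape C K X h T R"
  obtains c D where "D \<in> sh_cells R" "(`) (\<lambda>z. c + h *\<^sub>R z) ` geo R D = simplices_in K T"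
    "\<And>k. X k T = {\<omega>. smooth \<omega> \<and> deg_form k \<omega> \<and>
        (\<exists>a. same_pullback (geo R D) (\<lambda>x. \<omega> (c + h *\<^sub>R x)) (sh_comb R k D a))}"
proof -
  define M where "M = macro_element C T"
  obtain c where c: "geo R ` sh_cells R = (\<lambda>A. (`) (\<lambda>x. (1 / h) *\<^sub>R (x - c)) ` simplices_in K A) ` {T'\<in>C. T' \<subseteq> M}"
    and X: "\<forall>T'\<in>C. \<forall>D\<in>sh_cells R. T' \<subseteq> M \<and> geo R D = (`) (\<lambda>x. (1 / h) *\<^sub>R (x - c)) ` simplices_in K T' \<longrightarrow>
           (\<forall>k. X k T' = {\<omega>. smooth \<omega> \<and> deg_form k \<omega> \<and>
              (\<exists>a. same_pullback (geo R D) (\<lambda>x. \<omega> (c + h *\<^sub>R x)) (sh_comb R k D a))})"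
    using R unfolding has_shape_def Let_def M_def[symmetric] by (elim exE conjE) (rule that; assumption)
  have TM: "T \<subseteq> M"
  proof -
    have "T \<noteq> {}" using cell_lip[OF T] lip_cell_nonempty by blast
    then show ?thesis using T unfolding M_def macro_element_def by blast
  qed
  then have "(`) (\<lambda>x. (1 / h) *\<^sub>R (x - c)) ` simplices_in K T \<in> geo R ` sh_cells R" unfolding c using T by blast
  then obtain D where D: "D \<in> sh_cells R" "geo R D = (`) (\<lambda>x. (1 / h) *\<^sub>R (x - c)) ` simplices_in K T" by (metis imageE)
  have "(\<lambda>z. c + h *\<^sub>R z) ` (\<lambda>x. (1 / h) *\<^sub>R (x - c)) ` A = A" for A using h_pos by (simp add: image_image)
  then have "(`) (\<lambda>z. c + h *\<^sub>R z) ` geo R D = simplices_in K T" unfolding D(2) by (simp add: image_image[of "(`) (\<lambda>z. c + h *\<^sub>R z)"])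
  moreover have "X k T = {\<omega>. smooth \<omega> \<and> deg_form k \<omega> \<and>
        (\<exists>a. same_pullback (geo R D) (\<lambda>x. \<omega> (c + h *\<^sub>R x)) (sh_comb R k D a))}" for k
    using X[rule_format, OF T D(1) conjI[OF TM D(2)], of k] .
  ultimately show ?thesis by (rule that[OF D(1)])
qed

text \<open>A cell is connected, so the reachable and the unreachable simplices, two closed unions
  that cover it, would have to meet. Two simplices that meet share a vertex, which would link
  them.\<close>

lemma shape_linked:
  assumes T: "T \<in> C" and ok: "shape_ok R" and D: "D \<in> sh_cells R"
    and g: "(`) (\<lambda>z. c + h *\<^sub>R z) ` geo R D = simplices_in K T"
  shows "linked D"
  unfolding linked_def
proof (intro ballI, rule ccontr)
  fix s t assume s: "s \<in> D" and t: "t \<in> D"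
  let ?r = "{(s, t). s \<in> D \<and> t \<in> D \<and> s \<inter> t \<noteq> {}}"
  assume nt: "(s, t) \<notin> ?r\<^sup>*"
  define \<pi> where "\<pi> i = c + h *\<^sub>R sh_pos R i" for i
  note fin = shape_cell_finite[OF ok D]
  have hull: "(\<lambda>z. c + h *\<^sub>R z) ` (convex hull (sh_pos R ` a)) = convex hull (\<pi> ` a)" for a
    unfolding convex_hull_affinity[symmetric] by (simp add: image_image \<pi>_def)
  have simp: "simplices_in K T = (\<lambda>a. convex hull (\<pi> ` a)) ` D"
    unfolding g[symmetric] geo_def by (simp add: image_image hull)
  have inj: "inj_on \<pi> (\<Union>D)" using fin(3) h_pos by (auto simp: inj_on_def \<pi>_def)
  define A where "A = {a \<in> D. (s, a) \<in> ?r\<^sup>*}"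
  have clo: "closed (\<Union>a\<in>B. convex hull (\<pi> ` a))" if "B \<subseteq> D" for B
    using that fin finite_subset[OF that fin(1)]
    by (intro closed_UN) (auto intro!: compact_imp_closed finite_imp_compact_convex_hull)
  have T_eq: "T = (\<Union>a\<in>A. convex hull (\<pi> ` a)) \<union> (\<Union>a\<in>D - A. convex hull (\<pi> ` a))"
    using cell_simplices[OF T] unfolding simp A_def by blast
  have con: "connected T" using cell_lip[OF T] lip_cell_connected by blast
  have sA: "s \<in> A" "t \<in> D - A" using s t nt by (auto simp: A_def)
  have ne: "convex hull (\<pi> ` a) \<noteq> {}" if "a \<in> D" for a using fin(4)[OF that] by simp
  have "(\<Union>a\<in>A. convex hull (\<pi> ` a)) \<inter> (\<Union>a\<in>D - A. convex hull (\<pi> ` a)) \<noteq> {}"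
  proof
    assume dis: "(\<Union>a\<in>A. convex hull (\<pi> ` a)) \<inter> (\<Union>a\<in>D - A. convex hull (\<pi> ` a)) = {}"
    have ne2: "(\<Union>a\<in>A. convex hull (\<pi> ` a)) \<noteq> {}" "(\<Union>a\<in>D - A. convex hull (\<pi> ` a)) \<noteq> {}"
      using sA ne s t by blast+
    have "closed (\<Union>a\<in>A. convex hull (\<pi> ` a))" "closed (\<Union>a\<in>D - A. convex hull (\<pi> ` a))"
      by (rule clo, auto simp: A_def)+
    moreover have "(\<Union>a\<in>A. convex hull (\<pi> ` a)) \<inter> (\<Union>a\<in>D - A. convex hull (\<pi> ` a)) \<inter> T = {}" unfolding dis by simp
    ultimately have "(\<Union>a\<in>A. convex hull (\<pi> ` a)) \<inter> T = {} \<or> (\<Union>a\<in>D - A. convex hull (\<pi> ` a)) \<inter> T = {}"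
      using connected_closedD[OF con, of "\<Union>a\<in>A. convex hull (\<pi> ` a)" "\<Union>a\<in>D - A. convex hull (\<pi> ` a)"] T_eq by simp
    then show False unfolding T_eq using ne2 by blast
  qed
  then obtain a b where ab: "a \<in> A" "b \<in> D - A" "convex hull (\<pi> ` a) \<inter> convex hull (\<pi> ` b) \<noteq> {}" by blast
  let ?\<sigma> = "convex hull (\<pi> ` a)" and ?\<tau> = "convex hull (\<pi> ` b)"
  have aD: "a \<in> D" using ab(1) by (simp add: A_def)
  have "?\<sigma> \<in> simplices_in K T" "?\<tau> \<in> simplices_in K T" unfolding simp using aD ab(2) by auto
  then have K: "?\<sigma> \<in> K" "?\<tau> \<in> K" by (auto simp: simplices_in_def)
  note f = K_inter[OF K]
  have "compact (?\<sigma> \<inter> ?\<tau>)" "convex (?\<sigma> \<inter> ?\<tau>)"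
    using fin(4)[OF aD] fin(4)[of b] ab(2) by (auto intro!: compact_Int finite_imp_compact_convex_hull convex_Int)
  \<comment> \<open>The intersection is a common face; its extreme points are vertices of both
    simplices, and as positions determine vertex numbers this is a common vertex.\<close>
  then obtain x where x: "x extreme_point_of (?\<sigma> \<inter> ?\<tau>)" using extreme_point_exists_convex ab(3) by blast
  have "x extreme_point_of ?\<sigma>" "x extreme_point_of ?\<tau>" using x f extreme_point_of_face by blast+
  then have "x \<in> \<pi> ` a" "x \<in> \<pi> ` b" using extreme_point_of_convex_hull by blast+
  then obtain i j where ij: "i \<in> a" "j \<in> b" "\<pi> i = \<pi> j" by auto
  then have "i = j" using inj aD ab(2) by (auto dest: inj_onD)
  then have "(a, b) \<in> ?r" using ij aD ab(2) by blast
  then have "b \<in> A" using ab(1,2) unfolding A_def by (auto intro: rtrancl_into_rtrancl)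
  then show False using ab(2) by simp
qed

text \<open>On an \<open>n\<close>-simplex of the cell equal pullbacks mean equal coefficients.
  Derivatives then agree in its interior, and by continuity on all of it; the scaling contributes
  the factor \<open>h\<close>.\<close>

lemma shape_representation:
  assumes T: "T \<in> ncells" and ok: "shape_ok R" and D: "D \<in> sh_cells R"
    and g: "(`) (\<lambda>z. c + h *\<^sub>R z) ` geo R D = simplices_in K T"
    and \<omega>: "cdiff 1 \<omega>" and a: "same_pullback (geo R D) (\<lambda>x. \<omega> (c + h *\<^sub>R x)) (sh_comb R k D a)"
    and z: "z \<in> \<Union>(geo R D)"
  shows "\<omega> (c + h *\<^sub>R z) = sh_comb R k D a z" "h *\<^sub>R partial i \<omega> (c + h *\<^sub>R z) = partial i (sh_comb R k D a) z"
proof -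
  let ?g = "\<lambda>z :: 'n point. c + h *\<^sub>R z"
  let ?w = "sh_comb R k D a"
  have inj: "inj ?g" using h_pos by (auto simp: inj_def)
  have cw: "cdiff 1 ?w" by (rule cdiff_1_sh_comb) (rule shape_ok_cdiff[OF ok D])
  have Un: "?g ` \<Union>(geo R D) = T" using g cell_simplices[OF ncells_C[OF T]] by (metis image_Union)
  \<comment> \<open>An \<open>n\<close>-simplex through the point is chosen, since pullback to a
    lower-dimensional face would only determine tangential components.\<close>
  obtain \<sigma> where \<sigma>: "\<sigma> \<in> nsimps" "?g z \<in> \<sigma>" "\<sigma> \<subseteq> T" using ncell_nsimps[OF T, of "?g z"] Un z by blast
  then have "\<sigma> \<in> simplices_in K T" using nsimps_D(1) by (auto simp: simplices_in_def)
  then obtain \<tau> where \<tau>: "\<tau> \<in> geo R D" "\<sigma> = ?g ` \<tau>" unfolding g[symmetric] by blast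
  have z\<tau>: "z \<in> \<tau>" using \<sigma>(2) \<tau>(2) inj by (auto dest: injD)
  obtain s where s: "s \<in> D" "\<tau> = convex hull (sh_pos R ` s)" using \<tau>(1) by (auto simp: geo_def)
  have conv: "convex \<tau>" "compact \<tau>" using s shape_cell_finite(4)[OF ok D s(1)] by (auto intro: finite_imp_compact_convex_hull)
  have int: "interior \<tau> \<noteq> {}"
  proof -
    have "interior \<sigma> \<noteq> {}" using simplex_interior_nonempty nsimps_D(2) \<sigma>(1) by blast
    then obtain x r where r: "0 < r" "ball x r \<subseteq> ?g ` \<tau>" unfolding \<tau>(2) by (metis ex_in_conv mem_interior)
    have "ball ((1 / h) *\<^sub>R (x - c)) (r / h) \<subseteq> \<tau>"
    proof
      fix y assume y: "y \<in> ball ((1 / h) *\<^sub>R (x - c)) (r / h)"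
      have "x - ?g y = h *\<^sub>R ((1 / h) *\<^sub>R (x - c) - y)" using h_pos by (simp add: algebra_simps)
      then have "norm (x - ?g y) = h * norm ((1 / h) *\<^sub>R (x - c) - y)" using h_pos by simp
      also have "\<dots> < r" using y h_pos by (simp add: dist_norm pos_less_divide_eq mult.commute)
      finally have "?g y \<in> ?g ` \<tau>" using r(2) by (auto simp: dist_norm)
      then show "y \<in> \<tau>" using inj by (auto dest: injD)
    qed
    then show ?thesis using r(1) h_pos by (metis interior_maximal open_ball centre_in_ball divide_pos_pos empty_iff subsetD)
  qed
  have eq: "\<omega> (?g y) = ?w y" if "y \<in> \<tau>" for y
    using a that \<tau>(1) span_differences_UNIV[OF int] unfolding same_pullback_def
    by (intro form_eval_eqD) auto
  show "\<omega> (?g z) = ?w z" using eq z\<tau> .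
  have der: "((\<lambda>y. \<omega> (?g y)) has_derivative (\<lambda>v. frechet_derivative \<omega> (at (?g y)) (h *\<^sub>R v))) (at y)" for y
    by (rule has_derivative_compose[OF _ cdiff_1_has_derivative[OF \<omega>], where f = ?g]) (auto intro!: derivative_eq_intros)
  have par: "partial i (\<lambda>y. \<omega> (?g y)) y = h *\<^sub>R partial i \<omega> (?g y)" for y
    unfolding partial_eqI[OF der] partial_def
    using linear_frechet_derivative[OF cdiff_1_differentiable[OF \<omega>]] by (simp add: linear_cmul)
  have inter: "h *\<^sub>R partial i \<omega> (?g y) = partial i ?w y" if y: "y \<in> interior \<tau>" for y
  proof -
    have "((\<lambda>y. \<omega> (?g y)) has_derivative frechet_derivative ?w (at y)) (at y)"
      
      by (intro has_derivative_transform_within_open[OF cdiff_1_has_derivative[OF cw] open_interior y])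
         (use eq interior_subset in \<open>metis subsetD\<close>)
    then have "partial i (\<lambda>y. \<omega> (?g y)) y = partial i ?w y" unfolding partial_def[of i ?w] by (rule partial_eqI)
    then show ?thesis unfolding par .
  qed
  have "closed {y. h *\<^sub>R partial i \<omega> (?g y) = partial i ?w y}"
    using cdiff_1_continuous_partial[OF \<omega>, of UNIV i] cdiff_1_continuous_partial[OF cw, of UNIV i]
    by (intro closed_Collect_eq continuous_on_scaleR continuous_on_const continuous_on_compose2[of UNIV "partial i \<omega>" UNIV ?g])
       (auto intro!: continuous_intros)
  then have "closure (interior \<tau>) \<subseteq> {y. h *\<^sub>R partial i \<omega> (?g y) = partial i ?w y}"
    using inter by (intro closure_minimal) auto
  moreover have "closure (interior \<tau>) = \<tau>"
    using convex_closure_interior[OF conv(1) int] conv(2) by (simp add: compact_imp_closed)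
  ultimately show "h *\<^sub>R partial i \<omega> (?g z) = partial i ?w z" using z\<tau> by blast
qed


text \<open>A ball of radius \<open>\<theta> * \<rho>\<^sub>0\<close> lies in the cell within
  distance \<open>\<delta> * h\<close> of the given point, also when that point is on the boundary;
  the lower bound holds on this ball.\<close>

lemma near_mass:
  fixes f :: "'n point \<Rightarrow> 'b::euclidean_space"
  assumes T: "T \<in> ncells" and x0: "x\<^sub>0 \<in> T" and \<theta>: "0 < \<theta>" "\<theta> \<le> 1" "\<theta> / \<kappa> < \<delta>"
    and f: "continuous_on UNIV f" and b: "0 \<le> b"
    and low: "\<And>x. x \<in> T \<Longrightarrow> norm (x\<^sub>0 - x) < \<delta> * h \<Longrightarrow> b \<le> norm (f x)"
  shows "b\<^sup>2 * ((\<theta> * \<kappa>\<^sup>2) ^ CARD('n) * unit_vol TYPE('n) * h ^ CARD('n)) \<le> (LINT y:T|lborel. (norm (f y))\<^sup>2)"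
proof -
  obtain \<sigma> where \<sigma>: "\<sigma> \<in> nsimps" "x\<^sub>0 \<in> \<sigma>" "\<sigma> \<subseteq> T" using ncell_nsimps[OF T x0] by blast
  obtain p where p: "cball p \<rho>\<^sub>0 \<subseteq> \<sigma>" using nsimps_ball[OF \<sigma>(1)] by blast
  have D: "\<sigma> \<subseteq> cball x\<^sub>0 (h / \<kappa>)" using nsimps_norm[OF \<sigma>(1) \<sigma>(2)] by (auto simp: dist_norm)
  define q where "q = x\<^sub>0 + \<theta> *\<^sub>R (p - x\<^sub>0)"
  let ?B = "cball q (\<theta> * \<rho>\<^sub>0)"
  have B: "?B \<subseteq> \<sigma> \<inter> cball x\<^sub>0 (\<theta> * (h / \<kappa>))"
    unfolding q_def using convex_contains_near_ball[OF nsimps_compact(2)[OF \<sigma>(1)] p \<sigma>(2) D \<theta>(1,2)] .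
  have \<theta>h: "\<theta> * (h / \<kappa>) < \<delta> * h" using mult_strict_right_mono[OF \<theta>(3) h_pos] by simp
  have int: "set_integrable lborel S (\<lambda>y. (norm (f y))\<^sup>2)" if "compact S" for S
    unfolding set_integrable_def using that
    by (intro borel_integrable_compact continuous_intros continuous_on_subset[OF f]) auto
  have "b\<^sup>2 * ((\<theta> * \<kappa>\<^sup>2) ^ CARD('n) * unit_vol TYPE('n) * h ^ CARD('n)) = b\<^sup>2 * measure lborel ?B"
    using \<theta>(1) h_pos by (subst measure_cball_unit_vol) (auto simp: \<rho>\<^sub>0_def power_mult_distrib)
  also have "\<dots> = (LINT y:?B|lborel. b\<^sup>2)"
    by (simp add: set_lebesgue_integral_def emeasure_lborel_bounded less_top[symmetric] mult.commute)
  also have "\<dots> \<le> (LINT y:T|lborel. (norm (f y))\<^sup>2)"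
    unfolding set_lebesgue_integral_def
  proof (rule integral_mono)
    show "integrable lborel (\<lambda>y. indicator ?B y *\<^sub>R b\<^sup>2)"
      by (intro integrable_scaleR_left) (auto simp: emeasure_lborel_bounded less_top[symmetric] integrable_indicator_iff)
    show "integrable lborel (\<lambda>y. indicator T y *\<^sub>R (norm (f y))\<^sup>2)"
      using int[OF cell_compact[OF ncells_C[OF T]]] unfolding set_integrable_def .
    fix y
    show "indicator ?B y *\<^sub>R b\<^sup>2 \<le> indicator T y *\<^sub>R (norm (f y))\<^sup>2"
    proof (cases "y \<in> ?B")
      case True
      then have "y \<in> T" "norm (x\<^sub>0 - y) < \<delta> * h" using B \<sigma>(3) \<theta>h by (auto simp: dist_norm)
      from this low[OF this] show ?thesis using b by (simp add: power_mono indicator_def)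
    qed (simp add: indicator_def)
  qed
  finally show ?thesis .
qed

text \<open>The coefficient norm of the form mediates: \<open>L\<close> bounds values and
  derivatives by it from above, \<eta> bounds them from below near one point, and
  \<open>near_mass\<close> turns this into mass. The constant is the squared ratio of the two
  bounds, divided by a relative volume.\<close>

lemma inverse_estimate:
  assumes T: "T \<in> ncells" and shp: "has_shape C K X h T R" and ok: "shape_ok R"
    and inv: "\<And>D. D \<in> sh_cells R \<Longrightarrow> D \<noteq> {} \<Longrightarrow> shape_inverse R D k \<eta> \<delta> L"
    and pos: "0 < \<eta>" "0 < \<delta>" "0 < L" and \<theta>: "0 < \<theta>" "\<theta> \<le> 1" "\<theta> / \<kappa> < \<delta>"
    and es: "element_system e C K X" and polys: "contains_polys p C X"
    and \<omega>: "\<omega> \<in> X k T" and x: "x \<in> T"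
    and c: "c\<^sub>0 = L\<^sup>2 / (\<eta>\<^sup>2 * ((\<theta> * \<kappa>\<^sup>2) ^ CARD('n) * unit_vol TYPE('n)))"
  shows "(norm (\<omega> x))\<^sup>2 * h ^ CARD('n) \<le> c\<^sub>0 * (LINT y:T|lborel. (norm (\<omega> y))\<^sup>2)"
    and "(h * norm (partial i \<omega> x))\<^sup>2 * h ^ CARD('n) \<le> c\<^sub>0 * (LINT y:T|lborel. (norm (\<omega> y))\<^sup>2)"
    and "(norm (partial i \<omega> x))\<^sup>2 * h ^ CARD('n) \<le> c\<^sub>0 * (\<Sum>j\<in>UNIV. LINT y:T|lborel. (norm (partial j \<omega> y))\<^sup>2)"
proof -
  note TC = ncells_C[OF T]
  obtain c D where D: "D \<in> sh_cells R" and g: "(`) (\<lambda>z. c + h *\<^sub>R z) ` geo R D = simplices_in K T"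
    and Xk: "\<And>k. X k T = {\<omega>. smooth \<omega> \<and> deg_form k \<omega> \<and>
        (\<exists>a. same_pullback (geo R D) (\<lambda>x. \<omega> (c + h *\<^sub>R x)) (sh_comb R k D a))}"
    by (rule cell_shape[OF TC shp]) (rule that)
  let ?S = "\<Union>(geo R D)" and ?g = "\<lambda>z :: 'n point. c + h *\<^sub>R z"
  let ?m = "(\<theta> * \<kappa>\<^sup>2) ^ CARD('n) * unit_vol TYPE('n)"
  have m: "0 < ?m" using \<theta>(1) kappa unit_vol_pos[where 'n='n] by simp
  have Un: "?g ` ?S = T" using g cell_simplices[OF TC] by (metis image_Union)
  have D0: "D \<noteq> {}" using Un x by (auto simp: geo_def)
  note I = inv[OF D D0, unfolded shape_inverse_def, rule_format]
  have rep: "\<exists>a. \<forall>z\<in>?S. \<phi> (?g z) = sh_comb R k D a z \<and> (\<forall>i. h *\<^sub>R partial i \<phi> (?g z) = partial i (sh_comb R k D a) z)"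
    if \<phi>: "\<phi> \<in> X k T" for \<phi>
  proof -
    obtain a where "same_pullback (geo R D) (\<lambda>x. \<phi> (c + h *\<^sub>R x)) (sh_comb R k D a)" and "smooth \<phi>" using \<phi> unfolding Xk by blast
    then show ?thesis using shape_representation[OF T ok D g smooth_imp_cdiff_1] by blast
  qed
  have sm: "cdiff 1 \<phi>" if "\<phi> \<in> X k T" for \<phi> using that unfolding Xk by (blast intro: smooth_imp_cdiff_1)
  obtain z where z: "z \<in> ?S" "x = ?g z" using x Un by blast
  have near: "norm (z0 - z') < \<delta>" if "norm (?g z0 - ?g z') < \<delta> * h" for z0 z'
  proof -
    have "?g z0 - ?g z' = h *\<^sub>R (z0 - z')" by (simp add: algebra_simps)
    then show ?thesis using that h_pos by (simp add: mult.commute)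
  qed
  \<comment> \<open>The parameter \<open>t\<close> is the scaling common to both sides: 1 for values
    and scaled derivatives, \<open>h\<close> for the derivatives themselves.\<close>
  have conclude: "A\<^sup>2 * h ^ CARD('n) \<le> c\<^sub>0 * B" if "0 \<le> A" "A * t \<le> L * \<nu>" "0 < t" "0 \<le> \<nu>" "(\<eta> * \<nu> / t)\<^sup>2 * (?m * h ^ CARD('n)) \<le> B" for A B t \<nu> :: real
  proof -
    have "A \<le> L * \<nu> / t" using that(2,3) by (simp add: pos_le_divide_eq)
    then have "A\<^sup>2 * h ^ CARD('n) \<le> (L * \<nu> / t)\<^sup>2 * h ^ CARD('n)" using that(1) h_pos by (intro mult_right_mono power_mono) auto
    also have "\<dots> = c\<^sub>0 * ((\<eta> * \<nu> / t)\<^sup>2 * (?m * h ^ CARD('n)))"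
    proof -
      have "(L * \<nu> / t)\<^sup>2 * H = L\<^sup>2 / (\<eta>\<^sup>2 * m) * ((\<eta> * \<nu> / t)\<^sup>2 * (m * H))" if "0 < m" for m H :: real
        using pos(1) \<open>0 < t\<close> that by (simp add: power_mult_distrib power_divide)
      from this[OF m] show ?thesis unfolding c .
    qed
    also have "\<dots> \<le> c\<^sub>0 * B" using that(5) m by (intro mult_left_mono) (auto simp: c)
    finally show ?thesis .
  qed
  obtain a where a: "\<forall>z\<in>?S. \<omega> (?g z) = sh_comb R k D a z \<and> (\<forall>i. h *\<^sub>R partial i \<omega> (?g z) = partial i (sh_comb R k D a) z)"
    using rep[OF \<omega>] by blast
  let ?\<nu> = "coeff_norm R k D a"
  have \<nu>: "0 \<le> ?\<nu>" by (simp add: coeff_norm_def sum_nonneg)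
  obtain z0 where z0: "z0 \<in> ?S" "\<forall>z'\<in>?S. norm (z0 - z') < \<delta> \<longrightarrow> \<eta> * ?\<nu> \<le> norm (sh_comb R k D a z')"
    using I[of a, THEN conjunct1] by blast
  have mass: "(\<eta> * ?\<nu> / 1)\<^sup>2 * (?m * h ^ CARD('n)) \<le> (LINT y:T|lborel. (norm (\<omega> y))\<^sup>2)"
  proof (rule near_mass[OF T _ \<theta>])
    show "?g z0 \<in> T" using z0(1) Un by blast
    show "continuous_on UNIV \<omega>" using sm[OF \<omega>] by (rule cdiff_1_continuous)
    fix y assume y: "y \<in> T" "norm (?g z0 - y) < \<delta> * h"
    then obtain z' where z': "z' \<in> ?S" "y = ?g z'" using Un by blast
    have "norm (z0 - z') < \<delta>" using near[of z0 z'] y(2) z'(2) by blast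
    then show "\<eta> * ?\<nu> / 1 \<le> norm (\<omega> y)" using bspec[OF z0(2) z'(1)] bspec[OF a z'(1)] z'(2) by simp
  qed (use pos \<nu> in auto)
  have bd: "norm (\<omega> x) \<le> L * ?\<nu>" "norm (partial i \<omega> x) * h \<le> L * ?\<nu>"
  proof -
    have *: "norm (sh_comb R k D a z) \<le> L * ?\<nu> \<and> norm (partial i (sh_comb R k D a) z) \<le> L * ?\<nu>"
      using I[of a, THEN conjunct2, THEN conjunct2] z(1) by blast
    have "norm (h *\<^sub>R partial i \<omega> x) \<le> L * ?\<nu>" "norm (\<omega> x) \<le> L * ?\<nu>" using * bspec[OF a z(1)] z(2) by metis+
    then show "norm (\<omega> x) \<le> L * ?\<nu>" "norm (partial i \<omega> x) * h \<le> L * ?\<nu>" using h_pos by (simp_all add: mult.commute)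
  qed
  show "(norm (\<omega> x))\<^sup>2 * h ^ CARD('n) \<le> c\<^sub>0 * (LINT y:T|lborel. (norm (\<omega> y))\<^sup>2)"
    by (rule conclude[OF _ _ _ \<nu> mass]) (use bd in auto)
  show "(h * norm (partial i \<omega> x))\<^sup>2 * h ^ CARD('n) \<le> c\<^sub>0 * (LINT y:T|lborel. (norm (\<omega> y))\<^sup>2)"
    by (rule conclude[OF _ _ _ \<nu> mass]) (use bd h_pos in \<open>auto simp: mult.commute\<close>)
  show "(norm (partial i \<omega> x))\<^sup>2 * h ^ CARD('n) \<le> c\<^sub>0 * (\<Sum>j\<in>UNIV. LINT y:T|lborel. (norm (partial j \<omega> y))\<^sup>2)"
  proof -
    obtain s v where s: "s \<in> D" "v \<in> s" using D0 shape_cell_finite(4)[OF ok D] by blast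
    define x1 where "x1 = ?g (sh_pos R v)"
    have v: "sh_pos R v \<in> ?S" unfolding geo_Union using s by (auto intro!: bexI[of _ s] hull_inc)
    \<comment> \<open>Subtracting the value at a vertex leaves all derivatives unchanged and
      produces the zero that the gradient part of \<open>shape_inverse\<close> asks for.\<close>
    define \<phi> where "\<phi> = (\<lambda>y. 1 *\<^sub>R \<omega> y + (- 1) *\<^sub>R \<omega> x1)"
    have "deg_form k \<omega>" using \<omega> unfolding Xk by blast
    then have const: "(\<lambda>y. \<omega> x1) \<in> X k T" by (intro contains_polys_const[OF polys TC]) (auto simp: deg_form_def)
    have lin: "\<forall>\<omega>\<in>X k T. \<forall>\<eta>\<in>X k T. \<forall>a b. (\<lambda>x. a *\<^sub>R \<omega> x + b *\<^sub>R \<eta> x) \<in> X k T"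
      using es TC unfolding element_system_def by (elim ballE[of _ _ T] allE[of _ k] conjE) (assumption | blast)+
    have \<phi>X: "\<phi> \<in> X k T" unfolding \<phi>_def by (rule lin[rule_format, OF \<omega> const])
    have "(\<phi> has_derivative frechet_derivative \<omega> (at y)) (at y)" for y
      using has_derivative_diff[OF cdiff_1_has_derivative[OF sm[OF \<omega>]] has_derivative_const] by (simp add: \<phi>_def)
    then have p\<phi>: "partial j \<phi> y = partial j \<omega> y" for j y by (subst partial_eqI) (auto simp: partial_def)
    obtain a where a: "\<forall>z\<in>?S. \<phi> (?g z) = sh_comb R k D a z \<and> (\<forall>i. h *\<^sub>R partial i \<phi> (?g z) = partial i (sh_comb R k D a) z)"
      using rep[OF \<phi>X] by blast
    let ?\<nu> = "coeff_norm R k D a"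
    have \<nu>: "0 \<le> ?\<nu>" by (simp add: coeff_norm_def sum_nonneg)
    have "sh_comb R k D a (sh_pos R v) = 0" using bspec[OF a v] by (simp add: \<phi>_def x1_def)
    then have "linked D \<and> (\<exists>v\<in>\<Union>D. sh_comb R k D a (sh_pos R v) = 0)" using shape_linked[OF TC ok D g] s by blast
    then obtain z0 j where z0: "z0 \<in> ?S" "\<forall>z'\<in>?S. norm (z0 - z') < \<delta> \<longrightarrow> \<eta> * ?\<nu> \<le> norm (partial j (sh_comb R k D a) z')"
      using I[of a, THEN conjunct2, THEN conjunct1] by blast
    have "(\<eta> * ?\<nu> / h)\<^sup>2 * (?m * h ^ CARD('n)) \<le> (LINT y:T|lborel. (norm (partial j \<omega> y))\<^sup>2)"
    proof (rule near_mass[OF T _ \<theta>])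
      show "?g z0 \<in> T" using z0(1) Un by blast
      show "continuous_on UNIV (partial j \<omega>)" using sm[OF \<omega>] by (rule cdiff_1_continuous_partial)
      fix y assume y: "y \<in> T" "norm (?g z0 - y) < \<delta> * h"
      then obtain z' where z': "z' \<in> ?S" "y = ?g z'" using Un by blast
      have "norm (z0 - z') < \<delta>" using near[of z0 z'] y(2) z'(2) by blast
      then have "\<eta> * ?\<nu> \<le> norm (h *\<^sub>R partial j \<phi> (?g z'))" using bspec[OF z0(2) z'(1)] bspec[OF a z'(1)] by metis
      then show "\<eta> * ?\<nu> / h \<le> norm (partial j \<omega> y)" using h_pos by (simp add: p\<phi> z'(2) pos_divide_le_eq mult.commute)
    qed (use pos \<nu> h_pos in auto)
    also have "\<dots> \<le> (\<Sum>j\<in>UNIV. LINT y:T|lborel. (norm (partial j \<omega> y))\<^sup>2)"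
      by (rule member_le_sum[where f = "\<lambda>j. LINT y:T|lborel. (norm (partial j \<omega> y))\<^sup>2"])
        (auto simp: set_lebesgue_integral_def intro!: integral_nonneg_AE)
    finally have mass: "(\<eta> * ?\<nu> / h)\<^sup>2 * (?m * h ^ CARD('n)) \<le> (\<Sum>j\<in>UNIV. LINT y:T|lborel. (norm (partial j \<omega> y))\<^sup>2)" .
    have "norm (partial i (sh_comb R k D a) z) \<le> L * ?\<nu>"
      using I[of a, THEN conjunct2, THEN conjunct2] z(1) by blast
    moreover have "h *\<^sub>R partial i \<omega> x = partial i (sh_comb R k D a) z" using bspec[OF a z(1)] z(2) p\<phi> by metis
    ultimately have "norm (h *\<^sub>R partial i \<omega> x) \<le> L * ?\<nu>" by simp
    then show ?thesis by (intro conclude[OF _ _ h_pos \<nu> mass]) (use h_pos in \<open>auto simp: mult.commute\<close>)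
  qed
qed

end

section \<open>Finite element fields\<close>

lemma L2_forms_add:
  fixes a b :: "('n::finite) form"
  assumes e: "lattice_basis e" and a: "a \<in> L2_forms e" and b: "b \<in> L2_forms e"
  shows "(\<lambda>x. a x + b x) \<in> L2_forms e"
proof -
  have [measurable]: "a \<in> borel_measurable lebesgue" "b \<in> borel_measurable lebesgue"
    using a b by (auto simp: L2_forms_def)
  have "integrable lebesgue (\<lambda>x. indicator (fund_domain e) x *\<^sub>R (norm (a x))\<^sup>2)"
    "integrable lebesgue (\<lambda>x. indicator (fund_domain e) x *\<^sub>R (norm (b x))\<^sup>2)"
    using a b by (auto simp: L2_forms_def set_integrable_def)
  then have i: "integrable lebesgue (\<lambda>x. 2 * (indicator (fund_domain e) x *\<^sub>R (norm (a x))\<^sup>2) + 2 * (indicator (fund_domain e) x *\<^sub>R (norm (b x))\<^sup>2))"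
    by (intro Bochner_Integration.integrable_add integrable_mult_right)
  have *: "(norm (a x + b x))\<^sup>2 \<le> 2 * (norm (a x))\<^sup>2 + 2 * (norm (b x))\<^sup>2" for x
  proof -
    have "(norm (a x + b x))\<^sup>2 \<le> (norm (a x) + norm (b x))\<^sup>2" by (intro power_mono norm_triangle_ineq) simp
    also have "\<dots> \<le> 2 * (norm (a x))\<^sup>2 + 2 * (norm (b x))\<^sup>2"
      using zero_le_power2[of "norm (a x) - norm (b x)"] by (simp add: power2_eq_square algebra_simps)
    finally show ?thesis .
  qed
  have "set_integrable lebesgue (fund_domain e) (\<lambda>x. (norm (a x + b x))\<^sup>2)"
    unfolding set_integrable_def
  proof (rule Bochner_Integration.integrable_bound[OF i])
    have [measurable]: "fund_domain e \<in> sets lebesgue" using borel_fund_domain[OF e] by simp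
    show "(\<lambda>x. indicator (fund_domain e) x *\<^sub>R (norm (a x + b x))\<^sup>2) \<in> borel_measurable lebesgue"
      by measurable
  qed (use * in \<open>auto simp: indicator_def\<close>)
  moreover have "periodic e (\<lambda>x. a x + b x)" using a b by (simp add: L2_forms_def periodic_def)
  ultimately show ?thesis by (simp add: L2_forms_def)
qed

lemma L2_forms_sum:
  fixes v :: "'k \<Rightarrow> ('n::finite) form"
  assumes e: "lattice_basis e" and "finite A" "\<And>k. k \<in> A \<Longrightarrow> v k \<in> L2_forms e"
  shows "(\<lambda>x. \<Sum>k\<in>A. v k x) \<in> L2_forms e"
  using assms(2,3)
proof (induction A)
  case empty
  show ?case by (simp add: L2_forms_def periodic_def set_integrable_def)
next
  case (insert k A)
  then show ?case using L2_forms_add[OF e, of "v k" "\<lambda>x. \<Sum>k\<in>A. v k x"] by simp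
qed

lemma L2_norm_nonneg: "0 \<le> L2_norm e u"
  unfolding L2_norm_def set_lebesgue_integral_def by (intro real_sqrt_ge_zero integral_nonneg_AE) auto

context mesh
begin

text \<open>Components of different degree are orthogonal at each point, and so are their
  derivatives; hence the inverse estimates for the single degrees add up with the same
  constant.\<close>

lemma fe_space_broken:
  assumes u: "u \<in> fe_space e C K X"
    and es: "element_system e C K X" and polys: "contains_polys p C X"
    and F: "compact_family F" and shp: "\<And>T. T \<in> C \<Longrightarrow> \<exists>R\<in>F. has_shape C K X h T R"
    and inv: "\<And>R D k. R \<in> F \<Longrightarrow> D \<in> sh_cells R \<Longrightarrow> D \<noteq> {} \<Longrightarrow> k \<le> CARD('n) \<Longrightarrow> shape_inverse R D k \<eta> \<delta> L"
    and pos: "0 < \<eta>" "0 < \<delta>" "0 < L" and \<theta>: "0 < \<theta>" "\<theta> \<le> 1" "\<theta> / \<kappa> < \<delta>"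
    and c: "c\<^sub>0 = L\<^sup>2 / (\<eta>\<^sup>2 * ((\<theta> * \<kappa>\<^sup>2) ^ CARD('n) * unit_vol TYPE('n)))"
    and H: "1 \<le> H" "\<kappa>\<^sup>2 * h \<le> H"
  obtains w where "broken e C K \<kappa> h N w u c\<^sub>0 H"
proof -
  let ?n = "CARD('n)"
  obtain v where u_eq: "u = (\<lambda>x. \<Sum>k\<le>?n. v k x)" and v: "\<forall>k\<le>?n. v k \<in> fe_space_deg e C K X k"
    using u unfolding fe_space_def by (elim CollectE exE conjE) (rule that; assumption)
  have "\<exists>w. k \<le> ?n \<longrightarrow> (\<forall>T\<in>C. w T \<in> X k T) \<and>
      (\<forall>T\<in>C. cell_dim T = ?n \<longrightarrow> (AE x in lebesgue. x \<in> T \<longrightarrow> v k x = w T x))" for k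
  proof (cases "k \<le> ?n")
    case True
    then have "v k \<in> fe_space_deg e C K X k" using v by simp
    then show ?thesis unfolding fe_space_deg_def by (elim CollectE exE conjE) (intro exI impI conjI; assumption)
  qed simp
  then obtain w where w: "\<forall>k. k \<le> ?n \<longrightarrow> (\<forall>T\<in>C. w k T \<in> X k T) \<and>
      (\<forall>T\<in>C. cell_dim T = ?n \<longrightarrow> (AE x in lebesgue. x \<in> T \<longrightarrow> v k x = w k T x))" by (rule choice[OF allI, THEN exE])
  note w1 = w[THEN spec, THEN mp, THEN conjunct1] and w2 = w[THEN spec, THEN mp, THEN conjunct2]
  have wX: "w k T \<in> X k T" if "k \<le> ?n" "T \<in> ncells" for k T using bspec[OF w1[OF that(1)] ncells_C[OF that(2)]] .
  have wv: "AE x in lebesgue. x \<in> T \<longrightarrow> v k x = w k T x" if "k \<le> ?n" "T \<in> ncells" for k T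
    using bspec[OF w2[OF that(1)] ncells_C[OF that(2)]] that(2) by (simp add: ncells_def)
  define W where "W T = (\<lambda>x. \<Sum>k\<le>?n. w k T x)" for T
  have smooth: "cdiff 1 (w k T)" and deg: "deg_form k (w k T)" if "k \<le> ?n" "T \<in> ncells" for k T
  proof -
    have "\<forall>\<omega>\<in>X k T. smooth \<omega> \<and> deg_form k \<omega>"
      using es[unfolded element_system_def, THEN bspec, OF ncells_C[OF that(2)], THEN spec, of k] by (elim conjE)
    from bspec[OF this wX[OF that]] show "cdiff 1 (w k T)" "deg_form k (w k T)" by (simp_all add: smooth_imp_cdiff_1 del: cdiff.simps One_nat_def)
  qed
  have der: "(W T has_derivative (\<lambda>d. \<Sum>k\<le>?n. frechet_derivative (w k T) (at x) d)) (at x)" if "T \<in> ncells" for T x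
    unfolding W_def using smooth[OF _ that] by (intro has_derivative_sum cdiff_1_has_derivative) auto
  have partial_W: "partial i (W T) x = (\<Sum>k\<le>?n. partial i (w k T) x)" if "T \<in> ncells" for T x i
    using partial_eqI[OF der[OF that]] by (simp add: partial_def)
  have W_C1: "cdiff 1 (W T)" if T: "T \<in> ncells" for T
  proof -
    have "frechet_derivative (W T) (at x) = (\<lambda>d. \<Sum>k\<le>?n. frechet_derivative (w k T) (at x) d)" for x
      using frechet_derivative_at[OF der[OF T]] by simp
    moreover have "continuous_on UNIV (\<lambda>x. \<Sum>k\<le>?n. frechet_derivative (w k T) (at x) d)" for d
      using smooth[OF _ T] unfolding cdiff_1_iff by (intro continuous_on_sum) auto
    ultimately show ?thesis unfolding cdiff_1_iff using der[OF T] by (auto simp: differentiable_def)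
  qed
  have norm_W: "(norm (W T x))\<^sup>2 = (\<Sum>k\<le>?n. (norm (w k T x))\<^sup>2)" if "T \<in> ncells" for T x
    unfolding W_def using deg[OF _ that] by (intro norm_sum_degrees) (auto simp: deg_form_def)
  have norm_pW: "(norm (partial i (W T) x))\<^sup>2 = (\<Sum>k\<le>?n. (norm (partial i (w k T) x))\<^sup>2)" if "T \<in> ncells" for T x i
    unfolding partial_W[OF that] using deg[OF _ that] smooth[OF _ that]
    by (intro norm_sum_degrees deg_form_partial[OF _ cdiff_1_differentiable]) auto
  have int: "set_integrable lborel T (\<lambda>y. (norm (f y))\<^sup>2)" if "T \<in> ncells" "continuous_on UNIV f" for T and f :: "'n form"
    unfolding set_integrable_def using cell_compact[OF ncells_C[OF that(1)]]
    by (intro borel_integrable_compact continuous_intros continuous_on_subset[OF that(2)]) auto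
  have L2_W: "(LINT y:T|lborel. (norm (W T y))\<^sup>2) = (\<Sum>k\<le>?n. LINT y:T|lborel. (norm (w k T y))\<^sup>2)" if T: "T \<in> ncells" for T
    unfolding norm_W[OF T] set_lebesgue_integral_def scaleR_sum_right
    using int[OF T cdiff_1_continuous[OF smooth[OF _ T]]] by (intro Bochner_Integration.integral_sum) (auto simp: set_integrable_def)
  have L2_pW: "(LINT y:T|lborel. (norm (partial j (W T) y))\<^sup>2) = (\<Sum>k\<le>?n. LINT y:T|lborel. (norm (partial j (w k T) y))\<^sup>2)" if T: "T \<in> ncells" for T j
    unfolding norm_pW[OF T] set_lebesgue_integral_def scaleR_sum_right
    using int[OF T cdiff_1_continuous_partial[OF smooth[OF _ T]]] by (intro Bochner_Integration.integral_sum) (auto simp: set_integrable_def)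
  have est: "(norm (w k T x))\<^sup>2 * h ^ ?n \<le> c\<^sub>0 * (LINT y:T|lborel. (norm (w k T y))\<^sup>2) \<and>
      (h * norm (partial i (w k T) x))\<^sup>2 * h ^ ?n \<le> c\<^sub>0 * (LINT y:T|lborel. (norm (w k T y))\<^sup>2) \<and>
      (norm (partial i (w k T) x))\<^sup>2 * h ^ ?n \<le> c\<^sub>0 * (\<Sum>j\<in>UNIV. LINT y:T|lborel. (norm (partial j (w k T) y))\<^sup>2)"
    if k: "k \<le> ?n" and T: "T \<in> ncells" and x: "x \<in> T" for k T x i
  proof -
    obtain R where R: "R \<in> F" "has_shape C K X h T R" using shp[OF ncells_C[OF T]] by blast
    have ok: "shape_ok R" using F R(1) by (simp add: compact_family_def)
    show ?thesis
      by (intro conjI inverse_estimate[OF T R(2) ok inv[OF R(1) _ _ k] pos \<theta> es polys wX[OF k T] x c])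
  qed
  have "broken e C K \<kappa> h N W u c\<^sub>0 H"
  proof (intro broken.intro broken_axioms.intro)
    show "mesh e C K \<kappa> h N" by (rule mesh_axioms)
    show "u \<in> L2_forms e" unfolding u_eq
      using v by (intro L2_forms_sum[OF basis]) (auto simp: fe_space_deg_def Hd_forms_def)
    show "0 \<le> c\<^sub>0" unfolding c using \<theta> unit_vol_pos[where 'n='n] by simp
    show "1 \<le> H" "\<kappa>\<^sup>2 * h \<le> H" by (fact H)+
    fix T assume T: "T \<in> ncells"
    show "cdiff 1 (W T)" by (rule W_C1[OF T])
    have "AE x in lebesgue. \<forall>k\<in>{..?n}. x \<in> T \<longrightarrow> v k x = w k T x"
      using wv[OF _ T] by (subst AE_ball_countable) (auto intro: countable_finite)
    then show "AE x in lebesgue. x \<in> T \<longrightarrow> u x = W T x"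
      by eventually_elim (auto simp: u_eq W_def)
    fix x assume x: "x \<in> T"
    show "(norm (W T x))\<^sup>2 * h ^ ?n \<le> c\<^sub>0 * (LINT y:T|lborel. (norm (W T y))\<^sup>2)"
      unfolding norm_W[OF T, of x] L2_W[OF T] sum_distrib_left sum_distrib_right
      using est[OF _ T x] by (intro sum_mono) auto
    fix i
    show "(h * norm (partial i (W T) x))\<^sup>2 * h ^ ?n \<le> c\<^sub>0 * (LINT y:T|lborel. (norm (W T y))\<^sup>2)"
      unfolding norm_pW[OF T, of i x] L2_W[OF T] sum_distrib_left sum_distrib_right power_mult_distrib
      using est[OF _ T x, of _ i] by (intro sum_mono) (auto simp: power_mult_distrib)
    show "(norm (partial i (W T) x))\<^sup>2 * h ^ ?n \<le> c\<^sub>0 * (\<Sum>j\<in>UNIV. LINT y:T|lborel. (norm (partial j (W T) y))\<^sup>2)"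
    proof -
      have "(norm (partial i (W T) x))\<^sup>2 * h ^ ?n
        \<le> (\<Sum>k\<le>?n. c\<^sub>0 * (\<Sum>j\<in>UNIV. LINT y:T|lborel. (norm (partial j (w k T) y))\<^sup>2))"
        unfolding norm_pW[OF T] sum_distrib_right using est[OF _ T x] by (intro sum_mono) auto
      also have "\<dots> = c\<^sub>0 * (\<Sum>j\<in>UNIV. LINT y:T|lborel. (norm (partial j (W T) y))\<^sup>2)"
        unfolding L2_pW[OF T] sum_distrib_left[symmetric] by (subst sum.swap) simp
      finally show ?thesis .
    qed
  qed
  then show ?thesis by (rule that)
qed

end

theorem proposition5p7:
  fixes e :: "'n::{finite,linorder} \<Rightarrow> 'n point"
    and C K :: "nat \<Rightarrow> ('n point) set set"
    and X :: "nat \<Rightarrow> nat \<Rightarrow> ('n point) set \<Rightarrow> 'n form set"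
    and p :: nat and s :: real
  assumes "lattice_basis e"
    and "\<forall>m. cellular_complex e (C m)"
    and "(\<lambda>m. mesh_width e (C m)) \<longlonglongrightarrow> 0"
    and "quasi_uniform e C K"
    and "\<forall>m. compatible_system e (C m) (K m) (X m)"
    and "compact_macro_elements e C K X"
    and "\<forall>m. contains_polys p (C m) (X m)"
    and "0 < s" and "s < 1 / 2"
  shows "\<exists>M::real. \<forall>m. \<forall>u \<in> fe_space e (C m) (K m) (X m).
           slobodetskij2 e s u < \<infinity> \<and>
           slobodetskij e s u
             \<le> M * L2_norm e u powr (1 - s) * discrete_H1 e (C m) (K m) u powr s"
proof -
  let ?h = "\<lambda>m. mesh_width e (C m)"
  obtain \<kappa> N where refine: "\<And>m. simplicial_refinement e (C m) (K m)" and \<kappa>: "0 < \<kappa>"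
    and simp: "\<forall>m. \<forall>\<sigma>\<in>K m. int CARD('n) simplex \<sigma> \<longrightarrow> (\<exists>x. cball x (\<kappa> * diameter \<sigma>) \<subseteq> \<sigma>) \<and>
        \<kappa> * ?h m \<le> diameter \<sigma> \<and> \<kappa> * diameter \<sigma> \<le> ?h m"
    and few: "\<forall>m. \<forall>T\<in>C m. finite (simplices_in (K m) T) \<and> card (simplices_in (K m) T) \<le> N"
    using assms(4) unfolding quasi_uniform_def by (elim conjE exE) (rule that; blast)
  have mesh: "mesh e (C m) (K m) \<kappa> (?h m) N" for m
  proof
    show "\<exists>x. cball x (\<kappa> * diameter \<sigma>) \<subseteq> \<sigma>" "\<kappa> * ?h m \<le> diameter \<sigma>" "\<kappa> * diameter \<sigma> \<le> ?h m"
      if "\<sigma> \<in> K m" "int CARD('n) simplex \<sigma>" for \<sigma> using simp[rule_format, OF that] by auto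
  qed (use assms(1,2) refine \<kappa> few in auto)
  obtain F where F: "compact_family F" and shp: "\<forall>m. \<forall>T\<in>C m. \<exists>R\<in>F. has_shape (C m) (K m) (X m) (?h m) T R"
    using assms(6) unfolding compact_macro_elements_def by (elim exE conjE) (rule that; assumption)
  obtain \<eta> \<delta> L where pos: "0 < \<eta>" "0 < \<delta>" "0 < L"
    and inv: "\<And>R D k. R \<in> F \<Longrightarrow> D \<in> sh_cells R \<Longrightarrow> D \<noteq> {} \<Longrightarrow> k \<le> CARD('n) \<Longrightarrow> shape_inverse R D k \<eta> \<delta> L"
    by (rule compact_family_inverse[OF F]) (rule that)
  \<comment> \<open>Small enough for \<open>near_mass\<close>, and dependent on \<delta> and
    \<open>\<kappa>\<close> only.\<close>
  define \<theta> where "\<theta> = min 1 (\<delta> * \<kappa> / 2)"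
  have \<theta>: "0 < \<theta>" "\<theta> \<le> 1" "\<theta> / \<kappa> < \<delta>"
  proof -
    have "\<theta> \<le> \<delta> * \<kappa> / 2" by (simp add: \<theta>_def)
    also have "\<dots> < \<delta> * \<kappa>" using pos \<kappa> by simp
    finally show "\<theta> / \<kappa> < \<delta>" using \<kappa> by (simp add: pos_divide_less_eq)
  qed (use pos \<kappa> in \<open>auto simp: \<theta>_def\<close>)
  define c where "c = L\<^sup>2 / (\<eta>\<^sup>2 * ((\<theta> * \<kappa>\<^sup>2) ^ CARD('n) * unit_vol TYPE('n)))"
  \<comment> \<open>Mesh widths tend to 0, so they are bounded; this gives the uniform
    \<open>H\<close>.\<close>
  have "Bseq ?h" using assms(3) by (intro convergent_imp_Bseq) (auto simp: convergent_def)
  then obtain B where B: "\<forall>m. norm (?h m) \<le> B" by (elim BseqE) (rule that)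
  define H where "H = max 1 (\<kappa>\<^sup>2 * B)"
  have H: "1 \<le> H" "\<kappa>\<^sup>2 * ?h m \<le> H" for m
  proof -
    have "\<kappa>\<^sup>2 * ?h m \<le> \<kappa>\<^sup>2 * B" using B[rule_format, of m] by (intro mult_left_mono) auto
    then show "\<kappa>\<^sup>2 * ?h m \<le> H" by (simp add: H_def)
  qed (simp add: H_def)
  \<comment> \<open>The locale constant involves only quantities fixed for the whole family, neither
    the mesh width nor \<open>u\<close>. The modulus makes it nonnegative without tracking its
    sign.\<close>
  define S where "S = \<bar>broken.slob_const TYPE('n) \<kappa> N c H s\<bar>"
  show ?thesis
  proof (intro exI[of _ "sqrt S"] allI ballI)
    fix m u assume u: "u \<in> fe_space e (C m) (K m) (X m)"
    have es: "element_system e (C m) (K m) (X m)" using assms(5) by (simp add: compatible_system_def)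
    obtain w where "broken e (C m) (K m) \<kappa> (?h m) N w u c H"
      using mesh.fe_space_broken[OF mesh u es assms(7)[rule_format] F shp[rule_format] inv pos \<theta> c_def H] .
    then interpret broken e "C m" "K m" \<kappa> "?h m" N w u c H .
    let ?r = "E\<^sub>0 powr (1 - s) * E\<^sub>1 powr s"
    have r: "0 \<le> ?r" by simp
    have "slobodetskij2 e s u \<le> ennreal (slob_const s * E\<^sub>0 powr (1 - s) * E\<^sub>1 powr s)"
      by (rule slobodetskij2_bound[OF assms(8,9)])
    also have "\<dots> \<le> ennreal (S * ?r)"
      unfolding S_def mult.assoc by (intro ennreal_leI mult_right_mono r) simp
    finally have le: "slobodetskij2 e s u \<le> ennreal (S * ?r)" .
    have "slobodetskij e s u \<le> sqrt (S * ?r)"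
      unfolding slobodetskij_def using le by (intro real_sqrt_le_mono enn2real_leI) (simp_all add: S_def)
    also have "sqrt (S * ?r) = sqrt S * L2_norm e u powr (1 - s) * discrete_H1 e (C m) (K m) u powr s"
    proof -
      \<comment> \<open>Both energies are squares, so the root restores the exponents 1 - s and
        s.\<close>
      have sq: "sqrt ((x\<^sup>2) powr t) = x powr t" if "0 \<le> x" for x t :: real
      proof (cases "x = 0")
        case False
        then have "(x\<^sup>2) powr t = (x powr t)\<^sup>2" using that by (simp add: power2_eq_square powr_mult)
        then show ?thesis by simp
      qed simp
      show ?thesis
        unfolding E\<^sub>0_def E\<^sub>1_def real_sqrt_mult
        by (subst (1 2) sq) (auto simp: L2_norm_nonneg discrete_H1_nonneg mult.assoc)
    qed
    finally show "slobodetskij2 e s u < \<infinity> \<and>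
        slobodetskij e s u \<le> sqrt S * L2_norm e u powr (1 - s) * discrete_H1 e (C m) (K m) u powr s"
      using le_less_trans[OF le ennreal_less_top] by simp
  qed
qed

end
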